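(* Let $\Omega \subset \mathbb{R}^2$ be a compact convex set with nonempty interior and let $M>0$. Let $f:\mathbb{R}^2\to\mathbb{R}$ be a $C^2$ function, and let $\{\xi\in\mathbb{R}^2 : \text{the smallest eigenvalue of } f''(\xi) \text{ is zero}\}$ be a closed nowhere dense set in $\mathbb{R}^2$. Then a function $u$ minimizing the functional $F(u)=\int_\Omega f(\nabla u(x))\,dx$ in the class $\mathfrak{C}_M=\{u:\Omega\to\mathbb{R} : 0\le u\le M,\ u \text{ is convex}\}$ is uniquely defined by the set of singular points of $\operatorname{epi}(u)$; that is, if $u_1$ and $u_2$ both minimize $F$ in $\mathfrak{C}_M$ and $\operatorname{sing}(\operatorname{epi}(u_1))=\operatorname{sing}(\operatorname{epi}(u_2))$, then $u_1=u_2$.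
   Context: Here $f''(\xi)$ is the second derivative (Hessian matrix) of $f$ at $\xi$. For a convex function $u:\Omega\to\mathbb{R}$, the gradient $\nabla u$ exists almost everywhere in $\Omega$ and is measurable, and $\operatorname{epi}(u)=\{(x,z): x\in\Omega,\ z\ge u(x)\}\subset\mathbb{R}^3$ is the epigraph of $u$. For a convex set $C\subset\mathbb{R}^3$, a point $\xi\in\partial C$ is called regular if there is a single plane of support to $C$ at $\xi$, and singular otherwise; $\operatorname{sing}(C)$ is the set of singular points of $\partial C$.
   Formalization: Equality u1 = u2 is proved on the interior of Ω, and on all of Ω only if both epigraphs are closed (values at single boundary points of Ω can otherwise differ without changing F or sing); a minimizer is required to have a finite value of F. *)

theory Defs
  imports "HOL-Analysis.Analysis"
begin

text \<open>Unspecified where \<open>u\<close> is not differentiable.\<close>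

definition gradient :: "('a::real_inner \<Rightarrow> real) \<Rightarrow> 'a \<Rightarrow> 'a" where
  "gradient u x = (THE D. GDERIV u x :> D)"

definition hessian :: "(real ^ 'n \<Rightarrow> real) \<Rightarrow> real ^ 'n \<Rightarrow> real ^ 'n ^ 'n" where
  "hessian f x = matrix (frechet_derivative (gradient f) (at x))"

definition C2_function :: "(real ^ 'n \<Rightarrow> real) \<Rightarrow> bool" where
  "C2_function f \<longleftrightarrow>
     (\<forall>x. f differentiable (at x)) \<and>
     (\<forall>x. gradient f differentiable (at x)) \<and>
     continuous_on UNIV (hessian f)"

definition eigenvalues :: "real ^ 'n ^ 'n \<Rightarrow> real set" where
  "eigenvalues A = {c. \<exists>v. v \<noteq> 0 \<and> A *v v = c *\<^sub>R v}"

text \<open>Only used for Hessians of \<open>C\<^sup>2\<close> functions; these are symmetric, so the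
  set of real eigenvalues is finite and nonempty.\<close>

definition smallest_eigenvalue :: "real ^ 'n ^ 'n \<Rightarrow> real" where
  "smallest_eigenvalue A = Min (eigenvalues A)"

definition nowhere_dense :: "'a::topological_space set \<Rightarrow> bool" where
  "nowhere_dense S \<longleftrightarrow> interior (closure S) = {}"

definition supporting_plane :: "'a::euclidean_space set \<Rightarrow> 'a \<Rightarrow> 'a set \<Rightarrow> bool" where
  "supporting_plane C \<xi> P \<longleftrightarrow>
     (\<exists>a b. a \<noteq> 0 \<and> P = {y. a \<bullet> y = b} \<and> \<xi> \<in> P \<and> C \<subseteq> {y. a \<bullet> y \<le> b})"

definition sing :: "'a::euclidean_space set \<Rightarrow> 'a set" where
  "sing C = {\<xi> \<in> frontier C. \<not> (\<exists>!P. supporting_plane C \<xi> P)}"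

text \<open>Elements of the class need not be lower semicontinuous at frontier points of
  \<open>\<Omega>\<close>. Their values there affect neither \<open>grad_functional\<close>, since the frontier
  is a null set, nor the topological boundary of the epigraph and its supporting planes,
  which are those of its closure.\<close>

definition convex_class :: "(real ^ 2) set \<Rightarrow> real \<Rightarrow> (real ^ 2 \<Rightarrow> real) set" where
  "convex_class \<Omega> M = {u. convex_on \<Omega> u \<and> (\<forall>x\<in>\<Omega>. 0 \<le> u x \<and> u x \<le> M)}"

text \<open>The integral of \<open>f (gradient u x)\<close> over \<open>\<Omega>\<close> as an extended real (positive
  part minus negative part); in \<^typ>\<open>ereal\<close>, \<open>\<infinity> - \<infinity> = \<infinity>\<close>. The Bochner
  integral would give the value 0 to a function whose true value is infinite.\<close>

definition grad_functional ::
    "(real ^ 2) set \<Rightarrow> (real ^ 2 \<Rightarrow> real) \<Rightarrow> (real ^ 2 \<Rightarrow> real) \<Rightarrow> ereal" where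
  "grad_functional \<Omega> f u =
     enn2ereal (\<integral>\<^sup>+x. ennreal (f (gradient u x)) \<partial>lebesgue_on \<Omega>)
     - enn2ereal (\<integral>\<^sup>+x. ennreal (- f (gradient u x)) \<partial>lebesgue_on \<Omega>)"

text \<open>The minimum has to be a real number: with the value \<open>-\<infinity>\<close> admitted, all
  functions with divergent integral would be minimizers. The value \<open>\<infinity>\<close> is never
  a minimum, as constants have finite value.\<close>

definition minimizes ::
    "(real ^ 2) set \<Rightarrow> real \<Rightarrow> (real ^ 2 \<Rightarrow> real) \<Rightarrow> (real ^ 2 \<Rightarrow> real) \<Rightarrow> bool" where
  "minimizes \<Omega> M f u \<longleftrightarrow>
     u \<in> convex_class \<Omega> M \<and>
     \<bar>grad_functional \<Omega> f u\<bar> \<noteq> \<infinity> \<and>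
     (\<forall>v \<in> convex_class \<Omega> M. grad_functional \<Omega> f u \<le> grad_functional \<Omega> f v)"

end

theory Submission
  imports Defs
begin

text \<open>It suffices that every extreme point of the closed epigraph of a minimizer is a limit of
  singular points: by the Krein-Milman theorem, applied to the face cut out by a subgradient plane,
  the graph over the interior of \<open>\<Omega>\<close> then lies in the convex hull of the closure of the
  singular set. Hence it lies in the closed epigraph of every minimizer with the same singular
  points. Extreme points of such a face over the frontier of \<open>\<Omega>\<close> are themselves singular,
  having also a vertical plane of support.

  An extreme point over the interior that is no such limit has a smooth neighbourhood in the graph,
  from which a plane cuts off a cap. The slopes of such planes form an open set, so \<open>u\<close> takes on all
  slopes of a small ball \<open>B\<close> inside the cap, and \<open>B\<close> can be chosen such that \<open>f''\<close> is either
  positive definite on \<open>B\<close> or uniformly negative in a fixed direction \<open>\<tau>\<close>. Let \<open>g\<close> be the conjugate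
  of \<open>u\<close> on \<open>B\<close>; it is strictly convex, as \<open>u\<close> is smooth. Convex functions \<open>W\<close> that agree with
  \<open>g\<close> near the boundary of \<open>B\<close> correspond to competitors, with energy \<open>E f W\<close>. If \<open>f''\<close> is
  positive, lowering \<open>W\<close> strictly lowers the energy by Jensen's inequality. In general \<open>E f W\<close> is
  quadratic in \<open>W\<close>: for the hinges \<open>max 0 (c \<bullet> \<xi> - b)\<close> integration along lines parallel to \<open>c\<close>
  gives the integral of the squared derivative of \<open>W\<close> along a chord, and hinges span a dense set.
  Raising \<open>g\<close> by a narrow wedge along \<open>\<tau>\<close> has negative second variation. The opposite variation
  is available up to \<open>o(1 / C)\<close> by strict convexity of \<open>g\<close>, so that the first variation cannot
  be positive and \<open>g\<close> is not minimal.\<close>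

text \<open>Up to a term independent of \<open>W\<close>, \<open>E f W\<close> is formally the
  integral of \<open>f\<close> against the Hessian determinant of \<open>W\<close>, as the gradients
  of \<open>W\<close> and \<open>cj W\<close> are inverse to each other; in the plane this
  determinant is a quadratic form. Arbitrary small bumps are excluded on both sides:
  \<open>u\<close> may have flat pieces, and a strictly convex \<open>g\<close> may have a
  degenerate Hessian. Hence upward variations are maxima with convex functions and downward ones are
  convex envelopes.

  Let \<open>q t\<close> be \<open>E f\<close> at \<open>(1 - t) * g + t * W\<close>, and
  \<open>M\<close> the midpoint. Three values encode the derivatives of \<open>q\<close>:
  \<open>q' 1\<close> is \<open>3 * E f W + E f g - 4 * E f M\<close>, and \<open>- q' 0\<close> is
  \<open>E f W + 3 * E f g - 4 * E f M\<close>. Where the wedge lies above \<open>g\<close>, the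
  Hessian of \<open>W\<close> is carried by the line through \<open>\<tau>\<close>; so
  \<open>q' 1\<close> is formally \<open>2 * \<kappa>\<close> times the integral along this line of
  \<open>W - g\<close> times the second derivative of \<open>f\<close> in the direction
  \<open>\<tau>\<close>, which is negative. This sign, \<open>q' 0 \<le> 0\<close> and
  \<open>q 0 \<le> q 1\<close> are incompatible, since
  \<open>2 * (q 1 - q 0) = q' 0 + q' 1\<close>.\<close>

section \<open>Orthonormal frames of the plane and integration along parallel lines\<close>

definition perp :: "real^2 \<Rightarrow> real^2" where
  "perp c = vector [- (c $ 2), c $ 1]"

lemma perp_nth [simp]: "perp c $ 1 = - (c $ 2)" "perp c $ 2 = c $ 1"
  by (simp_all add: perp_def)

lemma inner_vec2: "(x :: real^2) \<bullet> y = x $ 1 * y $ 1 + x $ 2 * y $ 2"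
  by (simp add: inner_vec_def sum_2)

lemma inner_perp [simp]: "c \<bullet> perp c = 0" "perp c \<bullet> c = 0"
  by (simp_all add: inner_vec2)

lemma inner_perp_perp [simp]: "perp c \<bullet> perp d = c \<bullet> d"
  by (simp add: inner_vec2 algebra_simps)

lemma norm_perp [simp]: "norm (perp c) = norm c"
  by (simp add: norm_eq_sqrt_inner)

definition frame :: "real^2 \<Rightarrow> real \<Rightarrow> real \<Rightarrow> real^2" where
  "frame c t y = t *\<^sub>R c + y *\<^sub>R perp c"

lemma inner_frame [simp]:
  assumes "norm c = 1"
  shows "c \<bullet> frame c t y = t" "frame c t y \<bullet> c = t"
    "perp c \<bullet> frame c t y = y" "frame c t y \<bullet> perp c = y"
  using assms by (simp_all add: frame_def inner_simps norm_eq_1)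

lemma frame_coordinates:
  assumes "norm c = 1"
  shows "frame c (c \<bullet> x) (perp c \<bullet> x) = x"
proof -
  have *: "(c$1)^2 + (c$2)^2 = 1"
    using assms by (simp add: norm_eq_1 inner_vec2 power2_eq_square)
  have "c$1 * (c$1 * x$1 + c$2 * x$2) + c$2 * (c$2 * x$1 - c$1 * x$2) = ((c$1)^2 + (c$2)^2) * x$1"
    "c$2 * (c$1 * x$1 + c$2 * x$2) + c$1 * (c$1 * x$2 - c$2 * x$1) = ((c$1)^2 + (c$2)^2) * x$2"
    by (simp_all add: algebra_simps power2_eq_square)
  then show ?thesis unfolding *
    by (simp add: vec_eq_iff forall_2 frame_def inner_vec2 algebra_simps)
qed

lemma continuous_on_frame [continuous_intros]:
  assumes "continuous_on S f" "continuous_on S g"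
  shows "continuous_on S (\<lambda>x. frame c (f x) (g x))"
  unfolding frame_def by (intro continuous_intros assms)

lemma norm_frame:
  assumes "norm c = 1"
  shows "(norm (frame c t y))^2 = t^2 + y^2"
proof -
  have "(norm (frame c t y))^2 = frame c t y \<bullet> frame c t y" by (rule power2_norm_eq_inner)
  also have "\<dots> = t^2 + y^2"
    using assms by (simp add: frame_def inner_simps norm_eq_1 power2_eq_square)
  finally show ?thesis .
qed

lemma measurable_frame [measurable]:
  "(\<lambda>(y, t). frame c t y) \<in> (lborel \<Otimes>\<^sub>M lborel) \<rightarrow>\<^sub>M borel"
  "(\<lambda>t. frame c t y) \<in> borel \<rightarrow>\<^sub>M borel"
proof -
  have "(\<lambda>p. frame c (snd p) (fst p)) \<in> borel \<rightarrow>\<^sub>M borel"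
    by (intro borel_measurable_continuous_onI continuous_intros)
  then show "(\<lambda>(y, t). frame c t y) \<in> (lborel \<Otimes>\<^sub>M lborel) \<rightarrow>\<^sub>M borel"
    unfolding lborel_prod case_prod_beta by simp
  show "(\<lambda>t. frame c t y) \<in> borel \<rightarrow>\<^sub>M borel"
    by (intro borel_measurable_continuous_onI continuous_intros)
qed

lemma abs_le_norm_frame:
  assumes "norm c = 1"
  shows "\<bar>t\<bar> \<le> norm (frame c t y)" "\<bar>y\<bar> \<le> norm (frame c t y)"
  using norm_frame[OF assms, of t y] abs_le_square_iff[of t "norm (frame c t y)"]
    abs_le_square_iff[of y "norm (frame c t y)"] by simp_all

text \<open>Lebesgue measure is determined by boxes, and the preimage of a box is a product of
  intervals. The pair is ordered \<open>(y, t)\<close> so that the inner integral of later iterated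
  integrals runs along the first frame vector.\<close>

lemma distr_frame_axis:
  "distr (lborel \<Otimes>\<^sub>M lborel) borel (\<lambda>(y, t). frame (axis 1 1) t y) = lborel"
proof (rule lborel_eqI[symmetric])
  have m: "(\<lambda>(y, t). frame (axis 1 1) t y) \<in> (lborel \<Otimes>\<^sub>M lborel) \<rightarrow>\<^sub>M borel"
    by (rule measurable_frame)
  fix l u :: "real^2" assume lu: "\<And>b. b \<in> Basis \<Longrightarrow> l \<bullet> b \<le> u \<bullet> b"
  have le: "l $ i \<le> u $ i" for i
    using lu[of "axis i 1"] by (simp add: inner_axis)
  have pre: "(\<lambda>(y, t). frame (axis 1 1) t y) -` box l u \<inter> space (lborel \<Otimes>\<^sub>M lborel)
     = {l $ 2 <..< u $ 2} \<times> {l $ 1 <..< u $ 1}"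
    by (auto simp: mem_box_cart forall_2 frame_def space_pair_measure axis_def)
  have B: "(\<Prod>b\<in>Basis. (u - l) \<bullet> b) = (u$1 - l$1) * (u$2 - l$2)"
  proof -
    have B: "Basis = {axis 1 1, axis 2 1 :: real^2}"
    proof -
      have "UNIV = {1, 2 :: 2}" using exhaust_2 by blast
      then show ?thesis by (auto simp: Basis_vec_def) (metis UNIV_I insert_iff empty_iff)
    qed
    have "axis 1 1 \<noteq> (axis 2 1 :: real^2)"
      by (simp add: axis_eq_axis)
    then show ?thesis unfolding B by (simp add: inner_axis)
  qed
  show "emeasure (distr (lborel \<Otimes>\<^sub>M lborel) borel (\<lambda>(y, t). frame (axis 1 1) t y)) (box l u)
    = ennreal (\<Prod>b\<in>Basis. (u - l) \<bullet> b)"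
    unfolding B
    by (subst emeasure_distr[OF m]) (auto simp: pre lborel.emeasure_pair_measure_Times le ennreal_mult' mult.commute)
qed simp

lemma distr_orthogonal:
  fixes r :: "real^2 \<Rightarrow> real^2"
  assumes r: "orthogonal_transformation r"
  shows "distr lborel borel r = lborel"
proof (rule lborel_eqI[symmetric])
  have lin: "linear r" and bij: "bij r"
    using r by (auto simp: orthogonal_transformation_linear orthogonal_transformation_bij)
  have inv: "orthogonal_transformation (inv r)"
    using r by (rule orthogonal_transformation_inv)
  have "r \<in> borel \<rightarrow>\<^sub>M borel"
    by (intro borel_measurable_continuous_onI linear_continuous_on) (rule lin[unfolded linear_conv_bounded_linear])
  then have m: "r \<in> lborel \<rightarrow>\<^sub>M borel" by simp
  fix l u :: "real^2" assume lu: "\<And>b. b \<in> Basis \<Longrightarrow> l \<bullet> b \<le> u \<bullet> b"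
  have pre: "r -` box l u \<inter> space lborel = inv r ` box l u"
    using bij by (simp add: bij_vimage_eq_inv_image)
  have b: "box l u \<in> lmeasurable" by simp
  have im: "inv r ` box l u \<in> lmeasurable"
    using measurable_orthogonal_image[OF inv b] .
  have sb: "inv r ` box l u \<in> sets borel"
    using measurable_sets[OF m, of "box l u"] pre by simp
  have "emeasure lborel (inv r ` box l u) = emeasure lebesgue (inv r ` box l u)"
    using sb by simp
  also have "\<dots> = ennreal (measure lebesgue (inv r ` box l u))"
    using im by (simp add: emeasure_eq_measure2 fmeasurableD2)
  also have "\<dots> = ennreal (measure lebesgue (box l u))"
    using measure_orthogonal_image[OF inv b] by simp
  also have "\<dots> = emeasure lebesgue (box l u)"
    using b by (simp add: emeasure_eq_measure2 fmeasurableD2)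
  also have "\<dots> = ennreal (\<Prod>b\<in>Basis. (u - l) \<bullet> b)"
    using lu by simp
  finally show "emeasure (distr lborel borel r) (box l u) = ennreal (\<Prod>b\<in>Basis. (u - l) \<bullet> b)"
    using emeasure_distr[OF m borel_open[OF open_box]] pre by simp
qed simp

text \<open>A general frame is the standard one followed by an orthogonal transformation, and both
  preserve the measure.\<close>

lemma distr_frame:
  assumes c: "norm c = 1"
  shows "distr (lborel \<Otimes>\<^sub>M lborel) borel (\<lambda>(y, t). frame c t y) = lborel"
proof -
  let ?r = "\<lambda>x::real^2. frame c (x $ 1) (x $ 2)"
  have r: "orthogonal_transformation ?r"
    unfolding orthogonal_transformation
  proof
    show "linear ?r"
      by (rule linearI) (auto simp: frame_def algebra_simps)
    show "\<forall>v. norm (?r v) = norm v"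
    proof
      fix v :: "real^2"
      have "(norm (?r v))^2 = (norm v)^2"
        using norm_frame[OF c, of "v$1" "v$2"] power2_norm_eq_inner[of v]
        by (simp add: inner_vec2 power2_eq_square)
      then show "norm (?r v) = norm v" by simp
    qed
  qed
  have m: "(\<lambda>(y, t). frame d t y) \<in> (lborel \<Otimes>\<^sub>M lborel) \<rightarrow>\<^sub>M borel" for d
    by (rule measurable_frame)
  have mr: "?r \<in> borel \<rightarrow>\<^sub>M borel"
    by (intro borel_measurable_continuous_onI continuous_intros)
  have "lborel = distr lborel borel ?r" using distr_orthogonal[OF r] by simp
  also have "\<dots> = distr (distr (lborel \<Otimes>\<^sub>M lborel) borel (\<lambda>(y, t). frame (axis 1 1) t y)) borel ?r"
    by (simp add: distr_frame_axis)
  also have "\<dots> = distr (lborel \<Otimes>\<^sub>M lborel) borel (?r \<circ> (\<lambda>(y, t). frame (axis 1 1) t y))"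
    by (rule distr_distr[OF mr m])
  also have "?r \<circ> (\<lambda>(y, t). frame (axis 1 1) t y) = (\<lambda>(y, t). frame c t y)"
    by (auto simp: fun_eq_iff frame_def axis_def)
  finally show ?thesis by simp
qed

lemma integral_frame:
  fixes F :: "real^2 \<Rightarrow> real"
  assumes c: "norm c = 1" and F: "integrable lborel F"
  shows "(LINT x|lborel. F x) = (LINT y|lborel. LINT t|lborel. F (frame c t y))"
proof -
  have "(LINT x|lborel. F x) = (LINT p|(lborel \<Otimes>\<^sub>M lborel). F (case p of (y,t) \<Rightarrow> frame c t y))"
    by (subst distr_frame[OF c, symmetric], subst integral_distr[OF measurable_frame(1)])
       (use F in auto)
  also have "\<dots> = (LINT y|lborel. LINT t|lborel. F (frame c t y))"
  proof (subst lborel_pair.integral_fst'[symmetric])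
    show "integrable (lborel \<Otimes>\<^sub>M lborel) (\<lambda>p. F (case p of (y,t) \<Rightarrow> frame c t y))"
      using F distr_frame[OF c] integrable_distr[OF measurable_frame(1), of c F] by simp
  qed simp
  finally show ?thesis .
qed

lemma AE_frame:
  assumes c: "norm c = 1" and P: "AE x in lborel. P x"
  shows "AE y in lborel. AE t in lborel. P (frame c t y)"
proof -
  have "AE x in distr (lborel \<Otimes>\<^sub>M lborel) borel (\<lambda>(y, t). frame c t y). P x"
    using P by (subst distr_frame[OF c])
  then have "AE p in lborel \<Otimes>\<^sub>M lborel. P (case p of (y,t) \<Rightarrow> frame c t y)"
    using AE_distrD[OF measurable_frame(1), of P c] by simp
  from lborel_pair.AE_pair[OF this] show ?thesis by simp
qed

lemma null_set_frame:
  assumes c: "norm c = 1" and N: "N \<in> sets borel"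
    and slices: "\<And>y. countable {t. frame c t y \<in> N}"
  shows "N \<in> null_sets lborel"
proof -
  have [measurable]: "N \<in> sets borel" by (rule N)
  have "emeasure lborel N = (\<integral>\<^sup>+ x. indicator N x \<partial>lborel)" by simp
  also have "\<dots> = (\<integral>\<^sup>+ p. indicator N (case p of (y,t) \<Rightarrow> frame c t y) \<partial>(lborel \<Otimes>\<^sub>M lborel))"
    by (subst distr_frame[OF c, symmetric], subst nn_integral_distr) auto
  also have "\<dots> = (\<integral>\<^sup>+ y. \<integral>\<^sup>+ t. indicator N (frame c t y) \<partial>lborel \<partial>lborel)"
    by (subst lborel.nn_integral_fst[symmetric]) auto
  also have "\<dots> = (\<integral>\<^sup>+ y. 0 \<partial>(lborel::real measure))"
  proof (rule nn_integral_cong)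
    fix y :: real
    have "{t. frame c t y \<in> N} \<in> null_sets lborel"
      by (rule countable_imp_null_set_lborel[OF slices])
    then have "AE t in lborel. t \<notin> {t. frame c t y \<in> N}" by (rule AE_not_in)
    then have "AE t in lborel. indicator N (frame c t y) = (0::ennreal)"
      by eventually_elim (auto simp: indicator_def)
    then have "(\<integral>\<^sup>+ t. indicator N (frame c t y) \<partial>lborel) = (\<integral>\<^sup>+ t. 0 \<partial>(lborel::real measure))"
      by (rule nn_integral_cong_AE)
    then show "(\<integral>\<^sup>+ t. indicator N (frame c t y) \<partial>lborel) = 0" by simp
  qed
  finally show ?thesis using N by (auto simp: null_sets_def)
qed

section \<open>Convex and Lipschitz functions of one variable\<close>

text \<open>The right derivative \<open>p\<close> is monotone, so it has countably many
  discontinuities. Where it is continuous, the subgradient inequalities at \<open>s\<close> and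
  \<open>t\<close> enclose the difference quotient between \<open>p t\<close> and
  \<open>p s\<close>, which forces differentiability.\<close>

lemma countable_nondifferentiable_convex:
  fixes n :: "real \<Rightarrow> real"
  assumes cv: "convex_on S n" and S: "open S"
  shows "countable {t \<in> S. \<not> n differentiable (at t)}"
proof -
  define p where "p x = Inf ((\<lambda>t. (n x - n t) / (x - t)) ` ({x<..} \<inter> S))" for x
  have sub: "n y \<ge> n x + p x * (y - x)" if "x \<in> S" "y \<in> S" for x y
    using convex_le_Inf_differential[OF cv _ that(2), of x] that(1) S
    by (simp add: p_def interior_open)
  have mono: "mono_on S p"
  proof (rule mono_onI)
    fix x y assume xy: "x \<in> S" "y \<in> S" "x \<le> y"
    show "p x \<le> p y"
    proof (cases "x = y")
      case False
      then have "x < y" using xy by simp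
      have "p x * (y - x) \<le> p y * (y - x)"
        using sub[OF xy(1,2)] sub[OF xy(2,1)] by (simp add: algebra_simps)
      then show ?thesis using \<open>x < y\<close> by simp
    qed simp
  qed
  have "n differentiable (at t)" if "t \<in> S" "isCont p t" for t
  proof -
    have ev: "\<forall>\<^sub>F s in at t. s \<in> S"
      using S that(1) by (simp add: eventually_at_topological) blast
    have "((\<lambda>s. (n s - n t) / (s - t) - p t) \<longlongrightarrow> 0) (at t)"
    proof (rule Lim_null_comparison)
      show "((\<lambda>s. \<bar>p s - p t\<bar>) \<longlongrightarrow> 0) (at t)"
        using that(2) unfolding isCont_def by (auto intro!: tendsto_eq_intros)
      show "\<forall>\<^sub>F s in at t. norm ((n s - n t) / (s - t) - p t) \<le> \<bar>p s - p t\<bar>"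
        using ev eventually_neq_at_within[of t t]
      proof eventually_elim
        case (elim s)
        have 1: "n s - n t \<ge> p t * (s - t)" "n s - n t \<le> p s * (s - t)"
          using sub[OF that(1) elim(1)] sub[OF elim(1) that(1)] by (simp_all add: algebra_simps)
        show ?case
        proof (cases "s > t")
          case True
          then have "p t \<le> (n s - n t) / (s - t)" "(n s - n t) / (s - t) \<le> p s"
            using 1 by (simp_all add: field_simps)
          then show ?thesis by simp
        next
          case False
          then have "s < t" using elim by simp
          then have "p t \<ge> (n s - n t) / (s - t)" "(n s - n t) / (s - t) \<ge> p s"
            using 1 by (simp_all add: field_simps)
          then show ?thesis by simp
        qed
      qed
    qed
    then have "((\<lambda>s. (n s - n t) / (s - t)) \<longlongrightarrow> p t) (at t)"
      by (simp add: LIM_zero_iff)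
    then have "(n has_field_derivative p t) (at t)"
      by (simp add: has_field_derivative_iff)
    then show ?thesis
      using real_differentiable_def by blast
  qed
  then have "{t \<in> S. \<not> n differentiable (at t)} \<subseteq> {t \<in> S. \<not> isCont p t}" by blast
  then show ?thesis
    using mono_on_ctble_discont_open[OF S mono] countable_subset by blast
qed

lemma has_bochner_integral_FTC_Icc_scaleR:
  fixes f F :: "real \<Rightarrow> real"
  assumes "a \<le> b" "\<And>x. a \<le> x \<Longrightarrow> x \<le> b \<Longrightarrow> DERIV F x :> f x" "\<And>x. a \<le> x \<Longrightarrow> x \<le> b \<Longrightarrow> isCont f x"
  shows "has_bochner_integral lborel (\<lambda>x. indicator {a..b} x *\<^sub>R f x) (F b - F a)"
  using has_bochner_integral_FTC_Icc_real[OF assms] by (simp add: mult.commute)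

text \<open>The difference quotients \<open>q m\<close> are bounded by \<open>L\<close> and converge
  to \<open>p\<close> almost everywhere, so dominated convergence applies. Their integrals are known
  exactly through an antiderivative \<open>N\<close> of \<open>n\<close>: they are differences of
  difference quotients of \<open>N\<close>, which converge to \<open>n b - n a\<close>.\<close>

lemma integral_derivative_Lipschitz:
  fixes n p :: "real \<Rightarrow> real"
  assumes lip: "L-lipschitz_on UNIV n" and p [measurable]: "p \<in> borel_measurable borel"
    and der: "AE t in lborel. (n has_real_derivative p t) (at t)"
    and ab: "a \<le> b"
  shows "set_integrable lborel {a..b} p" "(LINT t:{a..b}|lborel. p t) = n b - n a"
proof -
  have contn: "continuous_on UNIV n" by (rule lipschitz_on_continuous_on[OF lip])
  have [measurable]: "n \<in> borel_measurable borel"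
    using contn by (rule borel_measurable_continuous_onI)
  define q where "q m t = real (Suc m) * (n (t + 1 / real (Suc m)) - n t)" for m t
  have lipD: "\<bar>n x - n y\<bar> \<le> L * \<bar>x - y\<bar>" for x y
    using lipschitz_onD[OF lip, of x y] by (simp add: dist_real_def)
  have L0: "L \<ge> 0" using lipschitz_on_nonneg[OF lip] .
  have q_bound: "\<bar>q m t\<bar> \<le> L" for m t
  proof -
    have "\<bar>q m t\<bar> = real (Suc m) * \<bar>n (t + 1 / real (Suc m)) - n t\<bar>"
      by (simp add: q_def abs_mult)
    also have "\<dots> \<le> real (Suc m) * (L * (1 / real (Suc m)))"
      using lipD[of "t + 1 / real (Suc m)" t] by (intro mult_left_mono) auto
    finally show ?thesis by simp
  qed
  have q_lim: "(\<lambda>m. q m t) \<longlonglongrightarrow> d" if "(n has_real_derivative d) (at t)" for t d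
  proof -
    have 1: "((\<lambda>h. (n (t + h) - n t) / h) \<longlongrightarrow> d) (at 0)"
      using that by (simp add: DERIV_def)
    have 2: "filterlim (\<lambda>m. 1 / real (Suc m)) (at 0) sequentially"
      unfolding filterlim_at using LIMSEQ_Suc[OF lim_1_over_n[where 'a=real]] by auto
    from filterlim_compose[OF 1 2] show ?thesis by (simp add: q_def field_simps)
  qed
  have lim: "AE t in lborel. (\<lambda>m. indicator {a..b} t *\<^sub>R q m t) \<longlonglongrightarrow> indicator {a..b} t *\<^sub>R p t"
    using der by eventually_elim (intro tendsto_intros q_lim)
  have bd: "AE t in lborel. norm (indicator {a..b} t *\<^sub>R q m t) \<le> indicator {a..b} t * L" for m
    using q_bound L0 by (auto simp: indicator_def)
  have dom: "integrable lborel (\<lambda>t. indicator {a..b} t * L)"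
    by (intro integrable_mult_left integrable_real_indicator) (simp_all add: ab)
  have mq: "(\<lambda>t. indicator {a..b} t *\<^sub>R q m t) \<in> borel_measurable lborel" for m
    unfolding q_def by measurable
  have mp: "(\<lambda>t. indicator {a..b} t *\<^sub>R p t) \<in> borel_measurable lborel" by measurable
  show "set_integrable lborel {a..b} p"
    unfolding set_integrable_def by (rule integrable_dominated_convergence[OF mp mq dom lim bd])
  have conv: "(\<lambda>m. LINT t:{a..b}|lborel. q m t) \<longlonglongrightarrow> (LINT t:{a..b}|lborel. p t)"
    unfolding set_lebesgue_integral_def
    by (rule integral_dominated_convergence[OF mp mq dom lim bd])
  \<comment> \<open>The enlarged interval keeps \<open>x + 1 / real (Suc m)\<close>, which is at
    most \<open>b + 1\<close>, in the interior, where \<open>N\<close> has a two-sided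
    derivative.\<close>
  obtain N where N: "\<And>x. x \<in> {a-1..b+2} \<Longrightarrow> (N has_vector_derivative n x) (at x within {a-1..b+2})"
    using antiderivative_continuous[of "a-1" "b+2" n] continuous_on_subset[OF contn] ab
    by (metis subset_UNIV)
  have N': "(N has_real_derivative n x) (at x)" if "x \<in> {a-1<..<b+2}" for x
    using N[of x] that by (simp add: at_within_Icc_at has_real_derivative_iff_has_vector_derivative)
  have int_q: "(LINT t:{a..b}|lborel. q m t) =
     (N (b + 1 / real (Suc m)) - N b) / (1 / real (Suc m)) - (N (a + 1 / real (Suc m)) - N a) / (1 / real (Suc m))" for m
  proof -
    let ?h = "1 / real (Suc m)"
    have h: "0 < ?h" "?h \<le> 1" by auto
    let ?Q = "\<lambda>t. real (Suc m) * (N (t + ?h) - N t)"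
    have "has_bochner_integral lborel (\<lambda>x. indicator {a..b} x *\<^sub>R q m x) (?Q b - ?Q a)"
    proof (rule has_bochner_integral_FTC_Icc_scaleR[OF ab])
      fix x assume x: "a \<le> x" "x \<le> b"
      have shift: "((\<lambda>t. N (t + ?h)) has_real_derivative n (x + ?h)) (at x)"
      proof -
        have "x + ?h \<in> {a-1<..<b+2}" unfolding greaterThanLessThan_iff using x h by linarith
        from N'[OF this] show ?thesis by (simp only: DERIV_shift)
      qed
      have dN: "(N has_real_derivative n x) (at x)" using N'[of x] x by auto
      show "DERIV ?Q x :> q m x"
        unfolding q_def by (rule DERIV_cmult[OF DERIV_diff[OF shift dN]])
      show "isCont (q m) x"
      proof -
        have "continuous_on UNIV (\<lambda>t. n (t + ?h))"
          by (rule continuous_on_compose2[OF contn]) (auto intro!: continuous_intros)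
        then have "continuous_on UNIV (q m)"
          unfolding q_def using contn by (intro continuous_intros)
        then show ?thesis by (simp add: continuous_on_eq_continuous_at)
      qed
    qed
    then have "(LINT t:{a..b}|lborel. q m t) = ?Q b - ?Q a"
      unfolding set_lebesgue_integral_def by (rule has_bochner_integral_integral_eq)
    then show ?thesis by (simp add: field_simps)
  qed
  have Nlim: "(\<lambda>m. (N (x + 1 / real (Suc m)) - N x) / (1 / real (Suc m))) \<longlonglongrightarrow> n x" if "x \<in> {a..b}" for x
  proof -
    have 1: "((\<lambda>h. (N (x + h) - N x) / h) \<longlongrightarrow> n x) (at 0)"
      using N'[of x] that by (simp add: DERIV_def)
    have 2: "filterlim (\<lambda>m. 1 / real (Suc m)) (at 0) sequentially"
      unfolding filterlim_at using LIMSEQ_Suc[OF lim_1_over_n[where 'a=real]] by auto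
    show ?thesis using filterlim_compose[OF 1 2] .
  qed
  have "(\<lambda>m. LINT t:{a..b}|lborel. q m t) \<longlonglongrightarrow> n b - n a"
    unfolding int_q using ab by (intro tendsto_diff Nlim) auto
  with conv show "(LINT t:{a..b}|lborel. p t) = n b - n a"
    using LIMSEQ_unique by blast
qed

lemma convex_tangent_real:
  fixes n :: "real \<Rightarrow> real"
  assumes "convex_on UNIV n" "(n has_real_derivative d) (at t)"
  shows "n s \<ge> n t + d * (s - t)"
  using convex_on_imp_above_tangent[OF assms(1), of t s d] assms(2) by auto

text \<open>By convexity \<open>p - \<beta>\<close> changes sign at a minimizer \<open>ts\<close> of
  the tilted function, so each positive part is an integral over one side of \<open>ts\<close>. The
  minimal value that appears is, up to sign, a conjugate of \<open>n\<close> at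
  \<open>\<beta>\<close>; this is how conjugates enter the energy.\<close>

lemma integral_derivative_pos_part:
  fixes n p :: "real \<Rightarrow> real"
  assumes cv: "convex_on UNIV n" and lip: "L-lipschitz_on UNIV n"
    and p [measurable]: "p \<in> borel_measurable borel"
    and der: "AE t in lborel. (n has_real_derivative p t) (at t)"
    and ts: "ts \<in> {a..b}" and min: "\<And>t. t \<in> {a..b} \<Longrightarrow> n ts - \<beta> * ts \<le> n t - \<beta> * t"
  shows "(LINT t:{a..b}|lborel. max 0 (p t - \<beta>)) = (n b - \<beta> * b) - (n ts - \<beta> * ts)"
    and "(LINT t:{a..b}|lborel. max 0 (\<beta> - p t)) = (n a - \<beta> * a) - (n ts - \<beta> * ts)"
proof -
  have ab: "a \<le> ts" "ts \<le> b" using ts by auto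
  have right: "p t \<ge> \<beta>" if "(n has_real_derivative p t) (at t)" "t \<in> {a..b}" "t > ts" for t
  proof -
    have "n ts \<ge> n t + p t * (ts - t)" by (rule convex_tangent_real[OF cv that(1)])
    then have "\<beta> * (t - ts) \<le> p t * (t - ts)"
      using min[OF that(2)] by (simp add: algebra_simps)
    then show ?thesis using that(3) by simp
  qed
  have left: "p t \<le> \<beta>" if "(n has_real_derivative p t) (at t)" "t \<in> {a..b}" "t < ts" for t
  proof -
    have "n ts \<ge> n t + p t * (ts - t)" by (rule convex_tangent_real[OF cv that(1)])
    then have "p t * (ts - t) \<le> \<beta> * (ts - t)"
      using min[OF that(2)] by (simp add: algebra_simps)
    then show ?thesis using that(3) by simp
  qed
  have ne: "AE t in lborel. t \<noteq> ts" by (rule AE_lborel_singleton)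
  have const: "(LINT t:{c..d}|lborel. \<beta>) = \<beta> * (d - c)" "set_integrable lborel {c..d} (\<lambda>_. \<beta>)" if "c \<le> d" for c d :: real
    using that by (simp_all add: set_lebesgue_integral_def set_integrable_def)
  have "(LINT t:{a..b}|lborel. max 0 (p t - \<beta>)) = (LINT t:{ts..b}|lborel. p t - \<beta>)"
    unfolding set_lebesgue_integral_def
  proof (rule integral_cong_AE)
    show "AE t in lborel. indicator {a..b} t *\<^sub>R max 0 (p t - \<beta>) = indicator {ts..b} t *\<^sub>R (p t - \<beta>)"
      using der ne
    proof eventually_elim
      case (elim t)
      then show ?case using right[of t] left[of t] ab by (auto simp: indicator_def)
    qed
  qed auto
  also have "\<dots> = (n b - n ts) - \<beta> * (b - ts)"
    using integral_derivative_Lipschitz[OF lip p der ab(2)] const[OF ab(2)]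
    by (simp add: set_integral_diff)
  finally show "(LINT t:{a..b}|lborel. max 0 (p t - \<beta>)) = (n b - \<beta> * b) - (n ts - \<beta> * ts)"
    by (simp add: algebra_simps)
  have "(LINT t:{a..b}|lborel. max 0 (\<beta> - p t)) = (LINT t:{a..ts}|lborel. \<beta> - p t)"
    unfolding set_lebesgue_integral_def
  proof (rule integral_cong_AE)
    show "AE t in lborel. indicator {a..b} t *\<^sub>R max 0 (\<beta> - p t) = indicator {a..ts} t *\<^sub>R (\<beta> - p t)"
      using der ne
    proof eventually_elim
      case (elim t)
      then show ?case using right[of t] left[of t] ab by (auto simp: indicator_def)
    qed
  qed auto
  also have "\<dots> = \<beta> * (ts - a) - (n ts - n a)"
    using integral_derivative_Lipschitz[OF lip p der ab(1)] const[OF ab(1)]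
    by (simp add: set_integral_diff)
  finally show "(LINT t:{a..b}|lborel. max 0 (\<beta> - p t)) = (n a - \<beta> * a) - (n ts - \<beta> * ts)"
    by (simp add: algebra_simps)
qed

text \<open>The source of all quadratic formulas. The supremum at \<open>y\<close> is affine in
  \<open>y\<close> plus the integral of \<open>max 0 (y - p \<eta>)\<close> over
  \<open>\<eta>\<close>. Exchanging the integrations, the integral over \<open>y\<close> becomes
  \<open>(R - p \<eta>)^2 / 2\<close>, because \<open>p \<eta>\<close> lies in
  \<open>{-R..R}\<close>; expanding the square leaves boundary values of \<open>k\<close> and the
  integral of \<open>(p \<eta>)^2\<close>.\<close>

lemma integral_conjugate_quadratic_bounded:
  fixes k p :: "real \<Rightarrow> real"
  assumes cv: "convex_on UNIV k" and lip: "L-lipschitz_on UNIV k"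
    and p [measurable]: "p \<in> borel_measurable borel"
    and der: "AE t in lborel. (k has_real_derivative p t) (at t)"
    and pb: "\<And>\<eta>. \<bar>p \<eta>\<bar> \<le> R" and s: "0 \<le> s"
  shows "(LINT y:{-R..R}|lborel. (SUP \<eta>\<in>{-s..s}. y * \<eta> - k \<eta>))
    = R^2 * s - R * (k s + k (-s)) + (LINT \<eta>:{-s..s}|lborel. (p \<eta>)^2) / 2"
proof -
  have contk: "continuous_on UNIV k" by (rule lipschitz_on_continuous_on[OF lip])
  have R0: "0 \<le> R" using pb[of 0] by linarith
  have sup: "(SUP \<eta>\<in>{-s..s}. y * \<eta> - k \<eta>) = - y * s - k (-s) + (LINT \<eta>:{-s..s}|lborel. max 0 (y - p \<eta>))" for y
  proof -
    have "continuous_on {-s..s} (\<lambda>\<eta>. k \<eta> - y * \<eta>)"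
      using continuous_on_subset[OF contk] by (auto intro!: continuous_intros)
    from continuous_attains_inf[OF compact_Icc _ this] s
    obtain ts where ts: "ts \<in> {-s..s}" "\<And>t. t \<in> {-s..s} \<Longrightarrow> k ts - y * ts \<le> k t - y * t" by auto
    have "(SUP \<eta>\<in>{-s..s}. y * \<eta> - k \<eta>) = y * ts - k ts"
      using ts by (intro cSup_eq_maximum) (auto, smt (verit))
    then show ?thesis
      using integral_derivative_pos_part(2)[OF cv lip p der ts] by simp
  qed
  let ?F = "\<lambda>y \<eta>. indicator {-R..R} y * (indicator {-s..s} \<eta> * max 0 (y - p \<eta>)) :: real"
  have intF: "integrable (lborel \<Otimes>\<^sub>M lborel) (\<lambda>(y, \<eta>). ?F y \<eta>)"
  proof (rule Bochner_Integration.integrable_bound)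
    show "integrable (lborel \<Otimes>\<^sub>M lborel) (\<lambda>(y, \<eta>). indicator ({-R..R} \<times> {-s..s}) (y, \<eta>) * (2 * R))"
    proof -
      have "emeasure lborel ({-R..R} \<times> {-s..s}) < \<infinity>"
        by (intro emeasure_bounded_finite bounded_Times bounded_closed_interval)
      then have "integrable lborel (indicator ({-R..R} \<times> {-s..s}) :: real \<times> real \<Rightarrow> real)"
        by (intro integrable_real_indicator) (simp_all add: closed_Times borel_closed)
      then have "integrable lborel (\<lambda>x. indicator ({-R..R} \<times> {-s..s}) x * (2 * R))"
        by (rule integrable_mult_left)
      then show ?thesis by (simp only: lborel_prod split_beta' prod.collapse)
    qed
    show "AE x in lborel \<Otimes>\<^sub>M lborel. norm (case x of (y, \<eta>) \<Rightarrow> ?F y \<eta>) \<le>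
        norm (case x of (y, \<eta>) \<Rightarrow> indicator ({- R..R} \<times> {- s..s}) (y, \<eta>) * (2 * R))"
    proof (intro AE_I2)
      fix x :: "real \<times> real"
      show "norm (case x of (y, \<eta>) \<Rightarrow> ?F y \<eta>) \<le>
        norm (case x of (y, \<eta>) \<Rightarrow> indicator ({- R..R} \<times> {- s..s}) (y, \<eta>) * (2 * R))"
        using pb[of "snd x"] R0 by (auto simp: indicator_def split_beta')
    qed
    have "Measurable.pred (borel \<Otimes>\<^sub>M borel) (\<lambda>x. fst x \<in> {-R..R})" by measurable
    show "(\<lambda>(y, \<eta>). ?F y \<eta>) \<in> borel_measurable (lborel \<Otimes>\<^sub>M lborel)"
      unfolding split_beta'
      by (intro borel_measurable_times borel_measurable_max borel_measurable_diff borel_measurable_const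
          borel_measurable_indicator' measurable_compose[OF measurable_snd] measurable_compose[OF measurable_fst]) auto
  qed
  have inner: "(LINT y|lborel. ?F y \<eta>) = indicator {-s..s} \<eta> * ((R - p \<eta>)^2 / 2)" for \<eta>
  proof -
    have "has_bochner_integral lborel (\<lambda>y. indicator {p \<eta>..R} y *\<^sub>R (y - p \<eta>)) ((R - p \<eta>)^2/2 - (p \<eta> - p \<eta>)^2/2)"
      using pb[of \<eta>] by (intro has_bochner_integral_FTC_Icc_scaleR[where F="\<lambda>y. (y - p \<eta>)^2/2"]) (auto intro!: derivative_eq_intros continuous_intros)
    then have "(LINT y|lborel. indicator {p \<eta>..R} y *\<^sub>R (y - p \<eta>)) = (R - p \<eta>)^2/2"
      using has_bochner_integral_integral_eq by fastforce
    moreover have "(LINT y|lborel. ?F y \<eta>) = (LINT y|lborel. indicator {-s..s} \<eta> * (indicator {p \<eta>..R} y *\<^sub>R (y - p \<eta>)))"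
      using pb[of \<eta>] by (intro Bochner_Integration.integral_cong) (auto simp: indicator_def)
    ultimately show ?thesis by simp
  qed
  have dbl: "(LINT y|lborel. LINT \<eta>|lborel. ?F y \<eta>) = (LINT \<eta>:{-s..s}|lborel. (R - p \<eta>)^2 / 2)"
  proof -
    have "(LINT y|lborel. LINT \<eta>|lborel. ?F y \<eta>) = (LINT \<eta>|lborel. LINT y|lborel. ?F y \<eta>)"
      using lborel_pair.Fubini_integral[OF intF] by simp
    also have "\<dots> = (LINT \<eta>:{-s..s}|lborel. (R - p \<eta>)^2 / 2)"
      unfolding set_lebesgue_integral_def by (simp add: inner)
    finally show ?thesis .
  qed
  have intp: "set_integrable lborel {-s..s} p" "(LINT t:{-s..s}|lborel. p t) = k s - k (-s)"
    using integral_derivative_Lipschitz[OF lip p der, of "-s" s] s by auto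
  have intp2: "set_integrable lborel {-s..s} (\<lambda>\<eta>. (p \<eta>)^2)"
    unfolding set_integrable_def
  proof (rule Bochner_Integration.integrable_bound[of lborel "\<lambda>\<eta>. indicator {-s..s} \<eta> * R^2"])
    show "AE x in lborel. norm (indicator {- s..s} x *\<^sub>R (p x)\<^sup>2) \<le> norm (indicator {- s..s} x * R\<^sup>2)"
      using pb R0 by (auto simp: indicator_def abs_le_square_iff[symmetric])
    show "integrable lborel (\<lambda>\<eta>. indicator {-s..s} \<eta> * R^2)"
      by (intro integrable_mult_left integrable_real_indicator) (simp_all add: s)
  qed simp
  have quad: "(LINT \<eta>:{-s..s}|lborel. (R - p \<eta>)^2 / 2)
    = R^2 * s - R * (k s - k (-s)) + (LINT \<eta>:{-s..s}|lborel. (p \<eta>)^2) / 2"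
  proof -
    have c: "set_integrable lborel {-s..s} (\<lambda>_. R^2/2)" "(LINT \<eta>:{-s..s}|lborel. R^2/2) = R^2 * s"
      using s by (simp_all add: set_integrable_def set_lebesgue_integral_def)
    have "(LINT \<eta>:{-s..s}|lborel. (R - p \<eta>)^2 / 2) = (LINT \<eta>:{-s..s}|lborel. R^2/2 - R * p \<eta> + (p \<eta>)^2 / 2)"
      by (intro set_lebesgue_integral_cong) (auto simp: power2_eq_square field_simps)
    also have "\<dots> = (LINT \<eta>:{-s..s}|lborel. R^2/2 - R * p \<eta>) + (LINT \<eta>:{-s..s}|lborel. (p \<eta>)^2 / 2)"
      using c(1) intp(1) intp2 by (intro set_integral_add) auto
    also have "(LINT \<eta>:{-s..s}|lborel. R^2/2 - R * p \<eta>) = R^2 * s - R * (k s - k (-s))"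
      using c intp by (subst set_integral_diff) auto
    finally show ?thesis by simp
  qed
  have intin: "integrable lborel (\<lambda>y. LINT \<eta>|lborel. ?F y \<eta>)"
    using lborel_pair.integrable_fst[OF intF] by simp
  have lin: "has_bochner_integral lborel (\<lambda>y. indicator {-R..R} y *\<^sub>R (- y * s - k (-s))) ((- (R^2) * s/2 - R * k (-s)) - (- ((-R)^2) * s/2 - (-R) * k (-s)))"
    using R0 by (intro has_bochner_integral_FTC_Icc_scaleR[where F="\<lambda>y. - (y^2) * s/2 - y * k (-s)"]) (auto intro!: derivative_eq_intros continuous_intros)
  have "(LINT y:{-R..R}|lborel. (SUP \<eta>\<in>{-s..s}. y * \<eta> - k \<eta>))
      = (LINT y|lborel. indicator {-R..R} y *\<^sub>R (- y * s - k (-s)) + (LINT \<eta>|lborel. ?F y \<eta>))"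
    unfolding set_lebesgue_integral_def sup
    by (intro Bochner_Integration.integral_cong refl) (auto simp: indicator_def)
  also have "\<dots> = (- (R^2) * s/2 - R * k (-s)) - (- ((-R)^2) * s/2 - (-R) * k (-s)) + (LINT \<eta>:{-s..s}|lborel. (R - p \<eta>)^2 / 2)"
    using lin intin dbl by (subst Bochner_Integration.integral_add) (auto simp: has_bochner_integral_iff)
  also have "\<dots> = R^2 * s - R * (k s + k (-s)) + (LINT \<eta>:{-s..s}|lborel. (p \<eta>)^2) / 2"
    unfolding quad by (simp add: algebra_simps)
  finally show ?thesis by (simp add: algebra_simps)
qed

lemma convex_Lipschitz_derivative_bound:
  fixes k :: "real \<Rightarrow> real"
  assumes lip: "L-lipschitz_on UNIV k" and der: "(k has_real_derivative d) (at t)" and cv: "convex_on UNIV k"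
  shows "\<bar>d\<bar> \<le> L"
proof -
  have "\<bar>k (t+1) - k t\<bar> \<le> L" "\<bar>k (t-1) - k t\<bar> \<le> L"
    using lipschitz_onD[OF lip, of "t+1" t] lipschitz_onD[OF lip, of "t-1" t] by (simp_all add: dist_real_def)
  then show ?thesis
    using convex_tangent_real[OF cv der, of "t+1"] convex_tangent_real[OF cv der, of "t-1"] by (simp add: abs_le_iff)
qed

text \<open>Truncating \<open>p\<close> at height \<open>R\<close> changes it on a null set only, as
  derivatives of \<open>k\<close> are bounded by \<open>L\<close>.\<close>

lemma integral_conjugate_quadratic:
  fixes k p :: "real \<Rightarrow> real"
  assumes cv: "convex_on UNIV k" and lip: "L-lipschitz_on UNIV k"
    and p [measurable]: "p \<in> borel_measurable borel"
    and der: "AE t in lborel. (k has_real_derivative p t) (at t)"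
    and s: "0 \<le> s" and R: "L \<le> R"
  shows "(LINT y:{-R..R}|lborel. (SUP \<eta>\<in>{-s..s}. y * \<eta> - k \<eta>))
    = R^2 * s - R * (k s + k (-s)) + (LINT \<eta>:{-s..s}|lborel. (p \<eta>)^2) / 2"
proof -
  define q where "q t = max (-R) (min R (p t))" for t
  have R0: "0 \<le> R" using lipschitz_on_nonneg[OF lip] R by simp
  have eq: "AE t in lborel. q t = p t"
    using der
  proof eventually_elim
    case (elim t)
    have "\<bar>p t\<bar> \<le> R" using convex_Lipschitz_derivative_bound[OF lip elim cv] R by simp
    then show ?case by (auto simp: q_def)
  qed
  have q [measurable]: "q \<in> borel_measurable borel" unfolding q_def by measurable
  have derq: "AE t in lborel. (k has_real_derivative q t) (at t)"
    using der eq by eventually_elim simp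
  have qb: "\<bar>q \<eta>\<bar> \<le> R" for \<eta> using R0 by (auto simp: q_def)
  have "(LINT \<eta>:{-s..s}|lborel. (q \<eta>)^2) = (LINT \<eta>:{-s..s}|lborel. (p \<eta>)^2)"
    unfolding set_lebesgue_integral_def
    by (intro integral_cong_AE) (use eq in auto)
  then show ?thesis
    using integral_conjugate_quadratic_bounded[OF cv lip q derq qb s] by simp
qed

section \<open>Gradients and subgradients of convex functions\<close>

lemma gradient_eq: "GDERIV u x :> D \<Longrightarrow> gradient u x = D"
  unfolding gradient_def
proof (rule the_equality)
  fix D' assume "GDERIV u x :> D" "GDERIV u x :> D'"
  then have "(\<lambda>h. h \<bullet> D) = (\<lambda>h. h \<bullet> D')"
    unfolding gderiv_def by (rule has_derivative_unique)
  then have "(D' - D) \<bullet> D = (D' - D) \<bullet> D'" by (rule fun_cong)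
  then have "(D' - D) \<bullet> (D' - D) = 0" by (simp add: inner_diff_right)
  then show "D' = D" by simp
qed

lemma differentiable_imp_GDERIV:
  fixes u :: "'a::euclidean_space \<Rightarrow> real"
  assumes "u differentiable (at x)"
  shows "GDERIV u x :> gradient u x"
proof -
  obtain f' where f': "(u has_derivative f') (at x)"
    using assms by (auto simp: differentiable_def)
  have eq: "f' h = h \<bullet> (\<Sum>b\<in>Basis. f' b *\<^sub>R b)" for h
  proof -
    have "f' h = f' (\<Sum>b\<in>Basis. (h \<bullet> b) *\<^sub>R b)" by (simp add: euclidean_representation)
    also have "\<dots> = (\<Sum>b\<in>Basis. (h \<bullet> b) * f' b)"
      using has_derivative_linear[OF f'] by (simp add: linear_sum linear_cmul)
    finally show ?thesis by (simp add: inner_sum_right mult.commute)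
  qed
  then have "GDERIV u x :> (\<Sum>b\<in>Basis. f' b *\<^sub>R b)"
    using f' unfolding gderiv_def eq[abs_def, symmetric] by simp
  then show ?thesis using gradient_eq by metis
qed

lemma GDERIV_imp_differentiable: "GDERIV u x :> D \<Longrightarrow> u differentiable (at x)"
  by (auto simp: gderiv_def differentiable_def)

lemma GDERIV_line:
  assumes "GDERIV u (a + t *\<^sub>R c) :> D"
  shows "((\<lambda>s. u (a + s *\<^sub>R c)) has_real_derivative (c \<bullet> D)) (at t)"
proof -
  have "((\<lambda>s. a + s *\<^sub>R c) has_derivative (\<lambda>h. h *\<^sub>R c)) (at t)"
    by (auto intro!: derivative_eq_intros)
  from has_derivative_compose[OF this assms[unfolded gderiv_def]]
  show ?thesis by (simp add: has_field_derivative_def mult_commute_abs)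
qed

definition subgrad :: "'a::euclidean_space set \<Rightarrow> ('a \<Rightarrow> real) \<Rightarrow> 'a \<Rightarrow> 'a \<Rightarrow> bool" where
  "subgrad S u x D \<longleftrightarrow> (\<forall>y\<in>S. u x + D \<bullet> (y - x) \<le> u y)"

lemma subgradD: "subgrad S u x D \<Longrightarrow> y \<in> S \<Longrightarrow> u x + D \<bullet> (y - x) \<le> u y"
  by (auto simp: subgrad_def)

text \<open>A plane separates the epigraph from the open ray strictly below \<open>(x, u x)\<close>.
  It is not vertical: a vertical plane through the interior point \<open>x\<close> would have points
  of \<open>S\<close> on both sides.\<close>

lemma subgrad_ex:
  fixes u :: "'a::euclidean_space \<Rightarrow> real"
  assumes cv: "convex_on S u" and x: "x \<in> interior S"
  shows "\<exists>D. subgrad S u x D"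
proof -
  have xS: "x \<in> S" using x interior_subset by blast
  let ?A = "{x} \<times> {..< u x}" and ?B = "epigraph S u"
  have "convex ?A" "?A \<noteq> {}" by (auto simp: convex_Times intro: lt_ex)
  moreover have "convex ?B" "?B \<noteq> {}" using cv xS by (simp_all add: convex_epigraph) (auto simp: epigraph_def)
  moreover have "?A \<inter> ?B = {}" by (auto simp: epigraph_def)
  ultimately obtain a b where ab: "a \<noteq> 0" "\<forall>z\<in>?A. a \<bullet> z \<le> b" "\<forall>z\<in>?B. b \<le> a \<bullet> z"
    using separating_hyperplane_sets by metis
  obtain p q where pq: "a = (p, q)" by (cases a)
  have A: "p \<bullet> x + q * z \<le> b" if "z < u x" for z
    using ab(2) that by (auto simp: pq inner_Pair)
  have B: "b \<le> p \<bullet> y + q * z" if "y \<in> S" "u y \<le> z" for y z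
    using ab(3) that by (auto simp: pq inner_Pair epigraph_def)
  have q0: "q \<ge> 0"
    using A[of "u x - 1"] B[OF xS, of "u x"] by (simp add: algebra_simps)
  have bound: "p \<bullet> x + q * u x \<le> p \<bullet> y + q * u y" if "y \<in> S" for y
  proof (rule field_le_epsilon)
    fix e :: real assume e: "e > 0"
    have "p \<bullet> x + q * (u x - e / (q + 1)) \<le> b" using e q0 by (intro A) auto
    moreover have "q * (e / (q + 1)) \<le> e" using e q0 by (simp add: field_simps)
    ultimately show "p \<bullet> x + q * u x \<le> p \<bullet> y + q * u y + e"
      using B[OF that, of "u y"] by (simp add: algebra_simps)
  qed
  have "q \<noteq> 0"
  proof
    assume q: "q = 0"
    obtain e where e: "e > 0" "cball x e \<subseteq> S"
      using x by (metis mem_interior_cball)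
    have p: "p \<noteq> 0" using ab(1) pq q by (auto simp: zero_prod_def)
    let ?y = "x - (e / norm p) *\<^sub>R p"
    have "?y \<in> S" using e p by (intro subsetD[OF e(2)]) (auto simp: dist_norm)
    from bound[OF this] q have "(e / norm p) * (p \<bullet> p) \<le> 0" by (simp add: inner_diff_right)
    then have "p \<bullet> p \<le> 0" using e p by (simp add: mult_le_0_iff divide_le_0_iff)
    then show False using p inner_gt_zero_iff[of p] by linarith
  qed
  then have q: "q > 0" using q0 by simp
  have "subgrad S u x (- (1/q) *\<^sub>R p)"
    unfolding subgrad_def
  proof
    fix y assume "y \<in> S"
    from bound[OF this] q show "u x + (- (1/q) *\<^sub>R p) \<bullet> (y - x) \<le> u y"
      by (simp add: inner_diff_right field_simps)
  qed
  then show ?thesis by blast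
qed

text \<open>Moving from \<open>y\<close> by the distance \<open>r\<close> in the direction of
  \<open>D\<close> raises the affine minorant by \<open>r * norm D\<close>, while \<open>u\<close>
  varies by at most \<open>2 * M\<close> on the ball of twice the radius.\<close>

lemma subgrad_bounded:
  fixes u :: "'a::euclidean_space \<Rightarrow> real"
  assumes cont: "continuous_on S u" and S: "open S" and x: "x \<in> S"
  shows "\<exists>r>0. \<exists>B. cball x r \<subseteq> S \<and> (\<forall>y D. y \<in> cball x r \<longrightarrow> subgrad S u y D \<longrightarrow> norm D \<le> B)"
proof -
  obtain r where r: "r > 0" "cball x (2*r) \<subseteq> S"
  proof -
    obtain e where "e > 0" "cball x e \<subseteq> S" using S x by (meson open_contains_cball)
    then show ?thesis by (intro that[of "e/2"]) auto
  qed
  have "bounded (u ` cball x (2*r))"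
    by (rule compact_imp_bounded[OF compact_continuous_image[OF continuous_on_subset[OF cont r(2)] compact_cball]])
  then obtain M where M: "\<And>y. y \<in> cball x (2*r) \<Longrightarrow> \<bar>u y\<bar> \<le> M"
    by (auto simp: bounded_iff simp del: mem_cball)
  have "norm D \<le> 2 * M / r" if y: "y \<in> cball x r" and D: "subgrad S u y D" for y D
  proof (cases "D = 0")
    case True
    have "0 \<le> M" using M[of x] r by auto
    then show ?thesis using True r by simp
  next
    case False
    let ?z = "y + (r / norm D) *\<^sub>R D"
    have "dist y ?z \<le> r" using False r by (simp add: dist_norm)
    then have z: "?z \<in> cball x (2*r)" using y dist_triangle[of x ?z y] by auto
    have "u y + D \<bullet> (?z - y) \<le> u ?z" by (rule subgradD[OF D subsetD[OF r(2) z]])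
    moreover have "D \<bullet> (?z - y) = r * norm D"
      using False by (simp add: power2_norm_eq_inner[symmetric] power2_eq_square)
    moreover have "y \<in> cball x (2*r)" using y r by auto
    ultimately have "r * norm D \<le> 2 * M" using M[OF z] M[of y] by auto
    then show ?thesis using r by (simp add: field_simps)
  qed
  moreover have "cball x r \<subseteq> S"
    using r(1) subset_trans[OF cball_subset_cball_iff[THEN iffD2] r(2), of x r] by simp
  ultimately show ?thesis using r(1) by blast
qed

lemma subgrad_limit:
  fixes u :: "'a::euclidean_space \<Rightarrow> real"
  assumes cont: "isCont u x" and X: "X \<longlonglongrightarrow> x" and D: "D \<longlonglongrightarrow> d"
    and sub: "\<And>n. subgrad S u (X n) (D n)"
  shows "subgrad S u x d"
  unfolding subgrad_def
proof
  fix y assume y: "y \<in> S"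
  have "(\<lambda>n. u (X n) + D n \<bullet> (y - X n)) \<longlonglongrightarrow> u x + d \<bullet> (y - x)"
    by (intro tendsto_intros isCont_tendsto_compose[OF cont] X D)
  then show "u x + d \<bullet> (y - x) \<le> u y"
    by (rule LIMSEQ_le_const2) (use subgradD[OF sub y] in auto)
qed

text \<open>Otherwise subgradients at points tending to \<open>x\<close> would stay away from those
  at \<open>x\<close>; being locally bounded, they have a limit point, which is a subgradient at
  \<open>x\<close>.\<close>

lemma subgrad_upper_semicontinuous:
  fixes u :: "'a::euclidean_space \<Rightarrow> real"
  assumes cont: "continuous_on S u" and S: "open S" and x: "x \<in> S" and e: "e > 0"
  shows "\<exists>\<delta>>0. ball x \<delta> \<subseteq> S \<and> (\<forall>y\<in>ball x \<delta>. \<forall>D. subgrad S u y D \<longrightarrow> (\<exists>D0. subgrad S u x D0 \<and> norm (D - D0) < e))"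
proof (rule ccontr)
  assume neg: "\<not> ?thesis"
  obtain r B where r: "r > 0" "cball x r \<subseteq> S" and B: "\<And>y D. y \<in> cball x r \<Longrightarrow> subgrad S u y D \<Longrightarrow> norm D \<le> B"
    using subgrad_bounded[OF cont S x] by blast
  have "\<exists>y D. y \<in> ball x (min r (1 / Suc n)) \<and> subgrad S u y D \<and> (\<forall>D0. subgrad S u x D0 \<longrightarrow> norm (D - D0) \<ge> e)" for n :: nat
  proof -
    have "min r (1 / Suc n) > 0" using r by simp
    moreover have "ball x (min r (1 / Suc n)) \<subseteq> S" using r by (auto intro!: subsetD[OF r(2)])
    ultimately show ?thesis using neg by (meson not_less)
  qed
  then obtain y D where yD: "\<And>n. y n \<in> ball x (min r (1 / Suc n))" "\<And>n. subgrad S u (y n) (D n)"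
    "\<And>n D0. subgrad S u x D0 \<Longrightarrow> norm (D n - D0) \<ge> e"
    by metis
  have ylim: "y \<longlonglongrightarrow> x"
  proof (rule metric_LIMSEQ_I)
    fix r' :: real assume "r' > 0"
    then obtain N where N: "1 / real (Suc N) < r'" using nat_approx_posE by blast
    have "dist (y n) x < r'" if "n \<ge> N" for n
    proof -
      have "dist (y n) x < 1 / real (Suc n)" using yD(1)[of n] by (simp add: dist_commute)
      also have "\<dots> \<le> 1 / real (Suc N)" using that by (simp add: frac_le)
      finally show ?thesis using N by simp
    qed
    then show "\<exists>no. \<forall>n\<ge>no. dist (y n) x < r'" by blast
  qed
  have "norm (D n) \<le> B" for n
    using yD(1)[of n] by (intro B[OF _ yD(2)]) auto
  then have "bounded (range D)" by (auto simp: bounded_iff)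
  then obtain d s where s: "strict_mono s" "(D \<circ> s) \<longlonglongrightarrow> d"
    using bounded_imp_convergent_subsequence by blast
  have "subgrad S u x d"
  proof (rule subgrad_limit)
    show "isCont u x" using cont S x by (simp add: continuous_on_eq_continuous_at)
    show "(y \<circ> s) \<longlonglongrightarrow> x" using LIMSEQ_subseq_LIMSEQ[OF ylim s(1)] .
  qed (use s yD(2) in auto)
  from yD(3)[OF this] have "norm ((D \<circ> s) n - d) \<ge> e" for n by simp
  moreover have "\<forall>\<^sub>F n in sequentially. norm ((D \<circ> s) n - d) < e"
    using tendstoD[OF s(2) e] by (simp add: dist_norm)
  ultimately show False by (metis (mono_tags, lifting) eventually_sequentially not_less order_refl)
qed

lemma GDERIV_imp_subgrad:
  fixes u :: "'a::euclidean_space \<Rightarrow> real"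
  assumes cv: "convex_on S u" and x: "x \<in> S" and D: "GDERIV u x :> D"
  shows "subgrad S u x D"
  unfolding subgrad_def
proof
  fix y assume y: "y \<in> S"
  have "((\<lambda>t. u (x + t *\<^sub>R (y - x))) has_real_derivative ((y - x) \<bullet> D)) (at 0)"
    by (rule GDERIV_line) (use D in simp)
  then have lim: "((\<lambda>t. (u (x + t *\<^sub>R (y - x)) - u x) / t) \<longlongrightarrow> (y - x) \<bullet> D) (at_right 0)"
    by (simp add: DERIV_def filterlim_at_split)
  have "\<forall>\<^sub>F t in at_right 0. (u (x + t *\<^sub>R (y - x)) - u x) / t \<le> u y - u x"
    unfolding eventually_at_right_field
  proof (intro exI[of _ 1] conjI allI impI)
    fix t :: real assume t: "0 < t" "t < 1"
    have eq: "x + t *\<^sub>R (y - x) = (1 - t) *\<^sub>R x + t *\<^sub>R y" by (simp add: algebra_simps)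
    have "u (x + t *\<^sub>R (y - x)) \<le> (1 - t) * u x + t * u y"
      unfolding eq using cv x y t by (intro convex_onD) auto
    then show "(u (x + t *\<^sub>R (y - x)) - u x) / t \<le> u y - u x"
      using t by (simp add: field_simps)
  qed simp
  from tendsto_upperbound[OF lim this] show "u x + D \<bullet> (y - x) \<le> u y"
    by (simp add: inner_commute)
qed

text \<open>The derivative in the direction \<open>D' - D\<close> is at least its inner product with
  \<open>D'\<close>, which leaves \<open>norm (D' - D)^2 \<le> 0\<close>.\<close>

lemma GDERIV_subgrad_unique:
  fixes u :: "'a::euclidean_space \<Rightarrow> real"
  assumes D: "GDERIV u x :> D" and x: "x \<in> interior S" and D': "subgrad S u x D'"
  shows "D' = D"
proof -
  let ?c = "D' - D"
  have "((\<lambda>t. u (x + t *\<^sub>R ?c)) has_real_derivative (?c \<bullet> D)) (at 0)"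
    by (rule GDERIV_line) (use D in simp)
  then have lim: "((\<lambda>t. (u (x + t *\<^sub>R ?c) - u x) / t) \<longlongrightarrow> ?c \<bullet> D) (at_right 0)"
    by (simp add: DERIV_def filterlim_at_split)
  have "\<forall>\<^sub>F t in at_right 0. x + t *\<^sub>R ?c \<in> interior S"
  proof -
    have "((\<lambda>t. x + t *\<^sub>R ?c) \<longlongrightarrow> x + 0 *\<^sub>R ?c) (at_right 0)" by (intro tendsto_intros)
    then show ?thesis using x by (intro topological_tendstoD[where l=x]) auto
  qed
  then have "\<forall>\<^sub>F t in at_right 0. ?c \<bullet> D' \<le> (u (x + t *\<^sub>R ?c) - u x) / t"
    using eventually_at_right_less[of 0]
  proof eventually_elim
    case (elim t)
    have "u x + D' \<bullet> (x + t *\<^sub>R ?c - x) \<le> u (x + t *\<^sub>R ?c)"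
      using elim interior_subset by (intro subgradD[OF D']) blast
    then have "t * (?c \<bullet> D') \<le> u (x + t *\<^sub>R ?c) - u x" by (simp add: inner_commute)
    then show ?case using elim by (simp add: field_simps)
  qed
  from tendsto_lowerbound[OF lim this] have "?c \<bullet> ?c \<le> 0" by (simp add: inner_diff_right)
  then have "?c = 0" using inner_gt_zero_iff[of ?c] by linarith
  then show ?thesis by simp
qed

text \<open>By upper semicontinuity all subgradients at nearby points \<open>y\<close> are close to
  \<open>D\<close>. Those at \<open>x\<close> and \<open>y\<close> bound \<open>u y - u x\<close>
  from both sides, so the remainder is at most \<open>e * norm (y - x)\<close>.\<close>

lemma unique_subgrad_imp_GDERIV:
  fixes u :: "'a::euclidean_space \<Rightarrow> real"
  assumes cv: "convex_on S u" and S: "open S" and x: "x \<in> S"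
    and D: "subgrad S u x D" and uniq: "\<And>D'. subgrad S u x D' \<Longrightarrow> D' = D"
  shows "GDERIV u x :> D"
  unfolding gderiv_def has_derivative_at_alt
proof (intro conjI allI impI)
  show "bounded_linear (\<lambda>h. h \<bullet> D)" by (rule bounded_linear_inner_left)
  fix e :: real assume e: "e > 0"
  have cont: "continuous_on S u" using convex_on_continuous[OF S cv] .
  from subgrad_upper_semicontinuous[OF cont S x e] obtain d where d: "d > 0" "ball x d \<subseteq> S"
    and dd: "\<And>y D'. y \<in> ball x d \<Longrightarrow> subgrad S u y D' \<Longrightarrow> norm (D' - D) < e"
    using uniq by blast
  have "norm (u y - u x - (y - x) \<bullet> D) \<le> e * norm (y - x)" if y: "norm (y - x) < d" for y
  proof -
    have yb: "y \<in> ball x d" using y by (simp add: dist_norm norm_minus_commute)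
    then have yS: "y \<in> S" using d by auto
    obtain D' where D': "subgrad S u y D'"
      using subgrad_ex[OF cv, of y] yS S by (auto simp: interior_open)
    have 1: "u x + D \<bullet> (y - x) \<le> u y" by (rule subgradD[OF D yS])
    have 2: "u y + D' \<bullet> (x - y) \<le> u x" by (rule subgradD[OF D' x])
    have "(D' - D) \<bullet> (y - x) \<le> norm (D' - D) * norm (y - x)" by (rule norm_cauchy_schwarz)
    also have "\<dots> \<le> e * norm (y - x)" using dd[OF yb D'] by (intro mult_right_mono) auto
    finally have "(D' - D) \<bullet> (y - x) \<le> e * norm (y - x)" .
    then show ?thesis using 1 2 by (simp add: inner_diff_left inner_diff_right inner_commute)
  qed
  then show "\<exists>d>0. \<forall>y. norm (y - x) < d \<longrightarrow> norm (u y - u x - (y - x) \<bullet> D) \<le> e * norm (y - x)"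
    using d(1) by blast
qed

lemma continuous_on_gradient_convex:
  fixes u :: "'a::euclidean_space \<Rightarrow> real"
  assumes cv: "convex_on S u" and S: "open S" and T: "T \<subseteq> S" and "\<And>x. x \<in> T \<Longrightarrow> u differentiable (at x)"
  shows "continuous_on T (gradient u)"
  unfolding continuous_on_iff
proof (intro ballI allI impI)
  fix x and e :: real assume x: "x \<in> T" and e: "e > 0"
  have G: "GDERIV u y :> gradient u y" if "y \<in> T" for y
    using differentiable_imp_GDERIV assms(4)[OF that] .
  from subgrad_upper_semicontinuous[OF convex_on_continuous[OF S cv] S, of x e] x T e
  obtain d where d: "d > 0"
    and dd: "\<And>y D. y \<in> ball x d \<Longrightarrow> subgrad S u y D \<Longrightarrow> \<exists>D0. subgrad S u x D0 \<and> norm (D - D0) < e"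
    by blast
  have "dist (gradient u y) (gradient u x) < e" if y: "y \<in> T" "dist y x < d" for y
  proof -
    have "subgrad S u y (gradient u y)" using GDERIV_imp_subgrad[OF cv _ G] y T by blast
    with dd[of y] y obtain D0 where D0: "subgrad S u x D0" "norm (gradient u y - D0) < e"
      by (auto simp: dist_commute)
    have "D0 = gradient u x"
      using GDERIV_subgrad_unique[OF G[OF x] _ D0(1)] x T S by (auto simp: interior_open)
    then show ?thesis using D0 by (simp add: dist_norm)
  qed
  then show "\<exists>d>0. \<forall>x'\<in>T. dist x' x < d \<longrightarrow> dist (gradient u x') (gradient u x) < e"
    using d by blast
qed


section \<open>Differentiability almost everywhere and measurability of gradients\<close>

text \<open>All quantifiers on the right range over natural numbers, so that sets described by
  convergence are seen to be measurable.\<close>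

lemma LIMSEQ_0_iff_countable:
  fixes X :: "nat \<Rightarrow> real"
  shows "X \<longlonglongrightarrow> 0 \<longleftrightarrow> (\<forall>k. \<exists>N. \<forall>n. N \<le> n \<longrightarrow> \<bar>X n\<bar> < 1 / real (Suc k))"
proof
  assume "X \<longlonglongrightarrow> 0"
  then show "\<forall>k. \<exists>N. \<forall>n. N \<le> n \<longrightarrow> \<bar>X n\<bar> < 1 / real (Suc k)"
    unfolding LIMSEQ_iff by (auto simp del: of_nat_Suc)
next
  assume *: "\<forall>k. \<exists>N. \<forall>n. N \<le> n \<longrightarrow> \<bar>X n\<bar> < 1 / real (Suc k)"
  show "X \<longlonglongrightarrow> 0"
    unfolding LIMSEQ_iff
  proof (intro allI impI)
    fix r :: real assume "r > 0"
    then obtain k where k: "1 / real (Suc k) < r" using nat_approx_posE by blast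
    from * obtain N where "\<forall>n. N \<le> n \<longrightarrow> \<bar>X n\<bar> < 1 / real (Suc k)" by blast
    then show "\<exists>no. \<forall>n\<ge>no. norm (X n - 0) < r" using k by (intro exI[of _ N]) fastforce
  qed
qed

text \<open>For convex \<open>u\<close> this tends to the jump of the derivative along
  \<open>c\<close> at \<open>x\<close>. In contrast to differentiability it is visibly measurable in
  \<open>x\<close>.\<close>

definition second_difference :: "('a::real_vector \<Rightarrow> real) \<Rightarrow> 'a \<Rightarrow> nat \<Rightarrow> 'a \<Rightarrow> real" where
  "second_difference u c n x =
     real (Suc n) * (u (x + (1 / real (Suc n)) *\<^sub>R c) + u (x - (1 / real (Suc n)) *\<^sub>R c) - 2 * u x)"

lemma second_difference_tendsto_0:
  fixes u :: "'a::euclidean_space \<Rightarrow> real"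
  assumes "((\<lambda>s. u (x + s *\<^sub>R c)) has_real_derivative d) (at 0)"
  shows "(\<lambda>n. second_difference u c n x) \<longlonglongrightarrow> 0"
proof -
  have 1: "((\<lambda>h. (u (x + h *\<^sub>R c) - u x) / h) \<longlongrightarrow> d) (at 0)"
    using assms by (simp add: DERIV_def)
  have at0: "filterlim (\<lambda>m. 1 / real (Suc m)) (at 0) sequentially"
    "filterlim (\<lambda>m. - (1 / real (Suc m))) (at 0) sequentially"
    unfolding filterlim_at using LIMSEQ_Suc[OF lim_1_over_n[where 'a=real]] tendsto_minus[OF LIMSEQ_Suc[OF lim_1_over_n[where 'a=real]]] by auto
  have "(\<lambda>n. (u (x + (1 / real (Suc n)) *\<^sub>R c) - u x) / (1 / real (Suc n)) - (u (x + (- (1 / real (Suc n))) *\<^sub>R c) - u x) / (- (1 / real (Suc n)))) \<longlonglongrightarrow> d - d"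
    by (intro tendsto_diff filterlim_compose[OF 1] at0)
  moreover have "(u (x + (1 / real (Suc n)) *\<^sub>R c) - u x) / (1 / real (Suc n)) - (u (x + (- (1 / real (Suc n))) *\<^sub>R c) - u x) / (- (1 / real (Suc n))) = second_difference u c n x" for n
    by (simp add: second_difference_def algebra_simps)
  ultimately show ?thesis by simp
qed

lemma convex_on_line:
  assumes "convex_on S u"
  shows "convex_on {t. a + t *\<^sub>R c \<in> S} (\<lambda>t. u (a + t *\<^sub>R c))"
proof (rule convex_onI)
  show "convex {t. a + t *\<^sub>R c \<in> S}"
  proof (rule convexI, clarsimp)
    fix x y p q :: real assume *: "a + x *\<^sub>R c \<in> S" "a + y *\<^sub>R c \<in> S" "0 \<le> p" "0 \<le> q" "p + q = 1"
    have "p *\<^sub>R (a + x *\<^sub>R c) + q *\<^sub>R (a + y *\<^sub>R c) \<in> S"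
      using convex_on_imp_convex[OF assms] * by (intro convexD) auto
    moreover have "p *\<^sub>R (a + x *\<^sub>R c) + q *\<^sub>R (a + y *\<^sub>R c) = (p + q) *\<^sub>R a + (p * x + q * y) *\<^sub>R c"
      by (simp add: algebra_simps)
    ultimately show "a + (p * x + q * y) *\<^sub>R c \<in> S" using * by simp
  qed
  fix t x y :: real assume t: "0 < t" "t < 1" and x: "x \<in> {t. a + t *\<^sub>R c \<in> S}" and y: "y \<in> {t. a + t *\<^sub>R c \<in> S}"
  have "a + ((1 - t) *\<^sub>R x + t *\<^sub>R y) *\<^sub>R c = (1 - t) *\<^sub>R (a + x *\<^sub>R c) + t *\<^sub>R (a + y *\<^sub>R c)"
    by (simp add: algebra_simps)
  then show "u (a + ((1 - t) *\<^sub>R x + t *\<^sub>R y) *\<^sub>R c) \<le> (1 - t) * u (a + x *\<^sub>R c) + t * u (a + y *\<^sub>R c)"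
    using convex_onD[OF assms, of t "a + x *\<^sub>R c" "a + y *\<^sub>R c"] t x y by simp
qed

lemma borel_measurable_restrict_open:
  fixes u :: "'a::euclidean_space \<Rightarrow> real"
  assumes "convex_on S u" "open S"
  shows "(\<lambda>x. indicator S x * u x) \<in> borel_measurable borel"
  using borel_measurable_continuous_on_indicator[of S u] convex_on_continuous[OF assms(2,1)] assms(2)
  by simp

text \<open>On each line parallel to \<open>c\<close> the restriction of \<open>u\<close> has
  countably many kinks, so all slices of the exceptional set are countable. The extension
  \<open>v\<close> by zero is Borel measurable and has eventually the same second differences,
  \<open>S\<close> being open.\<close>

lemma kinks_null:
  fixes u :: "real^2 \<Rightarrow> real"
  assumes cv: "convex_on S u" and S: "open S" and c: "norm c = 1"
  shows "{x \<in> S. \<not> (\<lambda>n. second_difference u c n x) \<longlonglongrightarrow> 0} \<in> null_sets lborel" (is "?N \<in> _")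
proof (rule null_set_frame[OF c])
  define v where "v x = indicator S x * u x" for x
  have [measurable]: "v \<in> borel_measurable borel"
    unfolding v_def[abs_def] by (rule borel_measurable_restrict_open[OF cv S])
  have [measurable]: "S \<in> sets borel" using S by simp
  have [measurable]: "second_difference v c n \<in> borel_measurable borel" for n
    unfolding second_difference_def by measurable
  have eq: "(\<lambda>n. second_difference u c n x) \<longlonglongrightarrow> 0 \<longleftrightarrow> (\<lambda>n. second_difference v c n x) \<longlonglongrightarrow> 0"
    if x: "x \<in> S" for x
  proof (rule tendsto_cong)
    have lim: "(\<lambda>n. 1 / real (Suc n)) \<longlonglongrightarrow> 0"
      using LIMSEQ_Suc[OF lim_1_over_n[where 'a=real]] by simp
    have "(\<lambda>n. x + (1 / real (Suc n)) *\<^sub>R c) \<longlonglongrightarrow> x + 0 *\<^sub>R c" "(\<lambda>n. x - (1 / real (Suc n)) *\<^sub>R c) \<longlonglongrightarrow> x - 0 *\<^sub>R c"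
      by (intro tendsto_intros lim)+
    then have "\<forall>\<^sub>F n in sequentially. x + (1 / real (Suc n)) *\<^sub>R c \<in> S" "\<forall>\<^sub>F n in sequentially. x - (1 / real (Suc n)) *\<^sub>R c \<in> S"
      using x S by (auto intro: topological_tendstoD)
    then show "\<forall>\<^sub>F n in sequentially. second_difference u c n x = second_difference v c n x"
      by eventually_elim (simp add: second_difference_def v_def x)
  qed
  have "?N = {x \<in> S. \<not> (\<forall>k. \<exists>N. \<forall>n. N \<le> n \<longrightarrow> \<bar>second_difference v c n x\<bar> < 1 / real (Suc k))}"
    using eq by (auto simp only: LIMSEQ_0_iff_countable[of "\<lambda>n. second_difference v c n _"])
  also have "\<dots> \<in> sets borel"
    by measurable
  finally show "?N \<in> sets borel" .
  fix y
  let ?T = "{t. y *\<^sub>R perp c + t *\<^sub>R c \<in> S}" and ?n = "\<lambda>t. u (y *\<^sub>R perp c + t *\<^sub>R c)"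
  have fr: "frame c t y = y *\<^sub>R perp c + t *\<^sub>R c" for t by (simp add: frame_def add.commute)
  have "open ?T"
  proof -
    have "open ((\<lambda>t. y *\<^sub>R perp c + t *\<^sub>R c) -` S)"
      by (intro open_vimage S continuous_intros)
    then show ?thesis by (simp add: vimage_def)
  qed
  then have "countable {t \<in> ?T. \<not> ?n differentiable (at t)}"
    by (intro countable_nondifferentiable_convex convex_on_line[OF cv])
  moreover have "{t. frame c t y \<in> ?N} \<subseteq> {t \<in> ?T. \<not> ?n differentiable (at t)}"
  proof clarsimp
    fix t assume t: "frame c t y \<in> S" "\<not> (\<lambda>n. second_difference u c n (frame c t y)) \<longlonglongrightarrow> 0"
    have False if d: "?n differentiable (at t)"
    proof -
      obtain d where "(?n has_real_derivative d) (at t)" using d real_differentiable_def by blast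
      then have "((\<lambda>s. ?n (s + t)) has_real_derivative d) (at 0)" using DERIV_shift[of ?n d 0 t] by simp
      then have "((\<lambda>s. u (frame c t y + s *\<^sub>R c)) has_real_derivative d) (at 0)"
        by (simp add: fr algebra_simps)
      from second_difference_tendsto_0[OF this] t(2) show False by blast
    qed
    then show "y *\<^sub>R perp c + t *\<^sub>R c \<in> S \<and> \<not> ?n differentiable (at t)" using t by (auto simp: fr)
  qed
  ultimately show "countable {t. frame c t y \<in> ?N}" using countable_subset by blast
qed

lemma second_difference_imp_subgrad_eq:
  fixes u :: "'a::euclidean_space \<Rightarrow> real"
  assumes S: "open S" and x: "x \<in> S" and D: "subgrad S u x D" "subgrad S u x D'"
    and lim: "(\<lambda>n. second_difference u c n x) \<longlonglongrightarrow> 0"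
  shows "D \<bullet> c \<le> D' \<bullet> c"
proof -
  have l0: "(\<lambda>n. 1 / real (Suc n)) \<longlonglongrightarrow> 0"
    using LIMSEQ_Suc[OF lim_1_over_n[where 'a=real]] by simp
  have "(\<lambda>n. x + (1 / real (Suc n)) *\<^sub>R c) \<longlonglongrightarrow> x + 0 *\<^sub>R c" "(\<lambda>n. x - (1 / real (Suc n)) *\<^sub>R c) \<longlonglongrightarrow> x - 0 *\<^sub>R c"
    by (intro tendsto_intros l0)+
  then have "\<forall>\<^sub>F n in sequentially. x + (1 / real (Suc n)) *\<^sub>R c \<in> S" "\<forall>\<^sub>F n in sequentially. x - (1 / real (Suc n)) *\<^sub>R c \<in> S"
    using x S by (auto intro: topological_tendstoD)
  then have "\<forall>\<^sub>F n in sequentially. D \<bullet> c - D' \<bullet> c \<le> second_difference u c n x"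
  proof eventually_elim
    case (elim n)
    have "u x + D \<bullet> (x + (1 / real (Suc n)) *\<^sub>R c - x) \<le> u (x + (1 / real (Suc n)) *\<^sub>R c)"
      "u x + D' \<bullet> (x - (1 / real (Suc n)) *\<^sub>R c - x) \<le> u (x - (1 / real (Suc n)) *\<^sub>R c)"
      by (rule subgradD[OF D(1) elim(1)], rule subgradD[OF D(2) elim(2)])
    then have "(1 / real (Suc n)) * (D \<bullet> c - D' \<bullet> c) \<le> u (x + (1 / real (Suc n)) *\<^sub>R c) + u (x - (1 / real (Suc n)) *\<^sub>R c) - 2 * u x"
      by (simp add: algebra_simps)
    then have "real (Suc n) * ((1 / real (Suc n)) * (D \<bullet> c - D' \<bullet> c)) \<le> second_difference u c n x"
      unfolding second_difference_def by (intro mult_left_mono) auto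
    then show ?case by simp
  qed
  from tendsto_lowerbound[OF lim this] show ?thesis by simp
qed

definition diff_points :: "(real^2) set \<Rightarrow> (real^2 \<Rightarrow> real) \<Rightarrow> (real^2) set" where
  "diff_points S u = {x \<in> S. u differentiable (at x)}"

text \<open>If the jumps in the two coordinate directions vanish, both components of a subgradient
  are determined; so the subgradient is unique and \<open>u\<close> is differentiable.\<close>

lemma diff_points_convex:
  fixes u :: "real^2 \<Rightarrow> real"
  assumes cv: "convex_on S u" and S: "open S"
  shows "S - diff_points S u \<in> null_sets lborel"
proof -
  let ?N = "\<lambda>c. {x \<in> S. \<not> (\<lambda>n. second_difference u c n x) \<longlonglongrightarrow> 0}"
  have eq: "S - diff_points S u = ?N (axis 1 1) \<union> ?N (axis 2 1)"
  proof (intro equalityI subsetI)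
    fix x assume x: "x \<in> S - diff_points S u"
    show "x \<in> ?N (axis 1 1) \<union> ?N (axis 2 1)"
    proof (rule ccontr)
      assume "\<not> ?thesis"
      then have lim: "(\<lambda>n. second_difference u (axis 1 1) n x) \<longlonglongrightarrow> 0" "(\<lambda>n. second_difference u (axis 2 1) n x) \<longlonglongrightarrow> 0"
        using x by auto
      have xS: "x \<in> S" using x by simp
      obtain D where D: "subgrad S u x D" using subgrad_ex[OF cv, of x] xS S by (auto simp: interior_open)
      have uniq: "D' = D" if "subgrad S u x D'" for D'
      proof -
        have "D' $ i = D $ i" for i
        proof -
          have "(\<lambda>n. second_difference u (axis i 1) n x) \<longlonglongrightarrow> 0"
            using lim exhaust_2[of i] by auto
          from second_difference_imp_subgrad_eq[OF S xS D that this] second_difference_imp_subgrad_eq[OF S xS that D this]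
          show ?thesis by (simp add: inner_axis)
        qed
        then show ?thesis by (simp add: vec_eq_iff)
      qed
      have "GDERIV u x :> D" by (rule unique_subgrad_imp_GDERIV[OF cv S xS D uniq])
      then show False using x GDERIV_imp_differentiable by (auto simp: diff_points_def)
    qed
  next
    fix x assume x: "x \<in> ?N (axis 1 1) \<union> ?N (axis 2 1)"
    have "(\<lambda>n. second_difference u c n x) \<longlonglongrightarrow> 0" if "u differentiable (at x)" for c
    proof (rule second_difference_tendsto_0)
      show "((\<lambda>s. u (x + s *\<^sub>R c)) has_real_derivative (c \<bullet> gradient u x)) (at 0)"
        by (rule GDERIV_line) (use differentiable_imp_GDERIV[OF that] in simp)
    qed
    then show "x \<in> S - diff_points S u" using x by (auto simp: diff_points_def)
  qed
  show ?thesis unfolding eq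
    by (intro null_sets.Un kinks_null[OF cv S]) auto
qed

lemma AE_differentiable_convex:
  fixes u :: "real^2 \<Rightarrow> real"
  assumes "convex_on S u" "open S"
  shows "AE x in lborel. x \<in> S \<longrightarrow> u differentiable (at x)"
  using AE_not_in[OF diff_points_convex[OF assms]] by eventually_elim (auto simp: diff_points_def)

lemma borel_measurable_gradient:
  fixes u :: "real^2 \<Rightarrow> real"
  assumes cv: "convex_on S u" and S: "open S"
  shows "(\<lambda>x. indicator S x *\<^sub>R gradient u x) \<in> borel_measurable borel"
proof -
  define v where "v x = indicator S x * u x" for x
  have [measurable]: "v \<in> borel_measurable borel"
    unfolding v_def[abs_def] by (rule borel_measurable_restrict_open[OF cv S])
  have [measurable]: "S \<in> sets borel" using S by simp
  let ?D = "diff_points S u"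
  have "?D = S - (S - ?D)" by (auto simp: diff_points_def)
  also have "\<dots> \<in> sets borel" using diff_points_convex[OF cv S] S by auto
  finally have [measurable]: "?D \<in> sets borel" .
  have comp: "(\<lambda>x. indicator ?D x * (gradient u x $ i)) \<in> borel_measurable borel" for i
  proof (rule borel_measurable_LIMSEQ_metric)
    let ?e = "axis i 1 :: real^2"
    show "(\<lambda>x. indicator ?D x * (real (Suc n) * (v (x + (1 / real (Suc n)) *\<^sub>R ?e) - v x))) \<in> borel_measurable borel" for n
      by measurable
    fix x :: "real^2"
    show "(\<lambda>n. indicator ?D x * (real (Suc n) * (v (x + (1 / real (Suc n)) *\<^sub>R ?e) - v x))) \<longlonglongrightarrow> indicator ?D x * (gradient u x $ i)"
    proof (cases "x \<in> ?D")
      case True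
      then have x: "x \<in> S" "u differentiable (at x)" by (auto simp: diff_points_def)
      have "((\<lambda>s. u (x + s *\<^sub>R ?e)) has_real_derivative (?e \<bullet> gradient u x)) (at 0)"
        by (rule GDERIV_line) (use differentiable_imp_GDERIV[OF x(2)] in simp)
      then have 1: "((\<lambda>h. (u (x + h *\<^sub>R ?e) - u x) / h) \<longlongrightarrow> ?e \<bullet> gradient u x) (at 0)"
        by (simp add: DERIV_def)
      have 2: "filterlim (\<lambda>m. 1 / real (Suc m)) (at 0) sequentially"
        unfolding filterlim_at using LIMSEQ_Suc[OF lim_1_over_n[where 'a=real]] by auto
      have l: "(\<lambda>n. (u (x + (1 / real (Suc n)) *\<^sub>R ?e) - u x) / (1 / real (Suc n))) \<longlonglongrightarrow> ?e \<bullet> gradient u x"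
        by (rule filterlim_compose[OF 1 2])
      have "(\<lambda>n. 1 / real (Suc n)) \<longlonglongrightarrow> 0"
        using LIMSEQ_Suc[OF lim_1_over_n[where 'a=real]] by simp
      then have "(\<lambda>n. x + (1 / real (Suc n)) *\<^sub>R ?e) \<longlonglongrightarrow> x + 0 *\<^sub>R ?e" by (intro tendsto_intros)
      then have "\<forall>\<^sub>F n in sequentially. x + (1 / real (Suc n)) *\<^sub>R ?e \<in> S"
        using x S by (auto intro: topological_tendstoD)
      then have "\<forall>\<^sub>F n in sequentially. (u (x + (1 / real (Suc n)) *\<^sub>R ?e) - u x) / (1 / real (Suc n))
          = indicator ?D x * (real (Suc n) * (v (x + (1 / real (Suc n)) *\<^sub>R ?e) - v x))"
        by eventually_elim (use x True in \<open>simp add: v_def\<close>)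
      from Lim_transform_eventually[OF l this] show ?thesis
        using True by (simp add: inner_axis inner_commute)
    qed simp
  qed
  \<comment> \<open>Where \<open>u\<close> is not differentiable, the description in
    \<open>gradient\<close> is that of an empty predicate, so its unspecified value is the same at
    all such points. This makes \<open>gradient u\<close> measurable on all of
    \<open>S\<close>.\<close>
  define c0 where "c0 = (THE D :: real^2. False)"
  have nd: "gradient u x = c0" if "x \<in> S - ?D" for x
  proof -
    have "\<not> GDERIV u x :> D" for D
      using that GDERIV_imp_differentiable by (auto simp: diff_points_def)
    then show ?thesis by (simp add: gradient_def c0_def)
  qed
  have "indicator S x *\<^sub>R gradient u x = (\<Sum>i\<in>UNIV. (indicator ?D x * (gradient u x $ i)) *\<^sub>R axis i 1) + indicator (S - ?D) x *\<^sub>R c0" for x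
  proof (cases "x \<in> ?D")
    case True
    then have "x \<in> S" by (auto simp: diff_points_def)
    then show ?thesis using True by (simp add: vec_eq_iff axis_def if_distrib[where f="\<lambda>z. _ * z"] sum.delta cong: if_cong)
  next
    case False
    then show ?thesis using nd[of x] by (auto simp: indicator_def)
  qed
  then show ?thesis
    by (simp only:) (intro borel_measurable_add borel_measurable_sum borel_measurable_scaleR comp
        borel_measurable_const borel_measurable_indicator sets.Diff; measurable)
qed

section \<open>Slopes along lines of a frame\<close>

text \<open>For convex \<open>k\<close> this is the right derivative: it exists everywhere and is
  monotone, hence measurable, and it is the derivative almost everywhere.\<close>

definition slope :: "(real \<Rightarrow> real) \<Rightarrow> real \<Rightarrow> real" where
  "slope k t = Inf ((\<lambda>s. (k t - k s) / (t - s)) ` {t<..})"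

lemma slope_convex:
  fixes k :: "real \<Rightarrow> real"
  assumes "convex_on UNIV k"
  shows "k t + slope k t * (s - t) \<le> k s"
  using convex_le_Inf_differential[OF assms, of t s] by (simp add: slope_def)

lemma slope_eq_derivative:
  assumes cv: "convex_on UNIV k" and d: "(k has_real_derivative d) (at t)"
  shows "slope k t = d"
proof (rule ccontr)
  assume ne: "slope k t \<noteq> d"
  have min: "k s - slope k t * s \<ge> k t - slope k t * t" for s
    using slope_convex[OF cv, of t s] by (simp add: algebra_simps)
  have "((\<lambda>s. k s - slope k t * s) has_real_derivative (d - slope k t)) (at t)"
    using d by (auto intro!: derivative_eq_intros)
  from DERIV_local_min[OF this, of 1] min show False using ne by auto
qed

lemma borel_measurable_slope:
  assumes cv: "convex_on UNIV k"
  shows "slope k \<in> borel_measurable borel"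
proof (rule borel_measurable_mono)
  show "mono (slope k)"
  proof (rule monoI)
    fix x y :: real assume "x \<le> y"
    show "slope k x \<le> slope k y"
    proof (cases "x = y")
      case False
      then have "x < y" using \<open>x \<le> y\<close> by simp
      have "slope k x * (y - x) \<le> slope k y * (y - x)"
        using slope_convex[OF cv, of x y] slope_convex[OF cv, of y x] by (simp add: algebra_simps)
      then show ?thesis using \<open>x < y\<close> by simp
    qed simp
  qed
qed

lemma AE_slope:
  assumes cv: "convex_on UNIV k"
  shows "AE t in lborel. (k has_real_derivative slope k t) (at t)"
proof -
  have "countable {t. \<not> k differentiable (at t)}"
    using countable_nondifferentiable_convex[OF cv open_UNIV] by simp
  then have "{t. \<not> k differentiable (at t)} \<in> null_sets lborel"
    by (rule countable_imp_null_set_lborel)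
  from AE_not_in[OF this] show ?thesis
  proof eventually_elim
    case (elim t)
    then obtain d where "(k has_real_derivative d) (at t)"
      using real_differentiable_def by auto
    then show ?case using slope_eq_derivative[OF cv] by metis
  qed
qed

lemma convex_on_frame:
  "convex_on UNIV u \<Longrightarrow> convex_on UNIV (\<lambda>t. u (frame c t y))"
  using convex_on_line[of UNIV u "y *\<^sub>R perp c" c] by (simp add: frame_def add.commute)

lemma convex_on_frame':
  "convex_on UNIV u \<Longrightarrow> convex_on UNIV (\<lambda>y. u (frame c t y))"
  using convex_on_line[of UNIV u "t *\<^sub>R c" "perp c"] by (simp add: frame_def)

lemma Lipschitz_frame:
  assumes "L-lipschitz_on UNIV u" "norm c = 1"
  shows "L-lipschitz_on UNIV (\<lambda>t. u (frame c t y))" "L-lipschitz_on UNIV (\<lambda>y. u (frame c t y))"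
proof -
  have d: "dist (frame c t y) (frame c t' y) = dist t t'" for t t' y
    using assms(2) by (simp add: dist_norm frame_def scaleR_diff_left[symmetric])
  show "L-lipschitz_on UNIV (\<lambda>t. u (frame c t y))"
    using lipschitz_on_nonneg[OF assms(1)] lipschitz_onD[OF assms(1), of "frame c t y" "frame c t' y" for t t']
    by (intro lipschitz_onI) (simp_all add: d)
  have d': "dist (frame c t y) (frame c t y') = dist y y'" for t y y'
    using assms(2) by (simp add: dist_norm frame_def scaleR_diff_left[symmetric])
  show "L-lipschitz_on UNIV (\<lambda>y. u (frame c t y))"
    using lipschitz_on_nonneg[OF assms(1)] lipschitz_onD[OF assms(1), of "frame c t y" "frame c t y'" for y y']
    by (intro lipschitz_onI) (simp_all add: d')
qed

lemma GDERIV_frame: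
  assumes "GDERIV u (frame c t y) :> D"
  shows "((\<lambda>s. u (frame c s y)) has_real_derivative (c \<bullet> D)) (at t)"
  using GDERIV_line[of u "y *\<^sub>R perp c" t c D] assms by (simp add: frame_def add.commute)

section \<open>Conjugates over a compact set of slopes\<close>

definition conj_on :: "'a::euclidean_space set \<Rightarrow> ('a \<Rightarrow> real) \<Rightarrow> 'a \<Rightarrow> real" where
  "conj_on B W x = (SUP \<xi>\<in>B. \<xi> \<bullet> x - W \<xi>)"

context
  fixes B :: "'a::euclidean_space set" and W :: "'a \<Rightarrow> real"
  assumes B: "compact B" "B \<noteq> {}" and contW: "continuous_on B W"
begin

lemma conj_on_attained:
  obtains \<xi> where "\<xi> \<in> B" "conj_on B W x = \<xi> \<bullet> x - W \<xi>" "\<And>\<zeta>. \<zeta> \<in> B \<Longrightarrow> \<zeta> \<bullet> x - W \<zeta> \<le> \<xi> \<bullet> x - W \<xi>"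
proof -
  have "continuous_on B (\<lambda>\<xi>. \<xi> \<bullet> x - W \<xi>)" by (intro continuous_intros contW)
  from continuous_attains_sup[OF B this] obtain \<xi>
    where \<xi>: "\<xi> \<in> B" "\<And>\<zeta>. \<zeta> \<in> B \<Longrightarrow> \<zeta> \<bullet> x - W \<zeta> \<le> \<xi> \<bullet> x - W \<xi>" by blast
  moreover have "conj_on B W x = \<xi> \<bullet> x - W \<xi>"
    unfolding conj_on_def using \<xi> by (intro cSup_eq_maximum) auto
  ultimately show ?thesis using that by blast
qed

lemma conj_on_upper: "\<xi> \<in> B \<Longrightarrow> \<xi> \<bullet> x - W \<xi> \<le> conj_on B W x"
proof -
  assume \<xi>: "\<xi> \<in> B"
  obtain \<zeta> where "conj_on B W x = \<zeta> \<bullet> x - W \<zeta>" "\<And>z. z \<in> B \<Longrightarrow> z \<bullet> x - W z \<le> \<zeta> \<bullet> x - W \<zeta>"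
    using conj_on_attained[of x] by blast
  then show ?thesis using \<xi> by simp
qed

lemma conj_on_eqI:
  assumes "\<xi> \<in> B" "\<And>\<zeta>. \<zeta> \<in> B \<Longrightarrow> \<zeta> \<bullet> x - W \<zeta> \<le> \<xi> \<bullet> x - W \<xi>"
  shows "conj_on B W x = \<xi> \<bullet> x - W \<xi>"
proof -
  obtain \<zeta> where \<zeta>: "\<zeta> \<in> B" "conj_on B W x = \<zeta> \<bullet> x - W \<zeta>"
    using conj_on_attained[of x] by blast
  then show ?thesis using assms(2)[OF \<zeta>(1)] conj_on_upper[OF assms(1), of x] by simp
qed

lemma conj_on_subgrad:
  assumes "\<xi> \<in> B" "conj_on B W x = \<xi> \<bullet> x - W \<xi>"
  shows "subgrad UNIV (conj_on B W) x \<xi>"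
  unfolding subgrad_def
proof
  fix y show "conj_on B W x + \<xi> \<bullet> (y - x) \<le> conj_on B W y"
    using conj_on_upper[OF assms(1), of y] assms(2) by (simp add: inner_diff_right)
qed

lemma convex_conj_on: "convex_on UNIV (conj_on B W)"
proof (rule convex_onI)
  fix t :: real and x y :: 'a assume t: "0 < t" "t < 1"
  let ?z = "(1 - t) *\<^sub>R x + t *\<^sub>R y"
  obtain \<xi> where \<xi>: "\<xi> \<in> B" "conj_on B W ?z = \<xi> \<bullet> ?z - W \<xi>" using conj_on_attained[of ?z] by blast
  have "conj_on B W ?z = (1 - t) * (\<xi> \<bullet> x - W \<xi>) + t * (\<xi> \<bullet> y - W \<xi>)"
    unfolding \<xi>(2) by (simp add: inner_add_right algebra_simps)
  also have "\<dots> \<le> (1 - t) * conj_on B W x + t * conj_on B W y"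
    using t by (intro add_mono mult_left_mono conj_on_upper[OF \<xi>(1)]) auto
  finally show "conj_on B W ?z \<le> (1 - t) * conj_on B W x + t * conj_on B W y" .
qed simp

lemma Lipschitz_conj_on:
  assumes "\<And>\<xi>. \<xi> \<in> B \<Longrightarrow> norm \<xi> \<le> C"
  shows "C-lipschitz_on UNIV (conj_on B W)"
proof (rule lipschitz_onI)
  have "conj_on B W x - conj_on B W y \<le> C * dist x y" for x y
  proof -
    obtain \<xi> where \<xi>: "\<xi> \<in> B" "conj_on B W x = \<xi> \<bullet> x - W \<xi>" using conj_on_attained[of x] by blast
    have "conj_on B W x - conj_on B W y \<le> \<xi> \<bullet> (x - y)"
      using conj_on_upper[OF \<xi>(1), of y] \<xi>(2) by (simp add: inner_diff_right)
    also have "\<dots> \<le> norm \<xi> * norm (x - y)" by (rule norm_cauchy_schwarz)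
    also have "\<dots> \<le> C * dist x y" using assms[OF \<xi>(1)] by (simp add: dist_norm mult_right_mono)
    finally show ?thesis .
  qed
  note le = this
  show "dist (conj_on B W x) (conj_on B W y) \<le> C * dist x y" for x y
    using le[of x y] le[of y x] by (simp add: dist_real_def abs_le_iff dist_commute)
  show "0 \<le> C" using assms B(2) norm_ge_zero order_trans by blast
qed

lemma gradient_conj_on:
  assumes "conj_on B W differentiable (at x)"
  shows "gradient (conj_on B W) x \<in> B"
proof -
  obtain \<xi> where \<xi>: "\<xi> \<in> B" "conj_on B W x = \<xi> \<bullet> x - W \<xi>" using conj_on_attained[of x] by blast
  have "\<xi> = gradient (conj_on B W) x"
    by (rule GDERIV_subgrad_unique[OF differentiable_imp_GDERIV[OF assms] _ conj_on_subgrad[OF \<xi>]]) simp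
  then show ?thesis using \<xi>(1) by simp
qed

text \<open>Growth of the conjugate at the rate \<open>b\<close> in the direction \<open>d\<close>
  is realized by a maximizing slope at \<open>x\<close> itself: the maximizers at
  \<open>x + X n *\<^sub>R d\<close> accumulate, by compactness of \<open>B\<close>, at a maximizer
  at \<open>x\<close>.\<close>

lemma conj_on_directional:
  assumes X: "\<And>n. X n > 0" "X \<longlonglongrightarrow> 0"
    and inc: "\<And>n. conj_on B W x + b * X n \<le> conj_on B W (x + X n *\<^sub>R d)"
  obtains \<xi> where "\<xi> \<in> B" "conj_on B W x = \<xi> \<bullet> x - W \<xi>" "b \<le> \<xi> \<bullet> d"
proof -
  have "\<exists>\<xi>. \<xi> \<in> B \<and> conj_on B W (x + X n *\<^sub>R d) = \<xi> \<bullet> (x + X n *\<^sub>R d) - W \<xi>" for n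
    by (rule conj_on_attained[of "x + X n *\<^sub>R d"]) blast
  then obtain Z where Z: "\<And>n. Z n \<in> B" "\<And>n. conj_on B W (x + X n *\<^sub>R d) = Z n \<bullet> (x + X n *\<^sub>R d) - W (Z n)"
    by metis
  have bZ: "b \<le> Z n \<bullet> d" for n
  proof -
    have "conj_on B W x + b * X n \<le> Z n \<bullet> (x + X n *\<^sub>R d) - W (Z n)" using inc[of n] Z(2) by simp
    also have "\<dots> \<le> conj_on B W x + (Z n \<bullet> d) * X n"
      using conj_on_upper[OF Z(1), of n x] by (simp add: inner_add_right mult.commute)
    finally show ?thesis using X(1)[of n] by simp
  qed
  obtain \<xi> and s :: "nat \<Rightarrow> nat" where s: "\<xi> \<in> B" "strict_mono s" "(Z \<circ> s) \<longlonglongrightarrow> \<xi>"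
    using spec[OF B(1)[unfolded compact_def], of Z] Z(1) by auto
  have Xs: "(X \<circ> s) \<longlonglongrightarrow> 0" by (rule LIMSEQ_subseq_LIMSEQ[OF X(2) s(2)])
  have "conj_on B W x = \<xi> \<bullet> x - W \<xi>"
  proof (rule conj_on_eqI[OF s(1)])
    fix \<zeta> assume \<zeta>: "\<zeta> \<in> B"
    have WZ: "(\<lambda>n. W (Z (s n))) \<longlonglongrightarrow> W \<xi>"
      using continuous_on_tendsto_compose[OF contW s(3) s(1)] Z(1) by (simp add: comp_def)
    have 1: "(\<lambda>n. Z (s n) \<bullet> (x + X (s n) *\<^sub>R d) - W (Z (s n))) \<longlonglongrightarrow> \<xi> \<bullet> (x + 0 *\<^sub>R d) - W \<xi>"
      using s(3) Xs WZ unfolding comp_def by (intro tendsto_intros)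
    have 2: "(\<lambda>n. \<zeta> \<bullet> (x + X (s n) *\<^sub>R d) - W \<zeta>) \<longlonglongrightarrow> \<zeta> \<bullet> (x + 0 *\<^sub>R d) - W \<zeta>"
      using Xs unfolding comp_def by (intro tendsto_intros)
    have "\<zeta> \<bullet> (x + X (s n) *\<^sub>R d) - W \<zeta> \<le> Z (s n) \<bullet> (x + X (s n) *\<^sub>R d) - W (Z (s n))" for n
      using conj_on_upper[OF \<zeta>, of "x + X (s n) *\<^sub>R d"] Z(2)[of "s n"] by simp
    then show "\<zeta> \<bullet> x - W \<zeta> \<le> \<xi> \<bullet> x - W \<xi>" using LIMSEQ_le[OF 2 1] by auto
  qed
  moreover have "b \<le> \<xi> \<bullet> d"
  proof (rule LIMSEQ_le_const)
    show "(\<lambda>n. Z (s n) \<bullet> d) \<longlonglongrightarrow> \<xi> \<bullet> d" using s(3) unfolding comp_def by (intro tendsto_intros)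
  qed (use bZ in auto)
  ultimately show ?thesis using that s(1) by blast
qed

end

lemma conj_on_mono:
  assumes "compact B" "B \<noteq> {}" "continuous_on B V" "continuous_on B W" "\<And>\<xi>. \<xi> \<in> B \<Longrightarrow> V \<xi> \<le> W \<xi>"
  shows "conj_on B W x \<le> conj_on B V x"
proof -
  obtain \<xi> where \<xi>: "\<xi> \<in> B" "conj_on B W x = \<xi> \<bullet> x - W \<xi>" using conj_on_attained[OF assms(1,2,4), of x] by blast
  then show ?thesis using conj_on_upper[OF assms(1,2,3) \<xi>(1), of x] assms(5)[OF \<xi>(1)] by simp
qed

lemma conj_on_diff_bound:
  assumes "compact B" "B \<noteq> {}" "continuous_on B V" "continuous_on B W" "\<And>\<xi>. \<xi> \<in> B \<Longrightarrow> \<bar>V \<xi> - W \<xi>\<bar> \<le> e"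
  shows "\<bar>conj_on B V x - conj_on B W x\<bar> \<le> e"
proof -
  have *: "conj_on B W x - conj_on B V x \<le> e"
    if c: "continuous_on B V" "continuous_on B W" "\<And>\<xi>. \<xi> \<in> B \<Longrightarrow> \<bar>V \<xi> - W \<xi>\<bar> \<le> e" for V W
  proof -
    obtain \<xi> where \<xi>: "\<xi> \<in> B" "conj_on B W x = \<xi> \<bullet> x - W \<xi>" using conj_on_attained[OF assms(1,2) c(2), of x] by blast
    then show ?thesis using conj_on_upper[OF assms(1,2) c(1) \<xi>(1), of x] c(3)[OF \<xi>(1)] by simp
  qed
  have "\<bar>W \<xi> - V \<xi>\<bar> \<le> e" if "\<xi> \<in> B" for \<xi> using assms(5)[OF that] by linarith
  from *[OF assms(3-5)] *[OF assms(4,3) this] show ?thesis by linarith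
qed

section \<open>The dual functional\<close>

text \<open>Its second derivative is concentrated on the line where
  \<open>c \<bullet> \<xi> = b\<close>, so testing with hinges isolates single chords of the ball of
  slopes.\<close>

definition hinge :: "real^2 \<Rightarrow> real \<Rightarrow> real^2 \<Rightarrow> real" where
  "hinge c b \<xi> = max 0 (c \<bullet> \<xi> - b)"

lemma continuous_on_hinge: "continuous_on S (hinge c b)"
  unfolding hinge_def by (intro continuous_intros)

text \<open>Slopes range over the ball of radius \<open>\<rho>\<close>, and variations of
  \<open>g\<close> are confined to the radius \<open>r\<close>. As \<open>g\<close> is
  \<open>L\<close>-Lipschitz, the conjugates then vary only over points of norm at most
  \<open>L\<close>; the larger radius \<open>R\<close> is that of the domain of integration.\<close>

locale dual_model =
  fixes \<rho> r L R :: real and g :: "real^2 \<Rightarrow> real"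
  assumes r: "0 < r" "r < \<rho>" and cvg: "convex_on UNIV g" and lipg: "L-lipschitz_on UNIV g"
    and L: "L < R"
begin

abbreviation "B \<equiv> cball (0 :: real^2) \<rho>"

definition cls :: "(real^2 \<Rightarrow> real) \<Rightarrow> bool" where
  "cls W \<longleftrightarrow> convex_on UNIV W \<and> (\<forall>\<xi>. r \<le> norm \<xi> \<longrightarrow> W \<xi> = g \<xi>)"

lemma L0: "0 \<le> L" using lipschitz_on_nonneg[OF lipg] .
lemma R0: "0 < R" using L0 L by simp
lemma rho0: "0 < \<rho>" using r by simp
lemma compactB: "compact B" "B \<noteq> {}" using rho0 by auto

lemma cls_g: "cls g" using cvg by (simp add: cls_def)
lemma cls_convex: "cls W \<Longrightarrow> convex_on UNIV W" by (simp add: cls_def)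
lemma cls_eq: "cls W \<Longrightarrow> r \<le> norm \<xi> \<Longrightarrow> W \<xi> = g \<xi>" by (simp add: cls_def)

lemma cls_combination:
  assumes "cls V" "cls W" "0 \<le> \<theta>" "\<theta> \<le> 1"
  shows "cls (\<lambda>\<xi>. (1 - \<theta>) * V \<xi> + \<theta> * W \<xi>)"
  unfolding cls_def
proof
  show "convex_on UNIV (\<lambda>\<xi>. (1 - \<theta>) * V \<xi> + \<theta> * W \<xi>)"
    using assms by (intro convex_on_add convex_on_cmul cls_convex) auto
  show "\<forall>\<xi>. r \<le> norm \<xi> \<longrightarrow> (1 - \<theta>) * V \<xi> + \<theta> * W \<xi> = g \<xi>"
    using assms by (simp add: cls_eq algebra_simps)
qed

text \<open>Along a ray the difference quotients of a convex function increase, and far out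
  \<open>W\<close> is \<open>g\<close>, so their limit is at most \<open>L\<close>.\<close>

lemma cls_Lipschitz:
  assumes W: "cls W"
  shows "L-lipschitz_on UNIV W"
proof (rule lipschitz_onI)
  have "W y - W x \<le> L * dist x y" for x y
  proof (cases "x = y")
    case False
    define d where "d = dist x y"
    have d: "d > 0" using False by (simp add: d_def)
    have gL: "g a - g b \<le> L * dist a b" for a b
      using lipschitz_onD[OF lipg, of a b] by (auto simp: dist_real_def)
    have step: "t * (W y - W x - L * d) \<le> g x - W x" if t: "1 \<le> t" "r + norm x \<le> t * d" for t
    proof -
      let ?z = "x + t *\<^sub>R (y - x)"
      have tpos: "0 < t" using t by simp
      have "norm ?z \<ge> norm (t *\<^sub>R (y - x)) - norm x" using norm_triangle_ineq2[of "t *\<^sub>R (y - x)" "- x"] by (simp add: add.commute)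
      then have "norm ?z \<ge> r" using t by (simp add: d_def dist_norm norm_minus_commute)
      then have Wz: "W ?z = g ?z" by (rule cls_eq[OF W])
      have "y = (1 - 1/t) *\<^sub>R x + (1/t) *\<^sub>R ?z" using tpos by (simp add: algebra_simps)
      then have "W y \<le> (1 - 1/t) * W x + (1/t) * W ?z"
        using convex_onD[OF cls_convex[OF W], of "1/t" x ?z] t by simp
      then have "t * W y \<le> t * ((1 - 1/t) * W x + (1/t) * W ?z)" using tpos by simp
      also have "\<dots> = t * W x - W x + g ?z" using tpos Wz by (simp add: algebra_simps)
      also have "g ?z \<le> g x + L * (t * d)"
        using gL[of ?z x] tpos by (simp add: dist_norm d_def norm_minus_commute)
      finally show ?thesis by (simp add: algebra_simps)
    qed
    have "W y - W x - L * d \<le> 0"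
    proof (rule ccontr)
      let ?e = "W y - W x - L * d"
      assume "\<not> ?e \<le> 0" then have e: "?e > 0" by simp
      \<comment> \<open>Large enough for the far point to lie beyond radius \<open>r\<close> and for
        \<open>t\<close> times the supposed excess to exceed \<open>g x - W x\<close>.\<close>
      define t where "t = max (max 1 ((r + norm x) / d)) ((g x - W x) / ?e + 1)"
      have "(r + norm x) / d \<le> t" "1 \<le> t" "(g x - W x) / ?e + 1 \<le> t" unfolding t_def by linarith+
      then have t: "1 \<le> t" "r + norm x \<le> t * d" "(g x - W x) + ?e \<le> t * ?e"
        using d e by (simp_all add: pos_divide_le_eq add_divide_distrib[symmetric] field_simps)
      from step[OF t(1,2)] t(3) e show False by linarith
    qed
    then show ?thesis by (simp add: d_def)
  qed simp
  note le = this
  show "dist (W x) (W y) \<le> L * dist x y" for x y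
    using le[of x y] le[of y x] by (simp add: dist_real_def abs_le_iff dist_commute)
qed (rule L0)

lemma cls_continuous: "cls W \<Longrightarrow> continuous_on S W"
  using lipschitz_on_continuous_on[OF cls_Lipschitz] continuous_on_subset by blast

definition cj :: "(real^2 \<Rightarrow> real) \<Rightarrow> real^2 \<Rightarrow> real" where "cj W = conj_on B W"

context
  fixes W assumes W: "cls W"
begin

lemmas cj_attained = conj_on_attained[OF compactB cls_continuous[OF W], folded cj_def]
lemmas cj_upper = conj_on_upper[OF compactB cls_continuous[OF W], folded cj_def]
lemmas cj_eqI = conj_on_eqI[OF compactB cls_continuous[OF W], folded cj_def]
lemmas convex_cj = convex_conj_on[OF compactB cls_continuous[OF W], folded cj_def]
lemmas gradient_cj = gradient_conj_on[OF compactB cls_continuous[OF W], folded cj_def]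
lemmas cj_directional = conj_on_directional[OF compactB cls_continuous[OF W], folded cj_def]

lemma Lipschitz_cj: "\<rho>-lipschitz_on UNIV (cj W)"
  unfolding cj_def by (rule Lipschitz_conj_on[OF compactB cls_continuous[OF W]]) simp

lemma AE_cj: "AE x in lborel. GDERIV (cj W) x :> gradient (cj W) x \<and> gradient (cj W) x \<in> B"
  using AE_differentiable_convex[OF convex_cj open_UNIV]
  by eventually_elim (simp add: differentiable_imp_GDERIV gradient_cj del: mem_cball mem_cball_0)

lemma measurable_gradient_cj [measurable]: "gradient (cj W) \<in> borel_measurable borel"
  using borel_measurable_gradient[OF convex_cj open_UNIV] by simp

text \<open>A maximizer for \<open>g\<close> outside the region where \<open>W \<noteq> g\<close> is a local, hence a global,
  maximizer of the concave function \<open>\<xi> \<bullet> x - W \<xi>\<close>.\<close>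

lemma cj_eq_of_outer_maximizer:
  assumes \<xi>: "\<xi> \<in> B" "cj g x = \<xi> \<bullet> x - g \<xi>" "r < norm \<xi>"
  shows "cj W x = cj g x"
proof -
  have W\<xi>: "W \<xi> = g \<xi>" using \<xi>(3) W by (simp add: cls_eq)
  have "cj W x = \<xi> \<bullet> x - W \<xi>"
  proof (rule cj_eqI[OF \<xi>(1)])
    fix \<zeta> assume \<zeta>: "\<zeta> \<in> B"
    have "((\<lambda>t. norm (\<xi> + t *\<^sub>R (\<zeta> - \<xi>))) \<longlongrightarrow> norm (\<xi> + 0 *\<^sub>R (\<zeta> - \<xi>))) (at_right 0)"
      by (intro tendsto_intros)
    then have "\<forall>\<^sub>F t in at_right 0. r < norm (\<xi> + t *\<^sub>R (\<zeta> - \<xi>))"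
      using \<xi>(3) by (intro order_tendstoD(1)) auto
    moreover have "\<forall>\<^sub>F t in at_right (0::real). t \<in> {0<..<1}"
      by (rule eventually_at_right_real) simp
    ultimately have "\<forall>\<^sub>F t in at_right 0. r < norm (\<xi> + t *\<^sub>R (\<zeta> - \<xi>)) \<and> t \<in> {0<..<1}"
      by eventually_elim simp
    then obtain t where t: "r < norm (\<xi> + t *\<^sub>R (\<zeta> - \<xi>))" "0 < t" "t < 1"
      using eventually_happens'[OF trivial_limit_at_right_real] by (auto dest!: eventually_happens'[OF trivial_limit_at_right_real])
    let ?z = "\<xi> + t *\<^sub>R (\<zeta> - \<xi>)"
    have z: "?z = (1 - t) *\<^sub>R \<xi> + t *\<^sub>R \<zeta>" by (simp add: algebra_simps)
    have zB: "?z \<in> B" unfolding z using \<xi>(1) \<zeta> t convex_cball[of 0 \<rho>] by (intro convexD) auto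
    have "W ?z = g ?z" using t W by (simp add: cls_eq)
    then have "?z \<bullet> x - W ?z \<le> \<xi> \<bullet> x - W \<xi>"
      using conj_on_upper[OF compactB cls_continuous[OF cls_g] zB, of x] \<xi>(2) W\<xi> by (simp add: cj_def)
    moreover have "W ?z \<le> (1 - t) * W \<xi> + t * W \<zeta>"
      unfolding z using t by (intro convex_onD[OF cls_convex[OF W]]) auto
    ultimately have "t * (\<zeta> \<bullet> x - W \<zeta>) \<le> t * (\<xi> \<bullet> x - W \<xi>)"
      unfolding z by (simp add: algebra_simps)
    then show "\<zeta> \<bullet> x - W \<zeta> \<le> \<xi> \<bullet> x - W \<xi>" using t by simp
  qed
  then show ?thesis using \<xi>(2) W\<xi> by simp
qed

end

text \<open>If \<open>norm x\<close> exceeds the Lipschitz constant, moving the slope in the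
  direction of \<open>x\<close> always pays; so maximizers for \<open>g\<close> lie beyond the
  radius \<open>r\<close>, where \<open>W\<close> and \<open>g\<close> agree.\<close>

lemma cj_outside:
  assumes W: "cls W" and x: "L < norm x"
  shows "cj W x = cj g x"
proof -
  obtain \<xi> where \<xi>: "\<xi> \<in> B" "cj g x = \<xi> \<bullet> x - g \<xi>" using cj_attained[OF cls_g, of x] by blast
  have "r < norm \<xi>"
  proof (rule ccontr)
    assume "\<not> ?thesis" then have nr: "norm \<xi> \<le> r" by simp
    have xpos: "norm x > 0" using L0 x by (rule le_less_trans)
    define s where "s = (\<rho> - r) / norm x"
    have s: "s > 0" using r xpos by (simp add: s_def)
    have nsx: "norm (s *\<^sub>R x) = \<rho> - r" using r xpos by (simp add: s_def)
    have "\<xi> + s *\<^sub>R x \<in> B" using norm_triangle_ineq[of \<xi> "s *\<^sub>R x"] nsx nr by simp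
    from cj_upper[OF cls_g this, of x] \<xi>(2)
    have "s * (x \<bullet> x) \<le> g (\<xi> + s *\<^sub>R x) - g \<xi>" by (simp add: inner_add_left)
    also have "\<dots> \<le> L * (s * norm x)"
      using lipschitz_onD[OF lipg, of "\<xi> + s *\<^sub>R x" \<xi>] s by (simp add: dist_real_def dist_norm)
    finally have "s * norm x * norm x \<le> s * norm x * L"
      by (simp add: power2_norm_eq_inner[symmetric] power2_eq_square algebra_simps)
    then have "norm x \<le> L" using s xpos by simp
    then show False using x by simp
  qed
  then show ?thesis by (rule cj_eq_of_outer_maximizer[OF W \<xi>])
qed

text \<open>The convex functions on the primal side that agree with \<open>cj g\<close> near infinity;
  unlike the conjugates of \<open>cls\<close> they are obviously stable under maxima with affine functions.\<close>

definition prim :: "(real^2 \<Rightarrow> real) \<Rightarrow> bool" where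
  "prim v \<longleftrightarrow> convex_on UNIV v \<and> \<rho>-lipschitz_on UNIV v \<and> (\<forall>x. L < norm x \<longrightarrow> v x = cj g x)"

lemma prim_cj: "cls W \<Longrightarrow> prim (cj W)"
  by (simp add: prim_def convex_cj Lipschitz_cj cj_outside)

lemma prim_gradient_bound:
  assumes v: "prim v" and D: "GDERIV v x :> D"
  shows "D \<in> B"
proof -
  have "v x + D \<bullet> (x + D - x) \<le> v (x + D)"
    by (rule subgradD[OF GDERIV_imp_subgrad[OF _ _ D, of UNIV]]) (use v in \<open>auto simp: prim_def\<close>)
  moreover have "\<bar>v (x + D) - v x\<bar> \<le> \<rho> * norm D"
    using lipschitz_onD[of \<rho> UNIV v "x + D" x] v by (simp add: prim_def dist_real_def dist_norm)
  ultimately have "norm D * norm D \<le> \<rho> * norm D"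
    by (simp add: power2_norm_eq_inner[symmetric] power2_eq_square)
  then show ?thesis by (cases "D = 0") (use rho0 in auto)
qed

lemma AE_prim:
  assumes v: "prim v"
  shows "AE x in lborel. GDERIV v x :> gradient v x \<and> gradient v x \<in> B"
proof -
  have "convex_on UNIV v" using v by (simp add: prim_def)
  from AE_differentiable_convex[OF this open_UNIV] show ?thesis
    by eventually_elim (blast intro: differentiable_imp_GDERIV prim_gradient_bound[OF v])
qed

lemma measurable_gradient_prim: "prim v \<Longrightarrow> gradient v \<in> borel_measurable borel"
  using borel_measurable_gradient[of UNIV v] by (simp add: prim_def)

lemma gradient_cong_open:
  assumes "open S" "x \<in> S" "\<And>y. y \<in> S \<Longrightarrow> v y = w y"
  shows "gradient v x = gradient w x"
proof -
  have "(v has_derivative f') (at x) \<longleftrightarrow> (w has_derivative f') (at x)" for f'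
    using has_derivative_transform_within_open[OF _ assms(1,2), of v f' UNIV w]
      has_derivative_transform_within_open[OF _ assms(1,2), of w f' UNIV v] assms(3) by auto
  then show ?thesis by (simp add: gradient_def gderiv_def)
qed

lemma gradient_prim_outside:
  assumes v: "prim v" and x: "L < norm x"
  shows "gradient v x = gradient (cj g) x"
proof (rule gradient_cong_open)
  show "open {x :: real^2. L < norm x}" by (intro open_Collect_less continuous_intros)
qed (use v x in \<open>auto simp: prim_def\<close>)

text \<open>The ball contains every point at which two functions of \<open>prim\<close> can differ,
  so that differences of \<open>Ep\<close> are the full variations.\<close>

definition Ep :: "(real^2 \<Rightarrow> real) \<Rightarrow> (real^2 \<Rightarrow> real) \<Rightarrow> real" where
  "Ep f v = (LINT x:cball 0 R|lborel. f (gradient v x))"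

definition E :: "(real^2 \<Rightarrow> real) \<Rightarrow> (real^2 \<Rightarrow> real) \<Rightarrow> real" where
  "E f W = Ep f (cj W)"

definition area :: real where "area = measure lborel (cball (0 :: real^2) R)"

lemma bounded_on_B:
  assumes "continuous_on UNIV f"
  shows "\<exists>M. \<forall>\<xi>\<in>B. \<bar>f \<xi> :: real\<bar> \<le> M"
proof -
  have "bounded (f ` B)"
    by (rule compact_imp_bounded[OF compact_continuous_image[OF continuous_on_subset[OF assms] compactB(1)]]) simp
  then show ?thesis by (auto simp: bounded_iff simp del: mem_cball mem_cball_0)
qed

lemma finite_cball: "emeasure lborel (cball (0::real^2) R) < \<infinity>"
  by (rule emeasure_bounded_finite) simp

lemma borel_measurable_integrand:
  fixes f :: "real^2 \<Rightarrow> real"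
  assumes v: "prim v" and f: "continuous_on UNIV f"
  shows "(\<lambda>x. f (gradient v x)) \<in> borel_measurable borel"
    "(\<lambda>x. indicator (cball 0 R) x *\<^sub>R f (gradient v x)) \<in> borel_measurable borel"
proof -
  show 1: "(\<lambda>x. f (gradient v x)) \<in> borel_measurable borel"
    using measurable_compose[OF measurable_gradient_prim[OF v] borel_measurable_continuous_onI[OF f]] .
  show "(\<lambda>x. indicator (cball 0 R) x *\<^sub>R f (gradient v x)) \<in> borel_measurable borel"
    by (intro borel_measurable_scaleR borel_measurable_indicator 1) simp
qed

lemma E_integrable:
  fixes f :: "real^2 \<Rightarrow> real"
  assumes v: "prim v" and f: "continuous_on UNIV f"
  shows "set_integrable lborel (cball 0 R) (\<lambda>x. f (gradient v x))"
proof -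
  obtain M where M: "\<And>\<xi>. \<xi> \<in> B \<Longrightarrow> \<bar>f \<xi>\<bar> \<le> M" using bounded_on_B[OF f] by blast
  show ?thesis unfolding set_integrable_def
  proof (rule Bochner_Integration.integrable_bound)
    show "integrable lborel (\<lambda>x::real^2. indicator (cball 0 R) x * M)"
      using finite_cball by (intro integrable_mult_left integrable_real_indicator) auto
    show "AE x in lborel. norm (indicator (cball 0 R) x *\<^sub>R f (gradient v x)) \<le> norm (indicator (cball 0 R) x * M)"
      using AE_prim[OF v]
    proof eventually_elim
      case (elim x)
      then have "\<bar>f (gradient v x)\<bar> \<le> M" using M by blast
      then show ?case by (auto simp: indicator_def)
    qed
  qed (use borel_measurable_integrand(2)[OF v f] in simp)
qed

lemma E_add:
  assumes "cls W" "continuous_on UNIV f" "continuous_on UNIV h"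
  shows "E (\<lambda>\<xi>. f \<xi> + h \<xi>) W = E f W + E h W"
  unfolding E_def Ep_def using assms by (intro set_integral_add E_integrable prim_cj)

lemma E_cmult: "E (\<lambda>\<xi>. a * f \<xi>) W = a * E f W"
  unfolding E_def Ep_def by simp

lemma E_mono_AE:
  assumes W: "cls W" "cls V" and f: "continuous_on UNIV f" "continuous_on UNIV h" and le: "\<And>\<xi>. \<xi> \<in> B \<Longrightarrow> f \<xi> \<le> h \<xi>"
  shows "E f W \<le> E h W"
  unfolding E_def Ep_def set_lebesgue_integral_def
proof (rule integral_mono_AE)
  show "AE x in lborel. indicator (cball 0 R) x *\<^sub>R f (gradient (cj W) x) \<le> indicator (cball 0 R) x *\<^sub>R h (gradient (cj W) x)"
    using AE_prim[OF prim_cj[OF W(1)]] by eventually_elim (auto simp: indicator_def intro!: le)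
qed (use E_integrable[OF prim_cj[OF W(1)] f(1)] E_integrable[OF prim_cj[OF W(1)] f(2)] in \<open>simp_all only: set_integrable_def\<close>)

lemma E_const: "E (\<lambda>_. a) W = a * area"
  unfolding E_def Ep_def area_def set_lebesgue_integral_def using finite_cball by simp

lemma E_bound:
  assumes W: "cls W" and f: "continuous_on UNIV f" and le: "\<And>\<xi>. \<xi> \<in> B \<Longrightarrow> \<bar>f \<xi>\<bar> \<le> e"
  shows "\<bar>E f W\<bar> \<le> e * area"
proof -
  have "f \<xi> \<le> e" "- e \<le> f \<xi>" if "\<xi> \<in> B" for \<xi> using le[OF that] by linarith+
  then have "E f W \<le> E (\<lambda>_. e) W" "E (\<lambda>_. - e) W \<le> E f W"
    by (auto intro!: E_mono_AE[OF W W] f continuous_on_const simp del: mem_cball mem_cball_0)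
  then show ?thesis by (simp add: E_const abs_le_iff)
qed

text \<open>The two integrands agree outside the ball. Hence a slice may be integrated over any
  interval \<open>{-T..T}\<close> containing the slice of the ball, and \<open>T\<close> may depend
  on \<open>y\<close>, as the coercivity used later provides no uniform bound.\<close>

lemma Ep_diff_slices:
  assumes v: "prim v" and w: "prim w" and f: "continuous_on UNIV f" and c: "norm c = 1"
    and D [measurable]: "D \<in> borel_measurable borel"
    and key: "\<And>y. \<bar>y\<bar> \<le> R \<Longrightarrow>
      AE t in lborel. GDERIV w (frame c t y) :> gradient w (frame c t y) \<Longrightarrow>
      AE t in lborel. GDERIV v (frame c t y) :> gradient v (frame c t y) \<Longrightarrow>
      \<exists>T\<ge>R. set_integrable lborel {-T..T} (\<lambda>t. f (gradient w (frame c t y))) \<and>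
        set_integrable lborel {-T..T} (\<lambda>t. f (gradient v (frame c t y))) \<and>
        (LINT t:{-T..T}|lborel. f (gradient w (frame c t y))) -
        (LINT t:{-T..T}|lborel. f (gradient v (frame c t y))) = D y"
  shows "Ep f w - Ep f v = (LINT y:{-R..R}|lborel. D y)"
proof -
  define F where "F x = indicator (cball 0 R) x *\<^sub>R f (gradient w x) - indicator (cball 0 R) x *\<^sub>R f (gradient v x)" for x
  have F_eq: "F x = f (gradient w x) - f (gradient v x)" for x
  proof (cases "x \<in> cball 0 R")
    case False
    then have "L < norm x" using L by simp
    then show ?thesis using False gradient_prim_outside[OF w] gradient_prim_outside[OF v] by (simp add: F_def)
  qed (simp add: F_def)
  have F0: "F x = 0" if "R < norm x" for x using that by (simp add: F_def)
  have intF: "integrable lborel F"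
    unfolding F_def using E_integrable[OF w f] E_integrable[OF v f]
    by (intro Bochner_Integration.integrable_diff) (auto simp: set_integrable_def)
  have "Ep f w - Ep f v = (LINT x|lborel. F x)"
    unfolding F_def Ep_def set_lebesgue_integral_def using E_integrable[OF w f] E_integrable[OF v f]
    by (subst Bochner_Integration.integral_diff) (auto simp: set_integrable_def)
  also have "\<dots> = (LINT y|lborel. LINT t|lborel. F (frame c t y))"
    by (rule integral_frame[OF c intF])
  also have "\<dots> = (LINT y:{-R..R}|lborel. D y)"
    unfolding set_lebesgue_integral_def[of _ "{-R..R}"]
  proof (rule integral_cong_AE)
    show "(\<lambda>y. LINT t|lborel. F (frame c t y)) \<in> borel_measurable lborel"
    proof (rule lborel.borel_measurable_lebesgue_integral)
      have "F \<in> borel_measurable borel"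
        unfolding F_def by (intro borel_measurable_diff borel_measurable_integrand(2) v w f)
      from measurable_compose[OF measurable_frame(1) this]
      show "(\<lambda>(y, t). F (frame c t y)) \<in> borel_measurable (lborel \<Otimes>\<^sub>M lborel)"
        by (simp add: split_beta')
    qed
    have AEW: "AE y in lborel. AE t in lborel. GDERIV w (frame c t y) :> gradient w (frame c t y)"
      by (rule AE_frame[OF c]) (use AE_prim[OF w] in \<open>eventually_elim, simp\<close>)
    have AEV: "AE y in lborel. AE t in lborel. GDERIV v (frame c t y) :> gradient v (frame c t y)"
      by (rule AE_frame[OF c]) (use AE_prim[OF v] in \<open>eventually_elim, simp\<close>)
    have main: "(LINT t|lborel. F (frame c t y)) = indicator {-R..R} y *\<^sub>R D y"
      if h: "AE t in lborel. GDERIV w (frame c t y) :> gradient w (frame c t y)"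
       "AE t in lborel. GDERIV v (frame c t y) :> gradient v (frame c t y)" for y
    proof (cases "y \<in> {-R..R}")
      case False
      have "F (frame c t y) = 0" for t
        using abs_le_norm_frame(2)[OF c, of y t] False by (intro F0) auto
      then show ?thesis using False by simp
    next
      case True
      then have "\<bar>y\<bar> \<le> R" by auto
      from key[OF this h] obtain T where T: "R \<le> T"
        "set_integrable lborel {-T..T} (\<lambda>t. f (gradient w (frame c t y)))"
        "set_integrable lborel {-T..T} (\<lambda>t. f (gradient v (frame c t y)))"
        "(LINT t:{-T..T}|lborel. f (gradient w (frame c t y))) -
         (LINT t:{-T..T}|lborel. f (gradient v (frame c t y))) = D y"
        by blast
      have "F (frame c t y) = indicator {-T..T} t *\<^sub>R f (gradient w (frame c t y)) - indicator {-T..T} t *\<^sub>R f (gradient v (frame c t y))" for t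
      proof (cases "t \<in> {-T..T}")
        case True then show ?thesis by (simp add: F_eq)
      next
        case False
        then have "R < norm (frame c t y)" using abs_le_norm_frame(1)[OF c, of t y] T(1) by auto
        then show ?thesis using F0 False by simp
      qed
      then have "(LINT t|lborel. F (frame c t y)) = D y"
        using T(2-4) unfolding set_lebesgue_integral_def set_integrable_def
        by simp
      then show ?thesis using True by simp
    qed
    from AEW AEV show "AE y in lborel. (LINT t|lborel. F (frame c t y)) = indicator {-R..R} y *\<^sub>R D y"
      by eventually_elim (rule main)
    show "(\<lambda>y. indicator {-R..R} y *\<^sub>R D y) \<in> borel_measurable lborel"
      by measurable
  qed
  finally show ?thesis .
qed

end

lemma inner_frame_frame:
  assumes "norm c = 1"
  shows "frame c a b \<bullet> frame c t y = a * t + b * y"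
  using assms by (simp add: frame_def inner_simps norm_eq_1)

lemma set_integrable_const_Icc: "set_integrable lborel {a..b :: real} (\<lambda>_. k :: real)"
  unfolding set_integrable_def using borel_integrable_compact[OF compact_Icc continuous_on_const] .

lemma frame_add: "frame c t y + s *\<^sub>R c = frame c (t + s) y"
  by (simp add: frame_def algebra_simps)

section \<open>Hinge integrands and the energies of chords\<close>

context dual_model
begin

definition chord :: "real \<Rightarrow> real" where "chord b = sqrt (\<rho>^2 - b^2)"

definition slice_conj :: "real^2 \<Rightarrow> real \<Rightarrow> (real^2 \<Rightarrow> real) \<Rightarrow> real \<Rightarrow> real" where
  "slice_conj c b W = conj_on {- chord b..chord b} (\<lambda>\<eta>. W (frame c b \<eta>))"

definition energy :: "real^2 \<Rightarrow> real \<Rightarrow> (real^2 \<Rightarrow> real) \<Rightarrow> real" where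
  "energy c b W = (LINT \<eta>:{- chord b..chord b}|lborel. (slope (\<lambda>\<eta>. W (frame c b \<eta>)) \<eta>)^2)"

lemma chord_pos:
  assumes "\<bar>b\<bar> < \<rho>"
  shows "0 < chord b"
  using assms abs_square_less_1[of "b/\<rho>"] rho0 by (simp add: chord_def power_strict_mono[of "\<bar>b\<bar>" \<rho> 2, simplified])

lemma norm_frame_chord:
  assumes "norm c = 1" "\<bar>b\<bar> < \<rho>" "\<bar>\<eta>\<bar> = chord b"
  shows "norm (frame c b \<eta>) = \<rho>"
proof -
  have "\<eta>^2 = (chord b)^2" using assms(3) by (metis power2_abs)
  also have "\<dots> = \<rho>^2 - b^2"
    unfolding chord_def using assms(2) by (intro real_sqrt_pow2) (simp add: abs_le_square_iff[symmetric])
  finally have "(norm (frame c b \<eta>))^2 = \<rho>^2" using norm_frame[OF assms(1)] by simp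
  then show ?thesis using rho0 by simp
qed

lemma frame_mem_B:
  assumes "norm c = 1" "\<bar>b\<bar> < \<rho>"
  shows "frame c b \<eta> \<in> B \<longleftrightarrow> \<eta> \<in> {- chord b..chord b}"
proof -
  have "(chord b)^2 = \<rho>^2 - b^2"
    unfolding chord_def using assms(2) by (intro real_sqrt_pow2) (simp add: abs_le_square_iff[symmetric])
  moreover have "frame c b \<eta> \<in> B \<longleftrightarrow> (norm (frame c b \<eta>))^2 \<le> \<rho>^2"
    using rho0 abs_le_square_iff[of "norm (frame c b \<eta>)" \<rho>] by simp
  ultimately have "frame c b \<eta> \<in> B \<longleftrightarrow> \<eta>^2 \<le> (chord b)^2"
    using norm_frame[OF assms(1), of b \<eta>] by auto
  also have "\<dots> \<longleftrightarrow> \<bar>\<eta>\<bar> \<le> chord b"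
    using chord_pos[OF assms(2)] abs_le_square_iff[of \<eta> "chord b"] by simp
  finally show ?thesis by auto
qed

context
  fixes c :: "real^2" and b :: real
  assumes c: "norm c = 1" and b: "\<bar>b\<bar> < \<rho>"
begin

lemma compact_chord: "compact {- chord b..chord b}" "{- chord b..chord b} \<noteq> {}"
  using chord_pos[OF b] by auto

lemma continuous_slice: "cls W \<Longrightarrow> continuous_on S (\<lambda>\<eta>. W (frame c b \<eta>))"
  by (rule continuous_on_compose2[OF cls_continuous[of W UNIV]]) (auto intro!: continuous_intros)

lemmas slice_conj_attained = conj_on_attained[OF compact_chord continuous_slice, folded slice_conj_def]
lemmas slice_conj_upper = conj_on_upper[OF compact_chord continuous_slice, folded slice_conj_def]

lemma Lipschitz_slice_conj:
  assumes "cls W" shows "(chord b)-lipschitz_on UNIV (slice_conj c b W)"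
  unfolding slice_conj_def
  by (rule Lipschitz_conj_on[OF compact_chord continuous_slice[OF assms]]) auto

lemma continuous_slice_conj: "cls W \<Longrightarrow> continuous_on S (slice_conj c b W)"
  using lipschitz_on_continuous_on[OF Lipschitz_slice_conj] continuous_on_subset by blast

text \<open>Minimizing a conjugate along a line is dual to restricting \<open>W\<close> to a chord.
  At an interior minimizer the two one-sided derivatives yield maximizing slopes on either side of
  the line \<open>c \<bullet> \<xi> = b\<close>; their convex combination on this line is again
  maximizing, by convexity of \<open>W\<close>.\<close>

lemma slice_minimum:
  assumes W: "cls W" and ts: "ts \<in> {-T<..<T}"
    and min: "\<And>t. t \<in> {-T..T} \<Longrightarrow> cj W (frame c ts y) - b * ts \<le> cj W (frame c t y) - b * t"
  shows "cj W (frame c ts y) - b * ts = slice_conj c b W y"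
proof (rule antisym)
  let ?x = "frame c ts y"
  obtain \<eta> where \<eta>: "\<eta> \<in> {- chord b..chord b}" "slice_conj c b W y = \<eta> \<bullet> y - W (frame c b \<eta>)"
    using slice_conj_attained[OF W, of y] by blast
  have "frame c b \<eta> \<in> B" using \<eta>(1) frame_mem_B[OF c b] by blast
  from cj_upper[OF W this, of ?x] show "slice_conj c b W y \<le> cj W ?x - b * ts"
    unfolding \<eta>(2) by (simp add: inner_frame_frame[OF c])
next
  let ?x = "frame c ts y"
  define e where "e = min (T - ts) (T + ts)"
  have e: "e > 0" using ts by (auto simp: e_def)
  define X where "X n = e / real (Suc n)" for n
  have Xle: "X n \<le> e" for n
  proof -
    have "e \<le> e * real (Suc n)" using e by simp
    then show ?thesis using e unfolding X_def by (subst pos_divide_le_eq) auto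
  qed
  have X: "X n > 0" "X n \<le> T - ts" "X n \<le> T + ts" for n
    using e Xle[of n] by (auto simp: X_def e_def simp del: of_nat_Suc)
  have Xlim: "X \<longlonglongrightarrow> 0"
    unfolding X_def[abs_def] using tendsto_mult[OF tendsto_const[of e] LIMSEQ_Suc[OF lim_1_over_n[where 'a=real]]] by simp
  have "cj W ?x + b * X n \<le> cj W (?x + X n *\<^sub>R c)" for n
    using min[of "ts + X n"] X[of n] ts unfolding frame_add by (simp add: algebra_simps)
  from cj_directional[OF W X(1) Xlim this]
  obtain \<xi>1 where 1: "\<xi>1 \<in> B" "cj W ?x = \<xi>1 \<bullet> ?x - W \<xi>1" "b \<le> \<xi>1 \<bullet> c" by blast
  have "cj W ?x + (- b) * X n \<le> cj W (?x + X n *\<^sub>R (- c))" for n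
    using min[of "ts - X n"] X[of n] ts frame_add[of c ts y "- X n"] by (simp add: algebra_simps)
  from cj_directional[OF W X(1) Xlim this]
  obtain \<xi>2 where 2: "\<xi>2 \<in> B" "cj W ?x = \<xi>2 \<bullet> ?x - W \<xi>2" "- b \<le> \<xi>2 \<bullet> (- c)" by blast
  have "\<exists>\<theta>. 0 \<le> \<theta> \<and> \<theta> \<le> 1 \<and> (1 - \<theta>) * (\<xi>2 \<bullet> c) + \<theta> * (\<xi>1 \<bullet> c) = b"
  proof (cases "\<xi>1 \<bullet> c = \<xi>2 \<bullet> c")
    case True
    then show ?thesis using 1(3) 2(3) by (intro exI[of _ 0]) auto
  next
    case False
    then have lt: "\<xi>2 \<bullet> c < \<xi>1 \<bullet> c" using 1(3) 2(3) by simp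
    define \<theta> where "\<theta> = (b - \<xi>2 \<bullet> c) / (\<xi>1 \<bullet> c - \<xi>2 \<bullet> c)"
    have "\<theta> * (\<xi>1 \<bullet> c - \<xi>2 \<bullet> c) = b - \<xi>2 \<bullet> c" using lt by (simp add: \<theta>_def)
    moreover have "0 \<le> \<theta>" "\<theta> \<le> 1" using 1(3) 2(3) lt by (simp_all add: \<theta>_def)
    ultimately show ?thesis by (intro exI[of _ \<theta>]) (simp add: algebra_simps)
  qed
  then obtain \<theta> where \<theta>: "0 \<le> \<theta>" "\<theta> \<le> 1" "(1 - \<theta>) * (\<xi>2 \<bullet> c) + \<theta> * (\<xi>1 \<bullet> c) = b" by blast
  let ?\<xi> = "(1 - \<theta>) *\<^sub>R \<xi>2 + \<theta> *\<^sub>R \<xi>1"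
  have xb: "c \<bullet> ?\<xi> = b" using \<theta>(3) by (simp add: inner_add_right inner_commute)
  have "W ?\<xi> \<le> (1 - \<theta>) * W \<xi>2 + \<theta> * W \<xi>1"
    using \<theta> by (intro convex_onD[OF cls_convex[OF W]]) auto
  moreover have "(1 - \<theta>) * cj W ?x + \<theta> * cj W ?x = (1 - \<theta>) * (\<xi>2 \<bullet> ?x - W \<xi>2) + \<theta> * (\<xi>1 \<bullet> ?x - W \<xi>1)"
    using 1(2) 2(2) by simp
  ultimately have le: "cj W ?x \<le> ?\<xi> \<bullet> ?x - W ?\<xi>"
    by (simp add: inner_add_left algebra_simps)
  have \<xi>B: "?\<xi> \<in> B" using 1(1) 2(1) \<theta> convex_cball[of 0 \<rho>] by (intro convexD) auto
  have fr: "?\<xi> = frame c b (perp c \<bullet> ?\<xi>)" using frame_coordinates[OF c, of ?\<xi>] xb by simp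
  have mem: "perp c \<bullet> ?\<xi> \<in> {- chord b..chord b}" using \<xi>B fr frame_mem_B[OF c b] by metis
  have "?\<xi> \<bullet> ?x = b * ts + (perp c \<bullet> ?\<xi>) * y"
    by (subst fr) (simp only: inner_frame_frame[OF c])
  moreover have "(perp c \<bullet> ?\<xi>) \<bullet> y - W (frame c b (perp c \<bullet> ?\<xi>)) \<le> slice_conj c b W y"
    by (rule slice_conj_upper[OF W mem])
  ultimately show "cj W ?x - b * ts \<le> slice_conj c b W y"
    using le fr by simp
qed

text \<open>As \<open>\<bar>b\<bar> < \<rho>\<close>, the ball contains slopes
  \<open>\<beta>\<close> and \<open>\<beta>'\<close> with components larger and smaller than
  \<open>b\<close>; they make the tilted slice grow at both ends.\<close>

lemma slice_coercive:
  assumes W: "cls W"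
  shows "\<exists>T0. \<forall>T\<ge>T0. cj W (frame c 0 y) < cj W (frame c T y) - b * T \<and> cj W (frame c 0 y) < cj W (frame c (-T) y) - b * (-T)"
proof -
  let ?n = "\<lambda>t. cj W (frame c t y)"
  define \<beta> \<beta>' where "\<beta> = (b + \<rho>) / 2" and "\<beta>' = (b - \<rho>) / 2"
  have \<beta>: "b < \<beta>" "\<bar>\<beta>\<bar> < \<rho>" "\<beta>' < b" "\<bar>\<beta>'\<bar> < \<rho>" using b by (auto simp: \<beta>_def \<beta>'_def)
  have low: "z * t - W (frame c z 0) \<le> ?n t" if "\<bar>z\<bar> < \<rho>" for z t
  proof -
    have "frame c z 0 \<in> B" using frame_mem_B[OF c that, of 0] chord_pos[OF that] by simp
    from cj_upper[OF W this, of "frame c t y"] show ?thesis by (simp add: inner_frame_frame[OF c])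
  qed
  define T1 T2 where "T1 = (?n 0 + W (frame c \<beta> 0)) / (\<beta> - b)" and "T2 = (?n 0 + W (frame c \<beta>' 0)) / (b - \<beta>')"
  have "?n 0 < ?n T - b * T \<and> ?n 0 < ?n (-T) - b * (-T)" if T: "max (T1 + 1) (T2 + 1) \<le> T" for T
  proof
    have "T1 < T" "T2 < T" using T by auto
    then have "?n 0 + W (frame c \<beta> 0) < T * (\<beta> - b)" "?n 0 + W (frame c \<beta>' 0) < T * (b - \<beta>')"
      unfolding T1_def T2_def using \<beta> by (simp_all add: pos_divide_less_eq)
    then show "?n 0 < ?n T - b * T" "?n 0 < ?n (-T) - b * (-T)"
      using low[OF \<beta>(2), of T] low[OF \<beta>(4), of "-T"] by (simp_all add: algebra_simps)
  qed
  then show ?thesis by blast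
qed

text \<open>\<open>integral_derivative_pos_part\<close> applies along the slice with tilt
  \<open>b\<close>. Coercivity keeps the minimizer away from the ends, so that its value is the
  conjugate over the chord by \<open>slice_minimum\<close>.\<close>

lemma slice_hinge_integral:
  assumes W: "cls W" and T: "0 < T"
    and coercive: "cj W (frame c 0 y) < cj W (frame c T y) - b * T" "cj W (frame c 0 y) < cj W (frame c (-T) y) - b * (-T)"
    and AE: "AE t in lborel. GDERIV (cj W) (frame c t y) :> gradient (cj W) (frame c t y)"
  shows "set_integrable lborel {-T..T} (\<lambda>t. hinge c b (gradient (cj W) (frame c t y)))"
    and "(LINT t:{-T..T}|lborel. hinge c b (gradient (cj W) (frame c t y))) =
      cj W (frame c T y) - b * T - slice_conj c b W y"
proof -
  let ?n = "\<lambda>t. cj W (frame c t y)"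
  define p where "p t = c \<bullet> gradient (cj W) (frame c t y)" for t
  have p: "p \<in> borel_measurable borel"
    unfolding p_def
    by (intro borel_measurable_inner borel_measurable_const
        measurable_compose[OF measurable_frame(2) measurable_gradient_cj[OF W]])
  have der: "AE t in lborel. (?n has_real_derivative p t) (at t)"
    using AE by eventually_elim (simp add: p_def GDERIV_frame)
  note lip = Lipschitz_frame(1)[OF Lipschitz_cj[OF W] c, of y]
  have cont: "continuous_on {-T..T} (\<lambda>t. ?n t - b * t)"
    using continuous_on_subset[OF lipschitz_on_continuous_on[OF lip], of "{-T..T}"]
    by (intro continuous_intros) auto
  from continuous_attains_inf[OF compact_Icc _ this] T
  obtain ts where ts: "ts \<in> {-T..T}" and min: "\<And>t. t \<in> {-T..T} \<Longrightarrow> ?n ts - b * ts \<le> ?n t - b * t"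
    by auto
  have "?n ts - b * ts \<le> ?n 0" using min[of 0] T by simp
  then have "ts \<noteq> T" "ts \<noteq> -T" using coercive by auto
  then have ts': "ts \<in> {-T<..<T}" using ts by auto
  have eq: "hinge c b (gradient (cj W) (frame c t y)) = max 0 (p t - b)" for t
    by (simp add: hinge_def p_def)
  have int_p: "set_integrable lborel {-T..T} p"
    using integral_derivative_Lipschitz(1)[OF lip p der] T by simp
  have "set_integrable lborel {-T..T} (\<lambda>_. b)" by (rule set_integrable_const_Icc)
  with int_p have "integrable lborel (\<lambda>t. max 0 (indicator {-T..T} t *\<^sub>R p t - indicator {-T..T} t *\<^sub>R b))"
    unfolding set_integrable_def by (intro integrable_max Bochner_Integration.integrable_diff) auto
  moreover have "max 0 (indicator {-T..T} t *\<^sub>R p t - indicator {-T..T} t *\<^sub>R b) = indicator {-T..T} t *\<^sub>R max 0 (p t - b)" for t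
    by (auto simp: indicator_def)
  ultimately show "set_integrable lborel {-T..T} (\<lambda>t. hinge c b (gradient (cj W) (frame c t y)))"
    unfolding eq set_integrable_def by simp
  show "(LINT t:{-T..T}|lborel. hinge c b (gradient (cj W) (frame c t y))) =
      cj W (frame c T y) - b * T - slice_conj c b W y"
    unfolding eq
    using integral_derivative_pos_part(1)[OF convex_on_frame[OF convex_cj[OF W]] lip p der ts min] slice_minimum[OF W ts' min]
    by simp
qed

text \<open>The end point \<open>frame c T y\<close> lies where the conjugates of \<open>V\<close>
  and \<open>W\<close> agree, so only the chord conjugates survive in the difference.\<close>

lemma hinge_difference:
  assumes V: "cls V" and W: "cls W"
  shows "E (hinge c b) W - E (hinge c b) V = (LINT y:{-R..R}|lborel. slice_conj c b V y - slice_conj c b W y)"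
  unfolding E_def
proof (rule Ep_diff_slices[OF prim_cj[OF V] prim_cj[OF W] continuous_on_hinge c])
  show "(\<lambda>y. slice_conj c b V y - slice_conj c b W y) \<in> borel_measurable borel"
    by (intro borel_measurable_continuous_onI continuous_intros continuous_slice_conj V W)
  fix y assume y: "\<bar>y\<bar> \<le> R"
    and AE: "AE t in lborel. GDERIV (cj W) (frame c t y) :> gradient (cj W) (frame c t y)"
      "AE t in lborel. GDERIV (cj V) (frame c t y) :> gradient (cj V) (frame c t y)"
  obtain T1 where T1: "\<And>T. T \<ge> T1 \<Longrightarrow> cj W (frame c 0 y) < cj W (frame c T y) - b * T \<and> cj W (frame c 0 y) < cj W (frame c (-T) y) - b * (-T)"
    using slice_coercive[OF W] by blast
  obtain T2 where T2: "\<And>T. T \<ge> T2 \<Longrightarrow> cj V (frame c 0 y) < cj V (frame c T y) - b * T \<and> cj V (frame c 0 y) < cj V (frame c (-T) y) - b * (-T)"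
    using slice_coercive[OF V] by blast
  define T where "T = max R (max T1 T2)"
  have T: "R \<le> T" "T1 \<le> T" "T2 \<le> T" "0 < T" using R0 by (auto simp: T_def)
  have "L < norm (frame c T y)" using abs_le_norm_frame(1)[OF c, of T y] T L by linarith
  then have "cj W (frame c T y) = cj V (frame c T y)" using cj_outside[OF W] cj_outside[OF V] by simp
  then show "\<exists>T\<ge>R. set_integrable lborel {-T..T} (\<lambda>t. hinge c b (gradient (cj W) (frame c t y))) \<and>
        set_integrable lborel {-T..T} (\<lambda>t. hinge c b (gradient (cj V) (frame c t y))) \<and>
        (LINT t:{-T..T}|lborel. hinge c b (gradient (cj W) (frame c t y))) -
        (LINT t:{-T..T}|lborel. hinge c b (gradient (cj V) (frame c t y))) = slice_conj c b V y - slice_conj c b W y"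
    using slice_hinge_integral[OF W T(4) _ _ AE(1)] slice_hinge_integral[OF V T(4) _ _ AE(2)] T1[OF T(2)] T2[OF T(3)] T(1)
    by (intro exI[of _ T]) simp
qed

lemma set_integrable_slice_conj:
  assumes "cls W" shows "set_integrable lborel {-R..R} (slice_conj c b W)"
  unfolding set_integrable_def
  using borel_integrable_compact[OF compact_Icc continuous_slice_conj[OF assms]] by simp

text \<open>In \<open>integral_conjugate_quadratic\<close> the linear terms involve only the end
  points of the chord. These lie on the sphere of radius \<open>\<rho>\<close>, where
  \<open>V\<close> and \<open>W\<close> both equal \<open>g\<close>; what remains is half the
  integral of the squared slope.\<close>

lemma hinge_energy:
  assumes V: "cls V" and W: "cls W"
  shows "E (hinge c b) W - E (hinge c b) V = (energy c b V - energy c b W) / 2"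
proof -
  have J: "(LINT y:{-R..R}|lborel. slice_conj c b W y) = R^2 * chord b - R * (W (frame c b (chord b)) + W (frame c b (- chord b))) + energy c b W / 2"
    if W: "cls W" for W
  proof -
    have cv: "convex_on UNIV (\<lambda>\<eta>. W (frame c b \<eta>))" by (rule convex_on_frame'[OF cls_convex[OF W]])
    have "slice_conj c b W y = (SUP \<eta>\<in>{- chord b..chord b}. y * \<eta> - W (frame c b \<eta>))" for y
      by (simp add: slice_conj_def conj_on_def mult.commute)
    then show ?thesis
      using integral_conjugate_quadratic[OF cv Lipschitz_frame(2)[OF cls_Lipschitz[OF W] c] borel_measurable_slope[OF cv] AE_slope[OF cv],
        of "chord b" R] chord_pos[OF b] L by (simp add: energy_def)
  qed
  have "W (frame c b \<eta>) = V (frame c b \<eta>)" if "\<bar>\<eta>\<bar> = chord b" for \<eta>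
    using norm_frame_chord[OF c b that] r cls_eq[OF W] cls_eq[OF V] by simp
  then have "W (frame c b (chord b)) = V (frame c b (chord b))" "W (frame c b (- chord b)) = V (frame c b (- chord b))"
    using chord_pos[OF b] by auto
  then show ?thesis
    unfolding hinge_difference[OF V W] set_integral_diff(2)[OF set_integrable_slice_conj[OF V] set_integrable_slice_conj[OF W]] J[OF V] J[OF W]
    by simp
qed

lemma hinge_mono:
  assumes V: "cls V" and W: "cls W" and le: "\<And>\<xi>. \<xi> \<in> B \<Longrightarrow> V \<xi> \<le> W \<xi>"
  shows "E (hinge c b) V \<le> E (hinge c b) W"
proof -
  have "slice_conj c b W y \<le> slice_conj c b V y" for y
    unfolding slice_conj_def
    by (rule conj_on_mono[OF compact_chord continuous_slice[OF V] continuous_slice[OF W]])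
       (use le frame_mem_B[OF c b] in blast)
  then have "0 \<le> (LINT y:{-R..R}|lborel. slice_conj c b V y - slice_conj c b W y)"
    unfolding set_lebesgue_integral_def by (intro Bochner_Integration.integral_nonneg) (simp add: indicator_def)
  then show ?thesis using hinge_difference[OF V W] by simp
qed

lemma hinge_Lipschitz:
  assumes V: "cls V" and W: "cls W" and le: "\<And>\<xi>. \<xi> \<in> B \<Longrightarrow> \<bar>V \<xi> - W \<xi>\<bar> \<le> e"
  shows "\<bar>E (hinge c b) W - E (hinge c b) V\<bar> \<le> 2 * R * e"
proof -
  have "\<bar>slice_conj c b V y - slice_conj c b W y\<bar> \<le> e" for y
    unfolding slice_conj_def
    by (rule conj_on_diff_bound[OF compact_chord continuous_slice[OF V] continuous_slice[OF W]])
       (use le frame_mem_B[OF c b] in blast)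
  then have "\<bar>LINT y:{-R..R}|lborel. slice_conj c b V y - slice_conj c b W y\<bar> \<le> (LINT y:{-R..R}|lborel. e)"
    unfolding set_lebesgue_integral_def
    by (intro integral_abs_bound_integral
        set_integral_diff(1)[OF set_integrable_slice_conj[OF V] set_integrable_slice_conj[OF W], unfolded set_integrable_def]
        set_integrable_const_Icc[unfolded set_integrable_def]) (auto simp: indicator_def)
  also have "\<dots> = 2 * R * e" using R0 by (simp add: set_lebesgue_integral_def)
  finally show ?thesis using hinge_difference[OF V W] by simp
qed

end

lemma prim_Lipschitz: "prim v \<Longrightarrow> \<rho>-lipschitz_on UNIV v" by (simp add: prim_def)
lemma prim_convex: "prim v \<Longrightarrow> convex_on UNIV v" by (simp add: prim_def)

text \<open>Integration along lines parallel to \<open>a\<close> leaves only values at end points of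
  norm at least \<open>R\<close>, where \<open>v\<close> and \<open>w\<close> agree.\<close>

lemma Ep_affine:
  assumes v: "prim v" and w: "prim w"
  shows "Ep (\<lambda>\<xi>. a \<bullet> \<xi>) w = Ep (\<lambda>\<xi>. a \<bullet> \<xi>) v"
proof -
  have cont: "continuous_on UNIV (\<lambda>\<xi>::real^2. a \<bullet> \<xi>)" by (intro continuous_intros)
  show ?thesis
  proof (cases "a = 0")
    case True then show ?thesis by (simp add: Ep_def)
  next
    case False
    define c where "c = a /\<^sub>R norm a"
    have c: "norm c = 1" and ac: "a = norm a *\<^sub>R c" using False by (auto simp: c_def)
    have "Ep (\<lambda>\<xi>. a \<bullet> \<xi>) w - Ep (\<lambda>\<xi>. a \<bullet> \<xi>) v = (LINT y:{-R..R}|lborel. 0)"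
    proof (rule Ep_diff_slices[OF v w cont c])
      fix y assume y: "\<bar>y\<bar> \<le> R"
        and AE: "AE t in lborel. GDERIV w (frame c t y) :> gradient w (frame c t y)"
          "AE t in lborel. GDERIV v (frame c t y) :> gradient v (frame c t y)"
      have *: "set_integrable lborel {-R..R} (\<lambda>t. a \<bullet> gradient w (frame c t y)) \<and>
          (LINT t:{-R..R}|lborel. a \<bullet> gradient w (frame c t y)) = norm a * (w (frame c R y) - w (frame c (-R) y))"
        if w: "prim w" and AE: "AE t in lborel. GDERIV w (frame c t y) :> gradient w (frame c t y)" for w
      proof -
        define p where "p t = c \<bullet> gradient w (frame c t y)" for t
        have p: "p \<in> borel_measurable borel"
          unfolding p_def
          by (intro borel_measurable_inner borel_measurable_const
              measurable_compose[OF measurable_frame(2) measurable_gradient_prim[OF w]])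
        have der: "AE t in lborel. ((\<lambda>t. w (frame c t y)) has_real_derivative p t) (at t)"
          using AE by eventually_elim (simp add: p_def GDERIV_frame)
        have eq: "a \<bullet> gradient w (frame c t y) = norm a * p t" for t
          by (subst ac) (simp add: p_def)
        show ?thesis
          unfolding eq using integral_derivative_Lipschitz[OF Lipschitz_frame(1)[OF prim_Lipschitz[OF w] c, of y] p der, of "-R" R] R0
          by auto
      qed
      have out: "w (frame c t y) = v (frame c t y)" if "\<bar>t\<bar> = R" for t
      proof -
        have "L < norm (frame c t y)" using abs_le_norm_frame(1)[OF c, of t y] that L by linarith
        then show ?thesis using v w by (simp add: prim_def)
      qed
      show "\<exists>T\<ge>R. set_integrable lborel {-T..T} (\<lambda>t. a \<bullet> gradient w (frame c t y)) \<and>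
          set_integrable lborel {-T..T} (\<lambda>t. a \<bullet> gradient v (frame c t y)) \<and>
          (LINT t:{-T..T}|lborel. a \<bullet> gradient w (frame c t y)) -
          (LINT t:{-T..T}|lborel. a \<bullet> gradient v (frame c t y)) = 0"
        using *[OF w AE(1)] *[OF v AE(2)] out[of R] out[of "-R"] R0 by (intro exI[of _ R]) simp
    qed simp
    then show ?thesis by simp
  qed
qed

lemma E_affine:
  assumes V: "cls V" and W: "cls W"
  shows "E (\<lambda>\<xi>. a \<bullet> \<xi> + d) W = E (\<lambda>\<xi>. a \<bullet> \<xi> + d) V"
proof -
  have cont: "continuous_on UNIV (\<lambda>\<xi>::real^2. a \<bullet> \<xi>)" by (intro continuous_intros)
  show ?thesis
    using E_add[OF W cont continuous_on_const, of d] E_add[OF V cont continuous_on_const, of d]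
      Ep_affine[OF prim_cj[OF V] prim_cj[OF W], of a] by (simp add: E_const E_def[of "\<lambda>\<xi>. a \<bullet> \<xi>"])
qed

end

section \<open>Functionals determined by hinges\<close>

definition node :: "real \<Rightarrow> nat \<Rightarrow> nat \<Rightarrow> real" where
  "node \<rho> m j = - \<rho> + real j * (2 * \<rho> / real m)"

text \<open>The jump of slope, at the node \<open>j\<close>, of the piecewise linear interpolation
  on a uniform grid. It is used for \<open>1 \<le> j\<close> only, so that \<open>j - 1\<close> is
  not truncated.\<close>

definition kink :: "real \<Rightarrow> (real \<Rightarrow> real) \<Rightarrow> nat \<Rightarrow> nat \<Rightarrow> real" where
  "kink \<rho> \<psi> m j = (\<psi> (node \<rho> m (Suc j)) - 2 * \<psi> (node \<rho> m j) + \<psi> (node \<rho> m (j - 1))) / (2 * \<rho> / real m)"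

text \<open>Piecewise linear interpolation, written as an affine function plus hinges in order that
  a functional known on hinges can be evaluated on it.\<close>

definition interpolant :: "real \<Rightarrow> (real \<Rightarrow> real) \<Rightarrow> nat \<Rightarrow> real \<Rightarrow> real" where
  "interpolant \<rho> \<psi> m s = \<psi> (- \<rho>) + (\<psi> (node \<rho> m 1) - \<psi> (- \<rho>)) / (2 * \<rho> / real m) * (s + \<rho>)
     + (\<Sum>j = 1..<m. kink \<rho> \<psi> m j * max 0 (s - node \<rho> m j))"

lemma node_less:
  assumes "0 < \<rho>" "1 \<le> j" "j < m"
  shows "\<bar>node \<rho> m j\<bar> < \<rho>"
proof -
  have "0 < real j * (2 * \<rho> / real m)" using assms by simp
  moreover have "real j * (2 * \<rho> / real m) < 2 * \<rho>" using assms by (simp add: field_simps)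
  ultimately show ?thesis by (simp add: node_def abs_less_iff)
qed

lemma interpolant_partial:
  assumes "0 < \<rho>" "i < m"
  shows "\<psi> (- \<rho>) + (\<psi> (node \<rho> m 1) - \<psi> (- \<rho>)) / (2 * \<rho> / real m) * (s + \<rho>)
     + (\<Sum>j = 1..<Suc i. kink \<rho> \<psi> m j * (s - node \<rho> m j))
    = \<psi> (node \<rho> m i) + (\<psi> (node \<rho> m (Suc i)) - \<psi> (node \<rho> m i)) / (2 * \<rho> / real m) * (s - node \<rho> m i)"
  using assms(2)
proof (induction i)
  case 0
  then show ?case by (simp add: node_def)
next
  case (Suc i)
  define h where "h = 2 * \<rho> / real m"
  have h: "h > 0" using assms Suc.prems by (simp add: h_def)
  let ?b = "node \<rho> m"
  have step: "?b (Suc i) - ?b i = h" by (simp add: node_def h_def algebra_simps add_divide_distrib)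
  have "(\<Sum>j = 1..<Suc (Suc i). kink \<rho> \<psi> m j * (s - ?b j)) = (\<Sum>j = 1..<Suc i. kink \<rho> \<psi> m j * (s - ?b j)) + kink \<rho> \<psi> m (Suc i) * (s - ?b (Suc i))"
    by simp
  then have "\<psi> (- \<rho>) + (\<psi> (?b 1) - \<psi> (- \<rho>)) / h * (s + \<rho>) + (\<Sum>j = 1..<Suc (Suc i). kink \<rho> \<psi> m j * (s - ?b j))
    = \<psi> (?b i) + (\<psi> (?b (Suc i)) - \<psi> (?b i)) / h * (s - ?b i) + kink \<rho> \<psi> m (Suc i) * (s - ?b (Suc i))"
    using Suc by (simp add: h_def)
  also have "kink \<rho> \<psi> m (Suc i) = (\<psi> (?b (Suc (Suc i))) - 2 * \<psi> (?b (Suc i)) + \<psi> (?b i)) / h"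
    by (simp add: kink_def h_def)
  also have "s - ?b i = (s - ?b (Suc i)) + h" using step by simp
  also have "\<psi> (?b i) + (\<psi> (?b (Suc i)) - \<psi> (?b i)) / h * ((s - ?b (Suc i)) + h) +
     (\<psi> (?b (Suc (Suc i))) - 2 * \<psi> (?b (Suc i)) + \<psi> (?b i)) / h * (s - ?b (Suc i))
    = \<psi> (?b (Suc i)) + (\<psi> (?b (Suc (Suc i))) - \<psi> (?b (Suc i))) / h * (s - ?b (Suc i))"
    using h by (simp add: field_simps)
  finally show ?case by (simp add: h_def)
qed

lemma interpolant_piece:
  assumes "0 < \<rho>" "i < m" and s: "node \<rho> m i \<le> s" "s \<le> node \<rho> m (Suc i)"
  shows "interpolant \<rho> \<psi> m s = \<psi> (node \<rho> m i) + (\<psi> (node \<rho> m (Suc i)) - \<psi> (node \<rho> m i)) / (2 * \<rho> / real m) * (s - node \<rho> m i)"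
proof -
  have h: "2 * \<rho> / real m > 0" using assms by simp
  have mono: "node \<rho> m j \<le> node \<rho> m k" if "j \<le> k" for j k
    unfolding node_def using that h by (intro add_left_mono mult_right_mono) auto
  have "(\<Sum>j = 1..<m. kink \<rho> \<psi> m j * max 0 (s - node \<rho> m j)) = (\<Sum>j = 1..<Suc i. kink \<rho> \<psi> m j * (s - node \<rho> m j))"
  proof (rule sum.mono_neutral_cong_right)
    show "\<forall>j\<in>{1..<m} - {1..<Suc i}. kink \<rho> \<psi> m j * max 0 (s - node \<rho> m j) = 0"
    proof
      fix j assume "j \<in> {1..<m} - {1..<Suc i}"
      then have "node \<rho> m (Suc i) \<le> node \<rho> m j" by (intro mono) auto
      then show "kink \<rho> \<psi> m j * max 0 (s - node \<rho> m j) = 0" using s by simp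
    qed
    fix j assume "j \<in> {1..<Suc i}"
    then have "node \<rho> m j \<le> node \<rho> m i" by (intro mono) auto
    then show "kink \<rho> \<psi> m j * max 0 (s - node \<rho> m j) = kink \<rho> \<psi> m j * (s - node \<rho> m j)" using s by simp
  qed (use assms in auto)
  then show ?thesis unfolding interpolant_def using interpolant_partial[OF assms(1,2)] by simp
qed

lemma interpolant_close:
  assumes \<rho>: "0 < \<rho>" and cont: "continuous_on UNIV \<psi>" and e: "0 < e"
  shows "\<exists>M\<ge>1. \<forall>m\<ge>M. \<forall>s\<in>{-\<rho>..\<rho>}. \<bar>interpolant \<rho> \<psi> m s - \<psi> s\<bar> \<le> e"
proof -
  have "uniformly_continuous_on {-\<rho>..\<rho>} \<psi>"
    using continuous_on_subset[OF cont] by (intro compact_uniformly_continuous) auto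
  then obtain d where d: "d > 0" "\<And>x y. x \<in> {-\<rho>..\<rho>} \<Longrightarrow> y \<in> {-\<rho>..\<rho>} \<Longrightarrow> \<bar>y - x\<bar> < d \<Longrightarrow> \<bar>\<psi> y - \<psi> x\<bar> < e"
    unfolding uniformly_continuous_on_def dist_real_def using e by blast
  define M where "M = nat \<lceil>2 * \<rho> / d\<rceil> + 1"
  have "\<bar>interpolant \<rho> \<psi> m s - \<psi> s\<bar> \<le> e" if m: "M \<le> m" and s: "s \<in> {-\<rho>..\<rho>}" for m s
  proof -
    have mpos: "0 < m" using m by (simp add: M_def)
    define h where "h = 2 * \<rho> / real m"
    have h: "h > 0" using \<rho> mpos by (simp add: h_def)
    have "2 * \<rho> / d < real m" using m unfolding M_def by linarith
    then have hd: "h < d" using d(1) mpos by (simp add: h_def field_simps)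
    \<comment> \<open>The index is a rounded-down quotient; this would put the right end point into
      a cell beyond the last one, so it is treated separately.\<close>
    obtain i where i: "i < m" "node \<rho> m i \<le> s" "s \<le> node \<rho> m (Suc i)"
    proof (cases "s = \<rho>")
      case True
      then show ?thesis using mpos \<rho> by (intro that[of "m - 1"]) (auto simp: node_def of_nat_diff field_simps)
    next
      case False
      define i where "i = nat \<lfloor>(s + \<rho>) / h\<rfloor>"
      have q: "0 \<le> (s + \<rho>) / h" using s h by simp
      have "real i \<le> (s + \<rho>) / h" "(s + \<rho>) / h < real i + 1" using q unfolding i_def by linarith+
      then have ih: "real i * h \<le> s + \<rho>" "s + \<rho> < (real i + 1) * h"
        using h by (simp_all add: pos_le_divide_eq pos_divide_less_eq)
      have "real i * h < 2 * \<rho>" using ih s False by auto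
      then have "real i < real m" using h mpos \<rho> by (simp add: h_def field_simps)
      then show ?thesis using ih by (intro that[of i]) (unfold node_def h_def[symmetric], auto simp: algebra_simps)
    qed
    have step: "node \<rho> m (Suc i) = node \<rho> m i + h" by (simp add: node_def h_def algebra_simps add_divide_distrib)
    have in1: "node \<rho> m i \<in> {-\<rho>..\<rho>}" "node \<rho> m (Suc i) \<in> {-\<rho>..\<rho>}"
    proof -
      have "real (Suc i) * h \<le> real m * h" "0 \<le> real i * h" "0 \<le> real (Suc i) * h" "real i * h \<le> real m * h"
        using i(1) h by (auto intro!: mult_right_mono)
      moreover have "real m * h = 2 * \<rho>" using mpos by (simp add: h_def)
      ultimately show "node \<rho> m i \<in> {-\<rho>..\<rho>}" "node \<rho> m (Suc i) \<in> {-\<rho>..\<rho>}" by (auto simp: node_def h_def[symmetric])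
    qed
    define t where "t = (s - node \<rho> m i) / h"
    have t: "0 \<le> t" "t \<le> 1" using i step h by (simp_all add: t_def)
    have "interpolant \<rho> \<psi> m s - \<psi> s = (1 - t) * (\<psi> (node \<rho> m i) - \<psi> s) + t * (\<psi> (node \<rho> m (Suc i)) - \<psi> s)"
    proof -
      have "x / h * (s - node \<rho> m i) = t * x" for x by (simp add: t_def)
      from this[of "\<psi> (node \<rho> m (Suc i)) - \<psi> (node \<rho> m i)"]
      show ?thesis unfolding interpolant_piece[OF \<rho> i] h_def[symmetric]
        by (simp only:) (simp add: algebra_simps)
    qed
    also have "\<bar>\<dots>\<bar> \<le> (1 - t) * \<bar>\<psi> (node \<rho> m i) - \<psi> s\<bar> + t * \<bar>\<psi> (node \<rho> m (Suc i)) - \<psi> s\<bar>"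
      using t by (intro order_trans[OF abs_triangle_ineq]) (simp add: abs_mult)
    also have "\<dots> \<le> (1 - t) * e + t * e"
    proof (intro add_mono mult_left_mono)
      show "\<bar>\<psi> (node \<rho> m i) - \<psi> s\<bar> \<le> e" using d(2)[OF s in1(1)] i step hd by fastforce
      show "\<bar>\<psi> (node \<rho> m (Suc i)) - \<psi> s\<bar> \<le> e" using d(2)[OF s in1(2)] i step hd by fastforce
    qed (use t in auto)
    finally show ?thesis by (simp add: algebra_simps)
  qed
  then show ?thesis by (intro exI[of _ M]) (auto simp: M_def)
qed

text \<open>Exponentials of linear forms are functions of a single linear form each, and yet their
  linear span is closed under multiplication; so ridge functions suffice for the Stone-Weierstrass
  theorem.\<close>

inductive exp_sum :: "(real^2 \<Rightarrow> real) \<Rightarrow> bool" where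
  zero: "exp_sum (\<lambda>_. 0)"
| plus: "exp_sum f \<Longrightarrow> exp_sum (\<lambda>\<xi>. k * exp (a \<bullet> \<xi>) + f \<xi>)"

lemma exp_sum_exp: "exp_sum (\<lambda>\<xi>. k * exp (a \<bullet> \<xi>))"
  using exp_sum.plus[OF exp_sum.zero, of k a] by simp

lemma exp_sum_add: "exp_sum f \<Longrightarrow> exp_sum h \<Longrightarrow> exp_sum (\<lambda>\<xi>. f \<xi> + h \<xi>)"
proof (induction rule: exp_sum.induct)
  case (plus f k a)
  then show ?case using exp_sum.plus[of "\<lambda>\<xi>. f \<xi> + h \<xi>" k a] by (simp add: add.assoc)
qed simp

lemma exp_sum_mult: "exp_sum f \<Longrightarrow> exp_sum h \<Longrightarrow> exp_sum (\<lambda>\<xi>. f \<xi> * h \<xi>)"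
proof (induction rule: exp_sum.induct)
  case zero then show ?case by (simp add: exp_sum.zero)
next
  case (plus f k a)
  have "exp_sum (\<lambda>\<xi>. k * exp (a \<bullet> \<xi>) * h \<xi>)"
    using plus.prems
  proof (induction rule: exp_sum.induct)
    case zero then show ?case by (simp add: exp_sum.zero)
  next
    case (plus f' k' a')
    then show ?case using exp_sum.plus[OF plus.IH, of "k * k'" "a + a'"]
      by (simp add: algebra_simps exp_add)
  qed
  then show ?case using exp_sum_add plus.IH plus.prems by (fastforce simp: algebra_simps)
qed

lemma exp_sum_continuous: "exp_sum f \<Longrightarrow> continuous_on S f"
  by (induction rule: exp_sum.induct) (auto intro!: continuous_intros)

lemma exp_sum_dense:
  assumes "compact S" "continuous_on S f" "0 < e"
  shows "\<exists>h. exp_sum h \<and> (\<forall>x\<in>S. \<bar>f x - h x\<bar> < e)"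
proof (rule Stone_Weierstrass_HOL[OF assms(1) _ _ _ _ _ assms(2,3)])
  show "exp_sum (\<lambda>x. c)" for c using exp_sum_exp[of c 0] by simp
  show "exp_sum f \<Longrightarrow> continuous_on S f" for f by (rule exp_sum_continuous)
  show "exp_sum f \<and> exp_sum g \<Longrightarrow> exp_sum (\<lambda>x. f x + g x)" for f g by (simp add: exp_sum_add)
  show "exp_sum f \<and> exp_sum g \<Longrightarrow> exp_sum (\<lambda>x. f x * g x)" for f g by (simp add: exp_sum_mult)
  fix x y :: "real^2" assume "x \<in> S \<and> y \<in> S \<and> x \<noteq> y"
  then have "(x - y) \<bullet> x \<noteq> (x - y) \<bullet> y" by (metis inner_diff_right inner_eq_zero_iff right_minus_eq)
  then show "\<exists>f. exp_sum f \<and> f x \<noteq> f y" using exp_sum_exp[of 1 "x - y"] by (intro exI[of _ "\<lambda>\<xi>. 1 * exp ((x - y) \<bullet> \<xi>)"]) simp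
qed

text \<open>Models a linear combination of energies whose weights add up to zero: linear in the
  integrand, bounded by the supremum norm on the ball, and zero on affine functions. Such a
  functional is determined by its values on hinges.\<close>

locale ridge_functional =
  fixes \<rho> C :: real and \<Psi> :: "(real^2 \<Rightarrow> real) \<Rightarrow> real"
  assumes rho: "0 < \<rho>"
    and add: "\<And>f h. continuous_on UNIV f \<Longrightarrow> continuous_on UNIV h \<Longrightarrow> \<Psi> (\<lambda>\<xi>. f \<xi> + h \<xi>) = \<Psi> f + \<Psi> h"
    and cmult: "\<And>f a. continuous_on UNIV f \<Longrightarrow> \<Psi> (\<lambda>\<xi>. a * f \<xi>) = a * \<Psi> f"
    and bound: "\<And>f e. continuous_on UNIV f \<Longrightarrow> (\<And>\<xi>. norm \<xi> \<le> \<rho> \<Longrightarrow> \<bar>f \<xi>\<bar> \<le> e) \<Longrightarrow> \<bar>\<Psi> f\<bar> \<le> C * e"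
    and affine: "\<And>a d. \<Psi> (\<lambda>\<xi>. a \<bullet> \<xi> + d) = 0"
begin

lemma diff_bound:
  assumes "continuous_on UNIV f" "continuous_on UNIV h" "\<And>\<xi>. norm \<xi> \<le> \<rho> \<Longrightarrow> \<bar>f \<xi> - h \<xi>\<bar> \<le> e"
  shows "\<bar>\<Psi> f - \<Psi> h\<bar> \<le> C * e"
proof -
  have "\<Psi> (\<lambda>\<xi>. f \<xi> + (-1) * h \<xi>) = \<Psi> f - \<Psi> h"
    using add[OF assms(1), of "\<lambda>\<xi>. (-1) * h \<xi>"] cmult[OF assms(2), of "-1"] assms(2) by (simp add: continuous_on_minus)
  moreover have "\<bar>\<Psi> (\<lambda>\<xi>. f \<xi> + (-1) * h \<xi>)\<bar> \<le> C * e"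
    using assms by (intro bound) (auto intro!: continuous_intros)
  ultimately show ?thesis by simp
qed

lemma C0: "0 \<le> C"
  using bound[of "\<lambda>_. 0" 1] by (simp add: continuous_on_const)

lemma sum:
  assumes "finite J" "\<And>j. j \<in> J \<Longrightarrow> continuous_on UNIV (f j)"
  shows "\<Psi> (\<lambda>\<xi>. \<Sum>j\<in>J. f j \<xi>) = (\<Sum>j\<in>J. \<Psi> (f j))"
  using assms
proof (induction rule: finite_induct)
  case empty
  then show ?case using affine[of 0 0] by simp
next
  case (insert j J)
  then show ?case using add[of "f j" "\<lambda>\<xi>. \<Sum>j\<in>J. f j \<xi>"] by (simp add: continuous_on_sum)
qed

lemma interpolant:
  "\<Psi> (\<lambda>\<xi>. interpolant \<rho> \<psi> m (c \<bullet> \<xi>)) = (\<Sum>j = 1..<m. kink \<rho> \<psi> m j * \<Psi> (hinge c (node \<rho> m j)))"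
proof -
  define d where "d = (\<psi> (node \<rho> m 1) - \<psi> (- \<rho>)) / (2 * \<rho> / real m)"
  have eq: "interpolant \<rho> \<psi> m (c \<bullet> \<xi>) = ((d *\<^sub>R c) \<bullet> \<xi> + (\<psi> (- \<rho>) + d * \<rho>)) + (\<Sum>j = 1..<m. kink \<rho> \<psi> m j * hinge c (node \<rho> m j) \<xi>)" for \<xi>
    unfolding interpolant_def hinge_def d_def[symmetric] by (simp add: algebra_simps)
  have cont: "continuous_on UNIV (\<lambda>\<xi>. kink \<rho> \<psi> m j * hinge c (node \<rho> m j) \<xi>)" for j
    by (intro continuous_intros continuous_on_hinge)
  have "\<Psi> (\<lambda>\<xi>. interpolant \<rho> \<psi> m (c \<bullet> \<xi>)) = \<Psi> (\<lambda>\<xi>. (d *\<^sub>R c) \<bullet> \<xi> + (\<psi> (- \<rho>) + d * \<rho>)) + \<Psi> (\<lambda>\<xi>. \<Sum>j = 1..<m. kink \<rho> \<psi> m j * hinge c (node \<rho> m j) \<xi>)"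
    unfolding eq by (rule add) (intro continuous_intros continuous_on_hinge)+
  also have "\<dots> = (\<Sum>j = 1..<m. kink \<rho> \<psi> m j * \<Psi> (hinge c (node \<rho> m j)))"
    by (subst sum, simp, rule cont) (simp only: affine cmult[OF continuous_on_hinge] add_0)
  finally show ?thesis .
qed

text \<open>A discrete form of the integral of the second derivative of \<open>\<psi>\<close>
  against the values on hinges. It requires only continuity of \<open>\<psi>\<close>, since the
  interpolants converge uniformly.\<close>

lemma ridge_limit:
  assumes \<psi>: "continuous_on UNIV \<psi>" and c: "norm c = 1" and e: "0 < e"
  shows "\<exists>M\<ge>1. \<forall>m\<ge>M. \<bar>(\<Sum>j = 1..<m. kink \<rho> \<psi> m j * \<Psi> (hinge c (node \<rho> m j))) - \<Psi> (\<lambda>\<xi>. \<psi> (c \<bullet> \<xi>))\<bar> \<le> e"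
proof -
  have "0 < e / (C + 1)" using e C0 by simp
  from interpolant_close[OF rho \<psi> this] obtain M where M: "M \<ge> 1"
    "\<And>m s. M \<le> m \<Longrightarrow> s \<in> {-\<rho>..\<rho>} \<Longrightarrow> \<bar>interpolant \<rho> \<psi> m s - \<psi> s\<bar> \<le> e / (C + 1)" by blast
  have "\<bar>\<Psi> (\<lambda>\<xi>. interpolant \<rho> \<psi> m (c \<bullet> \<xi>)) - \<Psi> (\<lambda>\<xi>. \<psi> (c \<bullet> \<xi>))\<bar> \<le> e" if m: "M \<le> m" for m
  proof -
    have "\<bar>\<Psi> (\<lambda>\<xi>. interpolant \<rho> \<psi> m (c \<bullet> \<xi>)) - \<Psi> (\<lambda>\<xi>. \<psi> (c \<bullet> \<xi>))\<bar> \<le> C * (e / (C + 1))"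
    proof (rule diff_bound)
      show "continuous_on UNIV (\<lambda>\<xi>. interpolant \<rho> \<psi> m (c \<bullet> \<xi>))"
        unfolding interpolant_def by (intro continuous_intros)
      show "continuous_on UNIV (\<lambda>\<xi>. \<psi> (c \<bullet> \<xi>))"
        by (rule continuous_on_compose2[OF \<psi>]) (auto intro!: continuous_intros)
      fix \<xi> :: "real^2" assume "norm \<xi> \<le> \<rho>"
      then have "\<bar>c \<bullet> \<xi>\<bar> \<le> \<rho>" using Cauchy_Schwarz_ineq2[of c \<xi>] c by simp
      then show "\<bar>interpolant \<rho> \<psi> m (c \<bullet> \<xi>) - \<psi> (c \<bullet> \<xi>)\<bar> \<le> e / (C + 1)" using M(2)[OF m, of "c \<bullet> \<xi>"] by (auto simp: abs_le_iff)
    qed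
    also have "\<dots> \<le> e" using C0 e by (simp add: field_simps)
    finally show ?thesis .
  qed
  then show ?thesis using M(1) unfolding interpolant by blast
qed

text \<open>From hinges one passes to interpolants, by uniform limits to ridge functions, in
  particular to exponentials, and by density to all continuous functions.\<close>

lemma vanishes:
  assumes hinges: "\<And>c b. norm c = 1 \<Longrightarrow> \<bar>b\<bar> < \<rho> \<Longrightarrow> \<Psi> (hinge c b) = 0"
    and f: "continuous_on UNIV f"
  shows "\<Psi> f = 0"
proof -
  have ridge: "\<Psi> (\<lambda>\<xi>. \<psi> (c \<bullet> \<xi>)) = 0" if \<psi>: "continuous_on UNIV \<psi>" and c: "norm c = 1" for \<psi> c
  proof -
    have "\<bar>\<Psi> (\<lambda>\<xi>. \<psi> (c \<bullet> \<xi>))\<bar> \<le> e" if e: "0 < e" for e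
    proof -
      from ridge_limit[OF \<psi> c e] obtain M where M: "M \<ge> 1"
        "\<bar>(\<Sum>j = 1..<M. kink \<rho> \<psi> M j * \<Psi> (hinge c (node \<rho> M j))) - \<Psi> (\<lambda>\<xi>. \<psi> (c \<bullet> \<xi>))\<bar> \<le> e" by blast
      moreover have "(\<Sum>j = 1..<M. kink \<rho> \<psi> M j * \<Psi> (hinge c (node \<rho> M j))) = 0"
        by (rule sum.neutral) (use node_less[OF rho] hinges[OF c] in auto)
      ultimately show ?thesis by simp
    qed
    then have "\<bar>\<Psi> (\<lambda>\<xi>. \<psi> (c \<bullet> \<xi>))\<bar> \<le> 0" by (rule field_le_epsilon) simp
    then show ?thesis by simp
  qed
  have ex: "\<Psi> (\<lambda>\<xi>. exp (a \<bullet> \<xi>)) = 0" for a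
  proof (cases "a = 0")
    case True then show ?thesis using affine[of 0 1] by simp
  next
    case False
    have "\<Psi> (\<lambda>\<xi>. exp (norm a * ((a /\<^sub>R norm a) \<bullet> \<xi>))) = 0"
      by (rule ridge) (use False in \<open>auto intro!: continuous_intros\<close>)
    moreover have "norm a * ((a /\<^sub>R norm a) \<bullet> \<xi>) = a \<bullet> \<xi>" for \<xi> using False by simp
    ultimately show ?thesis by (simp only:)
  qed
  have es: "\<Psi> h = 0" if "exp_sum h" for h
    using that
  proof (induction rule: exp_sum.induct)
    case zero then show ?case using affine[of 0 0] by simp
  next
    case (plus f k a)
    have ce: "continuous_on UNIV (\<lambda>\<xi>::real^2. exp (a \<bullet> \<xi>))" by (intro continuous_intros)
    show ?case
      by (subst add) (use plus ce exp_sum_continuous[OF plus.hyps] in \<open>auto simp: cmult ex intro!: continuous_intros\<close>)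
  qed
  have "\<bar>\<Psi> f\<bar> \<le> e" if e: "0 < e" for e
  proof -
    have "0 < e / (C + 1)" using e C0 by simp
    from exp_sum_dense[OF compact_cball[of 0 \<rho>] continuous_on_subset[OF f] this]
    obtain h where h: "exp_sum h" "\<And>\<xi>. \<xi> \<in> cball 0 \<rho> \<Longrightarrow> \<bar>f \<xi> - h \<xi>\<bar> < e / (C + 1)" by auto
    have "\<bar>\<Psi> f - \<Psi> h\<bar> \<le> C * (e / (C + 1))"
      by (rule diff_bound[OF f exp_sum_continuous[OF h(1)]]) (use h(2) in \<open>force intro: less_imp_le\<close>)
    also have "\<dots> \<le> e" using C0 e by (simp add: field_simps)
    finally show ?thesis using es[OF h(1)] by simp
  qed
  then have "\<bar>\<Psi> f\<bar> \<le> 0" by (rule field_le_epsilon) simp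
  then show ?thesis by simp
qed

text \<open>For the square every kink equals \<open>2 * h\<close>. Fewer than \<open>m\<close> nodes
  contribute, and \<open>m * h = 2 * \<rho>\<close> gives the constant.\<close>

lemma square_bound:
  assumes K: "\<And>b. \<bar>b\<bar> < \<rho> \<Longrightarrow> \<bar>\<Psi> (hinge c b)\<bar> \<le> K" and c: "norm c = 1"
  shows "\<bar>\<Psi> (\<lambda>\<xi>. (c \<bullet> \<xi>)^2)\<bar> \<le> 4 * \<rho> * K"
proof (rule field_le_epsilon)
  fix e :: real assume e: "0 < e"
  have cont: "continuous_on UNIV (\<lambda>s::real. s^2)" by (intro continuous_intros)
  from ridge_limit[OF cont c e] obtain m where m: "m \<ge> 1"
    "\<bar>(\<Sum>j = 1..<m. kink \<rho> (\<lambda>s. s^2) m j * \<Psi> (hinge c (node \<rho> m j))) - \<Psi> (\<lambda>\<xi>. (c \<bullet> \<xi>)^2)\<bar> \<le> e" by blast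
  define h where "h = 2 * \<rho> / real m"
  have h: "h > 0" using m rho by (simp add: h_def)
  have K0: "0 \<le> K" using K[of 0] rho by simp
  have kink: "kink \<rho> (\<lambda>s. s^2) m j = 2 * h" if "1 \<le> j" for j
  proof -
    have eq: "node \<rho> m (Suc j) = node \<rho> m j + h" "node \<rho> m (j - 1) = node \<rho> m j - h"
      using that unfolding node_def h_def[symmetric] by (simp_all add: of_nat_diff algebra_simps)
    show ?thesis using h unfolding kink_def h_def[symmetric] eq by (simp add: power2_eq_square field_simps)
  qed
  have "\<bar>\<Sum>j = 1..<m. kink \<rho> (\<lambda>s. s^2) m j * \<Psi> (hinge c (node \<rho> m j))\<bar> \<le> (\<Sum>j = 1..<m. 2 * h * K)"
    by (rule order_trans[OF sum_abs sum_mono])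
       (use kink K node_less[OF rho] h in \<open>auto simp: abs_mult intro!: mult_left_mono\<close>)
  also have "\<dots> \<le> 2 * (real m * h) * K"
  proof -
    have "real (m - 1) * (h * K) \<le> real m * (h * K)" using h K0 by (intro mult_right_mono) auto
    then show ?thesis by (simp add: algebra_simps)
  qed
  also have "\<dots> = 4 * \<rho> * K" using m by (simp add: h_def)
  finally show "\<bar>\<Psi> (\<lambda>\<xi>. (c \<bullet> \<xi>)^2)\<bar> \<le> 4 * \<rho> * K + e" using m(2) by linarith
qed

lemma strictly_concave_ridge:
  assumes \<psi>: "continuous_on UNIV \<psi>" and c: "norm c = 1" and k: "0 < k"
    and conc: "\<And>x h. 0 < h \<Longrightarrow> x - h \<ge> -\<rho> \<Longrightarrow> x + h \<le> \<rho> \<Longrightarrow> \<psi> (x + h) - 2 * \<psi> x + \<psi> (x - h) \<le> - k * h^2"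
    and nonneg: "\<And>b. \<bar>b\<bar> < \<rho> \<Longrightarrow> 0 \<le> \<Psi> (hinge c b)"
    and \<sigma>: "0 < \<sigma>" and lam: "0 < l" "l < \<rho>" and pos: "\<And>b. \<bar>b\<bar> \<le> l \<Longrightarrow> \<sigma> \<le> \<Psi> (hinge c b)"
  shows "\<Psi> (\<lambda>\<xi>. \<psi> (c \<bullet> \<xi>)) < 0"
proof -
  define e where "e = k * \<sigma> * l / 2"
  have e: "e > 0" using k \<sigma> lam by (simp add: e_def)
  from ridge_limit[OF \<psi> c e] obtain M where M: "M \<ge> 1"
    "\<And>m. m \<ge> M \<Longrightarrow> \<bar>(\<Sum>j = 1..<m. kink \<rho> \<psi> m j * \<Psi> (hinge c (node \<rho> m j))) - \<Psi> (\<lambda>\<xi>. \<psi> (c \<bullet> \<xi>))\<bar> \<le> e" by blast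
  define m where "m = max M (nat \<lceil>2 * \<rho> / l\<rceil> + 1)"
  have m: "m \<ge> M" "m \<ge> 1" using M(1) by (auto simp: m_def)
  define h where "h = 2 * \<rho> / real m"
  have h: "h > 0" using m rho by (simp add: h_def)
  have "2 * \<rho> / l < real m" unfolding m_def by linarith
  then have hl: "h < l" using lam m by (simp add: h_def field_simps)
  let ?b = "node \<rho> m"
  have b: "?b j = - \<rho> + real j * h" for j by (simp add: node_def h_def)
  have mh: "real m * h = 2 * \<rho>" using m by (simp add: h_def)
  have kink: "kink \<rho> \<psi> m j \<le> - k * h" if j: "1 \<le> j" "j < m" for j
  proof -
    have eq: "?b (Suc j) = ?b j + h" "?b (j - 1) = ?b j - h"
      using j by (simp_all add: b of_nat_diff algebra_simps)
    have "real (Suc j) * h \<le> real m * h" "real 1 * h \<le> real j * h" using j h by (auto intro!: mult_right_mono)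
    then have "?b j - h \<ge> - \<rho>" "?b j + h \<le> \<rho>" using mh by (auto simp: b algebra_simps)
    from conc[OF h this] have "kink \<rho> \<psi> m j \<le> (- k * h^2) / h"
      unfolding kink_def h_def[symmetric] eq using h by (intro divide_right_mono) auto
    then show ?thesis using h by (simp add: power2_eq_square)
  qed
  define J where "J = {nat \<lceil>(\<rho> - l) / h\<rceil>..nat \<lfloor>(\<rho> + l) / h\<rfloor>}"
  have quot: "0 < (\<rho> - l) / h" "0 < (\<rho> + l) / h" using lam rho h by auto
  have J: "1 \<le> j \<and> j < m \<and> \<bar>?b j\<bar> \<le> l" if "j \<in> J" for j
  proof -
    have "(\<rho> - l) / h \<le> real j" "real j \<le> (\<rho> + l) / h" "1 \<le> j"
      using that quot unfolding J_def by (auto; linarith)+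
    then have "\<rho> - l \<le> real j * h" "real j * h \<le> \<rho> + l" "1 \<le> j" using h by (simp_all add: pos_le_divide_eq pos_divide_le_eq)
    moreover from this have "real j * h < real m * h" using mh lam by linarith
    ultimately show ?thesis using h by (auto simp: b)
  qed
  have "real (card J) \<ge> (\<rho> + l) / h - (\<rho> - l) / h - 1"
    unfolding J_def using quot by (simp add: of_nat_diff) linarith
  then have "real (card J) * h \<ge> ((\<rho> + l) / h - (\<rho> - l) / h - 1) * h" using h by (intro mult_right_mono) auto
  also have "((\<rho> + l) / h - (\<rho> - l) / h - 1) * h = 2 * l - h" using h by (simp add: field_simps)
  finally have cardJ: "real (card J) * h \<ge> l" using hl by linarith
  have "(\<Sum>j = 1..<m. kink \<rho> \<psi> m j * \<Psi> (hinge c (?b j))) \<le> (\<Sum>j\<in>J. kink \<rho> \<psi> m j * \<Psi> (hinge c (?b j)))"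
  proof -
    have "(\<Sum>j\<in>J. - (kink \<rho> \<psi> m j * \<Psi> (hinge c (?b j)))) \<le> (\<Sum>j\<in>{1..<m}. - (kink \<rho> \<psi> m j * \<Psi> (hinge c (?b j))))"
    proof (rule sum_mono2)
      show "J \<subseteq> {1..<m}" using J by auto
      fix j assume "j \<in> {1..<m} - J"
      then have j: "1 \<le> j" "j < m" by auto
      have "kink \<rho> \<psi> m j \<le> 0" using kink[OF j] mult_pos_pos[OF k h] by linarith
      then show "0 \<le> - (kink \<rho> \<psi> m j * \<Psi> (hinge c (?b j)))"
        using nonneg[OF node_less[OF rho j]] by (simp add: mult_nonpos_nonneg)
    qed simp
    then show ?thesis by (simp add: sum_negf)
  qed
  also have "\<dots> \<le> (\<Sum>j\<in>J. - (k * h * \<sigma>))"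
  proof (rule sum_mono)
    fix j assume "j \<in> J"
    note j = J[OF this]
    have "k * h * \<sigma> \<le> (- kink \<rho> \<psi> m j) * \<Psi> (hinge c (?b j))"
    proof (rule mult_mono)
      show "k * h \<le> - kink \<rho> \<psi> m j" using kink[of j] j by simp
      then show "0 \<le> - kink \<rho> \<psi> m j" using mult_pos_pos[OF k h] by linarith
    qed (use j pos \<sigma> in auto)
    then show "kink \<rho> \<psi> m j * \<Psi> (hinge c (?b j)) \<le> - (k * h * \<sigma>)" by simp
  qed
  also have "\<dots> = - (k * \<sigma>) * (real (card J) * h)" by simp
  also have "\<dots> \<le> - (k * \<sigma>) * l" using cardJ k \<sigma> by (intro mult_left_mono_neg) auto
  finally have "(\<Sum>j = 1..<m. kink \<rho> \<psi> m j * \<Psi> (hinge c (?b j))) \<le> - 2 * e" by (simp add: e_def)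
  then show ?thesis using M(2)[OF m(1)] e by linarith
qed

end

section \<open>Quadratic dependence of the energy on \<open>W\<close>\<close>

lemma set_integrable_bounded_Icc:
  fixes p :: "real \<Rightarrow> real"
  assumes "p \<in> borel_measurable borel" "AE t in lborel. \<bar>p t\<bar> \<le> K"
  shows "set_integrable lborel {a..b} p"
  unfolding set_integrable_def
proof (rule Bochner_Integration.integrable_bound)
  show "integrable lborel (\<lambda>t. indicator {a..b} t *\<^sub>R K)"
    using set_integrable_const_Icc[of a b K] by (simp add: set_integrable_def)
  show "AE t in lborel. norm (indicator {a..b} t *\<^sub>R p t) \<le> norm (indicator {a..b} t *\<^sub>R K)"
    using assms(2) by eventually_elim (auto simp: indicator_def)
  show "(\<lambda>t. indicator {a..b} t *\<^sub>R p t) \<in> borel_measurable lborel"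
    using assms(1) by simp
qed

context dual_model
begin

lemma slope_combination:
  assumes V: "cls V" and W: "cls W" and \<theta>: "0 \<le> \<theta>" "\<theta> \<le> 1"
  shows "AE \<eta> in lborel. slope (\<lambda>\<eta>. (1 - \<theta>) * V (frame c b \<eta>) + \<theta> * W (frame c b \<eta>)) \<eta> =
    (1 - \<theta>) * slope (\<lambda>\<eta>. V (frame c b \<eta>)) \<eta> + \<theta> * slope (\<lambda>\<eta>. W (frame c b \<eta>)) \<eta>"
proof -
  note cv = convex_on_frame'[OF cls_convex[OF V], of c b] convex_on_frame'[OF cls_convex[OF W], of c b]
  have cz: "convex_on UNIV (\<lambda>\<eta>. (1 - \<theta>) * V (frame c b \<eta>) + \<theta> * W (frame c b \<eta>))"
    using convex_on_frame'[OF cls_convex[OF cls_combination[OF V W \<theta>]], of c b] by simp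
  show ?thesis
    using AE_slope[OF cv(1)] AE_slope[OF cv(2)]
  proof eventually_elim
    case (elim \<eta>)
    show ?case
      by (rule slope_eq_derivative[OF cz DERIV_add[OF DERIV_cmult[OF elim(1)] DERIV_cmult[OF elim(2)]]])
  qed
qed

lemma slope_bounded:
  assumes "cls W" "norm c = 1"
  shows "AE \<eta> in lborel. \<bar>slope (\<lambda>\<eta>. W (frame c b \<eta>)) \<eta>\<bar> \<le> L"
proof -
  have cv: "convex_on UNIV (\<lambda>\<eta>. W (frame c b \<eta>))" by (rule convex_on_frame'[OF cls_convex[OF assms(1)]])
  show ?thesis
    using AE_slope[OF cv]
    by eventually_elim (rule convex_Lipschitz_derivative_bound[OF Lipschitz_frame(2)[OF cls_Lipschitz[OF assms(1)] assms(2)] _ cv])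
qed

lemma set_integrable_slope_mult:
  assumes "cls V" "cls W" "norm c = 1"
  shows "set_integrable lborel {x..y} (\<lambda>\<eta>. slope (\<lambda>\<eta>. V (frame c b \<eta>)) \<eta> * slope (\<lambda>\<eta>. W (frame c b \<eta>)) \<eta>)"
proof (rule set_integrable_bounded_Icc)
  show "(\<lambda>\<eta>. slope (\<lambda>\<eta>. V (frame c b \<eta>)) \<eta> * slope (\<lambda>\<eta>. W (frame c b \<eta>)) \<eta>) \<in> borel_measurable borel"
    by (intro borel_measurable_times borel_measurable_slope convex_on_frame' cls_convex assms)
  show "AE \<eta> in lborel. \<bar>slope (\<lambda>\<eta>. V (frame c b \<eta>)) \<eta> * slope (\<lambda>\<eta>. W (frame c b \<eta>)) \<eta>\<bar> \<le> L * L"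
    using slope_bounded[OF assms(1,3)] slope_bounded[OF assms(2,3)]
    by eventually_elim (auto simp: abs_mult intro!: mult_mono L0)
qed

definition energy_diff :: "real^2 \<Rightarrow> real \<Rightarrow> (real^2 \<Rightarrow> real) \<Rightarrow> (real^2 \<Rightarrow> real) \<Rightarrow> real" where
  "energy_diff c b V W = (LINT \<eta>:{- chord b..chord b}|lborel.
     (slope (\<lambda>\<eta>. V (frame c b \<eta>)) \<eta> - slope (\<lambda>\<eta>. W (frame c b \<eta>)) \<eta>)^2)"

lemma energy_combination:
  assumes V: "cls V" and W: "cls W" and \<theta>: "0 \<le> \<theta>" "\<theta> \<le> 1" and c: "norm c = 1"
  shows "energy c b (\<lambda>\<xi>. (1 - \<theta>) * V \<xi> + \<theta> * W \<xi>) =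
    (1 - \<theta>) * energy c b V + \<theta> * energy c b W - \<theta> * (1 - \<theta>) * energy_diff c b V W"
proof -
  let ?v = "slope (\<lambda>\<eta>. V (frame c b \<eta>))" and ?w = "slope (\<lambda>\<eta>. W (frame c b \<eta>))"
  let ?I = "{- chord b..chord b}"
  note int = set_integrable_slope_mult[OF V V c, of "- chord b" "chord b" b]
    set_integrable_slope_mult[OF V W c, of "- chord b" "chord b" b]
    set_integrable_slope_mult[OF W W c, of "- chord b" "chord b" b]
  have en: "energy c b V = (LINT \<eta>:?I|lborel. ?v \<eta> * ?v \<eta>)" "energy c b W = (LINT \<eta>:?I|lborel. ?w \<eta> * ?w \<eta>)"
    by (simp_all add: energy_def power2_eq_square)
  have D: "energy_diff c b V W = energy c b V + energy c b W - 2 * (LINT \<eta>:?I|lborel. ?v \<eta> * ?w \<eta>)"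
  proof -
    have "energy_diff c b V W = (LINT \<eta>:?I|lborel. (?v \<eta> * ?v \<eta> + ?w \<eta> * ?w \<eta>) - 2 * (?v \<eta> * ?w \<eta>))"
      unfolding energy_diff_def by (intro set_lebesgue_integral_cong) (auto simp: power2_eq_square algebra_simps)
    also have "\<dots> = energy c b V + energy c b W - 2 * (LINT \<eta>:?I|lborel. ?v \<eta> * ?w \<eta>)"
      unfolding en using int by (subst set_integral_diff(2)) (auto simp: set_integral_add)
    finally show ?thesis .
  qed
  have m: "(\<lambda>x. indicator ?I x *\<^sub>R (slope (\<lambda>\<eta>. (1 - \<theta>) * V (frame c b \<eta>) + \<theta> * W (frame c b \<eta>)) x)\<^sup>2) \<in> borel_measurable lborel"
    using borel_measurable_slope[OF convex_on_frame'[OF cls_convex[OF cls_combination[OF V W \<theta>]], of c b]] by simp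
  have mv: "?v \<in> borel_measurable borel" "?w \<in> borel_measurable borel"
    by (intro borel_measurable_slope convex_on_frame' cls_convex V W)+
  have "energy c b (\<lambda>\<xi>. (1 - \<theta>) * V \<xi> + \<theta> * W \<xi>) = (LINT \<eta>:?I|lborel. ((1 - \<theta>)^2 * (?v \<eta> * ?v \<eta>) + \<theta>^2 * (?w \<eta> * ?w \<eta>)) + 2 * \<theta> * (1 - \<theta>) * (?v \<eta> * ?w \<eta>))"
    unfolding energy_def set_lebesgue_integral_def
  proof (rule integral_cong_AE[OF m])
    show "AE x in lborel. indicator ?I x *\<^sub>R (slope (\<lambda>\<eta>. (1 - \<theta>) * V (frame c b \<eta>) + \<theta> * W (frame c b \<eta>)) x)\<^sup>2
      = indicator ?I x *\<^sub>R (((1 - \<theta>)^2 * (?v x * ?v x) + \<theta>^2 * (?w x * ?w x)) + 2 * \<theta> * (1 - \<theta>) * (?v x * ?w x))"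
      using slope_combination[OF V W \<theta>, of c b]
    proof eventually_elim
      case (elim x)
      show ?case unfolding elim by (simp add: power2_eq_square algebra_simps)
    qed
    show "(\<lambda>x. indicator ?I x *\<^sub>R (((1 - \<theta>)^2 * (?v x * ?v x) + \<theta>^2 * (?w x * ?w x)) + 2 * \<theta> * (1 - \<theta>) * (?v x * ?w x))) \<in> borel_measurable lborel"
      using mv by simp
  qed
  also have "\<dots> = (1 - \<theta>)^2 * energy c b V + \<theta>^2 * energy c b W + 2 * \<theta> * (1 - \<theta>) * (LINT \<eta>:?I|lborel. ?v \<eta> * ?w \<eta>)"
    unfolding en using int by (subst set_integral_add(2)) (auto simp: set_integral_add)
  finally show ?thesis unfolding D by (simp add: power2_eq_square algebra_simps)
qed

text \<open>Lists of weighted members of \<open>cls\<close> serve for comparing two functions as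
  well as four. Affine integrands have the same energy for all members, so they are annihilated by
  weights of sum zero.\<close>

lemma functional_family:
  assumes "\<And>a W. (a, W) \<in> set xs \<Longrightarrow> cls W" and "(\<Sum>(a, W)\<leftarrow>xs. a) = 0"
  shows "ridge_functional \<rho> (area * (\<Sum>(a, W)\<leftarrow>xs. \<bar>a\<bar>)) (\<lambda>f. \<Sum>(a, W)\<leftarrow>xs. a * E f W)"
proof (unfold_locales)
  show "0 < \<rho>" by (rule rho0)
  fix f h :: "real^2 \<Rightarrow> real" assume f: "continuous_on UNIV f" and h: "continuous_on UNIV h"
  show "(\<Sum>(a, W)\<leftarrow>xs. a * E (\<lambda>\<xi>. f \<xi> + h \<xi>) W) = (\<Sum>(a, W)\<leftarrow>xs. a * E f W) + (\<Sum>(a, W)\<leftarrow>xs. a * E h W)"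
    using assms(1)
  proof (induction xs)
    case (Cons x xs)
    obtain a W where x: "x = (a, W)" by (cases x)
    have "cls W" using Cons.prems x by auto
    moreover have "(\<Sum>(a, W)\<leftarrow>xs. a * E (\<lambda>\<xi>. f \<xi> + h \<xi>) W) = (\<Sum>(a, W)\<leftarrow>xs. a * E f W) + (\<Sum>(a, W)\<leftarrow>xs. a * E h W)"
      by (rule Cons.IH) (use Cons.prems in auto)
    ultimately show ?case by (simp add: x E_add f h distrib_left)
  qed simp
next
  fix f :: "real^2 \<Rightarrow> real" and k :: real
  show "(\<Sum>(a, W)\<leftarrow>xs. a * E (\<lambda>\<xi>. k * f \<xi>) W) = k * (\<Sum>(a, W)\<leftarrow>xs. a * E f W)"
    by (induction xs) (auto simp: E_cmult distrib_left)
next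
  fix f :: "real^2 \<Rightarrow> real" and e assume f: "continuous_on UNIV f" and e: "\<And>\<xi>. norm \<xi> \<le> \<rho> \<Longrightarrow> \<bar>f \<xi>\<bar> \<le> e"
  show "\<bar>\<Sum>(a, W)\<leftarrow>xs. a * E f W\<bar> \<le> area * (\<Sum>(a, W)\<leftarrow>xs. \<bar>a\<bar>) * e"
    using assms(1)
  proof (induction xs)
    case (Cons x xs)
    obtain a W where x: "x = (a, W)" by (cases x)
    have "cls W" using Cons.prems x by auto
    have "\<bar>E f W\<bar> \<le> e * area" by (rule E_bound[OF \<open>cls W\<close> f]) (use e in simp)
    then have "\<bar>a * E f W\<bar> \<le> \<bar>a\<bar> * (e * area)" by (simp add: abs_mult mult_left_mono)
    moreover have "\<bar>\<Sum>(a, W)\<leftarrow>xs. a * E f W\<bar> \<le> area * (\<Sum>(a, W)\<leftarrow>xs. \<bar>a\<bar>) * e"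
      by (rule Cons.IH) (use Cons.prems in auto)
    ultimately show ?case unfolding x using abs_triangle_ineq[of "a * E f W" "\<Sum>(a, W)\<leftarrow>xs. a * E f W"] by (simp add: algebra_simps)
  qed simp
next
  fix a :: "real^2" and d :: real
  have "(\<Sum>(b, W)\<leftarrow>xs. b * E (\<lambda>\<xi>. a \<bullet> \<xi> + d) W) = (\<Sum>(b, W)\<leftarrow>xs. b) * E (\<lambda>\<xi>. a \<bullet> \<xi> + d) g"
    using assms(1)
  proof (induction xs)
    case (Cons x xs)
    obtain b W where x: "x = (b, W)" by (cases x)
    have "cls W" using Cons.prems x by auto
    then show ?case using Cons E_affine[OF cls_g, of W a d] by (auto simp: x distrib_right)
  qed simp
  then show "(\<Sum>(b, W)\<leftarrow>xs. b * E (\<lambda>\<xi>. a \<bullet> \<xi> + d) W) = 0" using assms(2) by simp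
qed

text \<open>The bracket is the coefficient of the quadratic term, expressed by the midpoint so that
  no bilinear form has to be defined. For hinges the identity is that of chord energies, and both
  sides are ridge functionals of \<open>f\<close>.\<close>

lemma E_quadratic:
  assumes V: "cls V" and W: "cls W" and \<theta>: "0 \<le> \<theta>" "\<theta> \<le> 1" and f: "continuous_on UNIV f"
  shows "E f (\<lambda>\<xi>. (1 - \<theta>) * V \<xi> + \<theta> * W \<xi>) = (1 - \<theta>) * E f V + \<theta> * E f W
    - \<theta> * (1 - \<theta>) * (2 * E f V + 2 * E f W - 4 * E f (\<lambda>\<xi>. (1 - 1/2) * V \<xi> + 1/2 * W \<xi>))"
proof -
  let ?Z = "\<lambda>\<xi>. (1 - \<theta>) * V \<xi> + \<theta> * W \<xi>" and ?M = "\<lambda>\<xi>. (1 - 1/2) * V \<xi> + 1/2 * W \<xi>"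
  have Z: "cls ?Z" by (rule cls_combination[OF V W \<theta>])
  have M: "cls ?M" by (rule cls_combination[OF V W]) auto
  define xs where "xs = [(1, ?Z), (- (1 - \<theta>) + 2 * \<theta> * (1 - \<theta>), V), (- \<theta> + 2 * \<theta> * (1 - \<theta>), W), (- 4 * \<theta> * (1 - \<theta>), ?M)]"
  interpret ridge_functional \<rho> "area * (\<Sum>(a, W)\<leftarrow>xs. \<bar>a\<bar>)" "\<lambda>f. \<Sum>(a, W)\<leftarrow>xs. a * E f W"
    by (rule functional_family) (use V W Z M in \<open>auto simp: xs_def\<close>)
  have "(\<Sum>(a, W)\<leftarrow>xs. a * E f W) = 0"
  proof (rule vanishes[OF _ f])
    fix c :: "real^2" and b :: real assume c: "norm c = 1" and b: "\<bar>b\<bar> < \<rho>"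
    have H: "E (hinge c b) U = E (hinge c b) g + (energy c b g - energy c b U) / 2" if "cls U" for U
      using hinge_energy[OF c b cls_g that] by linarith
    have eZ: "energy c b ?Z = (1 - \<theta>) * energy c b V + \<theta> * energy c b W - \<theta> * (1 - \<theta>) * energy_diff c b V W"
      by (rule energy_combination[OF V W \<theta> c])
    have eM: "energy c b ?M = (1 - 1/2) * energy c b V + 1/2 * energy c b W - 1/2 * (1 - 1/2) * energy_diff c b V W"
      by (rule energy_combination[OF V W _ _ c]) auto
    show "(\<Sum>(a, W)\<leftarrow>xs. a * E (hinge c b) W) = 0"
      unfolding xs_def by (simp only: list.map sum_list.Cons sum_list.Nil case_prod_conv H[OF Z] H[OF V] H[OF W] H[OF M] eZ eM) (simp add: field_simps)
  qed
  then show ?thesis unfolding xs_def by (simp add: algebra_simps)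
qed

section \<open>Monotonicity for convex integrands\<close>

text \<open>Replacing \<open>v\<close> by a maximum with an affine function replaces its gradient by its mean value
  over the set where it changes; so convex integrands decrease by Jensen's inequality.\<close>

lemma gradient_max_affine:
  fixes v :: "'a::euclidean_space \<Rightarrow> real"
  assumes cv: "convex_on UNIV v" and v: "GDERIV v x :> D" and m: "GDERIV (\<lambda>y. max (v y) (p \<bullet> y + d)) x :> D'"
  shows "D' = D \<and> max (v x) (p \<bullet> x + d) = v x \<or> D' = p \<and> max (v x) (p \<bullet> x + d) = p \<bullet> x + d"
proof (cases "p \<bullet> x + d \<le> v x")
  case True
  have "subgrad UNIV (\<lambda>y. max (v y) (p \<bullet> y + d)) x D"
    unfolding subgrad_def
  proof
    fix y
    show "max (v x) (p \<bullet> x + d) + D \<bullet> (y - x) \<le> max (v y) (p \<bullet> y + d)"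
      using subgradD[OF GDERIV_imp_subgrad[OF cv UNIV_I v], of y] True by simp
  qed
  from GDERIV_subgrad_unique[OF m _ this] True show ?thesis by simp
next
  case False
  have "subgrad UNIV (\<lambda>y. max (v y) (p \<bullet> y + d)) x p"
    unfolding subgrad_def
  proof
    fix y
    show "max (v x) (p \<bullet> x + d) + p \<bullet> (y - x) \<le> max (v y) (p \<bullet> y + d)"
      using False by (simp add: inner_diff_right)
  qed
  from GDERIV_subgrad_unique[OF m _ this] False show ?thesis by simp
qed

lemma prim_max_affine:
  assumes v: "prim v" and p: "p \<in> B" and le: "\<And>x. L < norm x \<Longrightarrow> p \<bullet> x + d \<le> cj g x"
  shows "prim (\<lambda>x. max (v x) (p \<bullet> x + d))"
  unfolding prim_def
proof (intro conjI allI impI)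
  have aff: "convex_on UNIV (\<lambda>x. p \<bullet> x + d)"
    by (intro convex_onI) (auto simp: inner_add_right algebra_simps)
  show "convex_on UNIV (\<lambda>x. max (v x) (p \<bullet> x + d))"
  proof (rule convex_onI)
    fix t :: real and x y :: "real^2" assume t: "0 < t" "t < 1"
    have 1: "v ((1 - t) *\<^sub>R x + t *\<^sub>R y) \<le> (1 - t) * v x + t * v y"
      using convex_onD[OF prim_convex[OF v], of t x y] t by simp
    have 2: "p \<bullet> ((1 - t) *\<^sub>R x + t *\<^sub>R y) + d \<le> (1 - t) * (p \<bullet> x + d) + t * (p \<bullet> y + d)"
      using convex_onD[OF aff, of t x y] t by simp
    have 3: "(1 - t) * v x + t * v y \<le> (1 - t) * max (v x) (p \<bullet> x + d) + t * max (v y) (p \<bullet> y + d)"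
      "(1 - t) * (p \<bullet> x + d) + t * (p \<bullet> y + d) \<le> (1 - t) * max (v x) (p \<bullet> x + d) + t * max (v y) (p \<bullet> y + d)"
      using t by (intro add_mono mult_left_mono; simp)+
    show "max (v ((1 - t) *\<^sub>R x + t *\<^sub>R y)) (p \<bullet> ((1 - t) *\<^sub>R x + t *\<^sub>R y) + d) \<le> (1 - t) * max (v x) (p \<bullet> x + d) + t * max (v y) (p \<bullet> y + d)"
      using order_trans[OF 1 3(1)] order_trans[OF 2 3(2)] by simp
  qed simp
  show "\<rho>-lipschitz_on UNIV (\<lambda>x. max (v x) (p \<bullet> x + d))"
  proof (rule lipschitz_onI)
    fix x y :: "real^2"
    have 1: "\<bar>v x - v y\<bar> \<le> \<rho> * dist x y" using lipschitz_onD[OF prim_Lipschitz[OF v], of x y] by (simp add: dist_real_def)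
    have "\<bar>p \<bullet> (x - y)\<bar> \<le> norm p * norm (x - y)" by (rule Cauchy_Schwarz_ineq2)
    also have "\<dots> \<le> \<rho> * dist x y" using p by (simp add: dist_norm mult_right_mono)
    finally have 2: "\<bar>(p \<bullet> x + d) - (p \<bullet> y + d)\<bar> \<le> \<rho> * dist x y" by (simp add: inner_diff_right)
    show "dist (max (v x) (p \<bullet> x + d)) (max (v y) (p \<bullet> y + d)) \<le> \<rho> * dist x y"
      using 1 2 by (auto simp: dist_real_def max_def abs_le_iff)
  qed (use rho0 in simp)
  fix x :: "real^2" assume x: "L < norm x"
  then show "max (v x) (p \<bullet> x + d) = cj g x" using le[OF x] v by (simp add: prim_def)
qed

text \<open>The new gradient is almost everywhere the old one or \<open>p\<close>, and
  \<open>p\<close> minimizes \<open>f - a \<bullet> \<xi>\<close> on \<open>B\<close>; so the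
  integrand decreases pointwise after subtraction of the linear part, whose integral does not
  change.\<close>

lemma Ep_max_affine_le:
  assumes v: "prim v" and p: "p \<in> B" and le: "\<And>x. L < norm x \<Longrightarrow> p \<bullet> x + d \<le> cj g x"
    and f: "continuous_on UNIV f" and a: "\<And>\<xi>. \<xi> \<in> B \<Longrightarrow> f p + a \<bullet> (\<xi> - p) \<le> f \<xi>"
  shows "Ep f (\<lambda>x. max (v x) (p \<bullet> x + d)) \<le> Ep f v"
proof -
  let ?w = "\<lambda>x. max (v x) (p \<bullet> x + d)"
  have w: "prim ?w" by (rule prim_max_affine[OF v p le])
  have fa: "continuous_on UNIV (\<lambda>\<xi>::real^2. a \<bullet> \<xi>)" by (intro continuous_intros)
  have "Ep f ?w - Ep (\<lambda>\<xi>. a \<bullet> \<xi>) ?w \<le> Ep f v - Ep (\<lambda>\<xi>. a \<bullet> \<xi>) v"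
  proof -
    have eq: "Ep f u - Ep (\<lambda>\<xi>. a \<bullet> \<xi>) u = (LINT x:cball 0 R|lborel. f (gradient u x) - a \<bullet> gradient u x)"
      "set_integrable lborel (cball 0 R) (\<lambda>x. f (gradient u x) - a \<bullet> gradient u x)" if "prim u" for u
      unfolding Ep_def using E_integrable[OF that f] E_integrable[OF that fa]
      by (simp_all add: set_integral_diff)
    show ?thesis
      unfolding eq(1)[OF v] eq(1)[OF w] set_lebesgue_integral_def
    proof (rule integral_mono_AE)
      show "AE x in lborel. indicator (cball 0 R) x *\<^sub>R (f (gradient ?w x) - a \<bullet> gradient ?w x) \<le> indicator (cball 0 R) x *\<^sub>R (f (gradient v x) - a \<bullet> gradient v x)"
        using AE_prim[OF v] AE_prim[OF w]
      proof eventually_elim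
        case (elim x)
        then have "gradient ?w x = gradient v x \<or> gradient ?w x = p"
          using gradient_max_affine[OF prim_convex[OF v], of x "gradient v x" p d "gradient ?w x"] by blast
        moreover have "f p + a \<bullet> (gradient v x - p) \<le> f (gradient v x)" by (rule a) (use elim in blast)
        ultimately show ?case by (auto simp: indicator_def inner_diff_right)
      qed
    qed (use eq(2)[OF v] eq(2)[OF w] in \<open>simp_all only: set_integrable_def\<close>)
  qed
  then show ?thesis using Ep_affine[OF v w, of a] by simp
qed

text \<open>For convex functions pointwise convergence implies convergence of gradients wherever all
  of them exist: limit points of the gradients are subgradients of \<open>v\<close>, and there is
  only one. Then dominated convergence applies, \<open>f\<close> being bounded on
  \<open>B\<close>.\<close>

lemma Ep_limit:
  assumes u: "\<And>n. prim (u n)" and v: "prim v" and lim: "\<And>x. (\<lambda>n. u n x) \<longlonglongrightarrow> v x"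
    and f: "continuous_on UNIV f"
  shows "(\<lambda>n. Ep f (u n)) \<longlonglongrightarrow> Ep f v"
  unfolding Ep_def set_lebesgue_integral_def
proof -
  obtain M where M: "\<And>\<xi>. \<xi> \<in> B \<Longrightarrow> \<bar>f \<xi>\<bar> \<le> M" using bounded_on_B[OF f] by blast
  show "(\<lambda>n. LINT x|lborel. indicator (cball 0 R) x *\<^sub>R f (gradient (u n) x)) \<longlonglongrightarrow> (LINT x|lborel. indicator (cball 0 R) x *\<^sub>R f (gradient v x))"
  proof (rule integral_dominated_convergence[where w="\<lambda>x. indicator (cball 0 R) x * M"])
    show "(\<lambda>x. indicator (cball 0 R) x *\<^sub>R f (gradient v x)) \<in> borel_measurable lborel"
      "\<And>n. (\<lambda>x. indicator (cball 0 R) x *\<^sub>R f (gradient (u n) x)) \<in> borel_measurable lborel"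
      using borel_measurable_integrand(2)[OF v f] borel_measurable_integrand(2)[OF u f] by simp_all
    show "integrable lborel (\<lambda>x::real^2. indicator (cball 0 R) x * M)"
      using finite_cball by (intro integrable_mult_left integrable_real_indicator) auto
    show "AE x in lborel. norm (indicator (cball 0 R) x *\<^sub>R f (gradient (u n) x)) \<le> indicator (cball 0 R) x * M" for n
      using AE_prim[OF u[of n]]
    proof eventually_elim
      case (elim x)
      then have "\<bar>f (gradient (u n) x)\<bar> \<le> M" using M by blast
      then show ?case by (auto simp: indicator_def)
    qed
    have "AE x in lborel. \<forall>n. GDERIV (u n) x :> gradient (u n) x \<and> gradient (u n) x \<in> B"
      using AE_prim[OF u] by (simp add: AE_all_countable)
    then show "AE x in lborel. (\<lambda>n. indicator (cball 0 R) x *\<^sub>R f (gradient (u n) x)) \<longlonglongrightarrow> indicator (cball 0 R) x *\<^sub>R f (gradient v x)"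
      using AE_prim[OF v]
    proof eventually_elim
      case (elim x)
      have sub: "subgrad UNIV (u n) x (gradient (u n) x)" for n
        using GDERIV_imp_subgrad[OF prim_convex[OF u] UNIV_I] elim by blast
      have "(\<lambda>n. gradient (u n) x) \<longlonglongrightarrow> gradient v x"
      proof (rule ccontr)
        assume "\<not> ?thesis"
        then obtain e where e: "e > 0" "\<And>N. \<exists>n\<ge>N. e \<le> dist (gradient (u n) x) (gradient v x)"
          unfolding lim_sequentially by (meson not_le)
        then obtain s :: "nat \<Rightarrow> nat" where s: "strict_mono s" "\<And>n. e \<le> dist (gradient (u (s n)) x) (gradient v x)"
          using infinite_enumerate[of "{n. e \<le> dist (gradient (u n) x) (gradient v x)}"]
          by (auto simp: infinite_nat_iff_unbounded_le)
        have "gradient (u (s n)) x \<in> B" for n using elim by blast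
        then obtain D and t :: "nat \<Rightarrow> nat" where t: "strict_mono t" "(\<lambda>n. gradient (u (s (t n))) x) \<longlonglongrightarrow> D"
          using spec[OF compactB(1)[unfolded compact_def], of "\<lambda>n. gradient (u (s n)) x"] by (auto simp: comp_def)
        have st: "strict_mono (s \<circ> t)" using s(1) t(1) by (rule strict_mono_o)
        have "subgrad UNIV v x D"
          unfolding subgrad_def
        proof
          fix y
          have l: "(\<lambda>n. u (s (t n)) z) \<longlonglongrightarrow> v z" for z
            using LIMSEQ_subseq_LIMSEQ[OF lim[of z] st] by (simp add: comp_def)
          have "(\<lambda>n. u (s (t n)) x + gradient (u (s (t n))) x \<bullet> (y - x)) \<longlonglongrightarrow> v x + D \<bullet> (y - x)"
            by (intro tendsto_intros l t)
          from LIMSEQ_le[OF this l[of y]] show "v x + D \<bullet> (y - x) \<le> v y"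
            using subgradD[OF sub] by auto
        qed
        then have "D = gradient v x" using GDERIV_subgrad_unique[of v x "gradient v x" UNIV D] elim by simp
        then have "\<forall>\<^sub>F n in sequentially. dist (gradient (u (s (t n))) x) (gradient v x) < e"
          using tendstoD[OF t(2) e(1)] by simp
        then show False using s(2) by (metis (no_types, lifting) eventually_sequentially not_less order_refl)
      qed
      then have "(\<lambda>n. f (gradient (u n) x)) \<longlonglongrightarrow> f (gradient v x)"
        using f by (intro isCont_tendsto_compose[of _ f]) (auto simp: continuous_on_eq_continuous_at)
      then show ?case by (intro tendsto_intros)
    qed
  qed
qed

text \<open>\<open>cj V\<close> is the supremum of \<open>cj W\<close> and countably many affine
  functions, one for each slope of a dense sequence \<open>q\<close>. They are added one at a time;
  each addition does not raise the energy, and the energies converge.\<close>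

lemma E_mono_convex:
  assumes V: "cls V" and W: "cls W" and le: "\<And>\<xi>. \<xi> \<in> B \<Longrightarrow> V \<xi> \<le> W \<xi>"
    and f: "continuous_on UNIV f" and a: "\<And>p. p \<in> B \<Longrightarrow> \<exists>a. \<forall>\<xi>\<in>B. f p + a \<bullet> (\<xi> - p) \<le> f \<xi>"
  shows "E f V \<le> E f W"
proof -
  obtain T where T: "countable T" "T \<subseteq> B" "B \<subseteq> closure T" using separable[of B] by blast
  have "T \<noteq> {}" using T(3) compactB(2) by auto
  define q where "q = from_nat_into T"
  have qB: "q n \<in> B" for n using from_nat_into[OF \<open>T \<noteq> {}\<close>] T(2) by (auto simp: q_def simp del: mem_cball mem_cball_0)
  have qr: "range q = T" unfolding q_def by (rule range_from_nat_into[OF \<open>T \<noteq> {}\<close> T(1)])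
  define u where "u = rec_nat (cj W) (\<lambda>n v x. max (v x) (q n \<bullet> x + (- V (q n))))"
  have u0: "u 0 = cj W" and uS: "u (Suc n) = (\<lambda>x. max (u n x) (q n \<bullet> x + (- V (q n))))" for n
    by (simp_all add: u_def)
  have up: "q n \<bullet> x + (- V (q n)) \<le> cj V x" for n x using cj_upper[OF V qB] by simp
  have out: "q n \<bullet> x + (- V (q n)) \<le> cj g x" if "L < norm x" for n x
    using up[of n x] cj_outside[OF V that] by simp
  have prim_u: "prim (u n)" for n
  proof (induction n)
    case 0 show ?case unfolding u0 by (rule prim_cj[OF W])
  next
    case (Suc n) show ?case unfolding uS by (rule prim_max_affine[OF Suc qB out])
  qed
  have u_le: "u n x \<le> cj V x" for n x
  proof (induction n)
    case 0
    show ?case unfolding u0 cj_def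
      by (rule conj_on_mono[OF compactB cls_continuous[OF V] cls_continuous[OF W] le])
  next
    case (Suc n)
    then show ?case using up[of n x] by (simp add: uS)
  qed
  have inc: "incseq (\<lambda>n. u n x)" for x by (rule incseq_SucI) (simp add: uS)
  have lim: "(\<lambda>n. u n x) \<longlonglongrightarrow> cj V x" for x
  proof (rule increasing_LIMSEQ)
    show "u n x \<le> u (Suc n) x" for n by (simp add: uS)
    show "u n x \<le> cj V x" for n by (rule u_le)
    fix e :: real assume e: "0 < e"
    obtain \<xi> where \<xi>: "\<xi> \<in> B" "cj V x = \<xi> \<bullet> x - V \<xi>" using cj_attained[OF V, of x] by blast
    have "continuous_on UNIV (\<lambda>\<zeta>. \<zeta> \<bullet> x - V \<zeta>)" by (intro continuous_intros cls_continuous[OF V])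
    then have "isCont (\<lambda>\<zeta>. \<zeta> \<bullet> x - V \<zeta>) \<xi>" by (simp add: continuous_on_eq_continuous_at)
    then obtain d where d: "d > 0" "\<And>\<zeta>. dist \<zeta> \<xi> < d \<Longrightarrow> \<bar>(\<zeta> \<bullet> x - V \<zeta>) - (\<xi> \<bullet> x - V \<xi>)\<bar> < e"
      unfolding continuous_at_eps_delta dist_real_def using e by blast
    obtain \<zeta> where \<zeta>: "\<zeta> \<in> T" "dist \<zeta> \<xi> < d"
      using T(3) \<xi>(1) d(1) closure_approachable[of \<xi> T] by blast
    then obtain n where "q n = \<zeta>" using qr by blast
    then have "cj V x - e \<le> q n \<bullet> x + (- V (q n))" using d(2)[OF \<zeta>(2)] \<xi>(2) by auto
    then show "\<exists>n. cj V x \<le> u n x + e" by (intro exI[of _ "Suc n"]) (simp add: uS)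
  qed
  have dec: "Ep f (u n) \<le> Ep f (cj W)" for n
  proof (induction n)
    case (Suc n)
    obtain a' where "\<And>\<xi>. \<xi> \<in> B \<Longrightarrow> f (q n) + a' \<bullet> (\<xi> - q n) \<le> f \<xi>" using a[OF qB] by blast
    from Ep_max_affine_le[OF prim_u qB out f this] have "Ep f (u (Suc n)) \<le> Ep f (u n)" by (simp add: uS)
    then show ?case using Suc by simp
  qed (simp add: u0)
  show ?thesis unfolding E_def
    by (rule LIMSEQ_le_const2[OF Ep_limit[OF prim_u prim_cj[OF V] lim f]]) (use dec in auto)
qed

section \<open>Lipschitz dependence of the energy on \<open>W\<close>\<close>

text \<open>The integrand is a sum of two squared coordinates. Each contributes
  \<open>4 * \<rho>\<close> by \<open>square_bound\<close> times the hinge bound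
  \<open>2 * R * e\<close>.\<close>

lemma E_square_diff:
  assumes V: "cls V" and W: "cls W" and e: "\<And>\<xi>. \<xi> \<in> B \<Longrightarrow> \<bar>V \<xi> - W \<xi>\<bar> \<le> e"
  shows "\<bar>E (\<lambda>\<xi>. \<xi> \<bullet> \<xi>) W - E (\<lambda>\<xi>. \<xi> \<bullet> \<xi>) V\<bar> \<le> 16 * \<rho> * R * e"
proof -
  interpret ridge_functional \<rho> "area * (\<Sum>(a, W)\<leftarrow>[(1, W), (-1, V)]. \<bar>a\<bar>)" "\<lambda>f. \<Sum>(a, W)\<leftarrow>[(1, W), (-1, V)]. a * E f W"
    by (rule functional_family) (use V W in auto)
  have "\<bar>E (\<lambda>\<xi>. (c \<bullet> \<xi>)^2) W - E (\<lambda>\<xi>. (c \<bullet> \<xi>)^2) V\<bar> \<le> 4 * \<rho> * (2 * R * e)" if c: "norm c = 1" for c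
    using square_bound[OF _ c, of "2 * R * e"] hinge_Lipschitz[OF c _ V W e] by simp
  from this[of "axis 1 1"] this[of "axis 2 1"]
  have "\<bar>E (\<lambda>\<xi>. (\<xi> $ 1)^2) W - E (\<lambda>\<xi>. (\<xi> $ 1)^2) V\<bar> \<le> 8 * \<rho> * R * e"
    "\<bar>E (\<lambda>\<xi>. (\<xi> $ 2)^2) W - E (\<lambda>\<xi>. (\<xi> $ 2)^2) V\<bar> \<le> 8 * \<rho> * R * e"
    by (simp_all add: inner_axis' )
  moreover have "E (\<lambda>\<xi>. \<xi> \<bullet> \<xi>) U = E (\<lambda>\<xi>. (\<xi> $ 1)^2) U + E (\<lambda>\<xi>. (\<xi> $ 2)^2) U" if "cls U" for U
    using E_add[OF that, of "\<lambda>\<xi>. (\<xi> $ 1)^2" "\<lambda>\<xi>. (\<xi> $ 2)^2"]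
    by (simp add: inner_vec2 power2_eq_square continuous_intros)
  ultimately show ?thesis using V W by simp
qed

definition taylor_bound :: "(real^2 \<Rightarrow> real) \<Rightarrow> real \<Rightarrow> bool" where
  "taylor_bound f k \<longleftrightarrow> (\<forall>p\<in>B. \<exists>a. \<forall>\<xi>\<in>B. \<bar>f \<xi> - f p - a \<bullet> (\<xi> - p)\<bar> \<le> k * ((\<xi> - p) \<bullet> (\<xi> - p)))"

text \<open>Both \<open>f\<close> and \<open>- f\<close> become convex after adding \<open>k\<close>
  times the squared norm. Monotonicity for the two sums bounds the variation for \<open>f\<close> by
  that for the square.\<close>

lemma E_Lipschitz_ordered:
  assumes f: "continuous_on UNIV f" and k: "taylor_bound f k"
    and V: "cls V" and W: "cls W" and le: "\<And>\<xi>. \<xi> \<in> B \<Longrightarrow> V \<xi> \<le> W \<xi>" and e: "\<And>\<xi>. \<xi> \<in> B \<Longrightarrow> \<bar>V \<xi> - W \<xi>\<bar> \<le> e"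
  shows "\<bar>E f W - E f V\<bar> \<le> \<bar>k\<bar> * (16 * \<rho> * R * e)"
proof -
  let ?q = "\<lambda>\<xi>::real^2. \<xi> \<bullet> \<xi>"
  have q: "continuous_on UNIV ?q" by (intro continuous_intros)
  have mono: "\<sigma> * E f V + k * E ?q V \<le> \<sigma> * E f W + k * E ?q W" if \<sigma>: "\<bar>\<sigma>\<bar> = 1" for \<sigma>
  proof -
    have cf: "continuous_on UNIV (\<lambda>\<xi>. \<sigma> * f \<xi>)" "continuous_on UNIV (\<lambda>\<xi>. k * ?q \<xi>)" using f q by (auto intro!: continuous_intros)
    have "E (\<lambda>\<xi>. \<sigma> * f \<xi> + k * ?q \<xi>) V \<le> E (\<lambda>\<xi>. \<sigma> * f \<xi> + k * ?q \<xi>) W"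
    proof (rule E_mono_convex[OF V W le])
      show "continuous_on UNIV (\<lambda>\<xi>. \<sigma> * f \<xi> + k * ?q \<xi>)" using cf by (rule continuous_on_add)
      fix p assume "p \<in> B"
      then obtain a where a: "\<And>\<xi>. \<xi> \<in> B \<Longrightarrow> \<bar>f \<xi> - f p - a \<bullet> (\<xi> - p)\<bar> \<le> k * ((\<xi> - p) \<bullet> (\<xi> - p))"
        using k unfolding taylor_bound_def by blast
      have "\<sigma> * f p + k * ?q p + (\<sigma> *\<^sub>R a + (2 * k) *\<^sub>R p) \<bullet> (\<xi> - p) \<le> \<sigma> * f \<xi> + k * ?q \<xi>" if "\<xi> \<in> B" for \<xi>
      proof -
        have "\<bar>\<sigma> * (f \<xi> - f p - a \<bullet> (\<xi> - p))\<bar> \<le> k * ((\<xi> - p) \<bullet> (\<xi> - p))"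
          using a[OF that] \<sigma> by (simp add: abs_mult)
        then have "- (k * ((\<xi> - p) \<bullet> (\<xi> - p))) \<le> \<sigma> * (f \<xi> - f p - a \<bullet> (\<xi> - p))" by linarith
        moreover have "\<xi> \<bullet> \<xi> = p \<bullet> p + 2 * (p \<bullet> (\<xi> - p)) + (\<xi> - p) \<bullet> (\<xi> - p)"
          by (simp add: inner_diff_left inner_diff_right inner_commute[of \<xi> p])
        then have "k * (\<xi> \<bullet> \<xi>) = k * (p \<bullet> p) + 2 * k * (p \<bullet> (\<xi> - p)) + k * ((\<xi> - p) \<bullet> (\<xi> - p))"
          by (simp only: distrib_left mult.assoc mult.left_commute)
        moreover have "(\<sigma> *\<^sub>R a + (2 * k) *\<^sub>R p) \<bullet> (\<xi> - p) = \<sigma> * (a \<bullet> (\<xi> - p)) + 2 * k * (p \<bullet> (\<xi> - p))"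
          by (simp add: inner_add_left)
        moreover have "\<sigma> * (f \<xi> - f p - a \<bullet> (\<xi> - p)) = \<sigma> * f \<xi> - \<sigma> * f p - \<sigma> * (a \<bullet> (\<xi> - p))"
          by (simp only: right_diff_distrib)
        ultimately show ?thesis by linarith
      qed
      then show "\<exists>a. \<forall>\<xi>\<in>B. \<sigma> * f p + k * ?q p + a \<bullet> (\<xi> - p) \<le> \<sigma> * f \<xi> + k * ?q \<xi>" by blast
    qed
    then show ?thesis using E_add[OF V cf] E_add[OF W cf] by (simp add: E_cmult)
  qed
  have "\<bar>E f W - E f V\<bar> \<le> k * (E ?q W - E ?q V)"
    using mono[of 1] mono[of "-1"] by (simp add: abs_le_iff algebra_simps)
  also have "\<dots> \<le> \<bar>k\<bar> * \<bar>E ?q W - E ?q V\<bar>" using abs_ge_self[of "k * (E ?q W - E ?q V)"] by (simp only: abs_mult)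
  also have "\<dots> \<le> \<bar>k\<bar> * (16 * \<rho> * R * e)" by (intro mult_left_mono E_square_diff[OF V W e]) auto
  finally show ?thesis .
qed

text \<open>The maximum of \<open>V\<close> and \<open>W\<close> is in the class, lies above both
  and is within \<open>e\<close> of both; passing through it doubles the constant.\<close>

lemma E_Lipschitz:
  assumes f: "continuous_on UNIV f" and k: "taylor_bound f k"
    and V: "cls V" and W: "cls W" and e: "\<And>\<xi>. \<xi> \<in> B \<Longrightarrow> \<bar>V \<xi> - W \<xi>\<bar> \<le> e"
  shows "\<bar>E f W - E f V\<bar> \<le> 32 * \<bar>k\<bar> * \<rho> * R * e"
proof -
  define U where "U \<xi> = max (V \<xi>) (W \<xi>)" for \<xi>
  have U: "cls U"
    unfolding cls_def
  proof
    show "convex_on UNIV U"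
    proof (rule convex_onI)
      fix t :: real and x y :: "real^2" assume t: "0 < t" "t < 1"
      have 1: "V ((1 - t) *\<^sub>R x + t *\<^sub>R y) \<le> (1 - t) * V x + t * V y" "W ((1 - t) *\<^sub>R x + t *\<^sub>R y) \<le> (1 - t) * W x + t * W y"
        using convex_onD[OF cls_convex[OF V], of t x y] convex_onD[OF cls_convex[OF W], of t x y] t by simp_all
      have 3: "(1 - t) * V x + t * V y \<le> (1 - t) * U x + t * U y" "(1 - t) * W x + t * W y \<le> (1 - t) * U x + t * U y"
        unfolding U_def using t by (intro add_mono mult_left_mono; simp)+
      show "U ((1 - t) *\<^sub>R x + t *\<^sub>R y) \<le> (1 - t) * U x + t * U y"
        using order_trans[OF 1(1) 3(1)] order_trans[OF 1(2) 3(2)] unfolding U_def by simp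
    qed simp
    show "\<forall>\<xi>. r \<le> norm \<xi> \<longrightarrow> U \<xi> = g \<xi>" using cls_eq[OF V] cls_eq[OF W] by (simp add: U_def)
  qed
  have "\<bar>V \<xi> - U \<xi>\<bar> \<le> e" "\<bar>W \<xi> - U \<xi>\<bar> \<le> e" if "\<xi> \<in> B" for \<xi>
    using e[OF that] by (auto simp: U_def max_def)
  then have "\<bar>E f U - E f V\<bar> \<le> \<bar>k\<bar> * (16 * \<rho> * R * e)" "\<bar>E f U - E f W\<bar> \<le> \<bar>k\<bar> * (16 * \<rho> * R * e)"
    by (intro E_Lipschitz_ordered[OF f k] V W U; simp add: U_def)+
  then show ?thesis by (simp add: abs_le_iff algebra_simps)
qed

end

section \<open>Raising \<open>g\<close> by a wedge\<close>

lemma perp_decomposition: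
  assumes t: "norm \<tau> = 1" and "perp \<tau> \<bullet> \<xi> = 0"
  shows "\<xi> = (\<tau> \<bullet> \<xi>) *\<^sub>R \<tau>"
  using frame_coordinates[OF t, of \<xi>] assms(2) by (simp add: frame_def)

lemma has_real_derivative_abs_at:
  assumes "x \<noteq> (0::real)"
  shows "((\<lambda>x. \<bar>x\<bar>) has_real_derivative sgn x) (at x)"
proof (cases "0 < x")
  case True
  show ?thesis
    by (rule has_field_derivative_transform_within_open[of "\<lambda>x. x" _ _ "{0<..}"]) (use True in auto)
next
  case False
  then have x: "x < 0" using assms by simp
  have "((\<lambda>x. - x) has_real_derivative sgn x) (at x)" using x by (auto intro!: derivative_eq_intros)
  then show ?thesis
    by (rule has_field_derivative_transform_within_open[of _ _ _ "{..<0}"]) (use x in auto)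
qed

lemma integral_sgn_derivative:
  fixes H p :: "real \<Rightarrow> real"
  assumes lip: "K-lipschitz_on UNIV H" and p [measurable]: "p \<in> borel_measurable borel"
    and der: "AE t in lborel. (H has_real_derivative p t) (at t)"
    and z: "z \<in> {a..b}"
  shows "(LINT t:{a..b}|lborel. sgn (t - z) * p t) = H a + H b - 2 * H z"
proof -
  have ab: "a \<le> z" "z \<le> b" using z by auto
  note i1 = integral_derivative_Lipschitz[OF lip p der ab(1)] and i2 = integral_derivative_Lipschitz[OF lip p der ab(2)]
  have "(LINT t:{a..b}|lborel. sgn (t - z) * p t) = (LINT t|lborel. indicator {z..b} t *\<^sub>R p t - indicator {a..z} t *\<^sub>R p t)"
    unfolding set_lebesgue_integral_def
  proof (rule integral_cong_AE)
    show "AE t in lborel. indicator {a..b} t *\<^sub>R (sgn (t - z) * p t) = indicator {z..b} t *\<^sub>R p t - indicator {a..z} t *\<^sub>R p t"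
      using AE_lborel_singleton[of z] by eventually_elim (use ab in \<open>auto simp: indicator_def sgn_if\<close>)
  qed auto
  also have "\<dots> = (H b - H z) - (H z - H a)"
    using i1 i2 unfolding set_integrable_def set_lebesgue_integral_def by simp
  finally show ?thesis by simp
qed

lemma AE_derivative_Lipschitz_bound:
  assumes "K-lipschitz_on UNIV (H :: real \<Rightarrow> real)" "(H has_real_derivative d) (at t)"
  shows "\<bar>d\<bar> \<le> K"
proof (rule tendsto_upperbound)
  have "((\<lambda>h. (H (t + h) - H t) / h) \<longlongrightarrow> d) (at 0)" using assms(2) by (simp add: DERIV_def)
  then show "((\<lambda>h. \<bar>(H (t + h) - H t) / h\<bar>) \<longlongrightarrow> \<bar>d\<bar>) (at 0)" by (rule tendsto_rabs)
  have "\<bar>(H (t + h) - H t) / h\<bar> \<le> K" if "h \<noteq> 0" for h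
    using lipschitz_onD[OF assms(1), of "t + h" t] that by (simp add: dist_real_def field_simps)
  then show "\<forall>\<^sub>F h in at 0. \<bar>(H (t + h) - H t) / h\<bar> \<le> K"
    by (auto simp: eventually_at_filter)
qed simp

context dual_model
begin

text \<open>A supporting plane of \<open>g\<close> at 0, raised by \<open>\<sigma>\<close> and
  folded along the line spanned by \<open>\<tau>\<close>; its second derivative lives on this line
  and acts only across it.\<close>

definition wedge :: "real^2 \<Rightarrow> real^2 \<Rightarrow> real \<Rightarrow> real \<Rightarrow> real^2 \<Rightarrow> real" where
  "wedge x0 \<tau> \<sigma> \<kappa> \<xi> = g 0 + x0 \<bullet> \<xi> + \<sigma> + \<kappa> * \<bar>perp \<tau> \<bullet> \<xi>\<bar>"

context
  fixes x0 \<tau> :: "real^2" and \<sigma> \<kappa> :: real and W :: "real^2 \<Rightarrow> real"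
  assumes \<tau>: "norm \<tau> = 1" and \<sigma>: "0 < \<sigma>" and \<kappa>: "0 < \<kappa>"
    and W: "cls W" and W_eq: "\<And>\<xi>. W \<xi> = max (g \<xi>) (wedge x0 \<tau> \<sigma> \<kappa> \<xi>)"
begin

abbreviation (input) "M \<equiv> (\<lambda>\<xi>. (1 - 1/2) * g \<xi> + 1/2 * W \<xi>)"

abbreviation (input) "xs \<equiv> [(3, W), (1, g), (-4, M)]"

lemma cls_M: "cls M" by (rule cls_combination[OF cls_g W]) auto

lemma W_ge: "g \<xi> \<le> W \<xi>" by (simp add: W_eq)

lemma ridge_functional_wedge:
  "ridge_functional \<rho> (area * (\<Sum>(a, W)\<leftarrow>xs. \<bar>a\<bar>)) (\<lambda>f. \<Sum>(a, W)\<leftarrow>xs. a * E f W)"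
  by (rule functional_family) (use W cls_g cls_M in auto)

text \<open>Where \<open>W = g\<close>, the nonnegative difference \<open>W - g\<close> has a
  minimum and the slopes coincide, so both sides vanish. Elsewhere \<open>W\<close> is locally the
  wedge, whose slope is explicit off the fold.\<close>

lemma slope_wedge:
  assumes c: "norm c = 1"
  shows "AE \<eta> in lborel. slope (\<lambda>\<eta>. W (frame c b \<eta>)) \<eta> * (slope (\<lambda>\<eta>. W (frame c b \<eta>)) \<eta> - slope (\<lambda>\<eta>. g (frame c b \<eta>)) \<eta>)
     = (x0 \<bullet> perp c + \<kappa> * (c \<bullet> \<tau>) * sgn (perp \<tau> \<bullet> frame c b \<eta>)) * (slope (\<lambda>\<eta>. W (frame c b \<eta>)) \<eta> - slope (\<lambda>\<eta>. g (frame c b \<eta>)) \<eta>)"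
proof -
  let ?w = "\<lambda>\<eta>. W (frame c b \<eta>)" and ?g = "\<lambda>\<eta>. g (frame c b \<eta>)"
  have cvw: "convex_on UNIV ?w" and cvg: "convex_on UNIV ?g"
    by (intro convex_on_frame' cls_convex W cls_g)+
  have ph: "perp \<tau> \<bullet> frame c b \<eta> = b * (perp \<tau> \<bullet> c) + \<eta> * (c \<bullet> \<tau>)" for \<eta>
    by (simp add: frame_def inner_add_right inner_commute)
  have "AE \<eta> in lborel. perp \<tau> \<bullet> frame c b \<eta> \<noteq> 0 \<or> c \<bullet> \<tau> = 0"
  proof (cases "c \<bullet> \<tau> = 0")
    case False
    show ?thesis
      using AE_lborel_singleton[of "- (b * (perp \<tau> \<bullet> c)) / (c \<bullet> \<tau>)"]
      by eventually_elim (use False in \<open>auto simp: ph field_simps\<close>)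
  qed simp
  then show ?thesis
    using AE_slope[OF cvw] AE_slope[OF cvg]
  proof eventually_elim
    case (elim \<eta>)
    show ?case
    proof (cases "?w \<eta> = ?g \<eta>")
      case True
      have "((\<lambda>\<eta>. ?w \<eta> - ?g \<eta>) has_real_derivative (slope ?w \<eta> - slope ?g \<eta>)) (at \<eta>)"
        by (rule DERIV_diff[OF elim(2,3)])
      from DERIV_local_min[OF this, of 1] True W_ge have "slope ?w \<eta> - slope ?g \<eta> = 0" by simp
      then show ?thesis by simp
    next
      case False
      let ?p = "\<lambda>\<eta>. wedge x0 \<tau> \<sigma> \<kappa> (frame c b \<eta>)"
      have gt: "?g \<eta> < ?p \<eta>" using False W_eq[of "frame c b \<eta>"] by (auto simp: max_def split: if_splits)
      have pe: "?p \<eta> = g 0 + x0 \<bullet> frame c b 0 + \<sigma> + \<eta> * (x0 \<bullet> perp c) + \<kappa> * \<bar>b * (perp \<tau> \<bullet> c) + \<eta> * (c \<bullet> \<tau>)\<bar>" for \<eta>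
        unfolding wedge_def ph by (simp add: frame_def inner_add_right)
      have cont: "continuous_on UNIV ?p" "continuous_on UNIV ?g"
        unfolding wedge_def by (intro continuous_intros continuous_on_compose2[OF cls_continuous[OF cls_g, of UNIV]]; simp)+
      have op: "open {t. ?g t < ?p t}" using cont by (intro open_Collect_less)
      have "(?p has_real_derivative (x0 \<bullet> perp c + \<kappa> * (c \<bullet> \<tau>) * sgn (perp \<tau> \<bullet> frame c b \<eta>))) (at \<eta>)"
      proof (cases "c \<bullet> \<tau> = 0")
        case True
        then show ?thesis unfolding pe by (auto intro!: derivative_eq_intros)
      next
        case f: False
        then have ne: "b * (perp \<tau> \<bullet> c) + \<eta> * (c \<bullet> \<tau>) \<noteq> 0" using elim(1) ph by simp
        have "((\<lambda>\<eta>. \<bar>b * (perp \<tau> \<bullet> c) + \<eta> * (c \<bullet> \<tau>)\<bar>) has_real_derivative (sgn (b * (perp \<tau> \<bullet> c) + \<eta> * (c \<bullet> \<tau>)) * (c \<bullet> \<tau>))) (at \<eta>)"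
          by (rule DERIV_chain2[where f=abs and g="\<lambda>\<eta>. b * (perp \<tau> \<bullet> c) + \<eta> * (c \<bullet> \<tau>)", OF has_real_derivative_abs_at[OF ne]]) (auto intro!: derivative_eq_intros)
        then have "((\<lambda>\<eta>. (g 0 + x0 \<bullet> frame c b 0 + \<sigma> + \<eta> * (x0 \<bullet> perp c)) + \<kappa> * \<bar>b * (perp \<tau> \<bullet> c) + \<eta> * (c \<bullet> \<tau>)\<bar>) has_real_derivative
            (x0 \<bullet> perp c + \<kappa> * (sgn (b * (perp \<tau> \<bullet> c) + \<eta> * (c \<bullet> \<tau>)) * (c \<bullet> \<tau>)))) (at \<eta>)"
          by (intro DERIV_add DERIV_cmult) (auto intro!: derivative_eq_intros)
        then show ?thesis unfolding pe ph by (simp add: mult_ac)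
      qed
      then have "(?w has_real_derivative (x0 \<bullet> perp c + \<kappa> * (c \<bullet> \<tau>) * sgn (perp \<tau> \<bullet> frame c b \<eta>))) (at \<eta>)"
        by (rule has_field_derivative_transform_within_open[OF _ op]) (use gt W_eq in \<open>auto simp: max_def\<close>)
      then have "slope ?w \<eta> = x0 \<bullet> perp c + \<kappa> * (c \<bullet> \<tau>) * sgn (perp \<tau> \<bullet> frame c b \<eta>)"
        by (rule slope_eq_derivative[OF cvw])
      then show ?thesis by simp
    qed
  qed
qed

text \<open>The excess \<open>W - g\<close> only sees the edge of the wedge, that is the line through \<open>\<tau>\<close>.\<close>

lemma hinge_wedge:
  assumes c: "norm c = 1" and b: "\<bar>b\<bar> < \<rho>"
  shows "3 * E (hinge c b) W + E (hinge c b) g - 4 * E (hinge c b) M =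
    (if c \<bullet> \<tau> = 0 then 0 else 2 * \<kappa> * \<bar>c \<bullet> \<tau>\<bar> * (W ((b / (c \<bullet> \<tau>)) *\<^sub>R \<tau>) - g ((b / (c \<bullet> \<tau>)) *\<^sub>R \<tau>)))"
proof -
  let ?w = "slope (\<lambda>\<eta>. W (frame c b \<eta>))" and ?g = "slope (\<lambda>\<eta>. g (frame c b \<eta>))"
  let ?I = "{- chord b..chord b}"
  define \<gamma> where "\<gamma> = c \<bullet> \<tau>"
  define h where "h \<eta> = W (frame c b \<eta>) - g (frame c b \<eta>)" for \<eta>
  define p where "p \<eta> = ?w \<eta> - ?g \<eta>" for \<eta>
  have mw: "?w \<in> borel_measurable borel" "?g \<in> borel_measurable borel"
    by (intro borel_measurable_slope convex_on_frame' cls_convex W cls_g)+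
  then have p [measurable]: "p \<in> borel_measurable borel" unfolding p_def by simp
  have lip: "(L + L)-lipschitz_on UNIV h"
    unfolding h_def by (intro lipschitz_on_diff Lipschitz_frame cls_Lipschitz W cls_g c)
  have der: "AE t in lborel. (h has_real_derivative p t) (at t)"
    using AE_slope[OF convex_on_frame'[OF cls_convex[OF W], of c b]] AE_slope[OF convex_on_frame'[OF cls_convex[OF cls_g], of c b]]
    unfolding h_def p_def by eventually_elim (rule DERIV_diff)
  have pb: "AE t in lborel. \<bar>p t\<bar> \<le> L + L"
    using der by eventually_elim (rule AE_derivative_Lipschitz_bound[OF lip])
  have chord: "0 < chord b" by (rule chord_pos[OF b])
  have h_out: "W \<xi> = g \<xi>" if "\<rho> \<le> norm \<xi>" for \<xi> using cls_eq[OF W, of \<xi>] that r by simp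
  have h_end: "h (chord b) = 0" "h (- chord b) = 0"
    using norm_frame_chord[OF c b, of "chord b"] norm_frame_chord[OF c b, of "- chord b"] chord h_out by (simp_all add: h_def)
  note int = set_integrable_slope_mult[OF cls_g cls_g c, of "- chord b" "chord b" b]
    set_integrable_slope_mult[OF cls_g W c, of "- chord b" "chord b" b]
    set_integrable_slope_mult[OF W W c, of "- chord b" "chord b" b]
  have en: "energy c b g = (LINT \<eta>:?I|lborel. ?g \<eta> * ?g \<eta>)" "energy c b W = (LINT \<eta>:?I|lborel. ?w \<eta> * ?w \<eta>)"
    by (simp_all add: energy_def power2_eq_square)
  have D: "energy_diff c b g W = energy c b g + energy c b W - 2 * (LINT \<eta>:?I|lborel. ?g \<eta> * ?w \<eta>)"
  proof -
    have "energy_diff c b g W = (LINT \<eta>:?I|lborel. (?g \<eta> * ?g \<eta> + ?w \<eta> * ?w \<eta>) - 2 * (?g \<eta> * ?w \<eta>))"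
      unfolding energy_diff_def by (intro set_lebesgue_integral_cong) (auto simp: power2_eq_square algebra_simps)
    then show ?thesis unfolding en using int by (subst (asm) set_integral_diff(2)) (auto simp: set_integral_add)
  qed
  have H: "E (hinge c b) U = E (hinge c b) g + (energy c b g - energy c b U) / 2" if "cls U" for U
    using hinge_energy[OF c b cls_g that] by linarith
  have eM: "energy c b M = (1 - 1/2) * energy c b g + 1/2 * energy c b W - 1/2 * (1 - 1/2) * energy_diff c b g W"
    by (rule energy_combination[OF cls_g W _ _ c]) auto
  \<comment> \<open>The combination is the derivative of \<open>E (hinge c b)\<close> at
    \<open>W\<close> in the direction \<open>W - g\<close>, that is minus the integral of
    \<open>?w * p\<close> along the chord.\<close>
  have "3 * E (hinge c b) W + E (hinge c b) g - 4 * E (hinge c b) M = (LINT \<eta>:?I|lborel. ?g \<eta> * ?w \<eta>) - energy c b W"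
    unfolding H[OF W] H[OF cls_M] eM D by (simp add: field_simps)
  also have "\<dots> = - (LINT \<eta>:?I|lborel. ?w \<eta> * p \<eta>)"
  proof -
    have "(LINT \<eta>:?I|lborel. ?w \<eta> * p \<eta>) = (LINT \<eta>:?I|lborel. ?w \<eta> * ?w \<eta> - ?g \<eta> * ?w \<eta>)"
      unfolding p_def by (intro set_lebesgue_integral_cong) (auto simp: algebra_simps)
    then show ?thesis unfolding en using int by (subst (asm) set_integral_diff(2)) auto
  qed
  also have "(LINT \<eta>:?I|lborel. ?w \<eta> * p \<eta>) = (LINT \<eta>:?I|lborel. (x0 \<bullet> perp c) * p \<eta> + \<kappa> * \<gamma> * (sgn (perp \<tau> \<bullet> frame c b \<eta>) * p \<eta>))"
    unfolding set_lebesgue_integral_def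
  proof (rule integral_cong_AE)
    show "AE x in lborel. indicator ?I x *\<^sub>R (?w x * p x) = indicator ?I x *\<^sub>R ((x0 \<bullet> perp c) * p x + \<kappa> * \<gamma> * (sgn (perp \<tau> \<bullet> frame c b x) * p x))"
      using slope_wedge[OF c, of b]
    proof eventually_elim
      case (elim x)
      have "?w x * p x = (x0 \<bullet> perp c) * p x + \<kappa> * \<gamma> * (sgn (perp \<tau> \<bullet> frame c b x) * p x)"
        unfolding p_def elim \<gamma>_def by (simp add: algebra_simps)
      then show ?case by simp
    qed
    have fr: "(\<lambda>x. perp \<tau> \<bullet> frame c b x) \<in> borel_measurable borel"
      by (intro borel_measurable_continuous_onI continuous_intros)
    show "(\<lambda>x. indicator ?I x *\<^sub>R ((x0 \<bullet> perp c) * p x + \<kappa> * \<gamma> * (sgn (perp \<tau> \<bullet> frame c b x) * p x))) \<in> borel_measurable lborel"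
      using fr by simp
    show "(\<lambda>x. indicator ?I x *\<^sub>R (?w x * p x)) \<in> borel_measurable lborel" using mw by simp
  qed
  also have "\<dots> = (x0 \<bullet> perp c) * (LINT \<eta>:?I|lborel. p \<eta>) + \<kappa> * \<gamma> * (LINT \<eta>:?I|lborel. sgn (perp \<tau> \<bullet> frame c b \<eta>) * p \<eta>)"
  proof -
    have i1: "set_integrable lborel ?I p" by (rule set_integrable_bounded_Icc[OF p pb])
    have fr: "(\<lambda>x. perp \<tau> \<bullet> frame c b x) \<in> borel_measurable borel"
      by (intro borel_measurable_continuous_onI continuous_intros)
    have i2: "set_integrable lborel ?I (\<lambda>\<eta>. sgn (perp \<tau> \<bullet> frame c b \<eta>) * p \<eta>)"
    proof (rule set_integrable_bounded_Icc)
      show "(\<lambda>\<eta>. sgn (perp \<tau> \<bullet> frame c b \<eta>) * p \<eta>) \<in> borel_measurable borel" using fr by simp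
      show "AE \<eta> in lborel. \<bar>sgn (perp \<tau> \<bullet> frame c b \<eta>) * p \<eta>\<bar> \<le> L + L"
        using pb by eventually_elim (auto simp: sgn_if abs_mult)
    qed
    show ?thesis using i1 i2 by (subst set_integral_add(2)) auto
  qed
  also have "(LINT \<eta>:?I|lborel. p \<eta>) = 0"
    using integral_derivative_Lipschitz(2)[OF lip p der, of "- chord b" "chord b"] chord h_end by simp
  finally have main: "3 * E (hinge c b) W + E (hinge c b) g - 4 * E (hinge c b) M = - (\<kappa> * \<gamma> * (LINT \<eta>:?I|lborel. sgn (perp \<tau> \<bullet> frame c b \<eta>) * p \<eta>))"
    by simp
  show ?thesis
  proof (cases "\<gamma> = 0")
    case True
    then show ?thesis using main by (simp add: \<gamma>_def)
  next
    case False
    \<comment> \<open>The chord's line crosses the fold at \<open>z\<close>, which may lie off the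
      chord. Clamping it to the chord changes the signs at most at the end points, and
      \<open>h\<close> vanishes at \<open>z'\<close> and at \<open>z\<close> in that case.\<close>
    define z where "z = - (b * (perp \<tau> \<bullet> c)) / \<gamma>"
    define z' where "z' = max (- chord b) (min (chord b) z)"
    have z': "z' \<in> ?I" using chord by (auto simp: z'_def)
    have ph: "perp \<tau> \<bullet> frame c b \<eta> = \<gamma> * (\<eta> - z)" for \<eta>
    proof -
      have "perp \<tau> \<bullet> frame c b \<eta> = b * (perp \<tau> \<bullet> c) + \<eta> * \<gamma>"
        by (simp add: frame_def inner_add_right inner_commute[of \<tau> c] \<gamma>_def)
      then show ?thesis using False by (simp add: z_def field_simps)
    qed
    have "(LINT \<eta>:?I|lborel. sgn (perp \<tau> \<bullet> frame c b \<eta>) * p \<eta>) = (LINT \<eta>:?I|lborel. sgn \<gamma> * (sgn (\<eta> - z') * p \<eta>))"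
      unfolding set_lebesgue_integral_def
    proof (rule integral_cong_AE)
      show "AE x in lborel. indicator ?I x *\<^sub>R (sgn (perp \<tau> \<bullet> frame c b x) * p x) = indicator ?I x *\<^sub>R (sgn \<gamma> * (sgn (x - z') * p x))"
        using AE_lborel_singleton[of "chord b"] AE_lborel_singleton[of "- chord b"]
      proof eventually_elim
        case (elim x)
        have "sgn (x - z) = sgn (x - z')" if "x \<in> ?I" using that elim chord by (auto simp: z'_def sgn_if max_def min_def)
        then show ?case by (auto simp: ph sgn_mult indicator_def)
      qed
      have fr: "(\<lambda>x. perp \<tau> \<bullet> frame c b x) \<in> borel_measurable borel"
        by (intro borel_measurable_continuous_onI continuous_intros)
      show "(\<lambda>x. indicator ?I x *\<^sub>R (sgn (perp \<tau> \<bullet> frame c b x) * p x)) \<in> borel_measurable lborel" using fr by simp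
    qed simp
    also have "\<dots> = sgn \<gamma> * (- 2 * h z')"
      using integral_sgn_derivative[OF lip p der z'] h_end by simp
    finally have I: "(LINT \<eta>:?I|lborel. sgn (perp \<tau> \<bullet> frame c b \<eta>) * p \<eta>) = sgn \<gamma> * (- 2 * h z')" .
    have pt: "frame c b z = (b / \<gamma>) *\<^sub>R \<tau>"
    proof -
      have "perp \<tau> \<bullet> frame c b z = 0" by (simp add: ph)
      from perp_decomposition[OF \<tau> this] have dec: "frame c b z = (\<tau> \<bullet> frame c b z) *\<^sub>R \<tau>" .
      have "b = c \<bullet> frame c b z" using c by simp
      also have "\<dots> = (\<tau> \<bullet> frame c b z) * \<gamma>" by (subst dec) (simp add: \<gamma>_def)
      finally have "\<tau> \<bullet> frame c b z = b / \<gamma>" using False by (simp add: field_simps)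
      then show ?thesis using dec by simp
    qed
    have "h z' = h z"
    proof (cases "z \<in> ?I")
      case True
      then show ?thesis by (auto simp: z'_def max_def min_def)
    next
      case out: False
      then have "h z' = 0" using h_end chord by (auto simp: z'_def max_def min_def)
      moreover have "frame c b z \<notin> B" using frame_mem_B[OF c b, of z] out by blast
      then have "h z = 0" unfolding h_def using h_out[of "frame c b z"] by simp
      ultimately show ?thesis by simp
    qed
    also have "h z = W ((b / \<gamma>) *\<^sub>R \<tau>) - g ((b / \<gamma>) *\<^sub>R \<tau>)" by (simp add: h_def pt)
    finally have hz: "h z' = W ((b / \<gamma>) *\<^sub>R \<tau>) - g ((b / \<gamma>) *\<^sub>R \<tau>)" .
    have "- (\<kappa> * \<gamma> * (sgn \<gamma> * (- 2 * h z'))) = 2 * \<kappa> * (\<gamma> * sgn \<gamma>) * h z'" by simp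
    then show ?thesis using False unfolding main I hz \<gamma>_def[symmetric] by (simp add: abs_sgn[symmetric])
  qed
qed

text \<open>By \<open>hinge_wedge\<close> the functional \<open>\<Phi>\<close> sees a hinge only
  through its restriction to the line spanned by \<open>\<tau>\<close>. So \<open>f\<close> and its
  composition with the projection onto this line have the same value, first for hinges and then for
  all \<open>f\<close>; the restriction of \<open>f\<close> to the line is strictly concave.\<close>

lemma wedge_decreases:
  assumes f: "continuous_on UNIV f" and k: "0 < k"
    and conc: "\<And>x h. 0 < h \<Longrightarrow> x - h \<ge> -\<rho> \<Longrightarrow> x + h \<le> \<rho> \<Longrightarrow> f ((x + h) *\<^sub>R \<tau>) - 2 * f (x *\<^sub>R \<tau>) + f ((x - h) *\<^sub>R \<tau>) \<le> - k * h^2"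
  shows "3 * E f W + E f g < 4 * E f M"
proof -
  define C where "C = area * (\<Sum>(a, W)\<leftarrow>xs. \<bar>a\<bar>)"
  define \<Phi> where "\<Phi> f = (\<Sum>(a, W)\<leftarrow>xs. a * E f W)" for f
  interpret ridge_functional \<rho> C \<Phi>
    using ridge_functional_wedge unfolding C_def \<Phi>_def .
  have \<Phi>: "\<Phi> f = 3 * E f W + E f g - 4 * E f M" for f by (simp add: \<Phi>_def)
  let ?P = "\<lambda>f \<xi>. f ((\<tau> \<bullet> \<xi>) *\<^sub>R \<tau>)"
  have contP: "continuous_on UNIV (?P f)" if "continuous_on UNIV f" for f :: "real^2 \<Rightarrow> real"
    by (rule continuous_on_compose2[OF that]) (auto intro!: continuous_intros)
  have normP: "norm ((\<tau> \<bullet> \<xi>) *\<^sub>R \<tau>) \<le> norm \<xi>" for \<xi> using Cauchy_Schwarz_ineq2[of \<tau> \<xi>] \<tau> by simp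
  interpret D: ridge_functional \<rho> "2 * C" "\<lambda>f. \<Phi> f - \<Phi> (?P f)"
  proof (unfold_locales)
    show "0 < \<rho>" by (rule rho0)
    fix f h :: "real^2 \<Rightarrow> real" assume fh: "continuous_on UNIV f" "continuous_on UNIV h"
    show "\<Phi> (\<lambda>\<xi>. f \<xi> + h \<xi>) - \<Phi> (?P (\<lambda>\<xi>. f \<xi> + h \<xi>)) = (\<Phi> f - \<Phi> (?P f)) + (\<Phi> h - \<Phi> (?P h))"
      using add[OF fh] add[OF contP[OF fh(1)] contP[OF fh(2)]] by simp
  next
    fix f :: "real^2 \<Rightarrow> real" and a assume f: "continuous_on UNIV f"
    show "\<Phi> (\<lambda>\<xi>. a * f \<xi>) - \<Phi> (?P (\<lambda>\<xi>. a * f \<xi>)) = a * (\<Phi> f - \<Phi> (?P f))"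
      using cmult[OF f, of a] cmult[OF contP[OF f], of a] by (simp add: right_diff_distrib)
  next
    fix f :: "real^2 \<Rightarrow> real" and e assume f: "continuous_on UNIV f" and e: "\<And>\<xi>. norm \<xi> \<le> \<rho> \<Longrightarrow> \<bar>f \<xi>\<bar> \<le> e"
    have "\<bar>\<Phi> f\<bar> \<le> C * e" by (rule bound[OF f e])
    moreover have "\<bar>\<Phi> (?P f)\<bar> \<le> C * e"
      by (rule bound[OF contP[OF f]]) (use e normP order_trans in blast)
    ultimately show "\<bar>\<Phi> f - \<Phi> (?P f)\<bar> \<le> 2 * C * e" by linarith
  next
    fix a :: "real^2" and d
    have "\<Phi> (\<lambda>\<xi>. a \<bullet> ((\<tau> \<bullet> \<xi>) *\<^sub>R \<tau>) + d) = 0"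
      using affine[of "(a \<bullet> \<tau>) *\<^sub>R \<tau>" d] by (simp add: mult.commute)
    then show "\<Phi> (\<lambda>\<xi>. a \<bullet> \<xi> + d) - \<Phi> (?P (\<lambda>\<xi>. a \<bullet> \<xi> + d)) = 0" using affine[of a d] by simp
  qed
  have excess_out: "W (t *\<^sub>R \<tau>) - g (t *\<^sub>R \<tau>) = 0" if "\<rho> \<le> \<bar>t\<bar>" for t
    using cls_eq[OF W, of "t *\<^sub>R \<tau>"] that r \<tau> by simp
  have "\<Phi> f - \<Phi> (?P f) = 0"
  proof (rule D.vanishes[OF _ f])
    fix c :: "real^2" and b :: real assume c: "norm c = 1" and b: "\<bar>b\<bar> < \<rho>"
    define \<gamma> where "\<gamma> = c \<bullet> \<tau>"
    note hw = hinge_wedge[OF c b, folded \<Phi> \<gamma>_def]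
    have P: "?P (hinge c b) = (\<lambda>\<xi>. max 0 (\<gamma> * (\<tau> \<bullet> \<xi>) - b))"
      by (auto simp: hinge_def \<gamma>_def fun_eq_iff mult.commute)
    show "\<Phi> (hinge c b) - \<Phi> (?P (hinge c b)) = 0"
    proof (cases "\<gamma> = 0")
      case True
      have "\<Phi> (?P (hinge c b)) = 0" unfolding P using affine[of 0 "max 0 (-b)"] True by simp
      then show ?thesis using hw True by simp
    next
      case False
      define c' where "c' = sgn \<gamma> *\<^sub>R \<tau>"
      have c': "norm c' = 1" "c' \<bullet> \<tau> = sgn \<gamma>" using \<tau> False by (simp_all add: c'_def norm_eq_1 sgn_if)
      define b' where "b' = b / \<bar>\<gamma>\<bar>"
      have P': "?P (hinge c b) = (\<lambda>\<xi>. \<bar>\<gamma>\<bar> * hinge c' b' \<xi>)"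
      proof
        fix \<xi>
        have "\<gamma> * (\<tau> \<bullet> \<xi>) - b = \<bar>\<gamma>\<bar> * (c' \<bullet> \<xi> - b')"
          using False by (cases "0 < \<gamma>") (simp_all add: c'_def b'_def field_simps)
        then show "?P (hinge c b) \<xi> = \<bar>\<gamma>\<bar> * hinge c' b' \<xi>"
          unfolding fun_cong[OF P, of \<xi>] hinge_def[of c' b'] by (simp add: max_mult_distrib_left)
      qed
      have PhiP: "\<Phi> (?P (hinge c b)) = \<bar>\<gamma>\<bar> * \<Phi> (hinge c' b')"
        unfolding P' by (rule cmult[OF continuous_on_hinge])
      have bb: "b' / sgn \<gamma> = b / \<gamma>" using False by (simp add: b'_def sgn_if abs_if)
      show ?thesis
      proof (cases "\<bar>b'\<bar> < \<rho>")
        case True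
        from hinge_wedge[OF c'(1) True, folded \<Phi>] show ?thesis
          using hw False c'(2) bb PhiP by (simp add: sgn_if)
      next
        \<comment> \<open>The hinge now bends outside the ball, where it is either zero or affine on
          the ball, so its value is zero; the excess \<open>W - g\<close> is zero at the
          corresponding far point as well.\<close>
        case far: False
        then have far': "\<rho> \<le> \<bar>b / \<gamma>\<bar>" by (simp add: b'_def abs_divide)
        have bd: "\<bar>c' \<bullet> \<xi>\<bar> \<le> \<rho>" if "norm \<xi> \<le> \<rho>" for \<xi>
          using Cauchy_Schwarz_ineq2[of c' \<xi>] c'(1) that by simp
        have "\<Phi> (hinge c' b') = 0"
        proof (cases "0 \<le> b'")
          case True
          have "\<bar>\<Phi> (hinge c' b')\<bar> \<le> C * 0"
          proof (rule bound[OF continuous_on_hinge])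
            fix \<xi> :: "real^2" assume "norm \<xi> \<le> \<rho>"
            from bd[OF this] True far show "\<bar>hinge c' b' \<xi>\<bar> \<le> 0" by (simp add: hinge_def)
          qed
          then show ?thesis by simp
        next
          case neg: False
          have "\<bar>\<Phi> (hinge c' b') - \<Phi> (\<lambda>\<xi>. c' \<bullet> \<xi> + (- b'))\<bar> \<le> C * 0"
          proof (rule diff_bound[OF continuous_on_hinge])
            show "continuous_on UNIV (\<lambda>\<xi>. c' \<bullet> \<xi> + (- b'))" by (intro continuous_intros)
            fix \<xi> :: "real^2" assume "norm \<xi> \<le> \<rho>"
            from bd[OF this] neg far show "\<bar>hinge c' b' \<xi> - (c' \<bullet> \<xi> + - b')\<bar> \<le> 0" by (simp add: hinge_def)
          qed
          then show ?thesis using affine[of c' "- b'"] by simp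
        qed
        moreover have "\<Phi> (hinge c b) = 0" using hw False excess_out[OF far'] by simp
        ultimately show ?thesis using PhiP by simp
      qed
    qed
  qed
  moreover have "\<Phi> (\<lambda>\<xi>. (\<lambda>s. f (s *\<^sub>R \<tau>)) (\<tau> \<bullet> \<xi>)) < 0"
  proof -
    have contf: "continuous_on UNIV (\<lambda>s. f (s *\<^sub>R \<tau>))"
      by (rule continuous_on_compose2[OF f]) (auto intro!: continuous_intros)
    have "\<tau> \<noteq> 0" using \<tau> by auto
    then have hw: "\<Phi> (hinge \<tau> b) = 2 * \<kappa> * (W (b *\<^sub>R \<tau>) - g (b *\<^sub>R \<tau>))" if "\<bar>b\<bar> < \<rho>" for b
      using hinge_wedge[OF \<tau> that] \<tau> unfolding \<Phi> by (simp add: norm_eq_1)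
    have nonneg: "0 \<le> \<Phi> (hinge \<tau> b)" if "\<bar>b\<bar> < \<rho>" for b
      using hw[OF that] \<kappa> W_ge[of "b *\<^sub>R \<tau>"] by simp
    have "continuous_on UNIV (\<lambda>b. W (b *\<^sub>R \<tau>) - g (b *\<^sub>R \<tau>))"
      by (intro continuous_intros continuous_on_compose2[OF cls_continuous[OF W, of UNIV]] continuous_on_compose2[OF cls_continuous[OF cls_g, of UNIV]]) auto
    then have "isCont (\<lambda>b. W (b *\<^sub>R \<tau>) - g (b *\<^sub>R \<tau>)) 0" by (simp add: continuous_on_eq_continuous_at)
    then obtain d where d: "d > 0" "\<And>b. \<bar>b\<bar> < d \<Longrightarrow> \<bar>(W (b *\<^sub>R \<tau>) - g (b *\<^sub>R \<tau>)) - (W 0 - g 0)\<bar> < \<sigma> / 2"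
      unfolding continuous_at_eps_delta dist_real_def using \<sigma>
      by (metis diff_zero half_gt_zero scaleR_zero_left)
    have W0: "W 0 - g 0 = \<sigma>" using \<sigma> by (simp add: W_eq wedge_def)
    define l where "l = min (d/2) (\<rho>/2)"
    have l: "0 < l" "l < \<rho>" "l < d" using d(1) rho0 by (auto simp: l_def)
    have pos: "\<kappa> * \<sigma> \<le> \<Phi> (hinge \<tau> b)" if "\<bar>b\<bar> \<le> l" for b
    proof -
      have "\<sigma> / 2 \<le> W (b *\<^sub>R \<tau>) - g (b *\<^sub>R \<tau>)" using d(2)[of b] that l W0 by linarith
      then have "2 * \<kappa> * (\<sigma> / 2) \<le> 2 * \<kappa> * (W (b *\<^sub>R \<tau>) - g (b *\<^sub>R \<tau>))" using \<kappa> by (intro mult_left_mono) auto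
      then show ?thesis using hw[of b] that l by simp
    qed
    have ks: "0 < \<kappa> * \<sigma>" using \<kappa> \<sigma> by simp
    show ?thesis by (rule strictly_concave_ridge[OF contf \<tau> k conc nonneg ks l(1,2) pos])
  qed
  ultimately show ?thesis unfolding \<Phi> by simp
qed

end

section \<open>Stationarity under downward variations of \<open>g\<close>\<close>

text \<open>The convex envelope of \<open>k\<close>, as the supremum of its affine
  minorants.\<close>

definition hull_fun :: "(real^2 \<Rightarrow> real) \<Rightarrow> real^2 \<Rightarrow> real" where
  "hull_fun k \<xi> = (SUP (x, c)\<in>{(x, c). \<forall>\<zeta>. x \<bullet> \<zeta> + c \<le> k \<zeta>}. x \<bullet> \<xi> + c)"

lemma hull_fun_upper:
  assumes "\<And>\<zeta>. x \<bullet> \<zeta> + c \<le> k \<zeta>"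
  shows "x \<bullet> \<xi> + c \<le> hull_fun k \<xi>"
proof -
  have "bdd_above ((\<lambda>(x, c). x \<bullet> \<xi> + c) ` {(x, c). \<forall>\<zeta>. x \<bullet> \<zeta> + c \<le> k \<zeta>})"
    by (rule bdd_aboveI[of _ "k \<xi>"]) auto
  from cSUP_upper[OF _ this, of "(x, c)"] assms show ?thesis
    unfolding hull_fun_def by auto
qed

lemma hull_fun_le:
  assumes "\<exists>x c. \<forall>\<zeta>. x \<bullet> \<zeta> + c \<le> k \<zeta>" "\<And>x c. (\<And>\<zeta>. x \<bullet> \<zeta> + c \<le> k \<zeta>) \<Longrightarrow> x \<bullet> \<xi> + c \<le> m"
  shows "hull_fun k \<xi> \<le> m"
  unfolding hull_fun_def using assms by (intro cSUP_least) auto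

lemma convex_hull_fun:
  assumes ex: "\<exists>x c. \<forall>\<zeta>. x \<bullet> \<zeta> + c \<le> k \<zeta>"
  shows "convex_on UNIV (hull_fun k)"
proof (rule convex_onI)
  fix t :: real and y z :: "real^2" assume t: "0 < t" "t < 1"
  show "hull_fun k ((1 - t) *\<^sub>R y + t *\<^sub>R z) \<le> (1 - t) * hull_fun k y + t * hull_fun k z"
  proof (rule hull_fun_le[OF ex])
    fix x :: "real^2" and c assume m: "\<And>\<zeta>. x \<bullet> \<zeta> + c \<le> k \<zeta>"
    have "x \<bullet> ((1 - t) *\<^sub>R y + t *\<^sub>R z) + c = (1 - t) * (x \<bullet> y + c) + t * (x \<bullet> z + c)"
      by (simp add: inner_add_right algebra_simps)
    also have "\<dots> \<le> (1 - t) * hull_fun k y + t * hull_fun k z"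
      using t by (intro add_mono mult_left_mono hull_fun_upper m) auto
    finally show "x \<bullet> ((1 - t) *\<^sub>R y + t *\<^sub>R z) + c \<le> (1 - t) * hull_fun k y + t * hull_fun k z" .
  qed
qed simp

text \<open>Strict convexity in a compact form: at distance \<open>\<delta>\<close> from the point
  of contact, supporting planes leave a gap \<open>\<omega>\<close> independent of \<open>p\<close>.
  No lower bound on curvature is implied.\<close>

definition uniformly_strict :: bool where
  "uniformly_strict \<longleftrightarrow> (\<forall>\<delta>>0. \<exists>\<omega>>0. \<forall>p\<in>B. \<exists>x. \<forall>\<xi>. g p + x \<bullet> (\<xi> - p) \<le> g \<xi> \<and>
     (\<xi> \<in> B \<and> \<delta> \<le> dist \<xi> p \<longrightarrow> g p + x \<bullet> (\<xi> - p) + \<omega> \<le> g \<xi>))"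

text \<open>By strict convexity the hull of \<open>g - h / C\<close> differs from \<open>g - h / C\<close> by \<open>o(1 / C)\<close>.\<close>

lemma downward_variation:
  assumes strict: uniformly_strict and h: "continuous_on UNIV h" "\<And>\<xi>. 0 \<le> h \<xi>" "\<And>\<xi>. h \<xi> \<le> H"
    and supp: "\<And>\<xi>. r / 2 \<le> norm \<xi> \<Longrightarrow> h \<xi> = 0" and e: "0 < e"
  shows "\<exists>C0>0. \<forall>C\<ge>C0. \<exists>v. cls v \<and> (\<forall>\<xi>. v \<xi> \<le> g \<xi> - h \<xi> / C) \<and> (\<forall>\<xi>\<in>B. g \<xi> - h \<xi> / C - e / C \<le> v \<xi>)"
proof -
  have "uniformly_continuous_on B h"
    using continuous_on_subset[OF h(1)] by (intro compact_uniformly_continuous compactB) auto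
  then obtain \<delta> where \<delta>: "\<delta> > 0" "\<And>x y. x \<in> B \<Longrightarrow> y \<in> B \<Longrightarrow> dist y x < \<delta> \<Longrightarrow> \<bar>h y - h x\<bar> < e"
    unfolding uniformly_continuous_on_def dist_real_def using e by blast
  have "min \<delta> (r / 2) > 0" using \<delta> r by simp
  then obtain \<omega> where \<omega>: "\<omega> > 0" and tan: "\<And>p. p \<in> B \<Longrightarrow> \<exists>x. \<forall>\<xi>. g p + x \<bullet> (\<xi> - p) \<le> g \<xi> \<and>
     (\<xi> \<in> B \<and> min \<delta> (r / 2) \<le> dist \<xi> p \<longrightarrow> g p + x \<bullet> (\<xi> - p) + \<omega> \<le> g \<xi>)"
    using strict unfolding uniformly_strict_def by meson
  have H0: "0 \<le> H" using h(2,3)[of 0] by linarith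
  \<comment> \<open>Then \<open>h \<xi> / C \<le> \<omega>\<close>, so that the gap absorbs the
    perturbation; adding 1 keeps \<open>C0\<close> positive.\<close>
  define C0 where "C0 = (H + 1) / \<omega>"
  have C0: "C0 > 0" using H0 \<omega> by (simp add: C0_def)
  have "\<exists>v. cls v \<and> (\<forall>\<xi>. v \<xi> \<le> g \<xi> - h \<xi> / C) \<and> (\<forall>\<xi>\<in>B. g \<xi> - h \<xi> / C - e / C \<le> v \<xi>)" if C: "C0 \<le> C" for C
  proof -
    have Cpos: "C > 0" using C C0 by simp
    have "H + 1 \<le> C * \<omega>" using C \<omega> by (simp add: C0_def pos_divide_le_eq)
    then have hC: "h \<xi> / C \<le> \<omega>" for \<xi> using h(3)[of \<xi>] Cpos by (simp add: pos_divide_le_eq mult.commute)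
    have hC0: "0 \<le> h \<xi> / C" for \<xi> using h(2)[of \<xi>] Cpos by simp
    let ?k = "\<lambda>\<xi>. g \<xi> - h \<xi> / C"
    define v where "v = hull_fun ?k"
    \<comment> \<open>The supporting plane of \<open>g\<close> at \<open>p\<close>, lowered by
      \<open>h p / C + e / C\<close>, is still a minorant: far from \<open>p\<close> by the gap,
      near \<open>p\<close> because \<open>h\<close> varies by less than \<open>e\<close>.\<close>
    have inner_minorant: "g p - h p / C - e / C \<le> v p" if p: "p \<in> B" for p
    proof -
      obtain x where x: "\<And>\<xi>. g p + x \<bullet> (\<xi> - p) \<le> g \<xi>"
        "\<And>\<xi>. \<xi> \<in> B \<Longrightarrow> min \<delta> (r / 2) \<le> dist \<xi> p \<Longrightarrow> g p + x \<bullet> (\<xi> - p) + \<omega> \<le> g \<xi>"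
        using tan[OF p] by blast
      have "x \<bullet> p + (g p - x \<bullet> p - h p / C - e / C) \<le> v p"
        unfolding v_def
      proof (rule hull_fun_upper)
        fix \<xi>
        have "g p + x \<bullet> (\<xi> - p) + h \<xi> / C \<le> g \<xi> + h p / C + e / C"
        proof (cases "\<xi> \<in> B \<and> min \<delta> (r / 2) \<le> dist \<xi> p")
          case True
          then show ?thesis using x(2)[of \<xi>] hC[of \<xi>] hC0[of p] divide_nonneg_pos[OF less_imp_le[OF e] Cpos] by linarith
        next
          case False
          have "h \<xi> \<le> h p + e"
          proof (cases "\<xi> \<in> B")
            case True
            then have "dist \<xi> p < \<delta>" using False by auto
            then show ?thesis using \<delta>(2)[OF p True] by linarith
          next
            case out: False
            then show ?thesis using supp[of \<xi>] r h(2)[of p] e by simp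
          qed
          then have "h \<xi> / C \<le> h p / C + e / C" using Cpos by (simp add: divide_right_mono add_divide_distrib[symmetric])
          then show ?thesis using x(1)[of \<xi>] by linarith
        qed
        then show "x \<bullet> \<xi> + (g p - x \<bullet> p - h p / C - e / C) \<le> ?k \<xi>" by (simp add: inner_diff_right)
      qed
      then show ?thesis by simp
    qed
    have ex: "\<exists>x c. \<forall>\<zeta>. x \<bullet> \<zeta> + c \<le> ?k \<zeta>"
    proof -
      have "0 \<in> B" using rho0 by simp
      from tan[OF this] obtain x where "\<And>\<xi>. g 0 + x \<bullet> (\<xi> - 0) \<le> g \<xi>" by blast
      then have "x \<bullet> \<zeta> + (g 0 - \<omega>) \<le> ?k \<zeta>" for \<zeta> using hC[of \<zeta>] by (smt (verit) diff_zero)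
      then show ?thesis by blast
    qed
    have v_le: "v \<xi> \<le> ?k \<xi>" for \<xi> unfolding v_def by (rule hull_fun_le[OF ex]) auto
    \<comment> \<open>Here the supporting plane of \<open>g\<close> at \<open>p\<close> need not be
      lowered at all: the perturbation lives within radius \<open>r / 2\<close>, where the plane
      already leaves the gap \<open>\<omega>\<close>.\<close>
    have outer: "v p = g p" if p: "r \<le> norm p" for p
    proof (rule antisym)
      show "v p \<le> g p" using v_le[of p] hC0[of p] by linarith
      have bracket: "g p + x \<bullet> (\<xi> - p) + \<omega> \<le> g \<xi>" if x: "\<And>\<xi>. g p + x \<bullet> (\<xi> - p) \<le> g \<xi>"
        "p \<in> B \<Longrightarrow> (\<forall>\<xi>. \<xi> \<in> B \<and> min \<delta> (r / 2) \<le> dist \<xi> p \<longrightarrow> g p + x \<bullet> (\<xi> - p) + \<omega> \<le> g \<xi>)" and \<xi>: "norm \<xi> < r / 2" for x \<xi>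
      proof -
        have far: "r / 2 \<le> dist \<xi> q" if "r \<le> norm q" for q
          using norm_triangle_ineq2[of q \<xi>] that \<xi> by (simp add: dist_norm norm_minus_commute)
        have \<xi>B: "\<xi> \<in> B" using \<xi> r by simp
        show ?thesis
        proof (cases "p \<in> B")
          case True
          then show ?thesis using x(2) \<xi>B far[OF p] by auto
        next
          case False
          \<comment> \<open>The gap is known only for points of contact in \<open>B\<close>. It is
            carried over from the point \<open>q\<close> of norm \<open>r\<close> on the segment
            from \<open>\<xi>\<close> to \<open>p\<close>: by monotonicity of subgradients the plane
            at \<open>p\<close> lies below that at \<open>q\<close> over
            \<open>\<xi>\<close>.\<close>
          have "\<exists>t. 0 \<le> t \<and> t \<le> 1 \<and> norm (\<xi> + t *\<^sub>R (p - \<xi>)) = r"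
            by (rule IVT') (use \<xi> r p in \<open>auto intro!: continuous_intros\<close>)
          then obtain t where t: "0 \<le> t" "t \<le> 1" "norm (\<xi> + t *\<^sub>R (p - \<xi>)) = r" by blast
          define q where "q = \<xi> + t *\<^sub>R (p - \<xi>)"
          have q: "norm q = r" using t by (simp add: q_def)
          then have qB: "q \<in> B" using r by simp
          have tpos: "0 < t" using q \<xi> r t(1) by (cases "t = 0") (auto simp: q_def)
          obtain y where y: "\<And>\<zeta>. g q + y \<bullet> (\<zeta> - q) \<le> g \<zeta>"
            "\<And>\<zeta>. \<zeta> \<in> B \<Longrightarrow> min \<delta> (r / 2) \<le> dist \<zeta> q \<Longrightarrow> g q + y \<bullet> (\<zeta> - q) + \<omega> \<le> g \<zeta>"
            using tan[OF qB] by blast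
          have "t < 1" using t(2,3) q False p r by (cases "t = 1") auto
          have "0 \<le> (x - y) \<bullet> (p - q)" using x(1)[of q] y(1)[of p] by (simp add: inner_diff_left inner_diff_right)
          also have "p - q = (1 - t) *\<^sub>R (p - \<xi>)" by (simp add: q_def algebra_simps)
          finally have "0 \<le> (x - y) \<bullet> (p - \<xi>)" using \<open>t < 1\<close> by (simp add: zero_le_mult_iff)
          then have "0 \<le> t * ((x - y) \<bullet> (p - \<xi>))" using tpos by simp
          then have "0 \<le> (x - y) \<bullet> (q - \<xi>)" by (simp add: q_def)
          then have "g p + x \<bullet> (\<xi> - p) \<le> g q + y \<bullet> (\<xi> - q)"
            using x(1)[of q] by (simp add: inner_diff_left inner_diff_right)
          moreover have "g q + y \<bullet> (\<xi> - q) + \<omega> \<le> g \<xi>" using y(2)[OF \<xi>B] far[of q] q by auto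
          ultimately show ?thesis by linarith
        qed
      qed
      obtain x where x: "\<And>\<xi>. g p + x \<bullet> (\<xi> - p) \<le> g \<xi>"
        "p \<in> B \<Longrightarrow> (\<forall>\<xi>. \<xi> \<in> B \<and> min \<delta> (r / 2) \<le> dist \<xi> p \<longrightarrow> g p + x \<bullet> (\<xi> - p) + \<omega> \<le> g \<xi>)"
      proof (cases "p \<in> B")
        case True
        from tan[OF True] show ?thesis using that by blast
      next
        case False
        obtain x where "subgrad UNIV g p x" using subgrad_ex[OF cvg, of p] by auto
        then show ?thesis using that False by (auto simp: subgrad_def)
      qed
      have "x \<bullet> p + (g p - x \<bullet> p) \<le> v p"
        unfolding v_def
      proof (rule hull_fun_upper)
        fix \<xi>
        have "g p + x \<bullet> (\<xi> - p) \<le> g \<xi> - h \<xi> / C"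
        proof (cases "norm \<xi> < r / 2")
          case True
          then show ?thesis using bracket[OF x True] hC[of \<xi>] by linarith
        next
          case False
          then show ?thesis using supp[of \<xi>] x(1)[of \<xi>] by simp
        qed
        then show "x \<bullet> \<xi> + (g p - x \<bullet> p) \<le> ?k \<xi>" by (simp add: inner_diff_right)
      qed
      then show "g p \<le> v p" by simp
    qed
    have "cls v" unfolding cls_def using convex_hull_fun[OF ex] outer by (auto simp: v_def)
    then show ?thesis using v_le inner_minorant by blast
  qed
  then show ?thesis using C0 by blast
qed

text \<open>The conclusion says that the first variation of \<open>E f\<close> at \<open>g\<close>
  towards \<open>W\<close> is not positive. Were it positive, the opposite direction would lower the
  energy, but it is available only as \<open>v\<close>, which is \<open>g - h / C\<close> up to
  \<open>e / C\<close>. A mixture of \<open>v\<close> and \<open>W\<close> returns to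
  \<open>g\<close> up to \<open>\<theta> * e\<close>; expanding it quadratically, dividing by
  \<open>\<theta>\<close> and letting \<open>C\<close> tend to infinity and then \<open>e\<close> to
  0 gives the claim.\<close>

lemma stationary:
  assumes strict: uniformly_strict and f: "continuous_on UNIV f" and k: "taylor_bound f k"
    and W: "cls W" "\<And>\<xi>. g \<xi> \<le> W \<xi>" "\<And>\<xi>. r / 2 \<le> norm \<xi> \<Longrightarrow> W \<xi> = g \<xi>" "\<And>\<xi>. W \<xi> - g \<xi> \<le> H"
    and e0: "0 < e0" and min: "\<And>V. cls V \<Longrightarrow> (\<And>\<xi>. \<xi> \<in> B \<Longrightarrow> \<bar>V \<xi> - g \<xi>\<bar> \<le> e0) \<Longrightarrow> E f g \<le> E f V"
  shows "4 * E f (\<lambda>\<xi>. (1 - 1/2) * g \<xi> + 1/2 * W \<xi>) \<le> E f W + 3 * E f g"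
proof -
  define h where "h \<xi> = W \<xi> - g \<xi>" for \<xi>
  have h: "continuous_on UNIV h" "\<And>\<xi>. 0 \<le> h \<xi>" "\<And>\<xi>. h \<xi> \<le> H" "\<And>\<xi>. r / 2 \<le> norm \<xi> \<Longrightarrow> h \<xi> = 0"
  proof -
    show "continuous_on UNIV h" unfolding h_def
      by (rule continuous_on_diff[OF cls_continuous[OF W(1)] cls_continuous[OF cls_g]])
  qed (use W in \<open>auto simp: h_def\<close>)
  have H0: "0 \<le> H" using h(2,3)[of 0] by linarith
  let ?M = "\<lambda>\<xi>. (1 - 1/2) * g \<xi> + 1/2 * W \<xi>"
  have M: "cls ?M" by (rule cls_combination[OF cls_g W(1)]) auto
  define K where "K = 32 * \<bar>k\<bar> * \<rho> * R"
  have K0: "0 \<le> K" using rho0 R0 by (simp add: K_def)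
  define Q where "Q = 2 * E f g + 2 * E f W - 4 * E f ?M"
  have main: "E f W - E f g \<le> K * e + Q" if e: "0 < e" for e
  proof -
    obtain C0 where C0: "C0 > 0" and var: "\<And>C. C0 \<le> C \<Longrightarrow> \<exists>v. cls v \<and> (\<forall>\<xi>. v \<xi> \<le> g \<xi> - h \<xi> / C) \<and> (\<forall>\<xi>\<in>B. g \<xi> - h \<xi> / C - e / C \<le> v \<xi>)"
      using downward_variation[OF strict h(1,2,3,4) e] by blast
    define D where "D = 4 * K * (H + e) + \<bar>Q\<bar>"
    have bd: "E f W - E f g - (K * e + Q) \<le> D / C" if C: "max C0 ((H + e) / e0) \<le> C" for C
    proof -
      have Cpos: "C > 0" using C C0 by simp
      obtain v where v: "cls v" "\<And>\<xi>. v \<xi> \<le> g \<xi> - h \<xi> / C" "\<And>\<xi>. \<xi> \<in> B \<Longrightarrow> g \<xi> - h \<xi> / C - e / C \<le> v \<xi>"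
        using var[of C] C by auto
      define d where "d = (H + e) / C"
      have d0: "d \<le> e0"
      proof -
        have "(H + e) / e0 \<le> C" using C by simp
        then show ?thesis using e0 Cpos by (simp add: d_def pos_divide_le_eq mult.commute)
      qed
      have vg: "\<bar>v \<xi> - g \<xi>\<bar> \<le> d" if "\<xi> \<in> B" for \<xi>
      proof -
        have "0 \<le> h \<xi> / C" "h \<xi> / C + e / C \<le> d"
          using h(2,3)[of \<xi>] Cpos by (simp_all add: d_def add_divide_distrib[symmetric] divide_right_mono)
        then show ?thesis using v(2)[of \<xi>] v(3)[OF that] by linarith
      qed
      have Ev: "E f g \<le> E f v" by (rule min[OF v(1)]) (use vg d0 order_trans in blast)
      have Ev': "\<bar>E f v - E f g\<bar> \<le> K * d"
        using E_Lipschitz[OF f k cls_g v(1), of d] vg by (simp add: K_def abs_minus_commute)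
      let ?Mv = "\<lambda>\<xi>. (1 - 1/2) * v \<xi> + 1/2 * W \<xi>"
      have Mv: "cls ?Mv" by (rule cls_combination[OF v(1) W(1)]) auto
      have EM: "\<bar>E f ?Mv - E f ?M\<bar> \<le> K * (d / 2)"
        unfolding K_def
      proof (rule E_Lipschitz[OF f k M Mv])
        fix \<xi> assume "\<xi> \<in> B"
        from vg[OF this] show "\<bar>((1 - 1/2) * g \<xi> + 1/2 * W \<xi>) - ((1 - 1/2) * v \<xi> + 1/2 * W \<xi>)\<bar> \<le> d / 2"
          by (simp add: abs_le_iff field_simps)
      qed
      \<comment> \<open>The weight for which \<open>(1 - \<theta>) / C = \<theta>\<close>, so that
        the variations \<open>- h / C\<close> and \<open>h\<close> cancel in
        \<open>?Z\<close>.\<close>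
      define \<theta> where "\<theta> = 1 / (C + 1)"
      have \<theta>: "0 < \<theta>" "\<theta> < 1" "1 - \<theta> = C * \<theta>" using Cpos by (simp_all add: \<theta>_def field_simps)
      have th: "0 \<le> \<theta>" "\<theta> \<le> 1" using \<theta> by simp_all
      let ?Z = "\<lambda>\<xi>. (1 - \<theta>) * v \<xi> + \<theta> * W \<xi>"
      have Z: "cls ?Z" by (rule cls_combination[OF v(1) W(1) th])
      have "\<bar>g \<xi> - ?Z \<xi>\<bar> \<le> \<theta> * e" if "\<xi> \<in> B" for \<xi>
      proof -
        have "?Z \<xi> - g \<xi> = (1 - \<theta>) * (v \<xi> - g \<xi>) + \<theta> * h \<xi>" by (simp add: h_def algebra_simps)
        also have "\<dots> = \<theta> * (C * (v \<xi> - g \<xi>) + h \<xi>)" unfolding \<theta>(3) by (simp add: algebra_simps)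
        finally have eq: "?Z \<xi> - g \<xi> = \<theta> * (C * (v \<xi> - g \<xi>) + h \<xi>)" .
        have "C * (v \<xi> - g \<xi>) \<le> C * (- (h \<xi> / C))" "C * (- (h \<xi> / C) - e / C) \<le> C * (v \<xi> - g \<xi>)"
          using v(2)[of \<xi>] v(3)[OF that] Cpos by (intro mult_left_mono; simp)+
        then have "\<bar>C * (v \<xi> - g \<xi>) + h \<xi>\<bar> \<le> e" using Cpos by (simp add: abs_le_iff right_diff_distrib)
        then have "\<theta> * \<bar>C * (v \<xi> - g \<xi>) + h \<xi>\<bar> \<le> \<theta> * e" using \<theta> by (intro mult_left_mono) auto
        then show ?thesis using eq \<theta>(1) by (simp add: abs_minus_commute[of "g \<xi>"] abs_mult)
      qed
      from E_Lipschitz[OF f k cls_g Z this] have EZ: "E f ?Z \<le> E f g + K * (\<theta> * e)" by (simp add: K_def)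
      define Qv where "Qv = 2 * E f v + 2 * E f W - 4 * E f ?Mv"
      have "E f ?Z = (1 - \<theta>) * E f v + \<theta> * E f W - \<theta> * (1 - \<theta>) * Qv"
        unfolding Qv_def by (rule E_quadratic[OF v(1) W(1) th f])
      moreover have "(1 - \<theta>) * E f g \<le> (1 - \<theta>) * E f v" using Ev \<theta> by (intro mult_left_mono) auto
      ultimately have "\<theta> * (E f W - E f g) \<le> \<theta> * (K * e + (1 - \<theta>) * Qv)"
        using EZ by (simp add: algebra_simps)
      then have 1: "E f W - E f g \<le> K * e + (1 - \<theta>) * Qv" using \<theta>(1) by simp
      have "Qv \<le> Q + 4 * (K * d)" using Ev' EM unfolding Qv_def Q_def by (simp only: times_divide_eq_right)
      then have "Qv \<le> Q + 4 * K * d" by simp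
      then have "(1 - \<theta>) * Qv \<le> (1 - \<theta>) * (Q + 4 * K * d)" using \<theta> by (intro mult_left_mono) auto
      also have "\<dots> \<le> Q + \<theta> * \<bar>Q\<bar> + 4 * K * d"
      proof -
        have "0 \<le> d" using H0 e Cpos by (simp add: d_def)
        then have "0 \<le> \<theta> * (4 * K * d)" using K0 \<theta> by simp
        moreover have "- (\<theta> * Q) \<le> \<theta> * \<bar>Q\<bar>" using \<theta> by (simp add: abs_if)
        ultimately show ?thesis by (simp add: algebra_simps)
      qed
      also have "\<theta> * \<bar>Q\<bar> \<le> \<bar>Q\<bar> / C"
      proof -
        have "\<theta> \<le> 1 / C" using Cpos by (simp add: \<theta>_def frac_le)
        then have "\<theta> * \<bar>Q\<bar> \<le> 1 / C * \<bar>Q\<bar>" by (intro mult_right_mono) auto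
        then show ?thesis by simp
      qed
      finally have "(1 - \<theta>) * Qv \<le> Q + \<bar>Q\<bar> / C + 4 * K * d" by simp
      moreover have "D / C = 4 * K * d + \<bar>Q\<bar> / C" using Cpos by (simp add: D_def d_def field_simps)
      ultimately show ?thesis using 1 by linarith
    qed
    have lim: "((\<lambda>C. D / C) \<longlongrightarrow> 0) at_top"
      by (intro tendsto_divide_0[OF tendsto_const] filterlim_at_top_imp_at_infinity filterlim_ident)
    have "\<forall>\<^sub>F C in at_top. E f W - E f g - (K * e + Q) \<le> D / C"
      using eventually_ge_at_top[of "max C0 ((H + e) / e0)"] by eventually_elim (rule bd)
    from tendsto_lowerbound[OF lim this] show ?thesis by simp
  qed
  have "E f W - E f g - Q \<le> 0"
  proof (rule field_le_epsilon)
    fix e :: real assume e: "0 < e"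
    have "K * (e / (K + 1)) \<le> e" using K0 e by (simp add: field_simps)
    then show "E f W - E f g - Q \<le> 0 + e" using main[of "e / (K + 1)"] e K0 by simp
  qed
  then show ?thesis by (simp add: Q_def)
qed

section \<open>Lowering the energy for concave and for convex integrands\<close>

theorem not_minimal:
  assumes strict: uniformly_strict and f: "continuous_on UNIV f" and k: "taylor_bound f k"
    and \<tau>: "norm \<tau> = 1" and k2: "0 < k2"
    and conc: "\<And>x h. 0 < h \<Longrightarrow> x - h \<ge> -\<rho> \<Longrightarrow> x + h \<le> \<rho> \<Longrightarrow> f ((x + h) *\<^sub>R \<tau>) - 2 * f (x *\<^sub>R \<tau>) + f ((x - h) *\<^sub>R \<tau>) \<le> - k2 * h^2"
    and e0: "0 < e0"
  shows "\<exists>V. cls V \<and> (\<forall>\<xi>\<in>B. \<bar>V \<xi> - g \<xi>\<bar> \<le> e0) \<and> E f V < E f g"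
proof (rule ccontr)
  assume "\<not> ?thesis"
  then have min: "\<And>V. cls V \<Longrightarrow> (\<And>\<xi>. \<xi> \<in> B \<Longrightarrow> \<bar>V \<xi> - g \<xi>\<bar> \<le> e0) \<Longrightarrow> E f g \<le> E f V" by (meson not_less)
  have r2: "r / 2 > 0" using r by simp
  obtain m where m: "m > 0" and tan: "\<forall>p\<in>B. \<exists>x. \<forall>\<xi>. g p + x \<bullet> (\<xi> - p) \<le> g \<xi> \<and>
     (\<xi> \<in> B \<and> r / 2 \<le> dist \<xi> p \<longrightarrow> g p + x \<bullet> (\<xi> - p) + m \<le> g \<xi>)"
    using strict r2 unfolding uniformly_strict_def by blast
  have "0 \<in> B" using rho0 by simp
  with tan obtain x0 where x0: "\<And>\<xi>. g 0 + x0 \<bullet> \<xi> \<le> g \<xi>" "\<And>\<xi>. \<xi> \<in> B \<Longrightarrow> r / 2 \<le> norm \<xi> \<Longrightarrow> g 0 + x0 \<bullet> \<xi> + m \<le> g \<xi>"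
    by fastforce
  \<comment> \<open>The bounds by \<open>m\<close> make the wedge fall below \<open>g\<close> from
    radius \<open>r / 2\<close> on; the bounds by \<open>e0\<close> keep \<open>W\<close> within
    \<open>e0\<close> of \<open>g\<close>, each of the two terms taking one half.\<close>
  define \<sigma> \<kappa> where "\<sigma> = min (m / 2) (e0 / 2)" and "\<kappa> = min (m / r) (e0 / r)"
  have \<sigma>: "0 < \<sigma>" "\<sigma> \<le> m / 2" "\<sigma> \<le> e0 / 2" and \<kappa>: "0 < \<kappa>" "\<kappa> \<le> m / r" "\<kappa> \<le> e0 / r"
    using m e0 r by (simp_all add: \<sigma>_def \<kappa>_def)
  have pt: "\<bar>perp \<tau> \<bullet> \<xi>\<bar> \<le> norm \<xi>" for \<xi> using Cauchy_Schwarz_ineq2[of "perp \<tau>" \<xi>] \<tau> by simp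
  define W where "W \<xi> = max (g \<xi>) (wedge x0 \<tau> \<sigma> \<kappa> \<xi>)" for \<xi>
  text \<open>Convexity along rays makes \<open>g\<close> grow linearly away from its tangent plane, hence above the wedge.\<close>
  have far: "wedge x0 \<tau> \<sigma> \<kappa> \<xi> \<le> g \<xi>" if n: "r / 2 \<le> norm \<xi>" for \<xi>
  proof -
    define s where "s = (r / 2) / norm \<xi>"
    have npos: "norm \<xi> > 0" using n r2 by linarith
    have s: "0 < s" "s \<le> 1" using n npos r2 by (simp_all add: s_def)
    have ns: "norm (s *\<^sub>R \<xi>) = r / 2" using npos r2 by (simp add: s_def)
    have "s *\<^sub>R \<xi> \<in> B" using ns r by simp
    from x0(2)[OF this] ns have "g 0 + s * (x0 \<bullet> \<xi>) + m \<le> g (s *\<^sub>R \<xi>)" by simp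
    also have "\<dots> \<le> (1 - s) * g 0 + s * g \<xi>"
      using convex_onD[OF cvg, of s 0 \<xi>] s by simp
    finally have "m \<le> s * (g \<xi> - (g 0 + x0 \<bullet> \<xi>))" by (simp add: algebra_simps)
    then have "m / s \<le> g \<xi> - (g 0 + x0 \<bullet> \<xi>)" using s by (simp add: pos_divide_le_eq mult.commute)
    moreover have "m / s = 2 * (m / r) * norm \<xi>" using npos r by (simp add: s_def field_simps)
    ultimately have 1: "2 * (m / r) * norm \<xi> \<le> g \<xi> - (g 0 + x0 \<bullet> \<xi>)" by simp
    have "\<kappa> * \<bar>perp \<tau> \<bullet> \<xi>\<bar> \<le> (m / r) * norm \<xi>" using \<kappa> pt[of \<xi>] by (intro mult_mono) auto
    moreover have "m / 2 \<le> (m / r) * norm \<xi>"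
      using mult_left_mono[OF n, of "m / r"] m r by simp
    ultimately have "\<sigma> + \<kappa> * \<bar>perp \<tau> \<bullet> \<xi>\<bar> \<le> (m / r) * norm \<xi> + (m / r) * norm \<xi>"
      by (intro add_mono order_trans[OF \<sigma>(2)])
    also have "\<dots> \<le> g \<xi> - (g 0 + x0 \<bullet> \<xi>)" using 1 by simp
    finally show ?thesis unfolding wedge_def by simp
  qed
  have Wg: "W \<xi> = g \<xi>" if "r / 2 \<le> norm \<xi>" for \<xi> using far[OF that] by (simp add: W_def)
  have cw: "convex_on UNIV (wedge x0 \<tau> \<sigma> \<kappa>)"
  proof (rule convex_onI)
    fix t :: real and x y :: "real^2" assume t: "0 < t" "t < 1"
    have "\<bar>perp \<tau> \<bullet> ((1 - t) *\<^sub>R x + t *\<^sub>R y)\<bar> \<le> (1 - t) * \<bar>perp \<tau> \<bullet> x\<bar> + t * \<bar>perp \<tau> \<bullet> y\<bar>"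
      using abs_triangle_ineq[of "(1 - t) * (perp \<tau> \<bullet> x)" "t * (perp \<tau> \<bullet> y)"] t by (simp add: inner_add_right abs_mult)
    then have "\<kappa> * \<bar>perp \<tau> \<bullet> ((1 - t) *\<^sub>R x + t *\<^sub>R y)\<bar> \<le> \<kappa> * ((1 - t) * \<bar>perp \<tau> \<bullet> x\<bar> + t * \<bar>perp \<tau> \<bullet> y\<bar>)"
      using \<kappa> by (intro mult_left_mono) auto
    then show "wedge x0 \<tau> \<sigma> \<kappa> ((1 - t) *\<^sub>R x + t *\<^sub>R y) \<le> (1 - t) * wedge x0 \<tau> \<sigma> \<kappa> x + t * wedge x0 \<tau> \<sigma> \<kappa> y"
      unfolding wedge_def by (simp add: inner_add_right algebra_simps)
  qed simp
  have W: "cls W"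
    unfolding cls_def
  proof
    show "convex_on UNIV W"
    proof (rule convex_onI)
      fix t :: real and x y :: "real^2" assume t: "0 < t" "t < 1"
      have 1: "g ((1 - t) *\<^sub>R x + t *\<^sub>R y) \<le> (1 - t) * g x + t * g y"
        "wedge x0 \<tau> \<sigma> \<kappa> ((1 - t) *\<^sub>R x + t *\<^sub>R y) \<le> (1 - t) * wedge x0 \<tau> \<sigma> \<kappa> x + t * wedge x0 \<tau> \<sigma> \<kappa> y"
        using convex_onD[OF cvg, of t x y] convex_onD[OF cw, of t x y] t by simp_all
      have 3: "(1 - t) * g x + t * g y \<le> (1 - t) * W x + t * W y"
        "(1 - t) * wedge x0 \<tau> \<sigma> \<kappa> x + t * wedge x0 \<tau> \<sigma> \<kappa> y \<le> (1 - t) * W x + t * W y"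
        unfolding W_def using t by (intro add_mono mult_left_mono; simp)+
      show "W ((1 - t) *\<^sub>R x + t *\<^sub>R y) \<le> (1 - t) * W x + t * W y"
        using order_trans[OF 1(1) 3(1)] order_trans[OF 1(2) 3(2)] unfolding W_def by simp
    qed simp
    show "\<forall>\<xi>. r \<le> norm \<xi> \<longrightarrow> W \<xi> = g \<xi>" using Wg r by auto
  qed
  have H: "W \<xi> - g \<xi> \<le> e0" for \<xi>
  proof (cases "r / 2 \<le> norm \<xi>")
    case True then show ?thesis using Wg e0 by simp
  next
    case False
    have "\<kappa> * \<bar>perp \<tau> \<bullet> \<xi>\<bar> \<le> (e0 / r) * (r / 2)"
      using \<kappa> pt[of \<xi>] False e0 r by (intro mult_mono) auto
    also have "\<dots> = e0 / 2" using r by simp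
    finally show ?thesis using x0(1)[of \<xi>] \<sigma>(3) e0 unfolding W_def wedge_def by auto
  qed
  have ge: "g \<xi> \<le> W \<xi>" for \<xi> by (simp add: W_def)
  have "3 * E f W + E f g < 4 * E f (\<lambda>\<xi>. (1 - 1/2) * g \<xi> + 1/2 * W \<xi>)"
    by (rule wedge_decreases[OF \<tau> \<sigma>(1) \<kappa>(1) W W_def f k2 conc])
  moreover have "4 * E f (\<lambda>\<xi>. (1 - 1/2) * g \<xi> + 1/2 * W \<xi>) \<le> E f W + 3 * E f g"
    by (rule stationary[OF strict f k W ge Wg H e0 min])
  moreover have "E f g \<le> E f W"
  proof (rule min[OF W])
    show "\<bar>W \<xi> - g \<xi>\<bar> \<le> e0" for \<xi> using H[of \<xi>] ge[of \<xi>] by simp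
  qed
  ultimately show False by linarith
qed

end

context dual_model
begin

text \<open>The envelope \<open>V\<close> of \<open>g\<close> minus a small tent lies below
  \<open>g\<close>, so it does not raise the energy of the convex remainder
  \<open>f - k * (\<xi> \<bullet> \<xi>)\<close>. The energy of the square drops strictly, because
  in every direction the hinges through points near 0 detect \<open>V 0 < g 0\<close>.\<close>

theorem not_minimal_convex:
  assumes strict: uniformly_strict and f: "continuous_on UNIV f" and k: "0 < k"
    and conv: "\<And>p. p \<in> B \<Longrightarrow> \<exists>a. \<forall>\<xi>\<in>B. f p + a \<bullet> (\<xi> - p) + k * ((\<xi> - p) \<bullet> (\<xi> - p)) \<le> f \<xi>"
    and e0: "0 < e0"
  shows "\<exists>V. cls V \<and> (\<forall>\<xi>\<in>B. \<bar>V \<xi> - g \<xi>\<bar> \<le> e0) \<and> E f V < E f g"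
proof -
  define h where "h \<xi> = max 0 (r / 2 - norm \<xi>)" for \<xi> :: "real^2"
  have h: "continuous_on UNIV h" "\<And>\<xi>. 0 \<le> h \<xi>" "\<And>\<xi>. h \<xi> \<le> r / 2" "\<And>\<xi>. r / 2 \<le> norm \<xi> \<Longrightarrow> h \<xi> = 0" "h 0 > 0"
  proof -
    show "h \<xi> \<le> r / 2" for \<xi> unfolding h_def using r norm_ge_zero[of \<xi>] by (intro max.boundedI) linarith+
  qed (use r in \<open>auto simp: h_def intro!: continuous_intros\<close>)
  obtain C0 where C0: "C0 > 0" and var: "\<And>C. C0 \<le> C \<Longrightarrow> \<exists>v. cls v \<and> (\<forall>\<xi>. v \<xi> \<le> g \<xi> - h \<xi> / C) \<and> (\<forall>\<xi>\<in>B. g \<xi> - h \<xi> / C - 1 / C \<le> v \<xi>)"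
    using downward_variation[OF strict h(1,2,3,4), of 1] by auto
  define C where "C = max C0 ((r / 2 + 1) / e0)"
  have C: "C0 \<le> C" "(r / 2 + 1) / e0 \<le> C" "0 < C" using C0 by (auto simp: C_def)
  obtain V where V: "cls V" "\<And>\<xi>. V \<xi> \<le> g \<xi> - h \<xi> / C" "\<And>\<xi>. \<xi> \<in> B \<Longrightarrow> g \<xi> - h \<xi> / C - 1 / C \<le> V \<xi>"
    using var[OF C(1)] by blast
  have Vle: "V \<xi> \<le> g \<xi>" for \<xi> using V(2)[of \<xi>] divide_nonneg_pos[OF h(2)[of \<xi>] C(3)] by linarith
  have V0: "V 0 < g 0" using V(2)[of 0] divide_pos_pos[OF h(5) C(3)] by linarith
  have close: "\<bar>V \<xi> - g \<xi>\<bar> \<le> e0" if "\<xi> \<in> B" for \<xi>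
  proof -
    have "r / 2 + 1 \<le> e0 * C" using C(2) e0 by (simp add: pos_divide_le_eq mult.commute)
    then have "h \<xi> / C + 1 / C \<le> e0"
      using h(3)[of \<xi>] C(3) by (simp add: add_divide_distrib[symmetric] pos_divide_le_eq)
    then show ?thesis using V(3)[OF that] Vle[of \<xi>] by (simp add: abs_le_iff)
  qed
  define \<Psi> where "\<Psi> f = (\<Sum>(a, W)\<leftarrow>[(1, g), (-1, V)]. a * E f W)" for f
  define K where "K = area * (\<Sum>(a, W)\<leftarrow>[(1, g), (-1, V)]. \<bar>a\<bar>)"
  interpret ridge_functional \<rho> K \<Psi>
    unfolding \<Psi>_def K_def by (rule functional_family) (use V(1) cls_g in auto)
  have \<Psi>: "\<Psi> f = E f g - E f V" for f by (simp add: \<Psi>_def)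
  have sq: "E (\<lambda>\<xi>. (c \<bullet> \<xi>)^2) V < E (\<lambda>\<xi>. (c \<bullet> \<xi>)^2) g" if c: "norm c = 1" for c
  proof -
    have nonneg: "0 \<le> \<Psi> (hinge c b)" if "\<bar>b\<bar> < \<rho>" for b
      unfolding \<Psi> using hinge_mono[OF c that V(1) cls_g] Vle by simp
    have b0: "\<bar>0::real\<bar> < \<rho>" using rho0 by simp
    define D where "D y = slice_conj c 0 V y - slice_conj c 0 g y" for y
    have D0: "0 \<le> D y" for y
      unfolding D_def slice_conj_def using conj_on_mono[OF compact_chord[OF c b0] continuous_slice[OF c b0 V(1)] continuous_slice[OF c b0 cls_g]] Vle
      by simp
    have Dc: "continuous_on S D" for S
      unfolding D_def by (intro continuous_intros continuous_slice_conj c b0 V(1) cls_g)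
    obtain x where x: "subgrad UNIV g 0 x" using subgrad_ex[OF cvg, of 0] by auto
    \<comment> \<open>At this \<open>y\<close> the function \<open>g\<close> on the chord through 0
      attains its conjugate at 0, with value \<open>- g 0\<close>, whereas \<open>V\<close> gives at
      least \<open>- V 0\<close>. So \<open>D\<close> is positive at one point of the open interval,
      and by continuity its integral is positive.\<close>
    define y0 where "y0 = perp c \<bullet> x"
    have "norm x \<le> L"
    proof -
      have "norm x * norm x \<le> g x - g 0" using subgradD[OF x, of x] by (simp add: power2_norm_eq_inner[symmetric] power2_eq_square)
      also have "\<dots> \<le> L * norm x" using lipschitz_onD[OF lipg, of x 0] by (simp add: dist_real_def)
      finally show ?thesis using L0 by (cases "x = 0") auto
    qed
    then have y0: "\<bar>y0\<bar> < R" using Cauchy_Schwarz_ineq2[of "perp c" x] c L by (simp add: y0_def)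
    have "D y0 > 0"
    proof -
      have "slice_conj c 0 g y0 \<le> - g 0"
      proof -
        obtain \<eta> where \<eta>: "slice_conj c 0 g y0 = \<eta> \<bullet> y0 - g (frame c 0 \<eta>)"
          using slice_conj_attained[OF c b0 cls_g, of y0] by blast
        have "g 0 + x \<bullet> (frame c 0 \<eta> - 0) \<le> g (frame c 0 \<eta>)" by (rule subgradD[OF x]) simp
        then show ?thesis using \<eta> by (simp add: frame_def y0_def inner_commute)
      qed
      moreover have "0 \<bullet> y0 - V (frame c 0 0) \<le> slice_conj c 0 V y0"
        by (rule slice_conj_upper[OF c b0 V(1)]) (use chord_pos[OF b0] in auto)
      ultimately show ?thesis using V0 by (simp add: D_def frame_def)
    qed
    have \<sigma>: "0 < \<Psi> (hinge c 0)"
    proof -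
      have "\<Psi> (hinge c 0) = (LINT y:{-R..R}|lborel. D y)"
        using hinge_difference[OF c b0 V(1) cls_g] by (simp add: \<Psi> D_def)
      also have "\<dots> = integral {-R..R} D"
        by (rule set_borel_integral_eq_integral) (use borel_integrable_compact[OF compact_Icc Dc] in \<open>simp add: set_integrable_def\<close>)
      finally have eq: "\<Psi> (hinge c 0) = integral {-R..R} D" .
      have "integral {-R..R} D \<noteq> 0"
      proof
        assume "integral {-R..R} D = 0"
        then have "D y0 = 0"
          using integral_eq_0_iff[of "-R" R D] Dc D0 y0 R0 by (auto simp: abs_less_iff)
        then show False using \<open>D y0 > 0\<close> by simp
      qed
      moreover have "0 \<le> integral {-R..R} D" using D0 Dc by (intro integral_nonneg integrable_continuous_interval) auto
      ultimately show ?thesis using eq by simp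
    qed
    \<comment> \<open>\<open>\<Psi> (hinge c b)\<close> is \<open>K\<close>-Lipschitz in
      \<open>b\<close>; within \<open>l\<close> of 0 it keeps half of its value at 0.\<close>
    define l where "l = min (\<rho> / 2) (\<Psi> (hinge c 0) / (2 * (K + 1)))"
    have l: "0 < l" "l < \<rho>" using rho0 \<sigma> C0 ridge_functional.C0[OF ridge_functional_axioms] by (auto simp: l_def)
    have pos: "\<Psi> (hinge c 0) / 2 \<le> \<Psi> (hinge c b)" if b: "\<bar>b\<bar> \<le> l" for b
    proof -
      have "\<bar>\<Psi> (hinge c 0) - \<Psi> (hinge c b)\<bar> \<le> K * l"
        by (rule diff_bound[OF continuous_on_hinge continuous_on_hinge]) (use b in \<open>auto simp: hinge_def\<close>)
      also have "\<dots> \<le> (K + 1) * (\<Psi> (hinge c 0) / (2 * (K + 1)))"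
        using ridge_functional.C0[OF ridge_functional_axioms] l by (intro mult_mono) (auto simp: l_def)
      also have "\<dots> = \<Psi> (hinge c 0) / 2" using ridge_functional.C0[OF ridge_functional_axioms] by (simp add: field_simps)
      finally show ?thesis by linarith
    qed
    have cont: "continuous_on UNIV (\<lambda>s::real. - (s^2))" by (intro continuous_intros)
    have "\<Psi> (\<lambda>\<xi>. (\<lambda>s. - (s^2)) (c \<bullet> \<xi>)) < 0"
    proof (rule strictly_concave_ridge[OF cont c _ _ nonneg _ l pos])
      show "(0::real) < 2" by simp
      show "- ((x + h)\<^sup>2) - 2 * - (x\<^sup>2) + - ((x - h)\<^sup>2) \<le> - 2 * h\<^sup>2" for x h :: real
        by (simp add: power2_eq_square algebra_simps)
    qed (use \<sigma> in auto)
    then show ?thesis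
      using cmult[of "\<lambda>\<xi>. (c \<bullet> \<xi>)^2" "-1"] by (simp add: \<Psi> continuous_intros)
  qed
  let ?q = "\<lambda>\<xi>::real^2. \<xi> \<bullet> \<xi>"
  have q: "continuous_on UNIV ?q" by (intro continuous_intros)
  have sqE: "E ?q U = E (\<lambda>\<xi>. (\<xi> $ 1)^2) U + E (\<lambda>\<xi>. (\<xi> $ 2)^2) U" if "cls U" for U
    using E_add[OF that, of "\<lambda>\<xi>. (\<xi> $ 1)^2" "\<lambda>\<xi>. (\<xi> $ 2)^2"]
    by (simp add: inner_vec2 power2_eq_square continuous_intros)
  have "E ?q V < E ?q g"
    unfolding sqE[OF V(1)] sqE[OF cls_g] using sq[of "axis 1 1"] sq[of "axis 2 1"] by (simp add: inner_axis')
  then have lt: "k * E ?q V < k * E ?q g" using k by simp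
  have cf: "continuous_on UNIV (\<lambda>\<xi>. (- k) * ?q \<xi>)" using q by (auto intro!: continuous_intros)
  have "E (\<lambda>\<xi>. f \<xi> + (- k) * ?q \<xi>) V \<le> E (\<lambda>\<xi>. f \<xi> + (- k) * ?q \<xi>) g"
  proof (rule E_mono_convex[OF V(1) cls_g Vle])
    show "continuous_on UNIV (\<lambda>\<xi>. f \<xi> + (- k) * ?q \<xi>)" using f cf by (rule continuous_on_add)
    fix p assume "p \<in> B"
    then obtain a where a: "\<And>\<xi>. \<xi> \<in> B \<Longrightarrow> f p + a \<bullet> (\<xi> - p) + k * ((\<xi> - p) \<bullet> (\<xi> - p)) \<le> f \<xi>"
      using conv by blast
    have "f p + (- k) * ?q p + (a - (2 * k) *\<^sub>R p) \<bullet> (\<xi> - p) \<le> f \<xi> + (- k) * ?q \<xi>" if "\<xi> \<in> B" for \<xi>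
    proof -
      have "\<xi> \<bullet> \<xi> = p \<bullet> p + 2 * (p \<bullet> (\<xi> - p)) + (\<xi> - p) \<bullet> (\<xi> - p)"
        by (simp add: inner_diff_left inner_diff_right inner_commute[of \<xi> p])
      then have "k * (\<xi> \<bullet> \<xi>) = k * (p \<bullet> p) + 2 * k * (p \<bullet> (\<xi> - p)) + k * ((\<xi> - p) \<bullet> (\<xi> - p))"
        by (simp only: distrib_left mult.assoc mult.left_commute)
      moreover have "(a - (2 * k) *\<^sub>R p) \<bullet> (\<xi> - p) = a \<bullet> (\<xi> - p) - 2 * k * (p \<bullet> (\<xi> - p))"
        by (simp add: inner_diff_left)
      ultimately show ?thesis using a[OF that] by simp
    qed
    then show "\<exists>a. \<forall>\<xi>\<in>B. f p + (- k) * ?q p + a \<bullet> (\<xi> - p) \<le> f \<xi> + (- k) * ?q \<xi>" by blast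
  qed
  then have "E f V - k * E ?q V \<le> E f g - k * E ?q g"
    using E_add[OF V(1) f cf] E_add[OF cls_g f cf] E_cmult[of "- k" ?q V] E_cmult[of "- k" ?q g] by simp
  then show ?thesis using V(1) close lt by (intro exI[of _ V]) auto
qed

end

section \<open>Twice differentiable integrands\<close>

lemma C2_line:
  fixes f :: "real^'n \<Rightarrow> real"
  assumes f: "C2_function f"
  shows "((\<lambda>t. f (p + t *\<^sub>R d)) has_real_derivative (d \<bullet> gradient f (p + t *\<^sub>R d))) (at t)"
    and "((\<lambda>t. v \<bullet> gradient f (p + t *\<^sub>R d)) has_real_derivative (v \<bullet> (hessian f (p + t *\<^sub>R d) *v d))) (at t)"
    and "(gradient f has_derivative (\<lambda>h. hessian f p *v h)) (at p)"
proof -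
  show "((\<lambda>t. f (p + t *\<^sub>R d)) has_real_derivative (d \<bullet> gradient f (p + t *\<^sub>R d))) (at t)"
    by (rule GDERIV_line, rule differentiable_imp_GDERIV) (use f in \<open>simp add: C2_function_def\<close>)
  have H: "(gradient f has_derivative (\<lambda>h. hessian f x *v h)) (at x)" for x
  proof -
    have "(gradient f has_derivative frechet_derivative (gradient f) (at x)) (at x)"
      using f by (simp add: C2_function_def frechet_derivative_works[symmetric])
    moreover from has_derivative_linear[OF this] have "frechet_derivative (gradient f) (at x) = (\<lambda>h. hessian f x *v h)"
      unfolding hessian_def by (simp add: matrix_works)
    ultimately show ?thesis by simp
  qed
  show "(gradient f has_derivative (\<lambda>h. hessian f p *v h)) (at p)" by (rule H)
  have "((\<lambda>t. p + t *\<^sub>R d) has_derivative (\<lambda>h. h *\<^sub>R d)) (at t)" by (auto intro!: derivative_eq_intros)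
  from has_derivative_inner_right[OF has_derivative_compose[OF this H], of v]
  show "((\<lambda>t. v \<bullet> gradient f (p + t *\<^sub>R d)) has_real_derivative (v \<bullet> (hessian f (p + t *\<^sub>R d) *v d))) (at t)"
    by (simp add: has_field_derivative_def matrix_vector_mult_scaleR mult_commute_abs)
qed

lemma second_order_lower_bound:
  fixes \<phi> \<phi>' \<phi>'' :: "real \<Rightarrow> real"
  assumes d1: "\<And>t. 0 \<le> t \<Longrightarrow> t \<le> 1 \<Longrightarrow> (\<phi> has_real_derivative \<phi>' t) (at t)"
    and d2: "\<And>t. 0 \<le> t \<Longrightarrow> t \<le> 1 \<Longrightarrow> (\<phi>' has_real_derivative \<phi>'' t) (at t)"
    and m: "\<And>t. 0 \<le> t \<Longrightarrow> t \<le> 1 \<Longrightarrow> m \<le> \<phi>'' t"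
  shows "\<phi> 0 + \<phi>' 0 + m / 2 \<le> \<phi> 1"
proof -
  define F where "F t = \<phi> t - m * t^2 / 2" for t
  have F: "(F has_real_derivative (\<phi>' t - m * t)) (at t)" if "0 \<le> t" "t \<le> 1" for t
    unfolding F_def using d1[OF that] by (auto intro!: derivative_eq_intros)
  have "(0::real) < 1" by simp
  from MVT2[OF this F] obtain s where s: "0 < s" "s < 1" "F 1 - F 0 = \<phi>' s - m * s" by auto
  have F': "((\<lambda>t. \<phi>' t - m * t) has_real_derivative (\<phi>'' t - m)) (at t)" if "0 \<le> t" "t \<le> s" for t
    using d2[of t] that s by (auto intro!: derivative_eq_intros)
  from MVT2[OF s(1) F'] obtain z where z: "0 < z" "z < s" "(\<phi>' s - m * s) - (\<phi>' 0 - m * 0) = s * (\<phi>'' z - m)" by auto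
  have "0 \<le> s * (\<phi>'' z - m)" using m[of z] z s by simp
  then show ?thesis using s(3) z(3) by (simp add: F_def)
qed

lemma C2_lower_bound:
  fixes f :: "real^'n \<Rightarrow> real"
  assumes f: "C2_function f" and m: "\<And>t. 0 \<le> t \<Longrightarrow> t \<le> 1 \<Longrightarrow> m \<le> d \<bullet> (hessian f (p + t *\<^sub>R d) *v d)"
  shows "f p + gradient f p \<bullet> d + m / 2 \<le> f (p + d)"
  using second_order_lower_bound[of "\<lambda>t. f (p + t *\<^sub>R d)" "\<lambda>t. d \<bullet> gradient f (p + t *\<^sub>R d)" "\<lambda>t. d \<bullet> (hessian f (p + t *\<^sub>R d) *v d)" m]
    C2_line(1,2)[OF f] m by (simp add: inner_commute)

lemma C2_upper_bound:
  fixes f :: "real^'n \<Rightarrow> real"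
  assumes f: "C2_function f" and m: "\<And>t. 0 \<le> t \<Longrightarrow> t \<le> 1 \<Longrightarrow> d \<bullet> (hessian f (p + t *\<^sub>R d) *v d) \<le> m"
  shows "f (p + d) \<le> f p + gradient f p \<bullet> d + m / 2"
  using second_order_lower_bound[of "\<lambda>t. - f (p + t *\<^sub>R d)" "\<lambda>t. - (d \<bullet> gradient f (p + t *\<^sub>R d))" "\<lambda>t. - (d \<bullet> (hessian f (p + t *\<^sub>R d) *v d))" "- m"]
    DERIV_minus[OF C2_line(1)[OF f]] DERIV_minus[OF C2_line(2)[OF f]] m by (simp add: inner_commute)

text \<open>The second difference \<open>S v w h\<close> is symmetric in \<open>v\<close> and
  \<open>w\<close>. The mean value theorem along \<open>v\<close> and differentiability of the
  gradient at \<open>x\<close> show that, divided by \<open>h^2\<close>, it tends to the Hessian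
  form.\<close>

lemma C2_hessian_symmetric:
  fixes f :: "real^'n \<Rightarrow> real"
  assumes f: "C2_function f"
  shows "v \<bullet> (hessian f x *v w) = w \<bullet> (hessian f x *v v)"
proof -
  define S where "S v w h = f (x + h *\<^sub>R v + h *\<^sub>R w) - f (x + h *\<^sub>R v) - f (x + h *\<^sub>R w) + f x" for v w h
  have lim: "((\<lambda>h. S v w h / h^2) \<longlongrightarrow> v \<bullet> (hessian f x *v w)) (at_right 0)" for v w
  proof (rule tendstoI)
    fix e :: real assume e: "e > 0"
    define N where "N = norm v * (2 * norm v + norm w) + 1"
    have N: "N > 0" by (simp add: N_def add_nonneg_pos)
    have "e / (2 * N) > 0" using e N by simp
    then obtain \<delta> where \<delta>: "\<delta> > 0" "\<And>y. norm (y - x) < \<delta> \<Longrightarrow> norm (gradient f y - gradient f x - hessian f x *v (y - x)) \<le> e / (2 * N) * norm (y - x)"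
      using C2_line(3)[OF f, of x] unfolding has_derivative_at_alt by blast
    define h0 where "h0 = \<delta> / (norm v + norm w + 1)"
    have pos: "norm v + norm w + 1 > 0" using norm_ge_zero[of v] norm_ge_zero[of w] by linarith
    have h0: "h0 > 0" using \<delta> pos by (simp add: h0_def)
    have "dist (S v w h / h^2) (v \<bullet> (hessian f x *v w)) < e" if h: "0 < h" "h < h0" for h
    proof -
      define \<psi> where "\<psi> s = f ((x + h *\<^sub>R w) + s *\<^sub>R (h *\<^sub>R v)) - f (x + s *\<^sub>R (h *\<^sub>R v))" for s
      have d\<psi>: "(\<psi> has_real_derivative ((h *\<^sub>R v) \<bullet> gradient f ((x + h *\<^sub>R w) + s *\<^sub>R (h *\<^sub>R v)) - (h *\<^sub>R v) \<bullet> gradient f (x + s *\<^sub>R (h *\<^sub>R v)))) (at s)" for s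
        unfolding \<psi>_def by (intro DERIV_diff C2_line(1)[OF f])
      then obtain s where s: "0 < s" "s < 1" "\<psi> 1 - \<psi> 0 = (h *\<^sub>R v) \<bullet> gradient f ((x + h *\<^sub>R w) + s *\<^sub>R (h *\<^sub>R v)) - (h *\<^sub>R v) \<bullet> gradient f (x + s *\<^sub>R (h *\<^sub>R v))"
        using MVT2[of 0 1 \<psi>, OF zero_less_one d\<psi>] by auto
      define y1 y2 where "y1 = (x + h *\<^sub>R w) + s *\<^sub>R (h *\<^sub>R v)" and "y2 = x + s *\<^sub>R (h *\<^sub>R v)"
      have S: "S v w h = h * (v \<bullet> (gradient f y1 - gradient f y2))"
      proof -
        have "S v w h = \<psi> 1 - \<psi> 0" by (simp add: S_def \<psi>_def algebra_simps)
        then show ?thesis unfolding s(3) y1_def[symmetric] y2_def[symmetric] by (simp add: inner_diff_right right_diff_distrib)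
      qed
      define r1 r2 where "r1 = gradient f y1 - gradient f x - hessian f x *v (y1 - x)" and "r2 = gradient f y2 - gradient f x - hessian f x *v (y2 - x)"
      have n1: "norm (y1 - x) \<le> h * (norm v + norm w)" and n2: "norm (y2 - x) \<le> h * norm v"
      proof -
        have "norm (y1 - x) \<le> norm (h *\<^sub>R w) + norm (s *\<^sub>R (h *\<^sub>R v))"
          unfolding y1_def using norm_triangle_ineq[of "h *\<^sub>R w" "s *\<^sub>R (h *\<^sub>R v)"] by (simp only: add.assoc add_diff_cancel_left')
        moreover have sv: "norm (s *\<^sub>R (h *\<^sub>R v)) \<le> h * norm v" using s h by (simp add: mult_left_le_one_le)
        ultimately show "norm (y1 - x) \<le> h * (norm v + norm w)" using h by (simp add: algebra_simps)
        show "norm (y2 - x) \<le> h * norm v" using sv by (simp add: y2_def)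
      qed
      have hh: "h * (norm v + norm w) < \<delta>"
      proof -
        have "h * (norm v + norm w) \<le> h * (norm v + norm w + 1)" using h by simp
        also have "\<dots> < h0 * (norm v + norm w + 1)" using h pos by simp
        also have "\<dots> = \<delta>" using pos by (simp add: h0_def)
        finally show ?thesis .
      qed
      have hv: "h * norm v \<le> h * (norm v + norm w)" using h by simp
      have "norm r1 \<le> e / (2 * N) * norm (y1 - x)" unfolding r1_def by (rule \<delta>(2)) (use n1 hh in linarith)
      also have "\<dots> \<le> e / (2 * N) * (h * (norm v + norm w))" using n1 e N by (intro mult_left_mono) auto
      finally have R1: "norm r1 \<le> e / (2 * N) * (h * (norm v + norm w))" .
      have "norm r2 \<le> e / (2 * N) * norm (y2 - x)" unfolding r2_def by (rule \<delta>(2)) (use n2 hh hv in linarith)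
      also have "\<dots> \<le> e / (2 * N) * (h * norm v)" using n2 e N by (intro mult_left_mono) auto
      finally have R2: "norm r2 \<le> e / (2 * N) * (h * norm v)" .
      have "y1 - x = (y2 - x) + h *\<^sub>R w" by (simp add: y1_def y2_def)
      then have "hessian f x *v (y1 - x) = hessian f x *v (y2 - x) + h *\<^sub>R (hessian f x *v w)"
        by (simp only: matrix_vector_right_distrib matrix_vector_mult_scaleR)
      then have "gradient f y1 - gradient f y2 = h *\<^sub>R (hessian f x *v w) + (r1 - r2)"
        unfolding r1_def r2_def by (simp add: algebra_simps)
      then have "S v w h = h * (v \<bullet> (h *\<^sub>R (hessian f x *v w) + (r1 - r2)))" unfolding S by simp
      then have "S v w h = h^2 * (v \<bullet> (hessian f x *v w)) + h * (v \<bullet> (r1 - r2))"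
        by (simp only: inner_add_right inner_scaleR_right power2_eq_square distrib_left mult.assoc)
      then have "S v w h / h^2 - v \<bullet> (hessian f x *v w) = (v \<bullet> (r1 - r2)) / h"
        using h by (simp add: field_simps power2_eq_square)
      then have "\<bar>S v w h / h^2 - v \<bullet> (hessian f x *v w)\<bar> = \<bar>v \<bullet> (r1 - r2)\<bar> / h" using h by (simp add: abs_divide)
      also have "\<dots> \<le> (h * (e / (2 * N) * (N - 1))) / h"
      proof (rule divide_right_mono)
        have "\<bar>v \<bullet> (r1 - r2)\<bar> \<le> norm v * norm (r1 - r2)" by (rule Cauchy_Schwarz_ineq2)
        also have "\<dots> \<le> norm v * (e / (2 * N) * (h * (norm v + norm w)) + e / (2 * N) * (h * norm v))"
          using norm_triangle_ineq4[of r1 r2] R1 R2 by (intro mult_left_mono) auto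
        also have "\<dots> = h * (e / (2 * N) * (N - 1))"
        proof -
          have N1: "N - 1 = norm v * (2 * norm v + norm w)" by (simp add: N_def)
          have "norm v * (q * (h * (norm v + norm w)) + q * (h * norm v)) = h * (q * (norm v * (2 * norm v + norm w)))" for q
            by (simp add: algebra_simps)
          then show ?thesis unfolding N1 .
        qed
        finally show "\<bar>v \<bullet> (r1 - r2)\<bar> \<le> h * (e / (2 * N) * (N - 1))" .
      qed (use h in simp)
      also have "\<dots> = e / (2 * N) * (N - 1)" using h by simp
      also have "\<dots> < e / (2 * N) * (2 * N)" using e N by (intro mult_strict_left_mono) auto
      also have "\<dots> = e" using N by simp
      finally have "\<bar>S v w h / h^2 - v \<bullet> (hessian f x *v w)\<bar> < e" .
      then show ?thesis by (simp add: dist_real_def)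
    qed
    then show "\<forall>\<^sub>F h in at_right 0. dist (S v w h / h\<^sup>2) (v \<bullet> (hessian f x *v w)) < e"
      unfolding eventually_at_right_field using h0 by blast
  qed
  have "S v w h = S w v h" for h by (simp add: S_def algebra_simps)
  then show ?thesis
    using tendsto_unique[OF trivial_limit_at_right_real lim[of v w]] lim[of w v] by simp
qed

lemma finite_eigenvalues_2:
  fixes A :: "real^2^2"
  shows "finite (eigenvalues A)"
proof -
  have "eigenvalues A \<subseteq> {c. poly [:A$1$1 * A$2$2 - A$1$2 * A$2$1, - (A$1$1 + A$2$2), 1:] c = 0}"
  proof
    fix c assume "c \<in> eigenvalues A"
    then obtain v where v: "v \<noteq> 0" "A *v v = c *\<^sub>R v" by (auto simp: eigenvalues_def)
    have e1: "A$1$1 * v$1 + A$1$2 * v$2 = c * v$1" and e2: "A$2$1 * v$1 + A$2$2 * v$2 = c * v$2"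
      using v(2) by (simp_all add: vec_eq_iff forall_2 matrix_vector_mult_def sum_2)
    define D where "D = (A$1$1 - c) * (A$2$2 - c) - A$1$2 * A$2$1"
    have f1: "(A$1$1 - c) * v$1 = - (A$1$2 * v$2)" and f2: "(A$2$2 - c) * v$2 = - (A$2$1 * v$1)"
      using e1 e2 by (simp_all add: left_diff_distrib)
    have "D * v$1 = (A$2$2 - c) * ((A$1$1 - c) * v$1) - A$1$2 * (A$2$1 * v$1)" by (simp add: D_def algebra_simps)
    also have "\<dots> = - A$1$2 * ((A$2$2 - c) * v$2) - A$1$2 * (A$2$1 * v$1)" unfolding f1 by (simp add: mult_ac)
    also have "\<dots> = 0" unfolding f2 by simp
    finally have D1: "D * v$1 = 0" .
    have "D * v$2 = (A$1$1 - c) * ((A$2$2 - c) * v$2) - A$2$1 * (A$1$2 * v$2)" by (simp add: D_def algebra_simps)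
    also have "\<dots> = - A$2$1 * ((A$1$1 - c) * v$1) - A$2$1 * (A$1$2 * v$2)" unfolding f2 by (simp add: mult_ac)
    also have "\<dots> = 0" unfolding f1 by simp
    finally have "D * v$2 = 0" .
    then have "D = 0" using D1 v(1) by (auto simp: vec_eq_iff forall_2)
    then show "c \<in> {c. poly [:A$1$1 * A$2$2 - A$1$2 * A$2$1, - (A$1$1 + A$2$2), 1:] c = 0}"
      by (simp add: D_def algebra_simps)
  qed
  moreover have "finite {c. poly [:A$1$1 * A$2$2 - A$1$2 * A$2$1, - (A$1$1 + A$2$2), 1:] c = 0}"
    by (rule poly_roots_finite) simp
  ultimately show ?thesis by (rule finite_subset)
qed

text \<open>If neither alternative holds, the form is nonnegative and vanishes at some
  \<open>v \<noteq> 0\<close>. Such a \<open>v\<close> lies in the kernel, so 0 is an eigenvalue,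
  and it is the smallest one.\<close>

lemma smallest_eigenvalue_nonzero_cases:
  fixes A :: "real^2^2"
  assumes sym: "\<And>v w. v \<bullet> (A *v w) = w \<bullet> (A *v v)" and nz: "smallest_eigenvalue A \<noteq> 0"
  shows "(\<exists>v. v \<bullet> (A *v v) < 0) \<or> (\<forall>v. v \<noteq> 0 \<longrightarrow> 0 < v \<bullet> (A *v v))"
proof (rule ccontr)
  assume "\<not> ?thesis"
  then obtain v where psd: "\<And>w. 0 \<le> w \<bullet> (A *v w)" and v: "v \<noteq> 0" "v \<bullet> (A *v v) = 0"
    by (metis linorder_not_less order.antisym)
  have "w \<bullet> (A *v v) = 0" for w
  proof (rule ccontr)
    assume ne: "w \<bullet> (A *v v) \<noteq> 0"
    define a b where "a = w \<bullet> (A *v v)" and "b = w \<bullet> (A *v w)"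
    \<comment> \<open>If \<open>w \<bullet> (A *v v)\<close> were nonzero, a step along
      \<open>w\<close> against its sign would make the form negative; dividing by
      \<open>b + 1\<close> handles \<open>b = 0\<close> as well.\<close>
    define t where "t = - a / (b + 1)"
    have b: "0 \<le> b" using psd by (simp add: b_def)
    have "0 \<le> (v + t *\<^sub>R w) \<bullet> (A *v (v + t *\<^sub>R w))" by (rule psd)
    also have "\<dots> = 2 * t * a + t^2 * b"
      using v(2) sym[of v w] by (simp add: a_def b_def matrix_vector_right_distrib matrix_vector_mult_scaleR inner_add_left inner_add_right power2_eq_square algebra_simps)
    also have "\<dots> = - (a^2 * (b + 2)) / (b + 1)^2"
      using b unfolding t_def by (simp add: power2_eq_square divide_simps) (simp add: algebra_simps)
    finally have "a^2 * (b + 2) / (b + 1)^2 \<le> 0" by simp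
    moreover have "0 < a^2 * (b + 2) / (b + 1)^2" using ne b by (simp add: a_def)
    ultimately show False by simp
  qed
  then have "A *v v = 0" by (metis inner_eq_zero_iff)
  then have 0: "0 \<in> eigenvalues A" using v(1) by (auto simp: eigenvalues_def)
  have "0 \<le> c" if ev: "c \<in> eigenvalues A" for c
  proof -
    obtain w where w: "w \<noteq> 0" "A *v w = c *\<^sub>R w" using ev by (auto simp: eigenvalues_def)
    then have "0 \<le> c * (w \<bullet> w)" using psd[of w] by simp
    moreover have "0 < w \<bullet> w" using w(1) by simp
    ultimately show ?thesis by (simp add: zero_le_mult_iff)
  qed
  then have "smallest_eigenvalue A = 0"
    unfolding smallest_eigenvalue_def using finite_eigenvalues_2 0 by (intro Min_eqI) auto
  then show False using nz by simp
qed

lemma C2_quadratic_form_continuous: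
  fixes f :: "real^'n \<Rightarrow> real"
  assumes "C2_function f"
  shows "continuous_on UNIV (\<lambda>(\<xi>, v). v \<bullet> (hessian f \<xi> *v v))"
proof -
  have "continuous_on UNIV (\<lambda>p::(real^'n) \<times> (real^'n). hessian f (fst p))"
    by (rule continuous_on_compose2[of UNIV "hessian f"])
       (use assms in \<open>simp_all add: C2_function_def continuous_on_fst continuous_on_id\<close>)
  note H = this
  have "continuous_on UNIV (\<lambda>p::(real^'n) \<times> (real^'n). hessian f (fst p) $ i $ j)" for i j
    by (rule continuous_on_component[OF continuous_on_component[OF H]])
  moreover have "continuous_on UNIV (\<lambda>p::(real^'n) \<times> (real^'n). snd p $ i)" for i
    by (rule continuous_on_component[OF continuous_on_snd[OF continuous_on_id]])
  ultimately have "continuous_on UNIV (\<lambda>p::(real^'n) \<times> (real^'n). \<Sum>i\<in>UNIV. snd p $ i * (\<Sum>j\<in>UNIV. hessian f (fst p) $ i $ j * snd p $ j))"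
    by (intro continuous_on_sum continuous_on_mult)
  moreover have "(\<Sum>i\<in>UNIV. snd p $ i * (\<Sum>j\<in>UNIV. hessian f (fst p) $ i $ j * snd p $ j)) = snd p \<bullet> (hessian f (fst p) *v snd p)" for p :: "(real^'n) \<times> (real^'n)"
    by (simp add: inner_vec_def matrix_vector_mult_def)
  ultimately have "continuous_on UNIV (\<lambda>p::(real^'n) \<times> (real^'n). snd p \<bullet> (hessian f (fst p) *v snd p))"
    by simp
  then show ?thesis by (simp add: case_prod_beta')
qed

text \<open>A negative direction at \<open>x\<close> persists nearby by continuity. A positive form
  at \<open>x\<close> is bounded below on the unit sphere, and uniform continuity on a compact set
  keeps half of this bound nearby.\<close>

lemma C2_dichotomy:
  fixes f :: "real^2 \<Rightarrow> real"
  assumes f: "C2_function f" and nz: "smallest_eigenvalue (hessian f x) \<noteq> 0"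
  shows "\<exists>\<delta>>0. \<exists>c>0. (\<forall>\<xi>\<in>cball x \<delta>. \<forall>v. c * (v \<bullet> v) \<le> v \<bullet> (hessian f \<xi> *v v)) \<or>
    (\<exists>\<tau>. norm \<tau> = 1 \<and> (\<forall>\<xi>\<in>cball x \<delta>. \<tau> \<bullet> (hessian f \<xi> *v \<tau>) \<le> - c))"
proof -
  note cont = C2_quadratic_form_continuous[OF f]
  let ?Q = "\<lambda>\<xi> v. v \<bullet> (hessian f \<xi> *v v)"
  have sc: "?Q \<xi> (t *\<^sub>R v) = t^2 * ?Q \<xi> v" for \<xi> t v by (simp add: matrix_vector_mult_scaleR power2_eq_square)
  from smallest_eigenvalue_nonzero_cases[OF C2_hessian_symmetric[OF f] nz] show ?thesis
  proof
    assume "\<exists>v. ?Q x v < 0"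
    then obtain v where v: "?Q x v < 0" by blast
    then have v0: "v \<noteq> 0" by auto
    define \<tau> where "\<tau> = (1 / norm v) *\<^sub>R v"
    have \<tau>: "norm \<tau> = 1" using v0 by (simp add: \<tau>_def)
    have neg: "?Q x \<tau> < 0" unfolding \<tau>_def sc using v v0 by (simp add: mult_pos_neg)
    define c where "c = - ?Q x \<tau> / 2"
    have c: "c > 0" using neg by (simp add: c_def)
    have "continuous_on UNIV (\<lambda>\<xi>. ?Q \<xi> \<tau>)"
      using continuous_on_compose2[OF cont, of UNIV "\<lambda>\<xi>. (\<xi>, \<tau>)"] by (simp add: continuous_intros)
    then have "isCont (\<lambda>\<xi>. ?Q \<xi> \<tau>) x" by (simp add: continuous_on_eq_continuous_at)
    then obtain d where d: "d > 0" "\<And>\<xi>. dist \<xi> x < d \<Longrightarrow> \<bar>?Q \<xi> \<tau> - ?Q x \<tau>\<bar> < c"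
      unfolding continuous_at_eps_delta dist_real_def using c by blast
    have "?Q \<xi> \<tau> \<le> - c" if "\<xi> \<in> cball x (d/2)" for \<xi>
      using d(2)[of \<xi>] that d(1) c_def by (auto simp: dist_commute)
    then show ?thesis using d(1) c \<tau> by (intro exI[of _ "d/2"] conjI exI[of _ c]) auto
  next
    assume pd: "\<forall>v. v \<noteq> 0 \<longrightarrow> 0 < ?Q x v"
    let ?S = "sphere (0::real^2) 1"
    have contx: "continuous_on ?S (\<lambda>v. ?Q x v)"
      using continuous_on_compose2[OF cont, of ?S "\<lambda>v. (x, v)"] by (simp add: continuous_intros)
    have "?S \<noteq> {}" by simp
    from continuous_attains_inf[OF compact_sphere this contx] obtain v0 where v0: "v0 \<in> ?S" "\<And>v. v \<in> ?S \<Longrightarrow> ?Q x v0 \<le> ?Q x v" by blast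
    define c where "c = ?Q x v0 / 2"
    have "v0 \<noteq> 0" using v0(1) by auto
    then have c: "c > 0" using pd by (simp add: c_def)
    have "uniformly_continuous_on (cball x 1 \<times> ?S) (\<lambda>(\<xi>, v). ?Q \<xi> v)"
      by (intro compact_uniformly_continuous continuous_on_subset[OF cont] compact_Times) auto
    then obtain d where d: "d > 0" "\<And>p q. p \<in> cball x 1 \<times> ?S \<Longrightarrow> q \<in> cball x 1 \<times> ?S \<Longrightarrow> dist q p < d \<Longrightarrow> dist ((\<lambda>(\<xi>, v). ?Q \<xi> v) q) ((\<lambda>(\<xi>, v). ?Q \<xi> v) p) < c"
      unfolding uniformly_continuous_on_def using c by blast
    define \<delta> where "\<delta> = min 1 (d / 2)"
    have \<delta>: "\<delta> > 0" "\<delta> \<le> 1" "\<delta> < d" using d(1) by (auto simp: \<delta>_def)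
    have unit: "c \<le> ?Q \<xi> v" if \<xi>: "\<xi> \<in> cball x \<delta>" and v: "v \<in> ?S" for \<xi> v
    proof -
      have "dist (\<xi>, v) (x, v) < d" using \<xi> \<delta> by (simp add: dist_Pair_Pair dist_commute)
      then have "\<bar>?Q \<xi> v - ?Q x v\<bar> < c" using d(2)[of "(x, v)" "(\<xi>, v)"] \<xi> v \<delta> by (simp add: dist_real_def)
      then show ?thesis using v0(2)[OF v] unfolding c_def by linarith
    qed
    have "c * (v \<bullet> v) \<le> ?Q \<xi> v" if \<xi>: "\<xi> \<in> cball x \<delta>" for \<xi> v
    proof (cases "v = 0")
      case False
      define w where "w = (1 / norm v) *\<^sub>R v"
      have w: "w \<in> ?S" and vw: "v = norm v *\<^sub>R w" using False by (auto simp: w_def)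
      have "(norm v)^2 * c \<le> (norm v)^2 * ?Q \<xi> w" using unit[OF \<xi> w] by (intro mult_left_mono) auto
      also have "\<dots> = ?Q \<xi> v" using sc[of "norm v" w \<xi>] by (simp only: vw[symmetric])
      finally show ?thesis by (simp add: power2_norm_eq_inner mult.commute)
    qed simp
    then show ?thesis using \<delta>(1) c by (intro exI[of _ \<delta>] conjI exI[of _ c]) auto
  qed
qed

lemma C2_taylor_bound:
  fixes f :: "real^2 \<Rightarrow> real"
  assumes f: "C2_function f"
  shows "\<exists>k. \<forall>p\<in>cball x \<delta>. \<forall>\<xi>\<in>cball x \<delta>. \<bar>f \<xi> - f p - gradient f p \<bullet> (\<xi> - p)\<bar> \<le> k * ((\<xi> - p) \<bullet> (\<xi> - p))"
proof -
  let ?Q = "\<lambda>\<xi> v. v \<bullet> (hessian f \<xi> *v v)"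
  let ?S = "sphere (0::real^2) 1"
  have "bounded ((\<lambda>(\<xi>, v). ?Q \<xi> v) ` (cball x \<delta> \<times> ?S))"
    by (intro compact_imp_bounded compact_continuous_image continuous_on_subset[OF C2_quadratic_form_continuous[OF f]] compact_Times) auto
  then obtain K where K': "\<forall>z\<in>(\<lambda>(\<xi>, v). ?Q \<xi> v) ` (cball x \<delta> \<times> ?S). norm z \<le> K"
    unfolding bounded_iff by blast
  have K: "\<bar>?Q \<xi> v\<bar> \<le> K" if "\<xi> \<in> cball x \<delta>" "v \<in> ?S" for \<xi> v
    using bspec[OF K', OF imageI[of "(\<xi>, v)"]] that by simp
  have Q: "\<bar>?Q \<xi> v\<bar> \<le> K * (v \<bullet> v)" if \<xi>: "\<xi> \<in> cball x \<delta>" for \<xi> v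
  proof (cases "v = 0")
    case False
    define w where "w = (1 / norm v) *\<^sub>R v"
    have w: "w \<in> ?S" and vw: "v = norm v *\<^sub>R w" using False by (auto simp: w_def)
    have "\<bar>?Q \<xi> v\<bar> = (norm v)^2 * \<bar>?Q \<xi> w\<bar>"
      by (subst (1 2) vw) (simp add: matrix_vector_mult_scaleR power2_eq_square abs_mult)
    also have "\<dots> \<le> (norm v)^2 * K" using K[OF \<xi> w] by (intro mult_left_mono) auto
    finally show ?thesis by (simp add: power2_norm_eq_inner mult.commute)
  qed simp
  have "\<bar>f \<xi> - f p - gradient f p \<bullet> (\<xi> - p)\<bar> \<le> (K / 2) * ((\<xi> - p) \<bullet> (\<xi> - p))" if p: "p \<in> cball x \<delta>" and \<xi>: "\<xi> \<in> cball x \<delta>" for p \<xi>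
  proof -
    have seg: "p + t *\<^sub>R (\<xi> - p) \<in> cball x \<delta>" if "0 \<le> t" "t \<le> 1" for t
    proof -
      have "(1 - t) *\<^sub>R p + t *\<^sub>R \<xi> \<in> cball x \<delta>" using p \<xi> that convex_cball[of x \<delta>] by (intro convexD) auto
      then show ?thesis by (simp add: algebra_simps)
    qed
    have b: "\<bar>?Q (p + t *\<^sub>R (\<xi> - p)) (\<xi> - p)\<bar> \<le> K * ((\<xi> - p) \<bullet> (\<xi> - p))" if "0 \<le> t" "t \<le> 1" for t
      by (rule Q[OF seg[OF that]])
    have "f p + gradient f p \<bullet> (\<xi> - p) + (- (K * ((\<xi> - p) \<bullet> (\<xi> - p)))) / 2 \<le> f (p + (\<xi> - p))"
      by (rule C2_lower_bound[OF f]) (use b[THEN abs_le_D2] in fastforce)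
    moreover have "f (p + (\<xi> - p)) \<le> f p + gradient f p \<bullet> (\<xi> - p) + (K * ((\<xi> - p) \<bullet> (\<xi> - p))) / 2"
      by (rule C2_upper_bound[OF f]) (rule b[THEN abs_le_D1])
    moreover have "p + (\<xi> - p) = \<xi>" "(K / 2) * ((\<xi> - p) \<bullet> (\<xi> - p)) = (K * ((\<xi> - p) \<bullet> (\<xi> - p))) / 2" by simp_all
    ultimately show ?thesis by (simp only:)
  qed
  then show ?thesis by blast
qed

section \<open>Local perturbations of a convex function\<close>

text \<open>At the leftmost point of a positive maximum the left neighbour is strictly smaller,
  which violates midpoint convexity there.\<close>

lemma discrete_maximum_principle:
  fixes a :: "nat \<Rightarrow> real"
  assumes end0: "a 0 \<le> 0" and endn: "a n \<le> 0" and mid: "\<And>i. 0 < i \<Longrightarrow> i < n \<Longrightarrow> 2 * a i \<le> a (i - 1) + a (i + 1)"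
    and i: "i \<le> n"
  shows "a i \<le> 0"
proof (rule ccontr)
  assume "\<not> a i \<le> 0"
  define m where "m = Max (a ` {..n})"
  have le: "a j \<le> m" if "j \<le> n" for j unfolding m_def using that by (intro Max_ge) auto
  have mpos: "m > 0" using le[OF i] \<open>\<not> a i \<le> 0\<close> by simp
  have "m \<in> a ` {..n}" unfolding m_def by (intro Max_in) auto
  then have ex: "\<exists>j. j \<le> n \<and> a j = m" by auto
  define j where "j = (LEAST j. j \<le> n \<and> a j = m)"
  have j: "j \<le> n" "a j = m" using LeastI_ex[OF ex] by (auto simp: j_def)
  have j0: "0 < j" "j < n" using j end0 endn mpos by (cases "j = 0"; cases "j = n"; auto)+
  have "j - 1 < j" using j0 by simp
  from not_less_Least[OF this[unfolded j_def]] have "a (j - 1) \<noteq> m" using j unfolding j_def by auto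
  then have "a (j - 1) < m" using le[of "j - 1"] j by fastforce
  moreover have "a (j + 1) \<le> m" using le[of "j + 1"] j0 by simp
  ultimately show False using mid[OF j0] j by linarith
qed

text \<open>On a segment, the excess \<open>\<phi>\<close> of \<open>w\<close> over its chord is
  convex on short subintervals, as each lies over \<open>U\<close> or over \<open>V\<close>. On a
  fine grid this is midpoint convexity, so \<open>\<phi>\<close> is nonpositive at the grid points,
  and by convexity between neighbours also at \<open>t\<close>.\<close>

lemma convex_on_locally:
  fixes w u v :: "'a::euclidean_space \<Rightarrow> real"
  assumes \<Omega>: "convex \<Omega>" and U: "open U" and V: "open V" and cover: "\<Omega> \<subseteq> U \<union> V"
    and u: "convex_on \<Omega> u" "\<And>x. x \<in> \<Omega> \<inter> U \<Longrightarrow> w x = u x"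
    and v: "convex_on \<Omega> v" "\<And>x. x \<in> \<Omega> \<inter> V \<Longrightarrow> w x = v x"
  shows "convex_on \<Omega> w"
proof (rule convex_onI[OF _ \<Omega>])
  fix t :: real and x y assume t: "0 < t" "t < 1" and xy: "x \<in> \<Omega>" "y \<in> \<Omega>"
  define \<gamma> where "\<gamma> s = (1 - s) *\<^sub>R x + s *\<^sub>R y" for s :: real
  define \<phi> where "\<phi> s = w (\<gamma> s) - ((1 - s) * w x + s * w y)" for s
  have \<gamma>\<Omega>: "\<gamma> s \<in> \<Omega>" if "s \<in> {0..1}" for s using \<Omega> xy that unfolding \<gamma>_def by (intro convexD) auto
  have cont: "continuous_on UNIV \<gamma>" unfolding \<gamma>_def by (intro continuous_intros)
  have opU: "open (\<gamma> -` U)" and opV: "open (\<gamma> -` V)"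
    by (rule open_vimage[OF U cont], rule open_vimage[OF V cont])
  have cov: "{0..1} \<subseteq> \<Union> {\<gamma> -` U, \<gamma> -` V}"
  proof
    fix s :: real assume "s \<in> {0..1}"
    from subsetD[OF cover \<gamma>\<Omega>[OF this]] show "s \<in> \<Union> {\<gamma> -` U, \<gamma> -` V}" by simp
  qed
  have opG: "open G" if "G \<in> {\<gamma> -` U, \<gamma> -` V}" for G using that opU opV by blast
  obtain e where e: "e > 0" "\<And>s. s \<in> {0..1} \<Longrightarrow> \<exists>G\<in>{\<gamma> -` U, \<gamma> -` V}. ball s e \<subseteq> G"
    by (rule Heine_Borel_lemma[OF compact_Icc cov opG]) (assumption, rule that)
  have combo: "\<gamma> ((1 - l) * p + l * q) = (1 - l) *\<^sub>R \<gamma> p + l *\<^sub>R \<gamma> q" for l p q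
    by (simp add: \<gamma>_def algebra_simps)
  have loc: "\<phi> ((1 - l) * p + l * q) \<le> (1 - l) * \<phi> p + l * \<phi> q"
    if s: "s \<in> {0..1}" and p: "p \<in> {0..1}" "p \<in> ball s e" and q: "q \<in> {0..1}" "q \<in> ball s e" and l: "0 \<le> l" "l \<le> 1" for s p q l
  proof -
    let ?z = "(1 - l) * p + l * q"
    have zb: "?z \<in> ball s e"
      using convexD[OF convex_ball[of s e] p(2) q(2), of "1 - l" l] l by simp
    have z01: "?z \<in> {0..1}"
      using convexD[OF convex_box(1)[of "0::real" 1], of p q "1 - l" l] p(1) q(1) l by (simp add: cbox_interval)
    have mem: "\<gamma> p \<in> \<Omega>" "\<gamma> q \<in> \<Omega>" "\<gamma> ?z \<in> \<Omega>" using \<gamma>\<Omega> p q z01 by blast+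
    from e(2)[OF s] have "ball s e \<subseteq> \<gamma> -` U \<or> ball s e \<subseteq> \<gamma> -` V" by simp
    then have *: "w (\<gamma> ?z) \<le> (1 - l) * w (\<gamma> p) + l * w (\<gamma> q)"
    proof
      assume "ball s e \<subseteq> \<gamma> -` U"
      then have "\<gamma> p \<in> U" "\<gamma> q \<in> U" "\<gamma> ?z \<in> U" using p(2) q(2) zb by auto
      then show ?thesis using u(2) mem convex_onD[OF u(1) l mem(1,2)] by (simp add: combo)
    next
      assume "ball s e \<subseteq> \<gamma> -` V"
      then have "\<gamma> p \<in> V" "\<gamma> q \<in> V" "\<gamma> ?z \<in> V" using p(2) q(2) zb by auto
      then show ?thesis using v(2) mem convex_onD[OF v(1) l mem(1,2)] by (simp add: combo)
    qed
    then show ?thesis unfolding \<phi>_def by (simp add: algebra_simps)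
  qed
  \<comment> \<open>The mesh is finer than the Lebesgue number \<open>e\<close> of the cover, so
    three consecutive grid points lie in one of its sets.\<close>
  obtain n :: nat where n: "1 / e < real n" using reals_Archimedean2 by blast
  have npos: "0 < real n" using n e(1) by (cases n) auto
  have ne: "1 / real n < e" using n e(1) npos by (simp add: field_simps)
  define a where "a i = \<phi> (real i / real n)" for i
  have grid: "real i / real n \<in> {0..1}" if "i \<le> n" for i using that npos by simp
  have a_le: "a i \<le> 0" if "i \<le> n" for i
  proof (rule discrete_maximum_principle[of a n, OF _ _ _ that])
    show "a 0 \<le> 0" "a n \<le> 0" using npos by (auto simp: a_def \<phi>_def \<gamma>_def)
    fix i assume i: "0 < i" "i < n"
    have d: "real (i - 1) / real n = real i / real n - 1 / real n" "real (i + 1) / real n = real i / real n + 1 / real n"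
      using i by (simp_all add: of_nat_diff diff_divide_distrib add_divide_distrib)
    have "\<phi> ((1 - 1/2) * (real (i - 1) / real n) + 1/2 * (real (i + 1) / real n)) \<le> (1 - 1/2) * \<phi> (real (i - 1) / real n) + 1/2 * \<phi> (real (i + 1) / real n)"
      by (rule loc[of "real i / real n"]) (use i d ne npos grid[of i] grid[of "i - 1"] grid[of "i + 1"] in \<open>auto simp: dist_real_def\<close>)
    moreover have "(1 - 1/2) * (real (i - 1) / real n) + 1/2 * (real (i + 1) / real n) = real i / real n"
      unfolding d by (simp add: field_simps)
    ultimately show "2 * a i \<le> a (i - 1) + a (i + 1)" unfolding a_def by simp
  qed
  define i where "i = nat \<lfloor>t * real n\<rfloor>"
  have fl: "real i \<le> t * real n" "t * real n < real i + 1" using t npos unfolding i_def by (simp_all add: of_nat_nat)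
  have "t * real n < real n" using t npos by simp
  then have i_lt: "i < n" using fl by linarith
  define l where "l = t * real n - real i"
  have l: "0 \<le> l" "l \<le> 1" using fl by (simp_all add: l_def)
  have tt: "t = (1 - l) * (real i / real n) + l * (real (i + 1) / real n)"
    using npos by (simp add: l_def field_simps)
  have d: "real (i + 1) / real n = real i / real n + 1 / real n" by (simp add: add_divide_distrib)
  have "\<phi> t \<le> (1 - l) * a i + l * a (i + 1)"
    unfolding tt a_def
    by (rule loc[of "real i / real n"]) (use i_lt d ne npos l e grid[of i] grid[of "i + 1"] in \<open>auto simp: dist_real_def\<close>)
  also have "\<dots> \<le> 0" using a_le[of i] a_le[of "i + 1"] i_lt l
    by (intro add_nonpos_nonpos mult_nonneg_nonpos) auto
  finally show "w ((1 - t) *\<^sub>R x + t *\<^sub>R y) \<le> (1 - t) * w x + t * w y" by (simp add: \<phi>_def \<gamma>_def)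
qed

section \<open>The functional as a Bochner integral\<close>

text \<open>Differs from the integrand of \<open>grad_functional\<close> only on the frontier, a
  null set. The indicator inside \<open>f\<close> is what makes it Borel measurable, as gradients
  are controlled on the interior only.\<close>

definition interior_integrand :: "(real^2) set \<Rightarrow> (real^2 \<Rightarrow> real) \<Rightarrow> (real^2 \<Rightarrow> real) \<Rightarrow> real^2 \<Rightarrow> real" where
  "interior_integrand \<Omega> f v x = indicator (interior \<Omega>) x * f (indicator (interior \<Omega>) x *\<^sub>R gradient v x)"

lemma borel_measurable_interior_integrand:
  assumes v: "convex_on \<Omega> v" and f: "continuous_on UNIV f"
  shows "interior_integrand \<Omega> f v \<in> borel_measurable borel"
proof -
  have cv: "convex_on (interior \<Omega>) v"
    by (rule convex_on_subset[OF v interior_subset convex_interior[OF convex_on_imp_convex[OF v]]])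
  have "(\<lambda>x. f (indicator (interior \<Omega>) x *\<^sub>R gradient v x)) \<in> borel_measurable borel"
    using measurable_compose[OF borel_measurable_gradient[OF cv open_interior] borel_measurable_continuous_onI[OF f]] .
  then show ?thesis unfolding interior_integrand_def by simp
qed

text \<open>The factor \<open>\<sigma>\<close> is taken as 1 and as -1, for the positive and the
  negative part of \<open>grad_functional\<close>.\<close>

lemma nn_integral_interior_integrand:
  assumes \<Omega>: "compact \<Omega>" "convex \<Omega>" and v: "convex_on \<Omega> v" and f: "continuous_on UNIV f"
  shows "(\<integral>\<^sup>+x. ennreal (\<sigma> * f (gradient v x)) \<partial>lebesgue_on \<Omega>) = (\<integral>\<^sup>+x. ennreal (\<sigma> * interior_integrand \<Omega> f v x) \<partial>lborel)"
proof -
  have \<Omega>b: "\<Omega> \<in> sets borel" by (rule borel_compact[OF \<Omega>(1)])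
  have "(\<integral>\<^sup>+x. ennreal (\<sigma> * f (gradient v x)) \<partial>lebesgue_on \<Omega>) = (\<integral>\<^sup>+x. ennreal (\<sigma> * f (gradient v x)) * indicator \<Omega> x \<partial>lebesgue)"
    using \<Omega>b by (subst nn_integral_restrict_space) auto
  also have "\<dots> = (\<integral>\<^sup>+x. ennreal (\<sigma> * interior_integrand \<Omega> f v x) \<partial>lebesgue)"
  proof (rule nn_integral_cong_AE)
    have "frontier \<Omega> \<in> null_sets lebesgue"
      using negligible_convex_frontier[OF \<Omega>(2)] negligible_iff_null_sets by blast
    from AE_not_in[OF this] show "AE x in lebesgue. ennreal (\<sigma> * f (gradient v x)) * indicator \<Omega> x = ennreal (\<sigma> * interior_integrand \<Omega> f v x)"
    proof eventually_elim
      case (elim x)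
      show ?case
      proof (cases "x \<in> interior \<Omega>")
        case True
        then have "x \<in> \<Omega>" using interior_subset by blast
        then show ?thesis using True by (simp add: interior_integrand_def)
      next
        case False
        then have "x \<notin> \<Omega>" using elim closure_subset[of \<Omega>] by (auto simp: frontier_def)
        then show ?thesis using False by (simp add: interior_integrand_def)
      qed
    qed
  qed
  also have "\<dots> = (\<integral>\<^sup>+x. ennreal (\<sigma> * interior_integrand \<Omega> f v x) \<partial>lborel)"
    by (rule nn_integral_completion)
  finally show ?thesis .
qed

lemma grad_functional_interior:
  assumes \<Omega>: "compact \<Omega>" "convex \<Omega>" and v: "convex_on \<Omega> v" and f: "continuous_on UNIV f"
  shows "\<bar>grad_functional \<Omega> f v\<bar> \<noteq> \<infinity> \<Longrightarrow> integrable lborel (interior_integrand \<Omega> f v)"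
    and "integrable lborel (interior_integrand \<Omega> f v) \<Longrightarrow> grad_functional \<Omega> f v = ereal (LINT x|lborel. interior_integrand \<Omega> f v x)"
proof -
  let ?G = "interior_integrand \<Omega> f v"
  let ?P = "\<integral>\<^sup>+x. ennreal (?G x) \<partial>lborel" and ?N = "\<integral>\<^sup>+x. ennreal (- ?G x) \<partial>lborel"
  have F: "grad_functional \<Omega> f v = enn2ereal ?P - enn2ereal ?N"
    using nn_integral_interior_integrand[OF \<Omega> v f, of 1] nn_integral_interior_integrand[OF \<Omega> v f, of "-1"]
    by (simp add: grad_functional_def)
  have m: "?G \<in> borel_measurable lborel" using borel_measurable_interior_integrand[OF v f] by simp
  show "integrable lborel ?G" if fin: "\<bar>grad_functional \<Omega> f v\<bar> \<noteq> \<infinity>"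
  proof -
    \<comment> \<open>Since \<open>\<infinity> - \<infinity> = \<infinity>\<close> in
      \<open>ereal\<close>, a finite difference forces both parts to be finite.\<close>
    have "\<bar>a - \<infinity>\<bar> = \<infinity>" "\<bar>\<infinity> - a\<bar> = \<infinity>" for a :: ereal by (cases a; simp)+
    then have "enn2ereal ?P \<noteq> \<infinity>" "enn2ereal ?N \<noteq> \<infinity>" using fin unfolding F by (metis, metis)
    then have "?P \<noteq> \<infinity>" "?N \<noteq> \<infinity>" by auto
    then show ?thesis using m by (simp add: real_integrable_def)
  qed
  show "grad_functional \<Omega> f v = ereal (LINT x|lborel. ?G x)" if int: "integrable lborel ?G"
  proof -
    have "?P \<noteq> \<infinity>" "?N \<noteq> \<infinity>" using int by (auto simp: real_integrable_def)
    moreover have "enn2ereal a = ereal (enn2real a)" if "a \<noteq> \<infinity>" for a :: ennreal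
      using that by (cases a) (auto simp: enn2ereal_ennreal)
    ultimately have "enn2ereal ?P = ereal (enn2real ?P)" "enn2ereal ?N = ereal (enn2real ?N)" by blast+
    then show ?thesis unfolding F real_lebesgue_integral_def[OF int] by simp
  qed
qed

section \<open>Transfer of dual variations to a smooth cap\<close>

text \<open>All slopes near \<open>\<xi>2\<close> are taken by \<open>u\<close> within the ball,
  where it is differentiable, and nowhere else in \<open>\<Omega>\<close>. As the slope 0 is not
  among them, \<open>u\<close> stays off its bounds at the points to be varied.\<close>

locale smooth_cap =
  fixes \<Omega> :: "(real^2) set" and mx :: real and u :: "real^2 \<Rightarrow> real" and x0 \<xi>2 :: "real^2" and \<epsilon> \<rho> :: real
  assumes compact_\<Omega>: "compact \<Omega>" and u: "u \<in> convex_class \<Omega> mx"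
    and eps: "0 < \<epsilon>" and inside: "cball x0 \<epsilon> \<subseteq> interior \<Omega>"
    and diff: "\<And>x. x \<in> ball x0 \<epsilon> \<Longrightarrow> u differentiable (at x)"
    and rho: "0 < \<rho>"
    and slopes: "\<And>\<xi>. \<xi> \<in> cball \<xi>2 \<rho> \<Longrightarrow> \<exists>x\<in>ball x0 \<epsilon>. subgrad \<Omega> u x \<xi>"
    and only: "\<And>\<xi> x. \<xi> \<in> cball \<xi>2 \<rho> \<Longrightarrow> x \<in> \<Omega> \<Longrightarrow> subgrad \<Omega> u x \<xi> \<Longrightarrow> x \<in> ball x0 \<epsilon>"
    and nonzero: "0 \<notin> cball \<xi>2 \<rho>"
begin

definition "X = cball x0 \<epsilon>"
text \<open>The linear shift moves the centre of the ball of slopes to 0, as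
  \<open>dual_model\<close> requires.\<close>

definition "uh x = u x - \<xi>2 \<bullet> x"
definition "g = conj_on X uh"
definition "L = norm x0 + \<epsilon>"

lemma u_convex: "convex_on \<Omega> u" and u_bounds: "x \<in> \<Omega> \<Longrightarrow> 0 \<le> u x" "x \<in> \<Omega> \<Longrightarrow> u x \<le> mx"
  using u by (auto simp: convex_class_def)

lemma convex_\<Omega>: "convex \<Omega>" using convex_on_imp_convex[OF u_convex] .

lemma X_interior: "X \<subseteq> interior \<Omega>" and ball_X: "ball x0 \<epsilon> \<subseteq> X" and X_\<Omega>: "X \<subseteq> \<Omega>"
  using inside interior_subset[of \<Omega>] by (auto simp: X_def)

lemma u_convex_interior: "convex_on (interior \<Omega>) u"
  by (rule convex_on_subset[OF u_convex interior_subset convex_interior[OF convex_\<Omega>]])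

lemma u_continuous: "continuous_on (interior \<Omega>) u"
  using convex_on_continuous[OF open_interior u_convex_interior] .

lemma X_compact: "compact X" "X \<noteq> {}" using eps by (auto simp: X_def)

lemma uh_continuous: "continuous_on X uh"
  unfolding uh_def using continuous_on_subset[OF u_continuous X_interior] by (intro continuous_intros)

lemma norm_X: "x \<in> X \<Longrightarrow> norm x \<le> L"
  using norm_triangle_ineq[of x0 "x - x0"] by (simp add: X_def L_def dist_norm norm_minus_commute)

sublocale dual_model \<rho> "\<rho> / 2" L "L + 1" g
proof unfold_locales
  show "convex_on UNIV g" unfolding g_def by (rule convex_conj_on[OF X_compact uh_continuous])
  show "L-lipschitz_on UNIV g" unfolding g_def by (rule Lipschitz_conj_on[OF X_compact uh_continuous norm_X])
qed (use rho in auto)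

lemma g_upper: "x \<in> X \<Longrightarrow> x \<bullet> \<xi> - uh x \<le> g \<xi>"
  unfolding g_def by (rule conj_on_upper[OF X_compact uh_continuous])

lemma g_attained: obtains x where "x \<in> X" "g \<xi> = x \<bullet> \<xi> - uh x"
  using conj_on_attained[OF X_compact uh_continuous, of \<xi>] unfolding g_def by blast

lemma gradient_u: "x \<in> ball x0 \<epsilon> \<Longrightarrow> GDERIV u x :> gradient u x"
  by (rule differentiable_imp_GDERIV[OF diff])

lemma subgrad_gradient_u: "x \<in> ball x0 \<epsilon> \<Longrightarrow> subgrad \<Omega> u x (gradient u x)"
  using GDERIV_imp_subgrad[OF u_convex _ gradient_u] ball_X X_\<Omega> by blast

lemma subgrad_eq_gradient: "x \<in> ball x0 \<epsilon> \<Longrightarrow> subgrad \<Omega> u x D \<Longrightarrow> D = gradient u x"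
  using GDERIV_subgrad_unique[OF gradient_u] ball_X X_interior by blast

text \<open>By \<open>slopes\<close> the supremum over \<open>X\<close> is one over all of
  \<open>\<Omega>\<close>. Hence a maximizer has the shifted slope as a subgradient on
  \<open>\<Omega>\<close>, and \<open>only\<close> puts it into the open ball, where the gradient is
  the only subgradient.\<close>

lemma active:
  assumes \<xi>: "\<xi> \<in> B" and x: "x \<in> X" "g \<xi> = x \<bullet> \<xi> - uh x"
  shows "x \<in> ball x0 \<epsilon>" "gradient u x = \<xi> + \<xi>2"
proof -
  have m: "\<xi> + \<xi>2 \<in> cball \<xi>2 \<rho>" using \<xi> by (simp add: dist_norm)
  obtain y where y: "y \<in> ball x0 \<epsilon>" "subgrad \<Omega> u y (\<xi> + \<xi>2)" using slopes[OF m] by blast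
  have "y \<bullet> \<xi> - uh y \<le> x \<bullet> \<xi> - uh x" using g_upper[of y \<xi>] y(1) ball_X x(2) by auto
  then have le: "u x - (\<xi> + \<xi>2) \<bullet> x \<le> u y - (\<xi> + \<xi>2) \<bullet> y" by (simp add: uh_def inner_add_left inner_commute[of x] inner_commute[of y])
  have sub: "subgrad \<Omega> u x (\<xi> + \<xi>2)"
    unfolding subgrad_def
  proof
    fix z assume "z \<in> \<Omega>"
    from subgradD[OF y(2) this] le show "u x + (\<xi> + \<xi>2) \<bullet> (z - x) \<le> u z" by (simp add: inner_diff_right)
  qed
  show b: "x \<in> ball x0 \<epsilon>" using only[OF m _ sub] x(1) X_\<Omega> by blast
  show "gradient u x = \<xi> + \<xi>2" using subgrad_eq_gradient[OF b sub] by simp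
qed

lemma g_at_gradient:
  assumes x: "x \<in> ball x0 \<epsilon>"
  shows "g (gradient u x - \<xi>2) = x \<bullet> (gradient u x - \<xi>2) - uh x"
  unfolding g_def
proof (rule conj_on_eqI[OF X_compact uh_continuous])
  show "x \<in> X" using x ball_X by blast
  fix z assume "z \<in> X"
  then have "u x + gradient u x \<bullet> (z - x) \<le> u z" using subgradD[OF subgrad_gradient_u[OF x]] X_\<Omega> by blast
  then show "z \<bullet> (gradient u x - \<xi>2) - uh z \<le> x \<bullet> (gradient u x - \<xi>2) - uh x"
    by (simp add: uh_def inner_diff_right inner_diff_left inner_commute)
qed

lemma cj_g_eq:
  assumes x: "x \<in> ball x0 \<epsilon>" "gradient u x - \<xi>2 \<in> B"
  shows "cj g x = uh x"
proof -
  have "cj g x = (gradient u x - \<xi>2) \<bullet> x - g (gradient u x - \<xi>2)"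
  proof (rule cj_eqI[OF cls_g x(2)])
    fix \<zeta> assume "\<zeta> \<in> B"
    have "x \<bullet> \<zeta> - uh x \<le> g \<zeta>" using g_upper x(1) ball_X by blast
    then show "\<zeta> \<bullet> x - g \<zeta> \<le> (gradient u x - \<xi>2) \<bullet> x - g (gradient u x - \<xi>2)"
      unfolding g_at_gradient[OF x(1)] by (simp add: inner_commute)
  qed
  then show ?thesis unfolding g_at_gradient[OF x(1)] by (simp add: inner_commute)
qed

text \<open>A point \<open>x\<close> active for two slopes in \<open>B\<close> would have two
  gradients; thus smoothness of \<open>u\<close> becomes strict convexity of \<open>g\<close>.
  Compactness of the set \<open>T\<close> of active pairs with a second slope at distance
  \<open>\<delta>\<close> makes the gap uniform.\<close>

lemma strict: uniformly_strict
  unfolding uniformly_strict_def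
proof (intro allI impI)
  fix \<delta> :: real assume \<delta>: "\<delta> > 0"
  define F where "F = (\<lambda>(p :: real^2, x, \<xi>). g \<xi> - (x \<bullet> \<xi> - uh x))"
  define T where "T = {(p, x, \<xi>) \<in> B \<times> X \<times> B. g p - (x \<bullet> p - uh x) = 0 \<and> \<delta> \<le> dist \<xi> p}"
  have contg: "continuous_on S g" for S by (rule cls_continuous[OF cls_g])
  let ?BX = "B \<times> X \<times> B"
  have comp: "compact ?BX" by (intro compact_Times compactB X_compact)
  have cg: "continuous_on ?BX (\<lambda>z. g (fst z))" "continuous_on ?BX (\<lambda>z. g (snd (snd z)))"
    by (rule continuous_on_compose2[OF contg[of UNIV]]; auto intro!: continuous_intros)+
  have cu: "continuous_on ?BX (\<lambda>z. uh (fst (snd z)))"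
    by (rule continuous_on_compose2[OF uh_continuous]) (auto intro!: continuous_intros)
  have contF: "continuous_on ?BX F"
    unfolding F_def case_prod_beta using cg(2) cu by (intro continuous_intros)
  have cont1: "continuous_on ?BX (\<lambda>z. g (fst z) - (fst (snd z) \<bullet> fst z - uh (fst (snd z))))"
    using cg(1) cu by (intro continuous_intros)
  have cont2: "continuous_on ?BX (\<lambda>z. dist (snd (snd z)) (fst z))" by (intro continuous_intros)
  have "T = {z \<in> ?BX. g (fst z) - (fst (snd z) \<bullet> fst z - uh (fst (snd z))) \<in> {0}} \<inter> {z \<in> ?BX. dist (snd (snd z)) (fst z) \<in> {\<delta>..}}"
    unfolding T_def by auto
  moreover have "closed {z \<in> ?BX. g (fst z) - (fst (snd z) \<bullet> fst z - uh (fst (snd z))) \<in> {0}}" "closed {z \<in> ?BX. dist (snd (snd z)) (fst z) \<in> {\<delta>..}}"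
    using continuous_closed_preimage[OF cont1 compact_imp_closed[OF comp], of "{0}"] continuous_closed_preimage[OF cont2 compact_imp_closed[OF comp], of "{\<delta>..}"]
    by (simp_all add: vimage_def Int_def)
  ultimately have "closed T" by auto
  moreover have TBX: "T \<subseteq> ?BX" unfolding T_def by auto
  ultimately have compT: "compact T" using compact_Int_closed[OF comp, of T] by (simp add: Int_absorb1)
  have Fpos: "0 < F z" if z: "z \<in> T" for z
  proof -
    obtain p x \<xi> where zz: "z = (p, x, \<xi>)" by (cases z) auto
    have h: "p \<in> B" "x \<in> X" "\<xi> \<in> B" "g p = x \<bullet> p - uh x" "\<delta> \<le> dist \<xi> p" using z unfolding T_def zz by auto
    have "0 \<le> F z" using g_upper[OF h(2), of \<xi>] by (simp add: F_def zz)
    moreover have "F z \<noteq> 0"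
    proof
      assume "F z = 0"
      then have "g \<xi> = x \<bullet> \<xi> - uh x" by (simp add: F_def zz)
      from active(2)[OF h(3) h(2) this] active(2)[OF h(1,2,4)] have "\<xi> = p" by simp
      then show False using h(5) \<delta> by simp
    qed
    ultimately show ?thesis by simp
  qed
  have "\<exists>\<omega>>0. \<forall>z\<in>T. \<omega> \<le> F z"
  proof (cases "T = {}")
    case True then show ?thesis by (intro exI[of _ 1]) auto
  next
    case False
    from continuous_attains_inf[OF compT False continuous_on_subset[OF contF TBX]]
    obtain z0 where "z0 \<in> T" "\<forall>z\<in>T. F z0 \<le> F z" by blast
    then show ?thesis using Fpos by blast
  qed
  then obtain \<omega> where \<omega>: "\<omega> > 0" "\<And>z. z \<in> T \<Longrightarrow> \<omega> \<le> F z" by blast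
  have "\<exists>x. \<forall>\<xi>. g p + x \<bullet> (\<xi> - p) \<le> g \<xi> \<and> (\<xi> \<in> B \<and> \<delta> \<le> dist \<xi> p \<longrightarrow> g p + x \<bullet> (\<xi> - p) + \<omega> \<le> g \<xi>)" if p: "p \<in> B" for p
  proof -
    obtain x where x: "x \<in> X" "g p = x \<bullet> p - uh x" using g_attained[of p] by blast
    have "g p + x \<bullet> (\<xi> - p) \<le> g \<xi>" for \<xi> using g_upper[OF x(1), of \<xi>] x(2) by (simp add: inner_diff_right)
    moreover have "g p + x \<bullet> (\<xi> - p) + \<omega> \<le> g \<xi>" if "\<xi> \<in> B" "\<delta> \<le> dist \<xi> p" for \<xi>
    proof -
      have "(p, x, \<xi>) \<in> T" unfolding T_def using p x that by auto
      from \<omega>(2)[OF this] show ?thesis using x(2) by (simp add: F_def inner_diff_right)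
    qed
    ultimately show ?thesis by blast
  qed
  then show "\<exists>\<omega>>0. \<forall>p\<in>B. \<exists>x. \<forall>\<xi>. g p + x \<bullet> (\<xi> - p) \<le> g \<xi> \<and> (\<xi> \<in> B \<and> \<delta> \<le> dist \<xi> p \<longrightarrow> g p + x \<bullet> (\<xi> - p) + \<omega> \<le> g \<xi>)"
    using \<omega>(1) by blast
qed

text \<open>Variations in \<open>cls\<close> change conjugates on \<open>Core\<close> only, and on
  the open set \<open>Nbhd\<close> the function \<open>u\<close> is \<open>cj g\<close> plus a
  linear function. The complement of the one and the other form the open cover for
  \<open>convex_on_locally\<close>.\<close>

definition "Core = {x \<in> ball x0 \<epsilon>. norm (gradient u x - \<xi>2) \<le> \<rho> / 2}"
definition "Nbhd = {x \<in> ball x0 \<epsilon>. norm (gradient u x - \<xi>2) < \<rho>}"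

lemma Core_Nbhd: "Core \<subseteq> Nbhd" using rho by (auto simp: Core_def Nbhd_def)

lemma continuous_gradient_u: "continuous_on (ball x0 \<epsilon>) (gradient u)"
  using continuous_on_gradient_convex[OF u_convex_interior open_interior _ diff] ball_X X_interior by blast

lemma open_Nbhd: "open Nbhd"
proof -
  have "continuous_on (ball x0 \<epsilon>) (\<lambda>x. norm (gradient u x - \<xi>2))"
    using continuous_gradient_u by (intro continuous_intros)
  from continuous_open_preimage[OF this open_ball open_lessThan[of \<rho>]]
  show ?thesis by (simp add: Nbhd_def vimage_def Int_def)
qed

text \<open>In a limit of points of \<open>Core\<close> the gradients subconverge to a subgradient
  with slope in the smaller ball, and \<open>only\<close> keeps the limit point inside the open
  ball.\<close>

lemma compact_Core: "compact Core"
  unfolding compact_def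
proof (intro allI impI)
  fix z :: "nat \<Rightarrow> real^2" assume z: "\<forall>n. z n \<in> Core"
  have "\<forall>n. z n \<in> X" using z ball_X by (auto simp: Core_def)
  then obtain x and s :: "nat \<Rightarrow> nat" where s: "x \<in> X" "strict_mono s" "(z \<circ> s) \<longlonglongrightarrow> x"
    using spec[OF X_compact(1)[unfolded compact_def], of z] by auto
  define D where "D n = gradient u (z (s n))" for n
  have Dn: "\<forall>n. D n \<in> cball \<xi>2 (\<rho> / 2)" using z by (auto simp: D_def Core_def dist_norm norm_minus_commute)
  then obtain d and t :: "nat \<Rightarrow> nat" where t: "d \<in> cball \<xi>2 (\<rho> / 2)" "strict_mono t" "(D \<circ> t) \<longlonglongrightarrow> d"
    using spec[OF compact_cball[of \<xi>2 "\<rho>/2", unfolded compact_def], of D] by auto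
  have lim: "(\<lambda>n. z (s (t n))) \<longlonglongrightarrow> x" using LIMSEQ_subseq_LIMSEQ[OF s(3) t(2)] by (simp add: comp_def)
  have "isCont u x" using u_continuous X_interior s(1) by (auto simp: continuous_on_eq_continuous_at)
  from subgrad_limit[OF this lim t(3), of \<Omega>] have sub: "subgrad \<Omega> u x d"
    using subgrad_gradient_u z by (simp add: D_def Core_def)
  have "d \<in> cball \<xi>2 \<rho>" using t(1) rho by auto
  then have xb: "x \<in> ball x0 \<epsilon>" using only[OF _ _ sub] s(1) X_\<Omega> by blast
  have "d = gradient u x" by (rule subgrad_eq_gradient[OF xb sub])
  then have "x \<in> Core" using xb t(1) by (simp add: Core_def dist_norm norm_minus_commute)
  then show "\<exists>l\<in>Core. \<exists>r. strict_mono r \<and> (z \<circ> r) \<longlonglongrightarrow> l"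
    using lim strict_mono_o[OF s(2) t(2)] by (intro bexI[of _ x] exI[of _ "s \<circ> t"]) (auto simp: comp_def)
qed

text \<open>If the maximizing slope \<open>\<xi>\<close> at \<open>x\<close> had norm at most
  \<open>\<rho> / 2\<close>, then \<open>x\<close> would be a subgradient of \<open>g\<close> at
  \<open>\<xi>\<close>. These subgradients are exactly the points \<open>A\<close> active for
  \<open>\<xi>\<close>, a closed convex set contained in \<open>Core\<close>; so the slope lies
  beyond the varied region.\<close>

lemma cj_off_Core:
  assumes W: "cls W" and x: "x \<notin> Core"
  shows "cj W x = cj g x"
proof -
  obtain \<xi> where \<xi>: "\<xi> \<in> B" "cj g x = \<xi> \<bullet> x - g \<xi>" using cj_attained[OF cls_g, of x] by blast
  have "\<rho> / 2 < norm \<xi>"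
  proof (rule ccontr)
    assume "\<not> ?thesis"
    then have n\<xi>: "norm \<xi> \<le> \<rho> / 2" by simp
    define A where "A = {y \<in> X. g \<xi> \<le> y \<bullet> \<xi> - uh y}"
    have Aeq: "g \<xi> = y \<bullet> \<xi> - uh y" if "y \<in> A" for y using that g_upper[of y \<xi>] by (auto simp: A_def)
    have "continuous_on X (\<lambda>y. y \<bullet> \<xi> - uh y)" using uh_continuous by (intro continuous_intros)
    from continuous_closed_preimage[OF this compact_imp_closed[OF X_compact(1)] closed_atLeast[of "g \<xi>"]]
    have Acl: "closed A" by (simp add: A_def vimage_def Int_def)
    have Acv: "convex A"
    proof (rule convexI)
      fix y z and p q :: real assume yz: "y \<in> A" "z \<in> A" and pq: "0 \<le> p" "0 \<le> q" "p + q = 1"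
      have X': "y \<in> X" "z \<in> X" using yz by (auto simp: A_def)
      have p: "p = 1 - q" using pq by simp
      have "u (p *\<^sub>R y + q *\<^sub>R z) \<le> p * u y + q * u z"
        unfolding p using convex_onD[OF u_convex, of q y z] pq X' X_\<Omega> by auto
      then have "p * (y \<bullet> \<xi> - uh y) + q * (z \<bullet> \<xi> - uh z) \<le> (p *\<^sub>R y + q *\<^sub>R z) \<bullet> \<xi> - uh (p *\<^sub>R y + q *\<^sub>R z)"
        by (simp add: uh_def inner_add_left inner_add_right algebra_simps)
      moreover have "p * (y \<bullet> \<xi> - uh y) + q * (z \<bullet> \<xi> - uh z) = g \<xi>"
        using Aeq[OF yz(1)] Aeq[OF yz(2)] pq by (metis distrib_right mult_1)
      moreover have "p *\<^sub>R y + q *\<^sub>R z \<in> X" using X' pq convex_cball[of x0 \<epsilon>] unfolding X_def by (intro convexD) auto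
      ultimately show "p *\<^sub>R y + q *\<^sub>R z \<in> A" by (simp add: A_def)
    qed
    have "x \<in> A"
    proof (rule ccontr)
      assume "x \<notin> A"
      from separating_hyperplane_closed_point[OF Acv Acl this] obtain d b where db: "d \<bullet> x < b" "\<And>y. y \<in> A \<Longrightarrow> b < d \<bullet> y" by blast
      \<comment> \<open>Small enough for \<open>\<xi> + Y n *\<^sub>R (- d)\<close> to stay in
        \<open>B\<close>. The growth of \<open>g\<close> in the direction \<open>- d\<close> then
        produces an active point that is not separated from \<open>x\<close> by
        \<open>d\<close>.\<close>
      define e where "e = (\<rho> / 2) / (norm d + 1)"
      have e: "0 < e" using rho by (simp add: e_def add_nonneg_pos)
      define Y where "Y n = e / real (Suc n)" for n
      have Y: "Y n > 0" "Y n \<le> e" for n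
        using e by (simp_all add: Y_def divide_le_eq mult_left_le_one_le)
      have Ylim: "Y \<longlonglongrightarrow> 0"
        unfolding Y_def[abs_def] using tendsto_mult[OF tendsto_const[of e] LIMSEQ_Suc[OF lim_1_over_n[where 'a=real]]] by simp
      have "conj_on X uh \<xi> + ((- d) \<bullet> x) * Y n \<le> conj_on X uh (\<xi> + Y n *\<^sub>R (- d))" for n
      proof -
        have "norm (Y n *\<^sub>R (- d)) \<le> e * (norm d + 1)" using Y[of n] by (simp add: mult_mono)
        also have "\<dots> = \<rho> / 2" using add_nonneg_pos[OF norm_ge_zero[of d] zero_less_one] unfolding e_def by (metis less_irrefl nonzero_eq_divide_eq)
        finally have "\<xi> + Y n *\<^sub>R (- d) \<in> B" using norm_triangle_ineq[of \<xi> "Y n *\<^sub>R (- d)"] n\<xi> by simp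
        from cj_upper[OF cls_g this, of x] \<xi>(2) show ?thesis
          unfolding g_def[symmetric] by (simp add: inner_diff_left algebra_simps)
      qed
      from conj_on_directional[OF X_compact uh_continuous Y(1) Ylim this]
      obtain y where y: "y \<in> X" "conj_on X uh \<xi> = y \<bullet> \<xi> - uh y" "(- d) \<bullet> x \<le> y \<bullet> (- d)" by blast
      have "y \<in> A" using y(1,2) by (simp add: A_def g_def)
      from db(2)[OF this] db(1) y(3) show False by (simp add: inner_commute)
    qed
    then have "x \<in> X" by (simp add: A_def)
    note this Aeq[OF \<open>x \<in> A\<close>]
    from active[OF \<xi>(1) this] have "x \<in> Core" using n\<xi> by (simp add: Core_def)
    then show False using x by simp
  qed
  then show ?thesis by (rule cj_eq_of_outer_maximizer[OF W \<xi>])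
qed

text \<open>At a point where \<open>u\<close> attains 0 or \<open>mx\<close> its gradient vanishes,
  which is excluded on \<open>Core\<close>; compactness turns this into the margin \<open>e0\<close>
  for perturbations.\<close>

lemma u_strict_bounds: "\<exists>e0>0. \<forall>x\<in>Core. e0 \<le> u x \<and> u x \<le> mx - e0"
proof (cases "Core = {}")
  case True then show ?thesis by (intro exI[of _ 1]) auto
next
  case False
  have C\<Omega>: "Core \<subseteq> interior \<Omega>" using ball_X X_interior by (auto simp: Core_def)
  have "continuous_on Core (\<lambda>x. min (u x) (mx - u x))"
    using continuous_on_subset[OF u_continuous C\<Omega>] by (intro continuous_intros)
  from continuous_attains_inf[OF compact_Core False this] obtain y where y: "y \<in> Core" "\<And>x. x \<in> Core \<Longrightarrow> min (u y) (mx - u y) \<le> min (u x) (mx - u x)" by blast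
  have yb: "y \<in> ball x0 \<epsilon>" using y(1) by (simp add: Core_def)
  have ne: "gradient u y \<noteq> 0" using y(1) nonzero rho by (auto simp: Core_def dist_norm)
  have y\<Omega>: "y \<in> \<Omega>" using yb ball_X X_\<Omega> by blast
  have "u y \<noteq> 0"
  proof
    assume "u y = 0"
    then have "subgrad \<Omega> u y 0" using u_bounds by (simp add: subgrad_def)
    from subgrad_eq_gradient[OF yb this] ne show False by simp
  qed
  moreover have "u y \<noteq> mx"
  proof
    assume eq: "u y = mx"
    have "subgrad (ball y (\<epsilon> - dist x0 y)) u y 0"
      unfolding subgrad_def
    proof
      fix z assume z: "z \<in> ball y (\<epsilon> - dist x0 y)"
      \<comment> \<open>Reflection at \<open>y\<close>: since \<open>u\<close> is at most
        \<open>mx\<close> at the reflected point, convexity forces \<open>u z \<ge> mx\<close>, so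
        \<open>y\<close> would also be a local minimum.\<close>
      have z': "2 *\<^sub>R y - z \<in> ball y (\<epsilon> - dist x0 y)" using z by (simp add: dist_norm scaleR_2 norm_minus_commute algebra_simps)
      have sub: "ball y (\<epsilon> - dist x0 y) \<subseteq> ball x0 \<epsilon>"
      proof
        fix p assume "p \<in> ball y (\<epsilon> - dist x0 y)"
        then show "p \<in> ball x0 \<epsilon>" using dist_triangle[of x0 p y] by simp
      qed
      have in\<Omega>: "z \<in> \<Omega>" "2 *\<^sub>R y - z \<in> \<Omega>" using z z' sub ball_X X_\<Omega> by blast+
      have "y = (1 - 1/2) *\<^sub>R z + (1/2) *\<^sub>R (2 *\<^sub>R y - z)" by (simp add: algebra_simps)
      then have "u y \<le> (1 - 1/2) * u z + 1/2 * u (2 *\<^sub>R y - z)"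
        using convex_onD[OF u_convex _ _ in\<Omega>, of "1/2"] by simp
      then show "u y + 0 \<bullet> (z - y) \<le> u z" using u_bounds(2)[OF in\<Omega>(2)] eq by simp
    qed
    from GDERIV_subgrad_unique[OF gradient_u[OF yb] _ this] yb ne show False by simp
  qed
  ultimately have "0 < min (u y) (mx - u y)" using u_bounds[OF y\<Omega>] by simp
  then show ?thesis using y(2) by (intro exI[of _ "min (u y) (mx - u y)"]) fastforce
qed

text \<open>A correction added to \<open>u\<close>, so that it is \<open>u\<close> itself off
  \<open>Core\<close>, also where \<open>u\<close> is not given by \<open>cj g\<close>.\<close>

definition "competitor W x = u x + (cj W x - cj g x)"

lemma competitor_off: "cls W \<Longrightarrow> x \<notin> Core \<Longrightarrow> competitor W x = u x"
  using cj_off_Core by (simp add: competitor_def)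

lemma u_eq_on_Nbhd: "x \<in> Nbhd \<Longrightarrow> u x = cj g x + \<xi>2 \<bullet> x"
  using cj_g_eq[of x] by (simp add: Nbhd_def uh_def)

lemma competitor_eq_on_Nbhd: "x \<in> Nbhd \<Longrightarrow> competitor W x = cj W x + \<xi>2 \<bullet> x"
  using u_eq_on_Nbhd by (simp add: competitor_def)

lemma competitor_class:
  assumes W: "cls W" and e0: "\<And>x. x \<in> Core \<Longrightarrow> e0 \<le> u x \<and> u x \<le> mx - e0" and close: "\<And>\<xi>. \<xi> \<in> B \<Longrightarrow> \<bar>W \<xi> - g \<xi>\<bar> \<le> e0"
  shows "competitor W \<in> convex_class \<Omega> mx"
proof -
  have "convex_on \<Omega> (competitor W)"
  proof (rule convex_on_locally[OF convex_\<Omega> _ open_Nbhd _ u_convex _ _ ])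
    show "open (- Core)" using compact_imp_closed[OF compact_Core] by (simp add: open_Compl)
    show "\<Omega> \<subseteq> - Core \<union> Nbhd" using Core_Nbhd by blast
    show "competitor W x = u x" if "x \<in> \<Omega> \<inter> - Core" for x using competitor_off[OF W] that by simp
    show "competitor W x = cj W x + \<xi>2 \<bullet> x" if "x \<in> \<Omega> \<inter> Nbhd" for x using competitor_eq_on_Nbhd that by simp
    have "convex_on \<Omega> (cj W)" by (rule convex_on_subset[OF convex_cj[OF W] subset_UNIV]) (rule convex_\<Omega>)
    moreover have "convex_on \<Omega> (\<lambda>x. \<xi>2 \<bullet> x)" by (rule convex_onI[OF _ convex_\<Omega>]) (simp add: inner_add_right)
    ultimately show "convex_on \<Omega> (\<lambda>x. cj W x + \<xi>2 \<bullet> x)" by (rule convex_on_add)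
  qed
  moreover have "0 \<le> competitor W x \<and> competitor W x \<le> mx" if x: "x \<in> \<Omega>" for x
  proof (cases "x \<in> Core")
    case False
    then show ?thesis using competitor_off[OF W False] u_bounds[OF x] by simp
  next
    case True
    have "\<bar>cj W x - cj g x\<bar> \<le> e0"
      unfolding cj_def by (rule conj_on_diff_bound[OF compactB cls_continuous[OF W] cls_continuous[OF cls_g] close])
    then show ?thesis using e0[OF True] unfolding competitor_def by linarith
  qed
  ultimately show ?thesis by (simp add: convex_class_def)
qed

lemma gradient_add_linear:
  assumes "open S" "x \<in> S" "\<And>y. y \<in> S \<Longrightarrow> w y = v y + \<xi>2 \<bullet> y" "GDERIV v x :> D"
  shows "gradient w x = D + \<xi>2"
proof -
  have "GDERIV (\<lambda>y. v y + \<xi>2 \<bullet> y) x :> D + \<xi>2"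
    by (rule GDERIV_add[OF assms(4)]) (auto simp: gderiv_def inner_commute intro!: derivative_eq_intros)
  then have "GDERIV w x :> D + \<xi>2"
    unfolding gderiv_def by (rule has_derivative_transform_within_open[OF _ assms(1,2)]) (simp add: assms(3))
  then show ?thesis by (rule gradient_eq)
qed

lemma competitor_functional:
  assumes W: "cls W" and wc: "competitor W \<in> convex_class \<Omega> mx" and f: "continuous_on UNIV f"
    and fin: "\<bar>grad_functional \<Omega> f u\<bar> \<noteq> \<infinity>" and lt: "E (\<lambda>\<xi>. f (\<xi> + \<xi>2)) W < E (\<lambda>\<xi>. f (\<xi> + \<xi>2)) g"
  shows "grad_functional \<Omega> f (competitor W) < grad_functional \<Omega> f u"
proof -
  let ?f = "\<lambda>\<xi>. f (\<xi> + \<xi>2)" and ?w = "competitor W"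
  have fh: "continuous_on UNIV ?f" by (rule continuous_on_compose2[OF f]) (auto intro!: continuous_intros)
  have wcv: "convex_on \<Omega> ?w" using wc by (simp add: convex_class_def)
  define d where "d x = ?f (gradient (cj W) x) - ?f (gradient (cj g) x)" for x
  have opC: "open (- Core)" using compact_imp_closed[OF compact_Core] by (simp add: open_Compl)
  have same: "gradient (cj W) x = gradient (cj g) x" if "x \<notin> Core" for x
    by (rule gradient_cong_open[OF opC]) (use that cj_off_Core[OF W] in auto)
  have d0: "d x = 0" if "x \<notin> Core" for x using same[OF that] by (simp add: d_def)
  have Core_R: "x \<in> cball 0 (L + 1)" if "x \<in> Core" for x
  proof -
    have "x \<in> X" using that ball_X by (auto simp: Core_def)
    from norm_X[OF this] show ?thesis by simp
  qed
  have d_eq: "d x = indicator (cball 0 (L + 1)) x *\<^sub>R ?f (gradient (cj W) x) - indicator (cball 0 (L + 1)) x *\<^sub>R ?f (gradient (cj g) x)" for x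
    using d0[of x] Core_R[of x] by (cases "x \<in> Core") (auto simp: d_def indicator_def)
  note iW = E_integrable[OF prim_cj[OF W] fh, unfolded set_integrable_def] and ig = E_integrable[OF prim_cj[OF cls_g] fh, unfolded set_integrable_def]
  have d_int: "integrable lborel d" "(LINT x|lborel. d x) = E ?f W - E ?f g"
    unfolding d_eq[abs_def] E_def Ep_def set_lebesgue_integral_def using iW ig by simp_all
  have AE: "AE x in lborel. interior_integrand \<Omega> f ?w x = interior_integrand \<Omega> f u x + d x"
    using AE_cj[OF W] AE_cj[OF cls_g]
  proof eventually_elim
    case (elim x)
    show ?case
    proof (cases "x \<in> interior \<Omega>")
      case False
      then have "x \<notin> Core" using ball_X X_interior by (auto simp: Core_def)
      then show ?thesis using False d0 by (simp add: interior_integrand_def)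
    next
      case True
      show ?thesis
      proof (cases "x \<in> Core")
        case False
        have "gradient ?w x = gradient u x"
          by (rule gradient_cong_open[OF opC]) (use False competitor_off[OF W] in auto)
        then show ?thesis using d0[OF False] by (simp add: interior_integrand_def)
      next
        case core: True
        then have xN: "x \<in> Nbhd" using Core_Nbhd by blast
        have "gradient ?w x = gradient (cj W) x + \<xi>2"
          by (rule gradient_add_linear[OF open_Nbhd xN competitor_eq_on_Nbhd]) (use elim in auto)
        moreover have "gradient u x = gradient (cj g) x + \<xi>2"
          by (rule gradient_add_linear[OF open_Nbhd xN u_eq_on_Nbhd]) (use elim in auto)
        ultimately show ?thesis using True by (simp add: interior_integrand_def d_def)
      qed
    qed
  qed
  note int_u = grad_functional_interior(1)[OF compact_\<Omega> convex_\<Omega> u_convex f fin]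
  have mw: "interior_integrand \<Omega> f ?w \<in> borel_measurable lborel" using borel_measurable_interior_integrand[OF wcv f] by simp
  have int_sum: "integrable lborel (\<lambda>x. interior_integrand \<Omega> f u x + d x)" using int_u d_int(1) by simp
  have int_w: "integrable lborel (interior_integrand \<Omega> f ?w)"
    using integrable_cong_AE[OF mw borel_measurable_integrable[OF int_sum] AE] int_sum by simp
  have "(LINT x|lborel. interior_integrand \<Omega> f ?w x) = (LINT x|lborel. interior_integrand \<Omega> f u x + d x)"
    by (rule integral_cong_AE[OF mw borel_measurable_integrable[OF int_sum] AE])
  also have "\<dots> = (LINT x|lborel. interior_integrand \<Omega> f u x) + (E ?f W - E ?f g)"
    using int_u d_int by simp
  finally show ?thesis
    unfolding grad_functional_interior(2)[OF compact_\<Omega> convex_\<Omega> wcv f int_w] grad_functional_interior(2)[OF compact_\<Omega> convex_\<Omega> u_convex f int_u]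
    using lt by simp
qed

theorem not_minimizer:
  assumes f: "C2_function f" and c: "0 < c"
    and cases: "(\<forall>\<xi>\<in>cball \<xi>2 \<rho>. \<forall>v. c * (v \<bullet> v) \<le> v \<bullet> (hessian f \<xi> *v v)) \<or>
      (\<exists>\<tau>. norm \<tau> = 1 \<and> (\<forall>\<xi>\<in>cball \<xi>2 \<rho>. \<tau> \<bullet> (hessian f \<xi> *v \<tau>) \<le> - c))"
  shows "\<not> minimizes \<Omega> mx f u"
proof
  assume min: "minimizes \<Omega> mx f u"
  have contf: "continuous_on UNIV f"
    using f by (auto simp: C2_function_def intro!: differentiable_imp_continuous_on differentiable_at_imp_differentiable_on)
  let ?f = "\<lambda>\<xi>. f (\<xi> + \<xi>2)"
  have fh: "continuous_on UNIV ?f" by (rule continuous_on_compose2[OF contf]) (auto intro!: continuous_intros)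
  have shift: "\<xi> + \<xi>2 \<in> cball \<xi>2 \<rho>" if "\<xi> \<in> B" for \<xi> using that by (simp add: dist_norm)
  obtain e0 where e0: "e0 > 0" "\<And>x. x \<in> Core \<Longrightarrow> e0 \<le> u x \<and> u x \<le> mx - e0" using u_strict_bounds by blast
  have "\<exists>V. cls V \<and> (\<forall>\<xi>\<in>B. \<bar>V \<xi> - g \<xi>\<bar> \<le> e0) \<and> E ?f V < E ?f g"
    using cases
  proof
    assume pd: "\<forall>\<xi>\<in>cball \<xi>2 \<rho>. \<forall>v. c * (v \<bullet> v) \<le> v \<bullet> (hessian f \<xi> *v v)"
    show ?thesis
    proof (rule not_minimal_convex[OF strict fh _ _ e0(1)])
      show "0 < c / 2" using c by simp
      fix p assume p: "p \<in> B"
      have "?f p + gradient f (p + \<xi>2) \<bullet> (\<xi> - p) + c / 2 * ((\<xi> - p) \<bullet> (\<xi> - p)) \<le> ?f \<xi>" if \<xi>: "\<xi> \<in> B" for \<xi>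
      proof -
        have "f (p + \<xi>2) + gradient f (p + \<xi>2) \<bullet> (\<xi> - p) + (c * ((\<xi> - p) \<bullet> (\<xi> - p))) / 2 \<le> f ((p + \<xi>2) + (\<xi> - p))"
        proof (rule C2_lower_bound[OF f])
          fix t :: real assume t: "0 \<le> t" "t \<le> 1"
          have "(1 - t) *\<^sub>R (p + \<xi>2) + t *\<^sub>R (\<xi> + \<xi>2) \<in> cball \<xi>2 \<rho>"
            using shift[OF p] shift[OF \<xi>] t convex_cball[of \<xi>2 \<rho>] by (intro convexD) auto
          moreover have "(1 - t) *\<^sub>R (p + \<xi>2) + t *\<^sub>R (\<xi> + \<xi>2) = p + \<xi>2 + t *\<^sub>R (\<xi> - p)" by (simp add: algebra_simps)
          ultimately have "p + \<xi>2 + t *\<^sub>R (\<xi> - p) \<in> cball \<xi>2 \<rho>" by simp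
          then show "c * ((\<xi> - p) \<bullet> (\<xi> - p)) \<le> (\<xi> - p) \<bullet> (hessian f (p + \<xi>2 + t *\<^sub>R (\<xi> - p)) *v (\<xi> - p))"
            using pd by blast
        qed
        then show ?thesis by (simp add: add.commute)
      qed
      then show "\<exists>a. \<forall>\<xi>\<in>B. ?f p + a \<bullet> (\<xi> - p) + c / 2 * ((\<xi> - p) \<bullet> (\<xi> - p)) \<le> ?f \<xi>" by blast
    qed
  next
    assume "\<exists>\<tau>. norm \<tau> = 1 \<and> (\<forall>\<xi>\<in>cball \<xi>2 \<rho>. \<tau> \<bullet> (hessian f \<xi> *v \<tau>) \<le> - c)"
    then obtain \<tau> where \<tau>: "norm \<tau> = 1" and neg: "\<And>\<xi>. \<xi> \<in> cball \<xi>2 \<rho> \<Longrightarrow> \<tau> \<bullet> (hessian f \<xi> *v \<tau>) \<le> - c" by blast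
    obtain k where k: "\<And>p \<xi>. p \<in> cball \<xi>2 \<rho> \<Longrightarrow> \<xi> \<in> cball \<xi>2 \<rho> \<Longrightarrow> \<bar>f \<xi> - f p - gradient f p \<bullet> (\<xi> - p)\<bar> \<le> k * ((\<xi> - p) \<bullet> (\<xi> - p))"
      using C2_taylor_bound[OF f, of \<xi>2 \<rho>] by blast
    have tb: "taylor_bound ?f k"
      unfolding taylor_bound_def
    proof
      fix p assume p: "p \<in> B"
      have "\<bar>?f \<xi> - ?f p - gradient f (p + \<xi>2) \<bullet> (\<xi> - p)\<bar> \<le> k * ((\<xi> - p) \<bullet> (\<xi> - p))" if "\<xi> \<in> B" for \<xi>
        using k[OF shift[OF p] shift[OF that]] by simp
      then show "\<exists>a. \<forall>\<xi>\<in>B. \<bar>?f \<xi> - ?f p - a \<bullet> (\<xi> - p)\<bar> \<le> k * ((\<xi> - p) \<bullet> (\<xi> - p))" by blast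
    qed
    show ?thesis
    proof (rule not_minimal[OF strict fh tb \<tau> c _ e0(1)])
      fix x h :: real assume h: "0 < h" "- \<rho> \<le> x - h" "x + h \<le> \<rho>"
      have mem: "(x *\<^sub>R \<tau> + \<xi>2) + t *\<^sub>R (s *\<^sub>R \<tau>) \<in> cball \<xi>2 \<rho>" if "0 \<le> t" "t \<le> 1" "\<bar>s\<bar> = h" for t s
      proof -
        have "\<bar>t * s\<bar> \<le> h" using that by (simp add: abs_mult mult_left_le_one_le)
        then have "\<bar>x + t * s\<bar> \<le> \<rho>" using h by linarith
        moreover have "(x *\<^sub>R \<tau> + \<xi>2) + t *\<^sub>R (s *\<^sub>R \<tau>) = (x + t * s) *\<^sub>R \<tau> + \<xi>2" by (simp add: algebra_simps)
        moreover have "dist \<xi>2 ((x + t * s) *\<^sub>R \<tau> + \<xi>2) = \<bar>x + t * s\<bar>" using \<tau> by (simp add: dist_norm)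
        ultimately show ?thesis by (simp only: mem_cball)
      qed
      have up: "f ((x *\<^sub>R \<tau> + \<xi>2) + s *\<^sub>R \<tau>) \<le> f (x *\<^sub>R \<tau> + \<xi>2) + gradient f (x *\<^sub>R \<tau> + \<xi>2) \<bullet> (s *\<^sub>R \<tau>) + (- c * h^2) / 2" if "\<bar>s\<bar> = h" for s
      proof (rule C2_upper_bound[OF f])
        fix t :: real assume t: "0 \<le> t" "t \<le> 1"
        have "s^2 = h^2" using that by (metis power2_abs)
        then have "(s *\<^sub>R \<tau>) \<bullet> (hessian f (x *\<^sub>R \<tau> + \<xi>2 + t *\<^sub>R (s *\<^sub>R \<tau>)) *v (s *\<^sub>R \<tau>)) = h^2 * (\<tau> \<bullet> (hessian f (x *\<^sub>R \<tau> + \<xi>2 + t *\<^sub>R (s *\<^sub>R \<tau>)) *v \<tau>))"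
          by (simp add: matrix_vector_mult_scaleR power2_eq_square mult.assoc[symmetric])
        also have "\<dots> \<le> h^2 * (- c)" using neg[OF mem[OF t that]] by (intro mult_left_mono) auto
        finally show "(s *\<^sub>R \<tau>) \<bullet> (hessian f (x *\<^sub>R \<tau> + \<xi>2 + t *\<^sub>R (s *\<^sub>R \<tau>)) *v (s *\<^sub>R \<tau>)) \<le> - c * h^2" by (simp add: mult.commute)
      qed
      have eq: "(x + h) *\<^sub>R \<tau> + \<xi>2 = (x *\<^sub>R \<tau> + \<xi>2) + h *\<^sub>R \<tau>" "(x - h) *\<^sub>R \<tau> + \<xi>2 = (x *\<^sub>R \<tau> + \<xi>2) + (- h) *\<^sub>R \<tau>"
        by (simp_all add: algebra_simps)
      show "?f ((x + h) *\<^sub>R \<tau>) - 2 * ?f (x *\<^sub>R \<tau>) + ?f ((x - h) *\<^sub>R \<tau>) \<le> - c * h\<^sup>2"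
        unfolding eq using up[of h] up[of "- h"] h by simp
    qed
  qed
  then obtain V where V: "cls V" "\<And>\<xi>. \<xi> \<in> B \<Longrightarrow> \<bar>V \<xi> - g \<xi>\<bar> \<le> e0" "E ?f V < E ?f g" by blast
  have wc: "competitor V \<in> convex_class \<Omega> mx" by (rule competitor_class[OF V(1) e0(2) V(2)])
  have fin: "\<bar>grad_functional \<Omega> f u\<bar> \<noteq> \<infinity>" using min by (simp add: minimizes_def)
  from competitor_functional[OF V(1) wc contf fin V(3)] min wc show False
    by (auto simp: minimizes_def not_le[symmetric])
qed

end

section \<open>Singular points of epigraphs\<close>

text \<open>For every slope near \<open>a\<close> the tilted function still attains its minimum over
  \<open>\<Omega>\<close> inside the ball only. This open set of slopes contains a nonzero one
  outside the closure of the degenerate set, around which \<open>C2_dichotomy\<close> holds.\<close>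

lemma cap_not_minimizer:
  fixes u f :: "real^2 \<Rightarrow> real"
  assumes \<Omega>: "compact \<Omega>" and u: "u \<in> convex_class \<Omega> mx" and f: "C2_function f"
    and nd: "nowhere_dense {\<xi>. smallest_eigenvalue (hessian f \<xi>) = 0}"
    and eps: "0 < \<epsilon>" and inside: "cball x0 \<epsilon> \<subseteq> interior \<Omega>" and diff: "\<And>x. x \<in> ball x0 \<epsilon> \<Longrightarrow> u differentiable (at x)"
    and at: "u x0 < a \<bullet> x0 + \<alpha>" and around: "\<And>x. dist x0 x = \<epsilon> \<Longrightarrow> a \<bullet> x + \<alpha> < u x"
  shows "\<not> minimizes \<Omega> mx f u"
proof -
  let ?Z = "{\<xi>. smallest_eigenvalue (hessian f \<xi>) = 0}"
  have cv: "convex_on \<Omega> u" using u by (simp add: convex_class_def)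
  have I\<Omega>: "interior \<Omega> \<subseteq> \<Omega>" by (rule interior_subset)
  have x0\<Omega>: "x0 \<in> \<Omega>" using inside I\<Omega> eps by force
  \<comment> \<open>The height of the cap at its centre, divided by the radius: a change of slope by
    less than \<open>r\<close> alters values over the sphere, relative to the centre, by at most
    this height.\<close>
  define r where "r = (a \<bullet> x0 + \<alpha> - u x0) / \<epsilon>"
  have r: "0 < r" using at eps by (simp add: r_def)
  have sphere: "u x0 - \<xi> \<bullet> x0 < u x - \<xi> \<bullet> x" if \<xi>: "\<xi> \<in> ball a r" and x: "dist x0 x = \<epsilon>" for \<xi> x
  proof -
    have "(\<xi> - a) \<bullet> (x - x0) \<le> norm (\<xi> - a) * norm (x - x0)" by (rule norm_cauchy_schwarz)
    also have "\<dots> \<le> r * \<epsilon>" using \<xi> x eps r by (intro mult_mono) (auto simp: dist_norm norm_minus_commute)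
    also have "\<dots> = a \<bullet> x0 + \<alpha> - u x0" using eps by (simp add: r_def)
    finally show ?thesis using around[OF x] by (simp add: inner_diff_left inner_diff_right)
  qed
  have far: "u x0 - \<xi> \<bullet> x0 < u x - \<xi> \<bullet> x" if \<xi>: "\<xi> \<in> ball a r" and x: "x \<in> \<Omega>" "x \<notin> ball x0 \<epsilon>" for \<xi> x
  proof -
    have d: "\<epsilon> \<le> dist x0 x" using x(2) by simp
    define t where "t = \<epsilon> / dist x0 x"
    have "0 < dist x0 x" using d eps by linarith
    then have t: "0 < t" "t \<le> 1" using d eps by (auto simp: t_def simp del: zero_less_dist_iff)
    define y where "y = (1 - t) *\<^sub>R x0 + t *\<^sub>R x"
    have "y - x0 = t *\<^sub>R (x - x0)" by (simp add: y_def algebra_simps)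
    then have "dist x0 y = t * dist x0 x" using t by (metis abs_of_pos dist_commute dist_norm norm_scaleR)
    then have "dist x0 y = \<epsilon>" using \<open>0 < dist x0 x\<close> by (simp add: t_def)
    from sphere[OF \<xi> this] have "u x0 - \<xi> \<bullet> x0 < u y - \<xi> \<bullet> y" .
    moreover have "u y \<le> (1 - t) * u x0 + t * u x"
      unfolding y_def using convex_onD[OF cv _ _ x0\<Omega> x(1), of t] t by simp
    moreover have "\<xi> \<bullet> y = (1 - t) * (\<xi> \<bullet> x0) + t * (\<xi> \<bullet> x)" by (simp add: y_def inner_add_right)
    ultimately have "t * (u x0 - \<xi> \<bullet> x0) < t * (u x - \<xi> \<bullet> x)" by (simp add: algebra_simps)
    then show ?thesis using t(1) by simp
  qed
  \<comment> \<open>Slope 0 is removed so that the varied part of \<open>u\<close> avoids the bounds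
    0 and \<open>mx\<close>.\<close>
  define U where "U = ball a r - {0}"
  have openU: "open U" by (simp add: U_def open_Diff)
  have "U \<noteq> {}"
  proof
    assume "U = {}"
    then have "ball a r = {0}" using r unfolding U_def by (metis Diff_eq_empty_iff ball_eq_empty not_le subset_singletonD)
    then show False using not_open_singleton[of "0::real^2"] open_ball[of a r] by simp
  qed
  have "\<not> U \<subseteq> closure ?Z" using nd interior_maximal[OF _ openU, of "closure ?Z"] \<open>U \<noteq> {}\<close> by (auto simp: nowhere_dense_def)
  then obtain \<xi>2 where \<xi>2: "\<xi>2 \<in> U" "\<xi>2 \<notin> closure ?Z" by blast
  have "\<xi>2 \<notin> ?Z" using \<xi>2(2) closure_subset[of ?Z] by blast
  then have nz: "smallest_eigenvalue (hessian f \<xi>2) \<noteq> 0" by simp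
  obtain \<delta> c where \<delta>: "\<delta> > 0" and c: "c > 0" and dich: "(\<forall>\<xi>\<in>cball \<xi>2 \<delta>. \<forall>v. c * (v \<bullet> v) \<le> v \<bullet> (hessian f \<xi> *v v)) \<or>
    (\<exists>\<tau>. norm \<tau> = 1 \<and> (\<forall>\<xi>\<in>cball \<xi>2 \<delta>. \<tau> \<bullet> (hessian f \<xi> *v \<tau>) \<le> - c))"
    using C2_dichotomy[OF f nz] by blast
  obtain e where e: "e > 0" "cball \<xi>2 e \<subseteq> U" using openU \<xi>2(1) unfolding open_contains_cball by blast
  define \<rho> where "\<rho> = min e \<delta>"
  have sub1: "cball \<xi>2 \<rho> \<subseteq> U" using e(2) subset_cball[of \<rho> e \<xi>2] by (force simp: \<rho>_def)
  have sub2: "cball \<xi>2 \<rho> \<subseteq> cball \<xi>2 \<delta>" by (rule subset_cball) (simp add: \<rho>_def)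
  have inball: "\<xi> \<in> ball a r" if "\<xi> \<in> cball \<xi>2 \<rho>" for \<xi> using subsetD[OF sub1 that] by (simp add: U_def)
  have cvI: "convex_on (interior \<Omega>) u"
    by (rule convex_on_subset[OF cv I\<Omega> convex_interior[OF convex_on_imp_convex[OF cv]]])
  have cont: "continuous_on (cball x0 \<epsilon>) u"
    by (rule continuous_on_subset[OF convex_on_continuous[OF open_interior cvI] inside])
  interpret smooth_cap \<Omega> mx u x0 \<xi>2 \<epsilon> \<rho>
  proof
    show "0 < \<rho>" using e \<delta> by (simp add: \<rho>_def)
    show "0 \<notin> cball \<xi>2 \<rho>" using sub1 unfolding U_def by blast
    fix \<xi> assume \<xi>: "\<xi> \<in> cball \<xi>2 \<rho>"
    have "continuous_on (cball x0 \<epsilon>) (\<lambda>x. u x - \<xi> \<bullet> x)" using cont by (intro continuous_intros)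
    from continuous_attains_inf[OF compact_cball _ this] obtain x
      where x: "x \<in> cball x0 \<epsilon>" "\<And>y. y \<in> cball x0 \<epsilon> \<Longrightarrow> u x - \<xi> \<bullet> x \<le> u y - \<xi> \<bullet> y" using eps by auto
    have x0le: "u x - \<xi> \<bullet> x \<le> u x0 - \<xi> \<bullet> x0" using x(2)[of x0] eps by simp
    have "dist x0 x \<noteq> \<epsilon>" using sphere[OF inball[OF \<xi>], of x] x0le by auto
    then have xb: "x \<in> ball x0 \<epsilon>" using x(1) by simp
    have "subgrad \<Omega> u x \<xi>" unfolding subgrad_def
    proof
      fix z assume z: "z \<in> \<Omega>"
      have "u x - \<xi> \<bullet> x \<le> u z - \<xi> \<bullet> z"
      proof (cases "z \<in> ball x0 \<epsilon>")
        case True then show ?thesis using x(2)[of z] by simp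
      next
        case False from far[OF inball[OF \<xi>] z this] x0le show ?thesis by simp
      qed
      then show "u x + \<xi> \<bullet> (z - x) \<le> u z" by (simp add: inner_diff_right)
    qed
    then show "\<exists>x\<in>ball x0 \<epsilon>. subgrad \<Omega> u x \<xi>" using xb by blast
  next
    fix \<xi> x assume \<xi>: "\<xi> \<in> cball \<xi>2 \<rho>" and x: "x \<in> \<Omega>" "subgrad \<Omega> u x \<xi>"
    show "x \<in> ball x0 \<epsilon>"
    proof (rule ccontr)
      assume "x \<notin> ball x0 \<epsilon>"
      from far[OF inball[OF \<xi>] x(1) this] subgradD[OF x(2) x0\<Omega>] show False by (simp add: inner_diff_right)
    qed
  qed (use \<Omega> u eps inside diff in auto)
  show ?thesis by (rule not_minimizer[OF f c]) (use dich sub2 in blast)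
qed

lemma supporting_plane_frontier:
  assumes "supporting_plane C p P" and "p \<in> closure C"
  shows "p \<in> frontier C"
proof -
  obtain a b where ab: "a \<noteq> 0" "a \<bullet> p = b" "C \<subseteq> {y. a \<bullet> y \<le> b}" using assms(1) by (auto simp: supporting_plane_def)
  have "interior C \<subseteq> {y. a \<bullet> y < b}" using interior_mono[OF ab(3)] interior_halfspace_le[OF ab(1)] by simp
  then show ?thesis using ab(2) assms(2) by (auto simp: frontier_def)
qed

lemma supporting_plane_epigraph:
  assumes "subgrad \<Omega> u x \<xi>" and "q = \<xi> \<bullet> x - u x" and "\<xi> \<bullet> y - z = q"
  shows "supporting_plane (epigraph \<Omega> u) (y, z) {p. (\<xi>, - 1) \<bullet> p = q}"
  unfolding supporting_plane_def
proof (intro exI[of _ "(\<xi>, - 1::real)"] exI[of _ q] conjI)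
  show "epigraph \<Omega> u \<subseteq> {p. (\<xi>, - 1) \<bullet> p \<le> q}"
  proof
    fix p assume "p \<in> epigraph \<Omega> u"
    then have "fst p \<in> \<Omega>" "u (fst p) \<le> snd p" by (auto simp: epigraph_def)
    with subgradD[OF assms(1) this(1)] show "p \<in> {p. (\<xi>, - 1) \<bullet> p \<le> q}"
      by (simp add: inner_prod_def inner_diff_right assms(2))
  qed
qed (use assms(3) in \<open>auto simp: prod_eq_iff\<close>)

lemma closure_epigraph_subgrad:
  assumes "subgrad \<Omega> u x \<xi>" and "p \<in> closure (epigraph \<Omega> u)"
  shows "u x + \<xi> \<bullet> (fst p - x) \<le> snd p"
proof -
  have "epigraph \<Omega> u \<subseteq> {p. (\<xi>, - 1) \<bullet> p \<le> \<xi> \<bullet> x - u x}"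
  proof
    fix p assume "p \<in> epigraph \<Omega> u"
    then have "fst p \<in> \<Omega>" "u (fst p) \<le> snd p" by (auto simp: epigraph_def)
    with subgradD[OF assms(1) this(1)] show "p \<in> {p. (\<xi>, - 1) \<bullet> p \<le> \<xi> \<bullet> x - u x}"
      by (simp add: inner_prod_def inner_diff_right)
  qed
  then have "closure (epigraph \<Omega> u) \<subseteq> {p. (\<xi>, - 1) \<bullet> p \<le> \<xi> \<bullet> x - u x}"
    by (rule closure_minimal[OF _ closed_halfspace_le])
  then show ?thesis using assms(2) by (auto simp: inner_prod_def inner_diff_right)
qed

lemma supporting_plane_unique:
  "\<exists>!P. supporting_plane C p P \<Longrightarrow> supporting_plane C p P \<Longrightarrow> supporting_plane C p Q \<Longrightarrow> P = Q"
  by (auto simp: Ex1_def)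

lemma subgrad_unique_of_not_sing:
  assumes x: "x \<in> \<Omega>" and ns: "(x, u x) \<notin> sing (epigraph \<Omega> u)"
    and sub: "subgrad \<Omega> u x \<xi>" "subgrad \<Omega> u x \<xi>'"
  shows "\<xi>' = \<xi>"
proof -
  let ?C = "epigraph \<Omega> u"
  have mem: "(x, u x) \<in> ?C" using x by (simp add: mem_epigraph)
  have P: "supporting_plane ?C (x, u x) {p. (\<xi>, - 1) \<bullet> p = \<xi> \<bullet> x - u x}"
    "supporting_plane ?C (x, u x) {p. (\<xi>', - 1) \<bullet> p = \<xi>' \<bullet> x - u x}"
    by (rule supporting_plane_epigraph[OF sub(1) refl refl], rule supporting_plane_epigraph[OF sub(2) refl refl])
  have "(x, u x) \<in> frontier ?C" by (rule supporting_plane_frontier[OF P(1) subsetD[OF closure_subset mem]])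
  then have "\<exists>!P. supporting_plane ?C (x, u x) P" using ns unfolding sing_def by simp
  then have eq: "{p. (\<xi>, - 1 :: real) \<bullet> p = \<xi> \<bullet> x - u x} = {p. (\<xi>', - 1) \<bullet> p = \<xi>' \<bullet> x - u x}"
    by (rule supporting_plane_unique[OF _ P])
  define y where "y = x + (\<xi>' - \<xi>)"
  have "(y, \<xi> \<bullet> y - (\<xi> \<bullet> x - u x)) \<in> {p. (\<xi>, - 1) \<bullet> p = \<xi> \<bullet> x - u x}" by (simp add: inner_prod_def)
  then have "(y, \<xi> \<bullet> y - (\<xi> \<bullet> x - u x)) \<in> {p. (\<xi>', - 1) \<bullet> p = \<xi>' \<bullet> x - u x}" unfolding eq .
  then have "\<xi>' \<bullet> (y - x) = \<xi> \<bullet> (y - x)" by (simp add: inner_prod_def inner_diff_right)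
  then have "(\<xi>' - \<xi>) \<bullet> (\<xi>' - \<xi>) = 0" by (simp add: y_def inner_diff_left)
  then show ?thesis by simp
qed

text \<open>The midpoint of \<open>x\<close> and a point \<open>y\<close> of \<open>\<Omega>\<close>
  is interior, and convexity carries the inequality from there to \<open>y\<close>.\<close>

lemma subgrad_extend:
  fixes u :: "'a::euclidean_space \<Rightarrow> real"
  assumes cv: "convex_on \<Omega> u" and x: "x \<in> interior \<Omega>" and D: "subgrad (interior \<Omega>) u x D"
  shows "subgrad \<Omega> u x D"
  unfolding subgrad_def
proof
  fix y assume y: "y \<in> \<Omega>"
  have x\<Omega>: "x \<in> \<Omega>" using x interior_subset by blast
  have "y - (1/2) *\<^sub>R (y - x) \<in> interior \<Omega>"
    by (rule mem_interior_convex_shrink[OF convex_on_imp_convex[OF cv] x y]) auto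
  moreover have m: "y - (1/2) *\<^sub>R (y - x) = (1 - 1/2) *\<^sub>R x + (1/2) *\<^sub>R y"
    by (simp add: algebra_simps) (simp add: scaleR_add_left[symmetric])
  ultimately have "u x + D \<bullet> ((1 - 1/2) *\<^sub>R x + (1/2) *\<^sub>R y - x) \<le> u ((1 - 1/2) *\<^sub>R x + (1/2) *\<^sub>R y)"
    using subgradD[OF D] by metis
  also have "\<dots> \<le> (1 - 1/2) * u x + 1/2 * u y" by (rule convex_onD[OF cv _ _ x\<Omega> y]) auto
  finally show "u x + D \<bullet> (y - x) \<le> u y" by (simp add: inner_diff_right inner_add_right)
qed

lemma extreme_point_in_closure_sing:
  fixes u f :: "real^2 \<Rightarrow> real"
  assumes \<Omega>: "compact \<Omega>" and f: "C2_function f"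
    and nd: "nowhere_dense {\<xi>. smallest_eigenvalue (hessian f \<xi>) = 0}"
    and min: "minimizes \<Omega> mx f u" and x0: "x0 \<in> interior \<Omega>"
    and ext: "(x0, u x0) extreme_point_of closure (epigraph \<Omega> u)"
  shows "(x0, u x0) \<in> closure (sing (epigraph \<Omega> u))"
proof (rule ccontr)
  let ?C = "epigraph \<Omega> u"
  assume "(x0, u x0) \<notin> closure (sing ?C)"
  then have opn: "open (- closure (sing ?C))" "(x0, u x0) \<in> - closure (sing ?C)" by auto
  have u: "u \<in> convex_class \<Omega> mx" using min by (simp add: minimizes_def)
  have cv: "convex_on \<Omega> u" using u by (simp add: convex_class_def)
  have I\<Omega>: "interior \<Omega> \<subseteq> \<Omega>" by (rule interior_subset)
  have cvI: "convex_on (interior \<Omega>) u"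
    by (rule convex_on_subset[OF cv I\<Omega> convex_interior[OF convex_on_imp_convex[OF cv]]])
  have uc: "continuous_on (interior \<Omega>) u" by (rule convex_on_continuous[OF open_interior cvI])
  have "continuous_on (interior \<Omega>) (\<lambda>x. (x, u x))" using uc by (intro continuous_intros)
  from continuous_open_preimage[OF this open_interior opn(1)]
  have "open (interior \<Omega> \<inter> (\<lambda>x. (x, u x)) -` (- closure (sing ?C)))" .
  moreover have "x0 \<in> interior \<Omega> \<inter> (\<lambda>x. (x, u x)) -` (- closure (sing ?C))" using x0 opn(2) by simp
  ultimately obtain \<epsilon> where eps: "\<epsilon> > 0" and sub: "cball x0 \<epsilon> \<subseteq> interior \<Omega> \<inter> (\<lambda>x. (x, u x)) -` (- closure (sing ?C))"
    unfolding open_contains_cball by blast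
  have inside: "cball x0 \<epsilon> \<subseteq> interior \<Omega>" using sub by blast
  have smooth: "(x, u x) \<notin> sing ?C" if "x \<in> cball x0 \<epsilon>" for x
    using subsetD[OF sub that] closure_subset[of "sing ?C"] by auto
  have diff: "u differentiable (at x)" if x: "x \<in> ball x0 \<epsilon>" for x
  proof -
    have xc: "x \<in> cball x0 \<epsilon>" using x by simp
    have xI: "x \<in> interior \<Omega>" using subsetD[OF inside xc] .
    have x\<Omega>: "x \<in> \<Omega>" using xI I\<Omega> by blast
    obtain D where D: "subgrad \<Omega> u x D" using subgrad_ex[OF cv xI] by blast
    have "GDERIV u x :> D"
    proof (rule unique_subgrad_imp_GDERIV[OF cvI open_interior xI])
      show "subgrad (interior \<Omega>) u x D" using D I\<Omega> unfolding subgrad_def by blast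
      show "D' = D" if "subgrad (interior \<Omega>) u x D'" for D'
        by (rule subgrad_unique_of_not_sing[OF x\<Omega> smooth[OF xc] D subgrad_extend[OF cv xI that]])
    qed
    then show ?thesis by (rule GDERIV_imp_differentiable)
  qed
  define T where "T = (\<lambda>x. (x, u x)) ` sphere x0 \<epsilon>"
  have "continuous_on (sphere x0 \<epsilon>) (\<lambda>x. (x, u x))"
    by (intro continuous_intros continuous_on_subset[OF uc]) (use inside sphere_cball in blast)
  then have "compact T" unfolding T_def by (rule compact_continuous_image) simp
  then have compK: "compact (convex hull T)" by (rule compact_convex_hull)
  obtain v :: "real^2" where v: "norm v = \<epsilon>" using vector_choose_size[of \<epsilon>] eps by auto
  have vs: "x0 + v \<in> sphere x0 \<epsilon>" "x0 - v \<in> sphere x0 \<epsilon>" using v by (auto simp: dist_norm)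
  have Kne: "convex hull T \<noteq> {}" using vs by (auto simp: T_def)
  have "sphere x0 \<epsilon> \<subseteq> \<Omega>" using inside I\<Omega> sphere_cball[of x0 \<epsilon>] by blast
  then have TC: "T \<subseteq> ?C" unfolding T_def by (auto simp: mem_epigraph subset_iff)
  have convC: "convex ?C" using cv by (simp add: convex_epigraph)
  have KC: "convex hull T \<subseteq> ?C" using hull_minimal[of T ?C convex] TC convC by simp
  \<comment> \<open>Separating the whole ray below the point, instead of the point, orients the
    plane: the ray excludes \<open>c < 0\<close>, and two antipodal points of the sphere exclude
    \<open>c = 0\<close>.\<close>
  define R where "R = {x0} \<times> {..u x0}"
  have "R \<inter> convex hull T = {}"
  proof (rule ccontr)
    assume "R \<inter> convex hull T \<noteq> {}"
    then obtain s where s: "s \<le> u x0" "(x0, s) \<in> convex hull T" by (auto simp: R_def)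
    have "u x0 \<le> s" using subsetD[OF KC s(2)] by (simp add: mem_epigraph)
    then have mem: "(x0, u x0) \<in> convex hull T" using s by simp
    have "convex hull T \<subseteq> closure ?C" using KC closure_subset by blast
    \<comment> \<open>An extreme point of the hull of \<open>T\<close> belongs to \<open>T\<close>,
      which lies over the sphere and not over its centre.\<close>
    then have "(x0, u x0) extreme_point_of (convex hull T)" using ext mem unfolding extreme_point_of_def by blast
    from extreme_point_of_convex_hull[OF this] show False using eps by (auto simp: T_def)
  qed
  moreover have "convex R" "closed R" by (auto simp: R_def convex_Times closed_Times)
  ultimately obtain h b where hb: "\<forall>p\<in>R. h \<bullet> p < b" "\<forall>p\<in>convex hull T. h \<bullet> p > b"
    using separating_hyperplane_closed_compact[OF _ _ convex_convex_hull compK Kne] by blast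
  obtain a c where h: "h = (a, c)" by (cases h) auto
  have below: "a \<bullet> x0 + c * s < b" if "s \<le> u x0" for s
    using hb(1) that by (auto simp: R_def h inner_prod_def)
  have above: "b < a \<bullet> x + c * u x" if "x \<in> sphere x0 \<epsilon>" for x
  proof -
    have "(x, u x) \<in> convex hull T" using that by (intro hull_inc) (simp add: T_def)
    then show ?thesis using hb(2) by (auto simp: h inner_prod_def)
  qed
  have "c > 0"
  proof (rule ccontr)
    assume "\<not> c > 0"
    then consider "c = 0" | "c < 0" by linarith
    then show False
    proof cases
      case 1
      then show ?thesis using below[of "u x0"] above[OF vs(1)] above[OF vs(2)]
        by (simp add: inner_add_right inner_diff_right)
    next
      case 2
      define s where "s = min (u x0) ((b - a \<bullet> x0) / c)"
      have "c * ((b - a \<bullet> x0) / c) \<le> c * s" using 2 by (intro mult_left_mono_neg) (auto simp: s_def)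
      then show ?thesis using below[of s] 2 by (simp add: s_def)
    qed
  qed
  have "\<not> minimizes \<Omega> mx f u"
  proof (rule cap_not_minimizer[OF \<Omega> u f nd eps inside diff])
    show "u x0 < (- (1 / c)) *\<^sub>R a \<bullet> x0 + b / c"
      using below[of "u x0"] \<open>c > 0\<close> by (simp add: field_simps)
    show "(- (1 / c)) *\<^sub>R a \<bullet> x + b / c < u x" if "dist x0 x = \<epsilon>" for x
      using above[of x] that \<open>c > 0\<close> by (simp add: field_simps)
  qed
  then show False using min by contradiction
qed

lemma graph_in_hull_closure_sing:
  fixes u f :: "real^2 \<Rightarrow> real"
  assumes \<Omega>: "compact \<Omega>" and f: "C2_function f"
    and nd: "nowhere_dense {\<xi>. smallest_eigenvalue (hessian f \<xi>) = 0}"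
    and min: "minimizes \<Omega> mx f u" and y: "y \<in> interior \<Omega>"
  shows "(y, u y) \<in> convex hull (closure (sing (epigraph \<Omega> u)))"
proof -
  let ?C = "epigraph \<Omega> u"
  have cv: "convex_on \<Omega> u" using min by (simp add: minimizes_def convex_class_def)
  have conv\<Omega>: "convex \<Omega>" by (rule convex_on_imp_convex[OF cv])
  have I\<Omega>: "interior \<Omega> \<subseteq> \<Omega>" by (rule interior_subset)
  have convD: "convex (closure ?C)" using cv by (intro convex_closure) (simp add: convex_epigraph)
  have fst\<Omega>: "fst p \<in> \<Omega>" if "p \<in> closure ?C" for p
  proof -
    have "closure ?C \<subseteq> \<Omega> \<times> UNIV"
      by (rule closure_minimal) (auto simp: epigraph_def intro!: closed_Times compact_imp_closed[OF \<Omega>])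
    then show ?thesis using that by auto
  qed
  obtain \<xi> where \<xi>: "subgrad \<Omega> u y \<xi>" using subgrad_ex[OF cv y] by blast
  define q where "q = \<xi> \<bullet> y - u y"
  define F where "F = closure ?C \<inter> {p. (\<xi>, - 1) \<bullet> p = q}"
  have face: "F face_of closure ?C"
    unfolding F_def
  proof (rule face_of_Int_supporting_hyperplane_le[OF convD])
    fix p assume "p \<in> closure ?C"
    from closure_epigraph_subgrad[OF \<xi> this] show "(\<xi>, - 1) \<bullet> p \<le> q"
      by (simp add: q_def inner_prod_def inner_diff_right)
  qed
  \<comment> \<open>Although the epigraph is unbounded, this face is compact: it lies on the graph
    of an affine function over \<open>\<Omega>\<close>.\<close>
  have "F \<subseteq> (\<lambda>x. (x, \<xi> \<bullet> x - q)) ` \<Omega>"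
  proof
    fix p assume "p \<in> F"
    then have "fst p \<in> \<Omega>" "snd p = \<xi> \<bullet> fst p - q" using fst\<Omega>[of p] by (auto simp: F_def inner_prod_def)
    then show "p \<in> (\<lambda>x. (x, \<xi> \<bullet> x - q)) ` \<Omega>" by (intro image_eqI[of _ _ "fst p"]) (auto simp: prod_eq_iff)
  qed
  moreover have "compact ((\<lambda>x. (x, \<xi> \<bullet> x - q)) ` \<Omega>)"
    by (rule compact_continuous_image[OF _ \<Omega>]) (intro continuous_intros)
  moreover have "closed F" unfolding F_def by (intro closed_Int closed_closure closed_hyperplane)
  ultimately have "compact F" by (metis compact_Int_closed inf.absorb_iff2)
  moreover have "convex F" unfolding F_def by (intro convex_Int convD convex_hyperplane)
  ultimately have F: "F = convex hull {p. p extreme_point_of F}" by (rule Krein_Milman_Minkowski)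
  have "{p. p extreme_point_of F} \<subseteq> closure (sing ?C)"
  proof
    fix p assume "p \<in> {p. p extreme_point_of F}"
    then have p: "p extreme_point_of closure ?C" "p \<in> F" using extreme_point_of_face[OF face] by auto
    obtain x z where xz: "p = (x, z)" by (cases p)
    have pC: "p \<in> closure ?C" and z: "\<xi> \<bullet> x - z = q" using p(2) by (auto simp: F_def xz inner_prod_def)
    have x\<Omega>: "x \<in> \<Omega>" using fst\<Omega>[OF pC] by (simp add: xz)
    show "p \<in> closure (sing ?C)"
    proof (cases "x \<in> interior \<Omega>")
      case True
      obtain \<zeta> where "subgrad \<Omega> u x \<zeta>" using subgrad_ex[OF cv True] by blast
      from closure_epigraph_subgrad[OF this pC] have "u x \<le> z" by (simp add: xz)
      moreover have "z \<le> u x" using subgradD[OF \<xi> x\<Omega>] z by (simp add: q_def inner_diff_right)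
      ultimately have "p = (x, u x)" by (simp add: xz)
      then show ?thesis using extreme_point_in_closure_sing[OF \<Omega> f nd min True] p(1) by simp
    next
      case False
      have "x \<notin> rel_interior \<Omega>" using False y rel_interior_nonempty_interior[of \<Omega>] by auto
      obtain a where a: "a \<noteq> 0" "\<And>w. w \<in> closure \<Omega> \<Longrightarrow> a \<bullet> x \<le> a \<bullet> w"
        by (rule supporting_hyperplane_relative_frontier[OF conv\<Omega> subsetD[OF closure_subset x\<Omega>] \<open>x \<notin> rel_interior \<Omega>\<close>]) (rule that)
      have a2: "a \<bullet> x \<le> a \<bullet> w" if "w \<in> \<Omega>" for w using a(2) closure_subset[of \<Omega>] that by blast
      let ?P = "{p. (\<xi>, - 1) \<bullet> p = q}" and ?V = "{p. (- a, 0::real) \<bullet> p = - (a \<bullet> x)}"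
      have P: "supporting_plane ?C p ?P" unfolding xz by (rule supporting_plane_epigraph[OF \<xi> q_def z])
      have V: "supporting_plane ?C p ?V"
        unfolding supporting_plane_def
        by (intro exI[of _ "(- a, 0::real)"] exI[of _ "- (a \<bullet> x)"])
          (use a(1) a2 in \<open>auto simp: xz epigraph_def inner_prod_def zero_prod_def\<close>)
      \<comment> \<open>The vertical plane contains the point just above \<open>p\<close>, the
        nonvertical one does not; so \<open>p\<close> has two planes of support.\<close>
      have "(x, z + 1) \<in> ?V" "(x, z + 1) \<notin> ?P" using z by (auto simp: inner_prod_def)
      then have "?V \<noteq> ?P" by blast
      then have "\<not> (\<exists>!Q. supporting_plane ?C p Q)" using supporting_plane_unique[OF _ V P] by auto
      moreover have "p \<in> frontier ?C" by (rule supporting_plane_frontier[OF P pC])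
      ultimately have "p \<in> sing ?C" by (simp add: sing_def)
      then show ?thesis using closure_subset by blast
    qed
  qed
  from hull_mono[OF this, of convex] have "F \<subseteq> convex hull (closure (sing ?C))" using F by simp
  moreover have "(y, u y) \<in> F"
    using y I\<Omega> closure_subset[of ?C] by (auto simp: F_def q_def inner_prod_def mem_epigraph subset_iff)
  ultimately show ?thesis by (rule subsetD)
qed

section \<open>Comparison of two minimizers\<close>

lemma minimizer_le_of_sing_eq:
  fixes u1 u2 f :: "real^2 \<Rightarrow> real"
  assumes \<Omega>: "compact \<Omega>" and f: "C2_function f"
    and nd: "nowhere_dense {\<xi>. smallest_eigenvalue (hessian f \<xi>) = 0}"
    and min: "minimizes \<Omega> mx f u1" "minimizes \<Omega> mx f u2"
    and sing: "sing (epigraph \<Omega> u1) = sing (epigraph \<Omega> u2)" and y: "y \<in> interior \<Omega>"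
  shows "u2 y \<le> u1 y"
proof -
  have cv: "convex_on \<Omega> u2" using min(2) by (simp add: minimizes_def convex_class_def)
  have "sing (epigraph \<Omega> u2) \<subseteq> closure (epigraph \<Omega> u2)" by (auto simp: sing_def frontier_def)
  then have "closure (sing (epigraph \<Omega> u2)) \<subseteq> closure (epigraph \<Omega> u2)" by (rule closure_minimal[OF _ closed_closure])
  moreover have "convex (closure (epigraph \<Omega> u2))" using cv by (intro convex_closure) (simp add: convex_epigraph)
  ultimately have "convex hull (closure (sing (epigraph \<Omega> u2))) \<subseteq> closure (epigraph \<Omega> u2)" by (rule hull_minimal)
  then have mem: "(y, u1 y) \<in> closure (epigraph \<Omega> u2)"
    using graph_in_hull_closure_sing[OF \<Omega> f nd min(1) y] unfolding sing by blast
  obtain \<xi> where "subgrad \<Omega> u2 y \<xi>" using subgrad_ex[OF cv y] by blast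
  from closure_epigraph_subgrad[OF this mem] show ?thesis by simp
qed

text \<open>Along the segment from an interior point to \<open>x\<close>, the values of
  \<open>u1\<close> are bounded by the interpolated ones, which tend to \<open>u1 x\<close>. The
  limit stays in the epigraph of \<open>u2\<close>, closedness being lower semicontinuity up to the
  frontier.\<close>

lemma convex_le_of_closed_epigraph:
  fixes u1 u2 :: "'a::euclidean_space \<Rightarrow> real"
  assumes u1: "convex_on \<Omega> u1" and closed: "closed (epigraph \<Omega> u2)" and ne: "interior \<Omega> \<noteq> {}"
    and le: "\<And>y. y \<in> interior \<Omega> \<Longrightarrow> u2 y \<le> u1 y" and x: "x \<in> \<Omega>"
  shows "u2 x \<le> u1 x"
proof -
  obtain y where y: "y \<in> interior \<Omega>" using ne by blast
  have y\<Omega>: "y \<in> \<Omega>" using y interior_subset by blast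
  define t where "t n = inverse (real (Suc n))" for n
  have t: "0 < t n" "t n \<le> 1" for n by (auto simp: t_def inverse_le_1_iff)
  have t0: "t \<longlonglongrightarrow> 0" unfolding t_def[abs_def] by (rule LIMSEQ_inverse_real_of_nat)
  have "(x - t n *\<^sub>R (x - y), (1 - t n) * u1 x + t n * u1 y) \<in> epigraph \<Omega> u2" for n
  proof -
    have I: "x - t n *\<^sub>R (x - y) \<in> interior \<Omega>"
      by (rule mem_interior_convex_shrink[OF convex_on_imp_convex[OF u1] y x t])
    have "x - t n *\<^sub>R (x - y) = (1 - t n) *\<^sub>R x + t n *\<^sub>R y" by (simp add: algebra_simps)
    then have "u1 (x - t n *\<^sub>R (x - y)) \<le> (1 - t n) * u1 x + t n * u1 y"
      using convex_onD[OF u1 _ _ x y\<Omega>, of "t n"] t[of n] by simp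
    then have "u2 (x - t n *\<^sub>R (x - y)) \<le> (1 - t n) * u1 x + t n * u1 y" using le[OF I] by linarith
    moreover have "x - t n *\<^sub>R (x - y) \<in> \<Omega>" using I interior_subset by blast
    ultimately show ?thesis by (simp add: mem_epigraph)
  qed
  moreover have "(\<lambda>n. (x - t n *\<^sub>R (x - y), (1 - t n) * u1 x + t n * u1 y)) \<longlonglongrightarrow> (x - 0 *\<^sub>R (x - y), (1 - 0) * u1 x + 0 * u1 y)"
    by (intro tendsto_intros t0)
  ultimately have "(x - 0 *\<^sub>R (x - y), (1 - 0) * u1 x + 0 * u1 y) \<in> epigraph \<Omega> u2"
    by (rule closed_sequentially[OF closed])
  then show ?thesis by (simp add: mem_epigraph)
qed

text \<open>Neither the functional nor the singular set determines how far a function jumps up at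
  the frontier of \<open>\<Omega>\<close>. Therefore equality on all of \<open>\<Omega>\<close> is
  stated for closed epigraphs, that is for the lower semicontinuous representatives.\<close>

theorem mainTheorem2:
  fixes \<Omega> :: "(real ^ 2) set" and M :: real
    and f u1 u2 :: "real ^ 2 \<Rightarrow> real"
  assumes "compact \<Omega>" and "convex \<Omega>" and "interior \<Omega> \<noteq> {}"
    and "M > 0"
    and "C2_function f"
    and "closed {\<xi>. smallest_eigenvalue (hessian f \<xi>) = 0}"
    and "nowhere_dense {\<xi>. smallest_eigenvalue (hessian f \<xi>) = 0}"
    and "minimizes \<Omega> M f u1"
    and "minimizes \<Omega> M f u2"
    and "sing (epigraph \<Omega> u1) = sing (epigraph \<Omega> u2)"
  shows "(\<forall>x\<in>interior \<Omega>. u1 x = u2 x) \<and>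
    (closed (epigraph \<Omega> u1) \<and> closed (epigraph \<Omega> u2) \<longrightarrow> (\<forall>x\<in>\<Omega>. u1 x = u2 x))"
proof -
  note le = minimizer_le_of_sing_eq[OF assms(1,5,7,8,9,10)]
    and ge = minimizer_le_of_sing_eq[OF assms(1,5,7,9,8) assms(10)[symmetric]]
  have "convex_on \<Omega> u1" "convex_on \<Omega> u2" using assms(8,9) by (auto simp: minimizes_def convex_class_def)
  note conv = this
  have "u1 x = u2 x" if "closed (epigraph \<Omega> u1)" "closed (epigraph \<Omega> u2)" "x \<in> \<Omega>" for x
    using convex_le_of_closed_epigraph[OF conv(1) that(2) assms(3) le that(3)]
      convex_le_of_closed_epigraph[OF conv(2) that(1) assms(3) ge that(3)] by simp
  moreover have "u1 x = u2 x" if "x \<in> interior \<Omega>" for x using le[OF that] ge[OF that] by simp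
  ultimately show ?thesis by blast
qed

end
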